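(* Let $F=(\mathcal F,\mathcal F_M,\mathcal F_A)$ be a ring context and let $\mathcal X$ be a cocomplete $\infty$-category with finite products such that the cartesian product preserves colimits in each variable. Then the equivalence $\mathrm{NRig}_F(\mathcal X)\simeq\mathrm{Fun}^\times(\mathrm{Bispan}_{M,A}(\mathcal F),\mathcal X)$ described in the context restricts to an equivalence $$\mathrm{NRing}_F(\mathcal X)\simeq\mathrm{Tamb}_F(\mathcal X)$$ between the full subcategories of $F$-normed rings in $\mathcal X$ and of $\mathcal X$-valued $F$-Tambara functors.
   Context: Spans. A span pair $(\mathcal C,\mathcal C_F)$ is an $\infty$-category $\mathcal C$ with a wide subcategory $\mathcal C_F$ such that base changes of morphisms in $\mathcal C_F$ exist and lie in $\mathcal C_F$. $\mathrm{Span}_F(\mathcal C)$ has the objects of $\mathcal C$ and morphisms the spans $x\xleftarrow{b}z\xrightarrow{f}y$ with $f\in\mathcal C_F$. An $\infty$-category $\mathcal C$ is extensive if it has finite coproducts and all coproduct functors $\prod_i\mathcal C_{/x_i}\to\mathcal C_{/\coprod_i x_i}$ are equivalences. A span pair is weakly extensive if $\mathcal C$ has finite coproducts, $\mathcal C_F$ is closed under finite coproducts, and $\prod_i\mathcal C^F_{/x_i}\to\mathcal C^F_{/\coprod_ix_i}$ is an equivalence, where $\mathcal C^F_{/y}\subseteq\mathcal C_{/y}$ is the full subcategory on maps to $y$ lying in $\mathcal C_F$. It is extensive if $\mathcal C$ is extensive, $\mathcal C_F$ is closed under finite coproducts, and $\emptyset\to x$, $x\amalg x\to x$ lie in $\mathcal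 C_F$ for all $x$; in that case $\mathrm{Span}_F(\mathcal C)$ is semiadditive with products and coproducts given by coproducts in $\mathcal C$. Ring context: a triple $(\mathcal F,\mathcal F_M,\mathcal F_A)$ with $\mathcal F$ an extensive $\infty$-category with pullbacks, $(\mathcal F,\mathcal F_M)$ weakly extensive, $(\mathcal F,\mathcal F_A)$ extensive, such that for $m\colon X\to Y$ in $\mathcal F_M$ the pullback functor $m^*\colon\mathcal F_{/Y}\to\mathcal F_{/X}$ has a right adjoint $m_*$ which preserves morphisms whose image in $\mathcal F$ lies in $\mathcal F_A$. $\mathrm{Bispan}_{M,A}(\mathcal F):=\mathrm{Span}_A(\mathrm{Span}_M(\mathcal F)^{\mathrm{op}})$, with morphisms $X\leftarrow Y\xrightarrow{m}Z\xrightarrow{a}W$, $m\in\mathcal F_M$, $a\in\mathcal F_A$; it contains $\mathrm{Span}_A(\mathcal F)$ as the bispans with $m$ an equivalence. Grouplike: if $(\mathcal F,\mathcal F_A)$ is extensive, a finite-product-preserving functor $M\colon\mathrm{Span}_A(\mathcal F)\to\mathcal X$ has a unique lift to commutative monoids in $\mathcal X$ by semiadditivity; $M$ is grouplike if all the commutative monoids $M(X)$ are grouplike. The same applies to $(\mathcal F_{/X},\mathcal F_{/X,A})$, where $\mathcal F_{/X,A}$ is the wide subcategory of $\mathcal F_{/X}$ on morphisms lying in $\mathcal F_A$; write $\mathrm{Span}_A(\mathcal F_{/X})=\mathrm{Span}(\mathcal F_{/X},\mathcal F_{/X,A})$. Normed semirings. An $(\mathcal F,\mathcal F_M)$-normed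 $\infty$-category is a finite-product-preserving functor $\mathcal C\colon\mathrm{Span}_M(\mathcal F)\to\mathrm{Cat}_\infty$; a normed algebra in $\mathcal C$ is a section of its cocartesian fibration $\mathcal C^\otimes\to\mathrm{Span}_M(\mathcal F)$ taking backward maps to cocartesian morphisms. The assignment $X\mapsto\mathrm{Span}_A(\mathcal F_{/X})$ is an $(\mathcal F,\mathcal F_M)$-normed $\infty$-category, a span $X\xleftarrow{f}Z\xrightarrow{m}Y$ acting via $m_*f^*$. Applying $\mathrm{Fun}^\times(-,\mathcal X)$ with functoriality by left Kan extension yields the normed $\infty$-category $\underline{\mathrm{NMon}}_{(\mathcal F,\mathcal F_A)}(\mathcal X)\colon X\mapsto\mathrm{Fun}^\times(\mathrm{Span}_A(\mathcal F_{/X}),\mathcal X)$. $\mathrm{NRig}_F(\mathcal X)$ is the $\infty$-category of normed algebras in it. $\mathrm{NRing}_F(\mathcal X)\subseteq\mathrm{NRig}_F(\mathcal X)$ is the full subcategory of those $R$ whose value $R_X\colon\mathrm{Span}_A(\mathcal F_{/X})\to\mathcal X$ is grouplike for every $X\in\mathcal F$. Tambara functors. $\mathrm{Tamb}_F(\mathcal X)\subseteq\mathrm{Fun}^\times(\mathrm{Bispan}_{M,A}(\mathcal F),\mathcal X)$ is the full subcategory of finite-product-preserving functors whose restriction to $\mathrm{Span}_A(\mathcal F)$ is grouplike. The equivalence. The cocartesian fibration of $X\mapsto\mathrm{Span}_A(\mathcal F_{/X})$ is $\mathcal B:=\mathrm{Bispan}_{M\text{-pb},A\text{-fw}}(\mathrm{Ar}(\mathcal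 F))\to\mathrm{Span}_M(\mathcal F)$ (induced by evaluation at the target), whose morphisms are bispans $X\leftarrow Y\to X'\xrightarrow{a}X''$ over $S\leftarrow T\xrightarrow{m}S'=S'$ with middle square cartesian, $m\in\mathcal F_M$, $a\in\mathcal F_A$. Normed semirings are identified with those functors $\mathcal B\to\mathcal X$ whose restriction to each fibre preserves finite products and which, for each $f\colon X\to Y$ in $\mathcal F$, exhibit the restriction to the fibre over $X$ as the left Kan extension along $f^*$ of the restriction to the fibre over $Y$. Under this identification, the equivalence $\mathrm{NRig}_F(\mathcal X)\simeq\mathrm{Fun}^\times(\mathrm{Bispan}_{M,A}(\mathcal F),\mathcal X)$ is inverse to precomposition with $\mathrm{ev}_0\colon\mathcal B\to\mathrm{Bispan}_{M,A}(\mathcal F)$ (evaluation at the source), and for each $X$ it identifies evaluation of a semiring at $X$ with restriction along the functor $\mathrm{Span}_A(\mathcal F_{/X})\to\mathrm{Bispan}_{M,A}(\mathcal F)$ induced by the forgetful functor $\mathcal F_{/X}\to\mathcal F$. *)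

theory Defs
  imports Main
begin

section \<open>Simplicial sets\<close>

text \<open>
  Infinity-categories are modelled by quasicategories. A monotone map from [m] to [n] is coded
  by the list of its m+1 values; \<open>act X n \<theta> x\<close> is the simplex \<open>\<theta>\<^sup>*x\<close> for an n-simplex x.
  Simplicial maps are functions of the dimension and the simplex, made extensional by the value
  \<open>undefined\<close> off their domain.
\<close>

record 'a sset =
  cells :: "nat \<Rightarrow> 'a set"
  act :: "nat \<Rightarrow> nat list \<Rightarrow> 'a \<Rightarrow> 'a"

type_synonym ('k, 'c) smap = "nat \<Rightarrow> 'k \<Rightarrow> 'c"

definition ops :: "nat \<Rightarrow> nat \<Rightarrow> nat list set" where
  "ops m n = {\<theta>. length \<theta> = Suc m \<and> sorted \<theta> \<and> set \<theta> \<subseteq> {..n}}"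

definition is_sset :: "'a sset \<Rightarrow> bool" where
  "is_sset X \<longleftrightarrow>
     (\<forall>m n. \<forall>\<theta>\<in>ops m n. \<forall>x\<in>cells X n. act X n \<theta> x \<in> cells X m) \<and>
     (\<forall>n. \<forall>x\<in>cells X n. act X n [0..<Suc n] x = x) \<and>
     (\<forall>k m n. \<forall>\<psi>\<in>ops k m. \<forall>\<theta>\<in>ops m n. \<forall>x\<in>cells X n.
        act X m \<psi> (act X n \<theta> x) = act X n (map (nth \<theta>) \<psi>) x)"

definition srestrict :: "'k sset \<Rightarrow> ('k, 'c) smap \<Rightarrow> ('k, 'c) smap" where
  "srestrict K f = (\<lambda>n x. if x \<in> cells K n then f n x else undefined)"

definition smaps :: "'k sset \<Rightarrow> 'c sset \<Rightarrow> ('k, 'c) smap set" where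
  "smaps K C = {f.
     (\<forall>n. \<forall>x\<in>cells K n. f n x \<in> cells C n) \<and>
     (\<forall>m n. \<forall>\<theta>\<in>ops m n. \<forall>x\<in>cells K n. f m (act K n \<theta> x) = act C n \<theta> (f n x)) \<and>
     (\<forall>n x. x \<notin> cells K n \<longrightarrow> f n x = undefined)}"

definition op_sset :: "'a sset \<Rightarrow> 'a sset" where
  "op_sset X = \<lparr>cells = cells X,
     act = (\<lambda>n \<theta>. act X n (rev (map (\<lambda>i. n - i) \<theta>)))\<rparr>"

definition prod_sset :: "'a sset \<Rightarrow> 'b sset \<Rightarrow> ('a \<times> 'b) sset" (infixr "\<otimes>\<^sub>s" 75) where
  "X \<otimes>\<^sub>s Y = \<lparr>cells = (\<lambda>n. cells X n \<times> cells Y n),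
     act = (\<lambda>n \<theta>. map_prod (act X n \<theta>) (act Y n \<theta>))\<rparr>"

definition pi_sset :: "nat \<Rightarrow> (nat \<Rightarrow> 'a sset) \<Rightarrow> (nat \<Rightarrow> 'a) sset" where
  "pi_sset k X = \<lparr>cells = (\<lambda>n. {s. \<forall>i. if i < k then s i \<in> cells (X i) n else s i = undefined}),
     act = (\<lambda>n \<theta> s i. if i < k then act (X i) n \<theta> (s i) else undefined)\<rparr>"

definition disc :: "'i set \<Rightarrow> 'i sset" where
  "disc I = \<lparr>cells = (\<lambda>n. I), act = (\<lambda>n \<theta> i. i)\<rparr>"

definition nerve :: "'p set \<Rightarrow> ('p \<Rightarrow> 'p \<Rightarrow> bool) \<Rightarrow> 'p list sset" where
  "nerve P le = \<lparr>cells = (\<lambda>n. {v. length v = Suc n \<and> set v \<subseteq> P \<and> sorted_wrt le v}),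
     act = (\<lambda>n \<theta> v. map (nth v) \<theta>)\<rparr>"

definition simplex :: "nat \<Rightarrow> nat list sset" where
  "simplex n = nerve {..n} (\<le>)"

definition sub_sset :: "'a sset \<Rightarrow> (nat \<Rightarrow> 'a \<Rightarrow> bool) \<Rightarrow> 'a sset" where
  "sub_sset X P = \<lparr>cells = (\<lambda>n. {x \<in> cells X n. P n x}), act = act X\<rparr>"

definition full_sub :: "'a sset \<Rightarrow> 'a set \<Rightarrow> 'a sset" where
  "full_sub X V = sub_sset X (\<lambda>n x. \<forall>i\<le>n. act X n [i] x \<in> V)"

definition fun_sset :: "'k sset \<Rightarrow> 'c sset \<Rightarrow> (nat list \<times> 'k, 'c) smap sset" where
  "fun_sset K C = \<lparr>cells = (\<lambda>n. smaps (simplex n \<otimes>\<^sub>s K) C),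
     act = (\<lambda>n \<theta> h. srestrict (simplex (length \<theta> - 1) \<otimes>\<^sub>s K)
                      (\<lambda>m (\<psi>, k). h m (map (nth \<theta>) \<psi>, k)))\<rparr>"

text \<open>Maps from K to C versus vertices of \<open>fun_sset K C\<close>, and whiskering of simplices.\<close>

definition fun_vertex :: "'k sset \<Rightarrow> ('k, 'c) smap \<Rightarrow> (nat list \<times> 'k, 'c) smap" where
  "fun_vertex K f = srestrict (simplex 0 \<otimes>\<^sub>s K) (\<lambda>n (\<psi>, k). f n k)"

definition fun_at :: "(nat list \<times> 'k, 'c) smap \<Rightarrow> ('k, 'c) smap" where
  "fun_at h = (\<lambda>n k. h n (replicate (Suc n) 0, k))"

definition whisker_l ::
    "'k sset \<Rightarrow> nat \<Rightarrow> ('c, 'd) smap \<Rightarrow> (nat list \<times> 'k, 'c) smap \<Rightarrow> (nat list \<times> 'k, 'd) smap" where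
  "whisker_l K n G h = srestrict (simplex n \<otimes>\<^sub>s K) (\<lambda>m y. G m (h m y))"

definition whisker_r ::
    "'l sset \<Rightarrow> nat \<Rightarrow> (nat list \<times> 'k, 'c) smap \<Rightarrow> ('l, 'k) smap \<Rightarrow> (nat list \<times> 'l, 'c) smap" where
  "whisker_r L n h G = srestrict (simplex n \<otimes>\<^sub>s L) (\<lambda>m (\<psi>, x). h m (\<psi>, G m x))"


section \<open>Quasicategories\<close>

definition face :: "nat \<Rightarrow> nat \<Rightarrow> nat list" where
  "face n i = filter (\<lambda>j. j \<noteq> i) [0..<Suc n]"

text \<open>Families of (n-1)-simplices, indexed by a set I of faces of the n-simplex, that agree on
  common faces: maps into C from a horn or from the boundary.\<close>

definition compatible :: "'a sset \<Rightarrow> nat \<Rightarrow> nat set \<Rightarrow> (nat \<Rightarrow> 'a) \<Rightarrow> bool" where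
  "compatible C n I s \<longleftrightarrow>
     (\<forall>i\<in>I. s i \<in> cells C (n - 1)) \<and>
     (2 \<le> n \<longrightarrow> (\<forall>i\<in>I. \<forall>j\<in>I. i < j \<longrightarrow>
        act C (n - 1) (face (n - 1) i) (s j) = act C (n - 1) (face (n - 1) (j - 1)) (s i)))"

definition qcat :: "'a sset \<Rightarrow> bool" where
  "qcat C \<longleftrightarrow> is_sset C \<and>
     (\<forall>n k s. 0 < k \<and> k < n \<and> compatible C n ({..n} - {k}) s \<longrightarrow>
        (\<exists>\<sigma>\<in>cells C n. \<forall>i\<in>{..n} - {k}. act C n (face n i) \<sigma> = s i))"

definition src :: "'a sset \<Rightarrow> 'a \<Rightarrow> 'a" where "src C e = act C 1 [0] e"
definition tgt :: "'a sset \<Rightarrow> 'a \<Rightarrow> 'a" where "tgt C e = act C 1 [1] e"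
definition idn :: "'a sset \<Rightarrow> 'a \<Rightarrow> 'a" where "idn C x = act C 0 [0, 0] x"

text \<open>\<open>triangle C f g h\<close>: h is a composite of f followed by g.\<close>

definition triangle :: "'a sset \<Rightarrow> 'a \<Rightarrow> 'a \<Rightarrow> 'a \<Rightarrow> bool" where
  "triangle C f g h \<longleftrightarrow>
     (\<exists>\<sigma>\<in>cells C 2. act C 2 [0, 1] \<sigma> = f \<and> act C 2 [1, 2] \<sigma> = g \<and> act C 2 [0, 2] \<sigma> = h)"

definition is_equiv :: "'a sset \<Rightarrow> 'a \<Rightarrow> bool" where
  "is_equiv C e \<longleftrightarrow> e \<in> cells C 1 \<and>
     (\<exists>g\<in>cells C 1. triangle C e g (idn C (src C e)) \<and> triangle C g e (idn C (tgt C e)))"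

definition terminal :: "'a sset \<Rightarrow> 'a \<Rightarrow> bool" where
  "terminal C t \<longleftrightarrow> t \<in> cells C 0 \<and>
     (\<forall>n\<ge>1. \<forall>s. compatible C n {..n} s \<and> act C (n - 1) [n - 1] (s 0) = t \<longrightarrow>
        (\<exists>\<sigma>\<in>cells C n. \<forall>i\<le>n. act C n (face n i) \<sigma> = s i))"

definition initial :: "'a sset \<Rightarrow> 'a \<Rightarrow> bool" where
  "initial C t \<longleftrightarrow> t \<in> cells C 0 \<and>
     (\<forall>n\<ge>1. \<forall>s. compatible C n {..n} s \<and> act C (n - 1) [0] (s n) = t \<longrightarrow>
        (\<exists>\<sigma>\<in>cells C n. \<forall>i\<le>n. act C n (face n i) \<sigma> = s i))"

definition nat_equiv :: "'c sset \<Rightarrow> 'd sset \<Rightarrow> ('c, 'd) smap \<Rightarrow> ('c, 'd) smap \<Rightarrow> bool" where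
  "nat_equiv C D f g \<longleftrightarrow>
     (\<exists>\<eta>. is_equiv (fun_sset C D) \<eta> \<and>
        src (fun_sset C D) \<eta> = fun_vertex C f \<and> tgt (fun_sset C D) \<eta> = fun_vertex C g)"

definition inverse_equivalences ::
    "'c sset \<Rightarrow> 'd sset \<Rightarrow> ('c, 'd) smap \<Rightarrow> ('d, 'c) smap \<Rightarrow> bool" where
  "inverse_equivalences C D f g \<longleftrightarrow> f \<in> smaps C D \<and> g \<in> smaps D C \<and>
     nat_equiv C C (\<lambda>n x. g n (f n x)) (\<lambda>n x. x) \<and>
     nat_equiv D D (\<lambda>n y. f n (g n y)) (\<lambda>n y. y)"

definition equivalence :: "'c sset \<Rightarrow> 'd sset \<Rightarrow> ('c, 'd) smap \<Rightarrow> bool" where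
  "equivalence C D f \<longleftrightarrow> (\<exists>g. inverse_equivalences C D f g)"

text \<open>L is left adjoint to R: unit, counit, and the triangle identities up to homotopy.\<close>

definition adjunction :: "'c sset \<Rightarrow> 'd sset \<Rightarrow> ('c, 'd) smap \<Rightarrow> ('d, 'c) smap \<Rightarrow> bool" where
  "adjunction C D L R \<longleftrightarrow> L \<in> smaps C D \<and> R \<in> smaps D C \<and>
     (\<exists>\<eta>\<in>cells (fun_sset C C) 1. \<exists>\<epsilon>\<in>cells (fun_sset D D) 1.
        src (fun_sset C C) \<eta> = fun_vertex C (\<lambda>n x. x) \<and>
        tgt (fun_sset C C) \<eta> = fun_vertex C (\<lambda>n x. R n (L n x)) \<and>
        src (fun_sset D D) \<epsilon> = fun_vertex D (\<lambda>n y. L n (R n y)) \<and>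
        tgt (fun_sset D D) \<epsilon> = fun_vertex D (\<lambda>n y. y) \<and>
        triangle (fun_sset C D) (whisker_l C 1 L \<eta>) (whisker_r C 1 \<epsilon> L)
          (idn (fun_sset C D) (fun_vertex C L)) \<and>
        triangle (fun_sset D C) (whisker_r D 1 \<eta> R) (whisker_l D 1 R \<epsilon>)
          (idn (fun_sset D C) (fun_vertex D R)))"

text \<open>The (Joyal) slice over x: its n-simplices are the (n+1)-simplices with last vertex x.\<close>

definition slice :: "'a sset \<Rightarrow> 'a \<Rightarrow> 'a sset" where
  "slice C x = \<lparr>cells = (\<lambda>n. {\<sigma> \<in> cells C (Suc n). act C (Suc n) [Suc n] \<sigma> = x}),
     act = (\<lambda>n \<theta>. act C (Suc n) (\<theta> @ [Suc n]))\<rparr>"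

definition forget :: "'a sset \<Rightarrow> ('a, 'a) smap" where
  "forget C n \<sigma> = act C (Suc n) [0..<Suc n] \<sigma>"

definition coslice :: "'a sset \<Rightarrow> 'a \<Rightarrow> 'a sset" where
  "coslice C x = \<lparr>cells = (\<lambda>n. {\<sigma> \<in> cells C (Suc n). act C (Suc n) [0] \<sigma> = x}),
     act = (\<lambda>n \<theta>. act C (Suc n) (0 # map Suc \<theta>))\<rparr>"

text \<open>Wide subcategories are given by their set of morphisms.\<close>

definition wide :: "'a sset \<Rightarrow> 'a set \<Rightarrow> bool" where
  "wide C W \<longleftrightarrow> W \<subseteq> cells C 1 \<and> {e. is_equiv C e} \<subseteq> W \<and>
     (\<forall>f\<in>W. \<forall>g\<in>W. \<forall>h. triangle C f g h \<longrightarrow> h \<in> W)"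

definition slice_on :: "'a sset \<Rightarrow> 'a set \<Rightarrow> 'a \<Rightarrow> 'a sset" where
  "slice_on C W x = full_sub (slice C x) W"


section \<open>Limits and colimits\<close>

definition const_cell :: "'k sset \<Rightarrow> 'c sset \<Rightarrow> nat \<Rightarrow> 'c \<Rightarrow> (nat list \<times> 'k, 'c) smap" where
  "const_cell K C n x = srestrict (simplex n \<otimes>\<^sub>s K) (\<lambda>m (\<psi>, k). act C n \<psi> x)"

text \<open>
  Cones on a vertex p of \<open>fun_sset K C\<close>: the fibre product of C with the slice over p, along the
  diagonal. The apex is kept as a component because it is not determined by the cone if K is empty.
\<close>

definition cones ::
    "'k sset \<Rightarrow> 'c sset \<Rightarrow> (nat list \<times> 'k, 'c) smap \<Rightarrow> ('c \<times> (nat list \<times> 'k, 'c) smap) sset" where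
  "cones K C p = sub_sset (C \<otimes>\<^sub>s slice (fun_sset K C) p)
     (\<lambda>n (x, h). forget (fun_sset K C) n h = const_cell K C n x)"

definition cocones ::
    "'k sset \<Rightarrow> 'c sset \<Rightarrow> (nat list \<times> 'k, 'c) smap \<Rightarrow> ('c \<times> (nat list \<times> 'k, 'c) smap) sset" where
  "cocones K C p = sub_sset (C \<otimes>\<^sub>s coslice (fun_sset K C) p)
     (\<lambda>n (x, h). act (fun_sset K C) (Suc n) [1..<Suc (Suc n)] h = const_cell K C n x)"

definition is_limit :: "'k sset \<Rightarrow> 'c sset \<Rightarrow> 'c \<Rightarrow> (nat list \<times> 'k, 'c) smap \<Rightarrow> bool" where
  "is_limit K C x h \<longleftrightarrow> terminal (cones K C (tgt (fun_sset K C) h)) (x, h)"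

definition is_colimit :: "'k sset \<Rightarrow> 'c sset \<Rightarrow> 'c \<Rightarrow> (nat list \<times> 'k, 'c) smap \<Rightarrow> bool" where
  "is_colimit K C x h \<longleftrightarrow> initial (cocones K C (src (fun_sset K C) h)) (x, h)"

text \<open>\<open>fan C k e\<close> is the (co)cone over the discrete diagram on k objects with legs \<open>e i\<close>.\<close>

definition fan :: "'c sset \<Rightarrow> nat \<Rightarrow> (nat \<Rightarrow> 'c) \<Rightarrow> (nat list \<times> nat, 'c) smap" where
  "fan C k e = srestrict (simplex 1 \<otimes>\<^sub>s disc {..<k}) (\<lambda>m (\<psi>, i). act C 1 \<psi> (e i))"

definition is_product :: "'c sset \<Rightarrow> nat \<Rightarrow> (nat \<Rightarrow> 'c) \<Rightarrow> 'c \<Rightarrow> bool" where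
  "is_product C k e z \<longleftrightarrow> (\<forall>i<k. e i \<in> cells C 1) \<and> is_limit (disc {..<k}) C z (fan C k e)"

definition is_coproduct :: "'c sset \<Rightarrow> nat \<Rightarrow> (nat \<Rightarrow> 'c) \<Rightarrow> 'c \<Rightarrow> bool" where
  "is_coproduct C k e z \<longleftrightarrow> (\<forall>i<k. e i \<in> cells C 1) \<and> is_colimit (disc {..<k}) C z (fan C k e)"

definition has_finite_products :: "'c sset \<Rightarrow> bool" where
  "has_finite_products C \<longleftrightarrow>
     (\<forall>k x. (\<forall>i<k. x i \<in> cells C 0) \<longrightarrow> (\<exists>e z. is_product C k e z \<and> (\<forall>i<k. tgt C (e i) = x i)))"

definition has_finite_coproducts :: "'c sset \<Rightarrow> bool" where
  "has_finite_coproducts C \<longleftrightarrow>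
     (\<forall>k x. (\<forall>i<k. x i \<in> cells C 0) \<longrightarrow> (\<exists>e z. is_coproduct C k e z \<and> (\<forall>i<k. src C (e i) = x i)))"

definition preserves_finite_products :: "'c sset \<Rightarrow> 'd sset \<Rightarrow> ('c, 'd) smap \<Rightarrow> bool" where
  "preserves_finite_products C D G \<longleftrightarrow>
     (\<forall>k e z. is_product C k e z \<longrightarrow> is_product D k (\<lambda>i. G 1 (e i)) (G 0 z))"

definition preserves_finite_coproducts :: "'c sset \<Rightarrow> 'd sset \<Rightarrow> ('c, 'd) smap \<Rightarrow> bool" where
  "preserves_finite_coproducts C D G \<longleftrightarrow>
     (\<forall>k e z. is_coproduct C k e z \<longrightarrow> is_coproduct D k (\<lambda>i. G 1 (e i)) (G 0 z))"

definition fun_prod :: "'c sset \<Rightarrow> 'd sset \<Rightarrow> (nat list \<times> 'c, 'd) smap sset" where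
  "fun_prod C D = full_sub (fun_sset C D) {h. preserves_finite_products C D (fun_at h)}"

text \<open>Small means: with simplices in the type \<open>'k\<close>, which plays the role of the universe of small
  sets and will also be the type of the simplices of the ring context.\<close>

definition cocomplete :: "'k itself \<Rightarrow> 'c sset \<Rightarrow> bool" where
  "cocomplete _ C \<longleftrightarrow>
     (\<forall>K :: 'k sset. is_sset K \<longrightarrow>
        (\<forall>p\<in>cells (fun_sset K C) 0. \<exists>x h. is_colimit K C x h \<and> src (fun_sset K C) h = p))"

text \<open>T is the functor sending x to the product of x and y.\<close>

definition times_functor :: "'c sset \<Rightarrow> 'c \<Rightarrow> ('c, 'c) smap \<Rightarrow> bool" where
  "times_functor C y T \<longleftrightarrow> T \<in> smaps C C \<and>
     (\<exists>\<alpha>\<in>cells (fun_sset C C) 1. \<exists>\<beta>\<in>cells (fun_sset C C) 1.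
        src (fun_sset C C) \<alpha> = fun_vertex C T \<and>
        tgt (fun_sset C C) \<alpha> = fun_vertex C (\<lambda>n x. x) \<and>
        src (fun_sset C C) \<beta> = fun_vertex C T \<and>
        tgt (fun_sset C C) \<beta> = fun_vertex C (\<lambda>n x. act C 0 (replicate (Suc n) 0) y) \<and>
        (\<forall>x\<in>cells C 0. is_product C 2
           (\<lambda>i. if i = 0 then \<alpha> 1 ([0, 1], idn C x) else \<beta> 1 ([0, 1], idn C x)) (T 0 x)))"

text \<open>By symmetry of the product it is enough to vary the first factor.\<close>

definition product_preserves_colimits :: "'k itself \<Rightarrow> 'c sset \<Rightarrow> bool" where
  "product_preserves_colimits _ C \<longleftrightarrow>
     (\<forall>y\<in>cells C 0. \<exists>T. times_functor C y T \<and>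
        (\<forall>(K :: 'k sset) x h. is_sset K \<and> is_colimit K C x h \<longrightarrow>
           is_colimit K C (T 0 x) (whisker_l K 1 T h)))"

definition le2 :: "nat \<times> nat \<Rightarrow> nat \<times> nat \<Rightarrow> bool" where
  "le2 p q \<longleftrightarrow> fst p \<le> fst q \<and> snd p \<le> snd q"

definition square :: "(nat \<times> nat) list sset" where
  "square = nerve ({0, 1} \<times> {0, 1}) le2"

definition cospan :: "(nat \<times> nat) list sset" where
  "cospan = nerve {(0, 1), (1, 0), (1, 1)} le2"

definition is_pullback :: "'c sset \<Rightarrow> ((nat \<times> nat) list, 'c) smap \<Rightarrow> bool" where
  "is_pullback C q \<longleftrightarrow> q \<in> smaps square C \<and>
     is_limit cospan C (q 0 [(0, 0)])
       (srestrict (simplex 1 \<otimes>\<^sub>s cospan)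
          (\<lambda>m (\<psi>, v). q m (map2 (\<lambda>i p. if i = 0 then (0, 0) else p) \<psi> v)))"

definition has_pullbacks :: "'c sset \<Rightarrow> bool" where
  "has_pullbacks C \<longleftrightarrow>
     (\<forall>f\<in>cells C 1. \<forall>g\<in>cells C 1. tgt C f = tgt C g \<longrightarrow>
        (\<exists>q. is_pullback C q \<and> q 1 [(1, 0), (1, 1)] = f \<and> q 1 [(0, 1), (1, 1)] = g))"


section \<open>Arrow categories\<close>

type_synonym 'c arr = "(nat list \<times> nat list, 'c) smap"

definition Ar :: "'c sset \<Rightarrow> 'c arr sset" where
  "Ar C = fun_sset (simplex 1) C"

definition arr :: "'c sset \<Rightarrow> 'c \<Rightarrow> 'c arr" where
  "arr C e = srestrict (simplex 0 \<otimes>\<^sub>s simplex 1) (\<lambda>m (\<psi>, \<epsilon>). act C 1 \<epsilon> e)"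

text \<open>Evaluation of an n-simplex of \<open>Ar C\<close> at the source (a = 0) or the target (a = 1).\<close>

definition ev :: "nat \<Rightarrow> ('c arr, 'c) smap" where
  "ev a n h = h n ([0..<Suc n], replicate (Suc n) a)"

text \<open>A morphism of \<open>Ar C\<close> as a square; the first coordinate is the direction of the morphism.\<close>

definition sq_of :: "'c arr \<Rightarrow> ((nat \<times> nat) list, 'c) smap" where
  "sq_of h = srestrict square (\<lambda>m v. h m (map fst v, map snd v))"

text \<open>
  T is the coproduct functor from the product of the slices over the sources of the legs \<open>c i\<close> of a
  coproduct cocone with apex z, to the slice over z: the components \<open>\<alpha> i\<close> map s naturally to a
  commutative square from \<open>s i\<close> to \<open>T s\<close> over \<open>c i\<close>, and the top edges of these squares form
  coproduct cocones.
\<close>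

definition coproduct_functor ::
    "'c sset \<Rightarrow> nat \<Rightarrow> (nat \<Rightarrow> 'c) \<Rightarrow> 'c \<Rightarrow> (nat \<Rightarrow> 'c, 'c) smap \<Rightarrow> bool" where
  "coproduct_functor C k c z T \<longleftrightarrow>
     (let P = pi_sset k (\<lambda>i. slice C (src C (c i))) in
      T \<in> smaps P (slice C z) \<and>
      (\<exists>\<alpha>. (\<forall>i<k. \<alpha> i \<in> smaps P (slice (Ar C) (arr C (c i))) \<and>
               (\<forall>n. \<forall>s\<in>cells P n. ev 0 (Suc n) (\<alpha> i n s) = s i \<and> ev 1 (Suc n) (\<alpha> i n s) = T n s)) \<and>
           (\<forall>s\<in>cells P 0. is_coproduct C k (\<lambda>i. \<alpha> i 0 s 1 ([0, 0], [0, 1])) (forget C 0 (T 0 s)))))"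

text \<open>G is the pullback functor along the edge m, exhibited by cartesian squares over m.\<close>

definition pullback_functor :: "'c sset \<Rightarrow> 'c \<Rightarrow> ('c, 'c) smap \<Rightarrow> bool" where
  "pullback_functor C m G \<longleftrightarrow> G \<in> smaps (slice C (tgt C m)) (slice C (src C m)) \<and>
     (\<exists>\<alpha>\<in>smaps (slice C (tgt C m)) (slice (Ar C) (arr C m)).
        (\<forall>n. \<forall>\<sigma>\<in>cells (slice C (tgt C m)) n.
           ev 0 (Suc n) (\<alpha> n \<sigma>) = G n \<sigma> \<and> ev 1 (Suc n) (\<alpha> n \<sigma>) = \<sigma>) \<and>
        (\<forall>\<sigma>\<in>cells (slice C (tgt C m)) 0. is_pullback C (sq_of (\<alpha> 0 \<sigma>))))"


section \<open>Span pairs and spans\<close>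

definition span_pair :: "'c sset \<Rightarrow> 'c set \<Rightarrow> bool" where
  "span_pair C W \<longleftrightarrow> qcat C \<and> wide C W \<and>
     (\<forall>f\<in>W. \<forall>g\<in>cells C 1. tgt C f = tgt C g \<longrightarrow>
        (\<exists>q. is_pullback C q \<and> q 1 [(1, 0), (1, 1)] = f \<and> q 1 [(0, 1), (1, 1)] = g)) \<and>
     (\<forall>q. is_pullback C q \<and> q 1 [(1, 0), (1, 1)] \<in> W \<longrightarrow> q 1 [(0, 0), (0, 1)] \<in> W)"

definition extensive :: "'c sset \<Rightarrow> bool" where
  "extensive C \<longleftrightarrow> qcat C \<and> has_finite_coproducts C \<and>
     (\<forall>k c z. is_coproduct C k c z \<longrightarrow>
        (\<exists>T. coproduct_functor C k c z T \<and>
             equivalence (pi_sset k (\<lambda>i. slice C (src C (c i)))) (slice C z) T))"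

text \<open>\<open>H i\<close> is the square from \<open>f i\<close> to \<open>g\<close> with \<open>c i\<close> and \<open>d i\<close> as its other two sides.\<close>

definition closed_under_coproducts :: "'c sset \<Rightarrow> 'c set \<Rightarrow> bool" where
  "closed_under_coproducts C W \<longleftrightarrow>
     (\<forall>k c x d y f g H.
        is_coproduct C k c x \<and> is_coproduct C k d y \<and>
        g \<in> cells C 1 \<and> src C g = x \<and> tgt C g = y \<and>
        (\<forall>i<k. f i \<in> W \<and> H i \<in> cells (Ar C) 1 \<and>
           H i 1 ([0, 0], [0, 1]) = f i \<and> H i 1 ([1, 1], [0, 1]) = g \<and>
           H i 1 ([0, 1], [0, 0]) = c i \<and> H i 1 ([0, 1], [1, 1]) = d i) \<longrightarrow> g \<in> W)"

definition weakly_extensive_pair :: "'c sset \<Rightarrow> 'c set \<Rightarrow> bool" where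
  "weakly_extensive_pair C W \<longleftrightarrow> span_pair C W \<and>
     has_finite_coproducts C \<and> closed_under_coproducts C W \<and>
     (\<forall>k c z. is_coproduct C k c z \<longrightarrow>
        (let P = pi_sset k (\<lambda>i. slice_on C W (src C (c i))) in
         \<exists>T. coproduct_functor C k c z T \<and> equivalence P (slice_on C W z) (srestrict P T)))"

text \<open>The last two clauses: the maps from the initial object, and the fold maps, lie in W.\<close>

definition extensive_pair :: "'c sset \<Rightarrow> 'c set \<Rightarrow> bool" where
  "extensive_pair C W \<longleftrightarrow> span_pair C W \<and> extensive C \<and> closed_under_coproducts C W \<and>
     (\<forall>e\<in>cells C 1. initial C (src C e) \<longrightarrow> e \<in> W) \<and>
     (\<forall>c z g x. is_coproduct C 2 c z \<and> x \<in> cells C 0 \<and>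
        triangle C (c 0) g (idn C x) \<and> triangle C (c 1) g (idn C x) \<longrightarrow> g \<in> W)"

text \<open>
  n-simplices of the span category are diagrams on the twisted arrow category of [n], with objects
  the intervals \<open>(i, j)\<close>, \<open>i \<le> j \<le> n\<close>, and a morphism to every subinterval. Raising i is a forward
  map, in W; lowering j is a backward map; the squares combining the two are cartesian.
\<close>

type_synonym 'c spn = "((nat \<times> nat) list, 'c) smap"

definition sub_interval :: "nat \<times> nat \<Rightarrow> nat \<times> nat \<Rightarrow> bool" where
  "sub_interval p q \<longleftrightarrow> fst p \<le> fst q \<and> snd q \<le> snd p"

definition Tw :: "nat \<Rightarrow> (nat \<times> nat) list sset" where
  "Tw n = nerve {(i, j). i \<le> j \<and> j \<le> n} sub_interval"

definition tw_square :: "'c spn \<Rightarrow> nat \<Rightarrow> nat \<Rightarrow> nat \<Rightarrow> nat \<Rightarrow> ((nat \<times> nat) list, 'c) smap" where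
  "tw_square h i i' j' j = srestrict square
     (\<lambda>m v. h m (map (\<lambda>(a, b). (if a = 0 then i else i', if b = 0 then j else j')) v))"

definition Span :: "'c sset \<Rightarrow> 'c set \<Rightarrow> 'c spn sset" where
  "Span C W = \<lparr>cells = (\<lambda>n. {h \<in> smaps (Tw n) C.
        (\<forall>i i' j. i \<le> i' \<and> i' \<le> j \<and> j \<le> n \<longrightarrow> h 1 [(i, j), (i', j)] \<in> W) \<and>
        (\<forall>i i' j' j. i < i' \<and> i' \<le> j' \<and> j' < j \<and> j \<le> n \<longrightarrow> is_pullback C (tw_square h i i' j' j))}),
     act = (\<lambda>n \<theta> h. srestrict (Tw (length \<theta> - 1))
        (\<lambda>m v. h m (map (map_prod (nth \<theta>) (nth \<theta>)) v)))\<rparr>"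

definition bw_leg :: "'c spn \<Rightarrow> 'c" where "bw_leg h = h 1 [(0, 1), (0, 0)]"
definition fw_leg :: "'c spn \<Rightarrow> 'c" where "fw_leg h = h 1 [(0, 1), (1, 1)]"

definition span_map :: "('c, 'd) smap \<Rightarrow> ('c spn, 'd spn) smap" where
  "span_map f n h = srestrict (Tw n) (\<lambda>m v. f m (h m v))"

text \<open>
  The inclusions of C (forward maps) and of its opposite (backward maps) into spans: the chain
  \<open>x\<^sub>0, \<dots>, x\<^sub>n\<close> of objects yields the diagrams \<open>(i, j) \<mapsto> x\<^sub>i\<close> and \<open>(i, j) \<mapsto> x\<^sub>n\<^sub>-\<^sub>j\<close>.
\<close>

definition fw :: "'c sset \<Rightarrow> ('c, 'c spn) smap" where
  "fw C n \<sigma> = srestrict (Tw n) (\<lambda>m v. act C n (map fst v) \<sigma>)"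

definition bw :: "'c sset \<Rightarrow> ('c, 'c spn) smap" where
  "bw C n \<sigma> = srestrict (Tw n) (\<lambda>m v. act C n (map (\<lambda>p. n - snd p) v) \<sigma>)"


section \<open>Ring contexts and bispans\<close>

definition ring_context :: "'c sset \<Rightarrow> 'c set \<Rightarrow> 'c set \<Rightarrow> bool" where
  "ring_context C M A \<longleftrightarrow> extensive C \<and> has_pullbacks C \<and>
     weakly_extensive_pair C M \<and> extensive_pair C A \<and>
     (\<forall>m\<in>M. \<exists>G R. pullback_functor C m G \<and>
        adjunction (slice C (tgt C m)) (slice C (src C m)) G R \<and>
        (\<forall>e\<in>cells (slice C (src C m)) 1. forget C 1 e \<in> A \<longrightarrow> forget C 1 (R 1 e) \<in> A))"

text \<open>
  In the opposite of the span category for M, the morphisms of A are the spans whose forward leg is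
  invertible and whose backward leg is in A.
\<close>

definition Bispan :: "'c sset \<Rightarrow> 'c set \<Rightarrow> 'c set \<Rightarrow> 'c spn spn sset" where
  "Bispan C M A = Span (op_sset (Span C M))
     {e \<in> cells (Span C M) 1. is_equiv C (fw_leg e) \<and> bw_leg e \<in> A}"

definition bispan_map :: "('c, 'd) smap \<Rightarrow> ('c spn spn, 'd spn spn) smap" where
  "bispan_map f = span_map (span_map f)"

definition bispan_incl :: "'c sset \<Rightarrow> ('c spn, 'c spn spn) smap" where
  "bispan_incl C = span_map (bw C)"


section \<open>Grouplike functors\<close>

text \<open>
  The nerve of a skeleton of finite sets: an n-simplex assigns to \<open>i \<le> j \<le> n\<close> the value list of a
  map from \<open>{..<k\<^sub>i}\<close> to \<open>{..<k\<^sub>j}\<close>, with \<open>k\<^sub>i\<close> the length of the identity list \<open>F i i\<close>.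
\<close>

definition Fin :: "(nat \<Rightarrow> nat \<Rightarrow> nat list) sset" where
  "Fin = \<lparr>cells = (\<lambda>n. {F.
        (\<forall>i\<le>n. F i i = [0..<length (F i i)]) \<and>
        (\<forall>i j. i \<le> j \<and> j \<le> n \<longrightarrow> length (F i j) = length (F i i) \<and> set (F i j) \<subseteq> set (F j j)) \<and>
        (\<forall>i j k. i \<le> j \<and> j \<le> k \<and> k \<le> n \<longrightarrow> F i k = map (nth (F j k)) (F i j)) \<and>
        (\<forall>i j. \<not> (i \<le> j \<and> j \<le> n) \<longrightarrow> F i j = [])}),
     act = (\<lambda>n \<theta> F i j. if i \<le> j \<and> j < length \<theta> then F (\<theta> ! i) (\<theta> ! j) else [])\<rparr>"

definition fin_map :: "nat \<Rightarrow> nat \<Rightarrow> nat list \<Rightarrow> nat \<Rightarrow> nat \<Rightarrow> nat list" where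
  "fin_map a b f = (\<lambda>i j. if i = 0 \<and> j = 0 then [0..<a] else if i = 1 \<and> j = 1 then [0..<b]
     else if i = 0 \<and> j = 1 then f else [])"

text \<open>
  A commutative monoid N in a category with finite products is a finite-product-preserving functor
  on spans of finite sets; its underlying object is \<open>N(1)\<close>. The projections \<open>N(2) \<rightarrow> N(1)\<close> come
  from the inclusions of 1 into 2, the addition from the fold map. N is grouplike if the shear map
  \<open>(x, y) \<mapsto> (x, x + y)\<close> is invertible.
\<close>

definition cmon_proj :: "((nat \<Rightarrow> nat \<Rightarrow> nat list) spn, 'x) smap \<Rightarrow> nat \<Rightarrow> 'x" where
  "cmon_proj N i = N 1 (bw Fin 1 (fin_map 1 2 [i]))"

definition cmon_add :: "((nat \<Rightarrow> nat \<Rightarrow> nat list) spn, 'x) smap \<Rightarrow> 'x" where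
  "cmon_add N = N 1 (fw Fin 1 (fin_map 2 1 [0, 0]))"

definition cmon_grouplike :: "'x sset \<Rightarrow> ((nat \<Rightarrow> nat \<Rightarrow> nat list) spn, 'x) smap \<Rightarrow> bool" where
  "cmon_grouplike X N \<longleftrightarrow>
     (\<exists>s. triangle X s (cmon_proj N 0) (cmon_proj N 0) \<and> triangle X s (cmon_proj N 1) (cmon_add N) \<and>
          is_equiv X s)"

text \<open>
  The lift of a finite-product-preserving functor N on the span category of an extensive span pair
  to commutative monoids sends an object x to the composite of N with the functor on spans of finite
  sets induced by the copower \<open>t = (- \<otimes> x)\<close>. The copower functors are the functors from finite sets
  to C that preserve finite coproducts, with \<open>x = t(1)\<close>.
\<close>

definition grouplike :: "'c sset \<Rightarrow> 'x sset \<Rightarrow> ('c spn, 'x) smap \<Rightarrow> bool" where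
  "grouplike C X N \<longleftrightarrow>
     (\<forall>t\<in>smaps Fin C. preserves_finite_coproducts Fin C t \<longrightarrow>
        cmon_grouplike X (\<lambda>n s. N n (span_map t n s)))"

definition Tamb :: "'c sset \<Rightarrow> 'c set \<Rightarrow> 'c set \<Rightarrow> 'x sset \<Rightarrow> (nat list \<times> 'c spn spn, 'x) smap sset" where
  "Tamb C M A X = full_sub (fun_prod (Bispan C M A) X)
     {h. grouplike C X (\<lambda>n s. fun_at h n (bispan_incl C n s))}"


section \<open>Normed semirings and rings\<close>

text \<open>
  The bispan category of arrows, for the cartesian squares with target in M and the squares with
  source in A and invertible target. Evaluation at the target takes values in the bispans whose
  second forward leg is invertible; B is its strict pullback to \<open>Span C M\<close> along the inclusion
  \<open>bw\<close>. The simplex s is recovered from \<open>bw s\<close> by evaluating at the chain of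
  intervals \<open>(0, n), \<dots>, (0, 0)\<close>.
\<close>

definition ar_pb :: "'c sset \<Rightarrow> 'c set \<Rightarrow> 'c arr set" where
  "ar_pb C M = {e \<in> cells (Ar C) 1. is_pullback C (sq_of e) \<and> ev 1 1 e \<in> M}"

definition ar_fw :: "'c sset \<Rightarrow> 'c set \<Rightarrow> 'c arr set" where
  "ar_fw C A = {e \<in> cells (Ar C) 1. ev 0 1 e \<in> A \<and> is_equiv C (ev 1 1 e)}"

definition ar_base :: "('c arr spn spn, 'c spn) smap" where
  "ar_base n b = bispan_map (ev 1) n b n (map (\<lambda>i. (0, n - i)) [0..<Suc n])"

definition ar_bispan :: "'c sset \<Rightarrow> 'c set \<Rightarrow> 'c set \<Rightarrow> 'c arr spn spn sset" where
  "ar_bispan C M A = sub_sset (Bispan (Ar C) (ar_pb C M) (ar_fw C A))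
     (\<lambda>n b. ar_base n b \<in> cells (Span C M) n \<and>
            bispan_map (ev 1) n b = bw (op_sset (Span C M)) n (ar_base n b))"

text \<open>
  The functor from \<open>Span (slice C x) A\<close> to the strict fibre of B over x. It is an equivalence but
  not an isomorphism: the M-components of the bispans in the fibre are invertible, not identities.
  \<open>slice_arr\<close> includes the slice over x in the arrow category.
\<close>

definition slice_arr :: "'c sset \<Rightarrow> ('c, 'c arr) smap" where
  "slice_arr C k \<sigma> = srestrict (simplex k \<otimes>\<^sub>s simplex 1)
     (\<lambda>m (\<psi>, \<epsilon>). act C (Suc k) (map2 (\<lambda>i a. if a = 0 then i else Suc k) \<psi> \<epsilon>) \<sigma>)"

definition fibre_incl :: "'c sset \<Rightarrow> ('c spn, 'c arr spn spn) smap" where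
  "fibre_incl C = span_map (\<lambda>k \<sigma>. bw (Ar C) k (slice_arr C k \<sigma>))"

text \<open>The pullback of \<open>p : B \<rightarrow> S\<close> to the n-simplex along an n-simplex \<open>\<sigma>\<close> of S.\<close>

definition pull :: "'b sset \<Rightarrow> ('b, 's) smap \<Rightarrow> 's sset \<Rightarrow> nat \<Rightarrow> 's \<Rightarrow> (nat list \<times> 'b) sset" where
  "pull B p S n \<sigma> = sub_sset (simplex n \<otimes>\<^sub>s B) (\<lambda>m (\<psi>, b). p m b = act S n \<psi> \<sigma>)"

text \<open>
  The total space over S whose fibre over a vertex x consists of the finite-product-preserving
  functors to X from the fibre of \<open>p : B \<rightarrow> S\<close> over x. An n-simplex over \<open>\<sigma>\<close> is a functor to X on
  the pullback of B along \<open>\<sigma>\<close>. For a cocartesian fibration p, an edge over \<open>e : x \<rightarrow> y\<close> amounts to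
  functors G on the fibre over x and H on the fibre over y with a transformation from G to the
  composite of H with the pushforward \<open>e\<^sub>!\<close> of p. It is cocartesian if it exhibits H as the left
  Kan extension of G along \<open>e\<^sub>!\<close>, so that the cocartesian functoriality is by left Kan extension.
  Sections are the same as functors from B to X that preserve finite products on the fibres.
\<close>

definition fibrewise_functors ::
    "'b sset \<Rightarrow> ('b, 's) smap \<Rightarrow> 's sset \<Rightarrow> 'x sset \<Rightarrow> ('s \<times> (nat list \<times> 'b, 'x) smap) sset" where
  "fibrewise_functors B p S X =
     full_sub
       \<lparr>cells = (\<lambda>n. {(\<sigma>, h). \<sigma> \<in> cells S n \<and> h \<in> smaps (pull B p S n \<sigma>) X}),
        act = (\<lambda>n \<theta> (\<sigma>, h). (act S n \<theta> \<sigma>,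
          srestrict (pull B p S (length \<theta> - 1) (act S n \<theta> \<sigma>)) (\<lambda>m (\<psi>, b). h m (map (nth \<theta>) \<psi>, b))))\<rparr>
       {(x, h). preserves_finite_products (pull B p S 0 x) X h}"

definition cocartesian :: "'t sset \<Rightarrow> 's sset \<Rightarrow> ('t, 's) smap \<Rightarrow> 't \<Rightarrow> bool" where
  "cocartesian T S q e \<longleftrightarrow> e \<in> cells T 1 \<and>
     (\<forall>n\<ge>2. \<forall>s. \<forall>\<sigma>\<in>cells S n.
        compatible T n {1..n} s \<and> act T (n - 1) [0, 1] (s n) = e \<and>
        (\<forall>i\<in>{1..n}. q (n - 1) (s i) = act S n (face n i) \<sigma>) \<longrightarrow>
        (\<exists>\<tau>\<in>cells T n. q n \<tau> = \<sigma> \<and> (\<forall>i\<in>{1..n}. act T n (face n i) \<tau> = s i)))"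

definition sections :: "'t sset \<Rightarrow> 's sset \<Rightarrow> ('t, 's) smap \<Rightarrow> (nat list \<times> 's, 't) smap sset" where
  "sections T S q = sub_sset (fun_sset S T)
     (\<lambda>n s. \<forall>m. \<forall>(\<psi>, \<sigma>)\<in>cells (simplex n \<otimes>\<^sub>s S) m. q m (s m (\<psi>, \<sigma>)) = \<sigma>)"

type_synonym ('c, 'x) nmon_cell = "'c spn \<times> (nat list \<times> 'c arr spn spn, 'x) smap"

definition NMon :: "'c sset \<Rightarrow> 'c set \<Rightarrow> 'c set \<Rightarrow> 'x sset \<Rightarrow> ('c, 'x) nmon_cell sset" where
  "NMon C M A X = fibrewise_functors (ar_bispan C M A) ar_base (Span C M) X"

text \<open>Normed algebras in \<open>NMon\<close>: sections that send backward maps to cocartesian edges.\<close>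

definition NRig :: "'c sset \<Rightarrow> 'c set \<Rightarrow> 'c set \<Rightarrow> 'x sset \<Rightarrow>
    (nat list \<times> 'c spn, ('c, 'x) nmon_cell) smap sset" where
  "NRig C M A X = full_sub (sections (NMon C M A X) (Span C M) (\<lambda>n. fst))
     {R. \<forall>e\<in>cells (Span C M) 1. is_equiv C (fw_leg e) \<longrightarrow>
           cocartesian (NMon C M A X) (Span C M) (\<lambda>n. fst) (fun_at R 1 e)}"

text \<open>The value at x of a normed semiring, as a functor on \<open>Span (slice C x) A\<close>.\<close>

definition nrig_value :: "'c sset \<Rightarrow> (nat list \<times> 'c spn, ('c, 'x) nmon_cell) smap \<Rightarrow> 'c \<Rightarrow>
    ('c spn, 'x) smap" where
  "nrig_value C R x = (\<lambda>n s. fun_at (snd (fun_at R 0 (bw C 0 x))) n (fibre_incl C n s))"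

definition NRing :: "'c sset \<Rightarrow> 'c set \<Rightarrow> 'c set \<Rightarrow> 'x sset \<Rightarrow>
    (nat list \<times> 'c spn, ('c, 'x) nmon_cell) smap sset" where
  "NRing C M A X = full_sub (NRig C M A X)
     {R. \<forall>x\<in>cells C 0. grouplike (slice C x) X (nrig_value C R x)}"

text \<open>
  Precomposition with evaluation at the source \<open>B \<rightarrow> Bispan C M A\<close>, where a functor on B is read
  as the section sending \<open>\<sigma>\<close> to the restriction of the functor to the pullback of B along \<open>\<sigma>\<close>.
\<close>

definition ev0_precomp :: "'c sset \<Rightarrow> 'c set \<Rightarrow> 'c set \<Rightarrow> 'x sset \<Rightarrow>
    ((nat list \<times> 'c spn spn, 'x) smap, (nat list \<times> 'c spn, ('c, 'x) nmon_cell) smap) smap" where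
  "ev0_precomp C M A X = srestrict (fun_prod (Bispan C M A) X)
     (\<lambda>n H. srestrict (simplex n \<otimes>\<^sub>s Span C M) (\<lambda>m (\<psi>, \<sigma>).
        (\<sigma>, srestrict (pull (ar_bispan C M A) ar_base (Span C M) m \<sigma>)
              (\<lambda>k (\<chi>, b). H k (map (nth \<psi>) \<chi>, bispan_map (ev 0) k b)))))"

end

theory Submission
  imports Defs
begin

text \<open>
  The functor \<open>\<Phi>\<close> is inverse to precomposition E with \<open>ev\<^sub>0\<close>, and \<open>R \<simeq> E (\<Phi> R)\<close>. Hence it suffices that
  grouplikeness of the values of R is invariant under equivalences, and that T is a Tambara functor
  if and only if E T is a normed ring.

  The value of E T at X is the composite of T with
  \<open>Span\<^sub>A(\<F>\<^bsub>/X\<^esub>) \<rightarrow> Span\<^sub>A(\<F>) \<rightarrow> Bispan\<^bsub>M,A\<^esub>(\<F>)\<close>. The forgetful functor \<open>\<F>\<^bsub>/X\<^esub> \<rightarrow> \<F>\<close> preserves and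
  reflects coproducts, so the commutative monoid of this composite at \<open>x \<rightarrow> X\<close> is the one of T at x,
  and every object x underlies the identity of x. The composite makes sense because squares with two
  degenerate parallel sides are pullbacks; this rests on fillers for horns with a degenerate outer edge.

  An equivalence of semirings has components that are equivalences between the values and commute with
  projections and addition, so that one of the two shear maps is an equivalence if the other is.
\<close>

text \<open>Two obstacles shape the proof. A pullback is a terminal vertex of a strictly defined
  simplicial set of cones. A cone carries its diagram as the last vertex, so terminality leads to
  horns opposite to the last vertex; they can be filled because a side of the square is an identity.
  Such fillings are organised combinatorially, as extensions of maps given on families of vertex
  sets. Secondly, the span category is not shown to be a quasicategory, so in its opposite even
  squares with degenerate sides are not known to be cartesian. The fibres of the bispan category of
  arrows are therefore treated as simplicial sets that may lack degeneracies, and a map out of them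
  has the default value \<open>undefined\<close> at the missing ones. Invariance of grouplikeness
  has to cope with these values; this takes a case analysis of the few bispans involved: the
  projections, the addition and the diagonal. Commutative monoids at an object are given by copower
  functors on finite sets. Each such functor t lifts to the slice over t(1), since finite sets map
  to the point; this is how the slices see all of them.\<close>

abbreviation bd :: "'a sset \<Rightarrow> nat \<Rightarrow> nat \<Rightarrow> 'a \<Rightarrow> 'a" where
  "bd X n i \<equiv> act X n (face n i)"

section \<open>Maps on complexes of vertices\<close>

lemma opsD: "\<theta> \<in> ops m n \<Longrightarrow> length \<theta> = Suc m" "\<theta> \<in> ops m n \<Longrightarrow> sorted \<theta>"
  "\<theta> \<in> ops m n \<Longrightarrow> set \<theta> \<subseteq> {..n}"
  by (auto simp: ops_def)

lemma ops_nth: "\<theta> \<in> ops m n \<Longrightarrow> i \<le> m \<Longrightarrow> \<theta> ! i \<le> n"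
  by (metis atMost_iff le_imp_less_Suc nth_mem opsD(1) opsD(3) subsetD)

lemma sorted_mapI:
  fixes f :: "'b::linorder \<Rightarrow> 'c::linorder"
  shows "sorted v \<Longrightarrow> (\<And>x y. x \<in> set v \<Longrightarrow> y \<in> set v \<Longrightarrow> x \<le> y \<Longrightarrow> f x \<le> f y) \<Longrightarrow> sorted (map f v)"
  by (simp add: sorted_map) (metis (mono_tags, lifting) sorted_wrt_mono_rel)

lemma sorted_map_nth: "sorted v \<Longrightarrow> sorted \<theta> \<Longrightarrow> set \<theta> \<subseteq> {..<length v} \<Longrightarrow> sorted (map (nth v) \<theta>)"
  by (rule sorted_mapI) (auto simp: subset_iff intro: sorted_nth_mono)

lemma set_map_nth: "\<theta> \<in> ops k n \<Longrightarrow> length v = Suc n \<Longrightarrow> set (map (nth v) \<theta>) \<subseteq> set v"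
  by (auto simp: ops_def subset_iff less_Suc_eq_le)

lemma ops_comp: "\<psi> \<in> ops k m \<Longrightarrow> \<theta> \<in> ops m n \<Longrightarrow> map (nth \<theta>) \<psi> \<in> ops k n"
  using ops_nth[of \<theta> m n] sorted_map_nth[of \<theta> \<psi>]
  by (auto simp: ops_def subset_iff less_Suc_eq_le)

lemma ops_id: "[0..<Suc n] \<in> ops n n"
  by (auto simp: ops_def simp del: upt_Suc)

lemma ops_replicate: "i \<le> n \<Longrightarrow> replicate (Suc m) i \<in> ops m n"
  by (auto simp: ops_def)

lemma map_nth_upt: "length v = Suc n \<Longrightarrow> map (nth v) [0..<Suc n] = v"
  by (metis map_nth)

lemma ops_map_nth_id: "\<psi> \<in> ops k n \<Longrightarrow> map (nth [0..<Suc n]) \<psi> = \<psi>"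
  by (rule map_idI) (auto simp: ops_def subset_iff nth_append less_Suc_eq_le)

lemma sorted_nth_ops: "\<theta> \<in> ops k n \<Longrightarrow> length v = Suc n \<Longrightarrow> sorted v \<Longrightarrow> sorted (map (nth v) \<theta>)"
  by (rule sorted_map_nth) (auto simp: ops_def subset_iff less_Suc_eq_le)

lemma face_eq: "i \<le> n \<Longrightarrow> face n i = map (\<lambda>j. if j < i then j else Suc j) [0..<n]"
proof -
  assume i: "i \<le> n"
  have "[0..<Suc n] = [0..<i] @ i # [Suc i..<Suc n]"
    using i upt_add_eq_append[of 0 i "Suc n - i"] upt_conv_Cons[of i "Suc n"] by (simp del: upt_Suc)
  then have "face n i = [0..<i] @ [Suc i..<Suc n]"
    by (auto simp: face_def filter_id_conv simp del: upt_Suc)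
  also have "[Suc i..<Suc n] = map Suc [i..<n]" by (simp add: map_Suc_upt)
  also have "[0..<i] @ map Suc [i..<n] = map (\<lambda>j. if j < i then j else Suc j) ([0..<i] @ [i..<n])"
    using map_idI[of "[0..<i]" "\<lambda>j. if j < i then j else Suc j"] by simp
  also have "[0..<i] @ [i..<n] = [0..<n]" using i by (metis le0 le_add_diff_inverse upt_add_eq_append)
  finally show ?thesis .
qed

lemma length_face[simp]: "i \<le> n \<Longrightarrow> length (face n i) = n" by (simp add: face_eq)

lemma face_nth: "i \<le> n \<Longrightarrow> j < n \<Longrightarrow> face n i ! j = (if j < i then j else Suc j)" by (simp add: face_eq)

lemma set_face: "set (face n i) = {..n} - {i}" by (auto simp: face_def)

lemma sorted_face: "sorted (face n i)" by (simp add: face_def sorted_filter sorted_wrt_filter del: upt_Suc)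

lemma distinct_face: "distinct (face n i)" by (simp add: face_def del: upt_Suc)

lemma face_ops: "1 \<le> n \<Longrightarrow> i \<le> n \<Longrightarrow> face n i \<in> ops (n - 1) n"
  by (auto simp: ops_def set_face sorted_face)

text \<open>The cosimplicial identity for faces coded as value lists: both sides skip i and
  j.\<close>

lemma face_face: "i < j \<Longrightarrow> j \<le> n \<Longrightarrow> 2 \<le> n \<Longrightarrow>
   map (nth (face n j)) (face (n - 1) i) = map (nth (face n i)) (face (n - 1) (j - 1))"
  by (rule nth_equalityI) (auto simp: face_nth)

lemma sset_in: "is_sset X \<Longrightarrow> \<theta> \<in> ops m n \<Longrightarrow> x \<in> cells X n \<Longrightarrow> act X n \<theta> x \<in> cells X m"
  by (auto simp: is_sset_def)

lemma sset_id: "is_sset X \<Longrightarrow> x \<in> cells X n \<Longrightarrow> act X n [0..<Suc n] x = x"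
  unfolding is_sset_def by blast

lemma sset_comp: "is_sset X \<Longrightarrow> \<psi> \<in> ops k m \<Longrightarrow> \<theta> \<in> ops m n \<Longrightarrow> x \<in> cells X n \<Longrightarrow>
   act X m \<psi> (act X n \<theta> x) = act X n (map (nth \<theta>) \<psi>) x"
  unfolding is_sset_def by blast

lemma is_ssetI:
  assumes "\<And>m n \<theta> x. \<theta> \<in> ops m n \<Longrightarrow> x \<in> cells X n \<Longrightarrow> act X n \<theta> x \<in> cells X m"
    "\<And>n x. x \<in> cells X n \<Longrightarrow> act X n [0..<Suc n] x = x"
    "\<And>k m n \<psi> \<theta> x. \<psi> \<in> ops k m \<Longrightarrow> \<theta> \<in> ops m n \<Longrightarrow> x \<in> cells X n \<Longrightarrow>
        act X m \<psi> (act X n \<theta> x) = act X n (map (nth \<theta>) \<psi>) x"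
  shows "is_sset X"
  unfolding is_sset_def using assms by blast

text \<open>A complex L is a family of nonempty finite sets of vertices, ordered as natural numbers;
  a map from the corresponding simplicial set to D is a function on the weakly increasing lists
  of vertices of its simplices.\<close>

definition cx :: "'a sset \<Rightarrow> nat set set \<Rightarrow> (nat list \<Rightarrow> 'a) \<Rightarrow> bool" where
  "cx D L g \<longleftrightarrow> (\<forall>v. v \<noteq> [] \<and> sorted v \<and> set v \<in> L \<longrightarrow>
     g v \<in> cells D (length v - 1) \<and>
     (\<forall>m. \<forall>\<theta>\<in>ops m (length v - 1). act D (length v - 1) \<theta> (g v) = g (map (nth v) \<theta>)))"

abbreviation cx_ext :: "'a sset \<Rightarrow> nat set set \<Rightarrow> (nat list \<Rightarrow> 'a) \<Rightarrow> nat set set \<Rightarrow> bool" where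
  "cx_ext D L g K \<equiv> \<exists>g'. cx D K g' \<and> (\<forall>v. set v \<in> L \<longrightarrow> g' v = g v)"

definition closed_cx :: "nat set set \<Rightarrow> bool" where
  "closed_cx L \<longleftrightarrow> (\<forall>S\<in>L. finite S \<and> S \<noteq> {} \<and> (\<forall>T. T \<noteq> {} \<and> T \<subseteq> S \<longrightarrow> T \<in> L))"

lemma cx_in: "cx D L g \<Longrightarrow> v \<noteq> [] \<Longrightarrow> sorted v \<Longrightarrow> set v \<in> L \<Longrightarrow> g v \<in> cells D (length v - 1)"
  by (auto simp: cx_def)

lemma cx_act: "cx D L g \<Longrightarrow> sorted v \<Longrightarrow> set v \<in> L \<Longrightarrow> length v = Suc n \<Longrightarrow> \<theta> \<in> ops m n \<Longrightarrow>
   act D n \<theta> (g v) = g (map (nth v) \<theta>)"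
  unfolding cx_def by (metis One_nat_def diff_Suc_1 length_0_conv nat.distinct(1))

lemma cxI:
  assumes "\<And>v n. length v = Suc n \<Longrightarrow> sorted v \<Longrightarrow> set v \<in> L \<Longrightarrow> g v \<in> cells D n"
    "\<And>v n m \<theta>. length v = Suc n \<Longrightarrow> sorted v \<Longrightarrow> set v \<in> L \<Longrightarrow> \<theta> \<in> ops m n \<Longrightarrow>
       act D n \<theta> (g v) = g (map (nth v) \<theta>)"
  shows "cx D L g"
  unfolding cx_def using assms
  by (metis One_nat_def Suc_pred length_greater_0_conv)

lemma cx_mono: "cx D L g \<Longrightarrow> L' \<subseteq> L \<Longrightarrow> cx D L' g"
  by (auto simp: cx_def)

lemma closed_cxD: "closed_cx L \<Longrightarrow> S \<in> L \<Longrightarrow> T \<subseteq> S \<Longrightarrow> T \<noteq> {} \<Longrightarrow> T \<in> L"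
  unfolding closed_cx_def by blast

text \<open>The rank of x with respect to c. On the elements of c it inverts the sorted list of c,
  and so it renumbers the vertices of the simplex on c as 0, 1, and so on.\<close>

definition pos :: "nat set \<Rightarrow> nat \<Rightarrow> nat" where "pos c x = card {y \<in> c. y < x}"

lemma pos_mono: "finite c \<Longrightarrow> x \<le> y \<Longrightarrow> pos c x \<le> pos c y"
  unfolding pos_def by (rule card_mono) auto

lemma pos_less: "finite c \<Longrightarrow> x \<in> c \<Longrightarrow> pos c x < card c"
  unfolding pos_def by (rule psubset_card_mono) auto

lemma pos_nth: "sorted l \<Longrightarrow> distinct l \<Longrightarrow> i < length l \<Longrightarrow> pos (set l) (l ! i) = i"
proof -
  assume a: "sorted l" "distinct l" "i < length l"
  have "{y \<in> set l. y < l ! i} = (nth l) ` {..<i}"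
  proof -
    have "sorted_wrt (<) l" using a by (simp add: strict_sorted_iff)
    then have *: "j < length l \<Longrightarrow> (l ! j < l ! i) = (j < i)" for j
      using a(3) by (metis linorder_neqE_nat not_less_iff_gr_or_eq sorted_wrt_nth_less)
    show ?thesis
    proof (intro equalityI subsetI)
      fix y assume "y \<in> {y \<in> set l. y < l ! i}"
      then obtain j where "j < length l" "y = l ! j" "l ! j < l ! i" by (auto simp: in_set_conv_nth)
      then show "y \<in> nth l ` {..<i}" using * by blast
    qed (use * a(3) in auto)
  qed
  then show ?thesis unfolding pos_def using a
    by (simp add: card_image inj_on_def nth_eq_iff_index_eq)
qed

abbreviation lst :: "nat set \<Rightarrow> nat list" where "lst \<equiv> sorted_list_of_set"

lemma nth_pos: "finite c \<Longrightarrow> x \<in> c \<Longrightarrow> lst c ! pos c x = x"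
  by (metis distinct_sorted_list_of_set in_set_conv_nth pos_nth set_sorted_list_of_set sorted_sorted_list_of_set)

text \<open>A definition by cases works, because \<open>eq\<close> makes the old values and those of
  \<sigma> agree on the lists common to both.\<close>

lemma cx_add:
  assumes D: "is_sset D" and L: "closed_cx L" and g: "cx D L g" and c: "finite c" "card c = Suc m"
    and \<sigma>: "\<sigma> \<in> cells D m"
    and eq: "\<And>v. v \<noteq> [] \<Longrightarrow> sorted v \<Longrightarrow> set v \<subseteq> c \<Longrightarrow> set v \<in> L \<Longrightarrow> g v = act D m (map (pos c) v) \<sigma>"
  shows "\<exists>g'. cx D (L \<union> {T. T \<noteq> {} \<and> T \<subseteq> c}) g' \<and> (\<forall>v. set v \<in> L \<longrightarrow> g' v = g v) \<and>
     (\<forall>v. v \<noteq> [] \<longrightarrow> sorted v \<longrightarrow> set v \<subseteq> c \<longrightarrow> g' v = act D m (map (pos c) v) \<sigma>)"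
proof -
  define g' where "g' v = (if set v \<in> L then g v else act D m (map (pos c) v) \<sigma>)" for v
  have ops: "map (pos c) v \<in> ops n m" if "length v = Suc n" "sorted v" "set v \<subseteq> c" for v n
    using that c pos_mono[of c] pos_less[of c] by (auto simp: ops_def sorted_iff_nth_mono_less subset_iff less_Suc_eq_le)
  have g'c: "g' v = act D m (map (pos c) v) \<sigma>" if "v \<noteq> []" "sorted v" "set v \<subseteq> c" for v
    using eq that by (auto simp: g'_def)
  have "cx D (L \<union> {T. T \<noteq> {} \<and> T \<subseteq> c}) g'"
  proof (rule cxI)
    fix v n assume v: "length v = Suc n" "sorted v" "set v \<in> L \<union> {T. T \<noteq> {} \<and> T \<subseteq> c}"
    have vn: "v \<noteq> []" using v by auto
    show "g' v \<in> cells D n"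
    proof (cases "set v \<in> L")
      case True then show ?thesis using cx_in[OF g vn v(2) True] v by (simp add: g'_def)
    next
      case False then show ?thesis using sset_in[OF D ops[of v n] \<sigma>] v by (auto simp: g'_def)
    qed
    fix k \<theta> assume \<theta>: "\<theta> \<in> ops k n"
    have s: "set (map (nth v) \<theta>) \<subseteq> set v" using set_map_nth[OF \<theta> v(1)] .
    have ne: "map (nth v) \<theta> \<noteq> []" using opsD[OF \<theta>] by auto
    have so: "sorted (map (nth v) \<theta>)" using sorted_nth_ops[OF \<theta> v(1,2)] .
    show "act D n \<theta> (g' v) = g' (map (nth v) \<theta>)"
    proof (cases "set v \<in> L")
      case True
      then have "set (map (nth v) \<theta>) \<in> L" using closed_cxD[OF L True s] ne by auto
      then show ?thesis using True cx_act[OF g v(2) True v(1) \<theta>] by (simp add: g'_def)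
    next
      case False
      then have vc: "set v \<subseteq> c" using v by auto
      have "act D n \<theta> (g' v) = act D m (map (nth (map (pos c) v)) \<theta>) \<sigma>"
        using sset_comp[OF D \<theta> ops[OF v(1,2) vc] \<sigma>] g'c[OF vn v(2) vc] by simp
      also have "map (nth (map (pos c) v)) \<theta> = map (pos c) (map (nth v) \<theta>)"
        using opsD[OF \<theta>] v by auto
      finally show ?thesis using g'c[OF ne so] s vc by auto
    qed
  qed
  moreover have "\<forall>v. set v \<in> L \<longrightarrow> g' v = g v" by (simp add: g'_def)
  ultimately show ?thesis using g'c by blast
qed

text \<open>The index j is a position in the sorted list of c, not a vertex, so that it matches the
  index of the face operator.\<close>

definition cface :: "nat set \<Rightarrow> nat \<Rightarrow> nat list" where
  "cface c j = map (nth (lst c)) (face (card c - 1) j)"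

lemma cface_props:
  assumes "finite c" "card c = Suc m" "j \<le> m"
  shows "sorted (cface c j)" "length (cface c j) = m" "set (cface c j) = c - {lst c ! j}"
    "distinct (cface c j)"
proof -
  show "sorted (cface c j)"
    unfolding cface_def using assms by (intro sorted_map_nth) (auto simp: sorted_face set_face)
  show "length (cface c j) = m" using assms by (simp add: cface_def)
  have "set (cface c j) = nth (lst c) ` ({..m} - {j})" using assms by (auto simp: cface_def set_face)
  also have "\<dots> = nth (lst c) ` {..m} - {lst c ! j}"
    using assms by (auto simp: nth_eq_iff_index_eq)
  also have "nth (lst c) ` {..m} = c"
  proof -
    have "c = set (lst c)" using assms by simp
    also have "\<dots> = nth (lst c) ` {..m}" using assms unfolding set_conv_nth by (auto simp: less_Suc_eq_le)
    finally show ?thesis by simp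
  qed
  finally show "set (cface c j) = c - {lst c ! j}" .
  show "distinct (cface c j)" unfolding cface_def using assms
    by (auto simp: distinct_map distinct_face inj_on_def nth_eq_iff_index_eq set_face)
qed

text \<open>By \<open>face_face\<close>, both iterated faces are values of g on the same list,
  namely c without two vertices.\<close>

lemma cface_compatible:
  assumes D: "is_sset D" and g: "cx D L g" and c: "finite c" "card c = Suc m" "1 \<le> m"
    and I: "I \<subseteq> {..m}" "\<And>i. i \<in> I \<Longrightarrow> c - {lst c ! i} \<in> L"
  shows "compatible D m I (\<lambda>i. g (cface c i))"
  unfolding compatible_def
proof (intro conjI ballI impI)
  fix i assume i: "i \<in> I"
  then have "i \<le> m" using I by auto
  note p = cface_props[OF c(1,2) this]
  show "g (cface c i) \<in> cells D (m - 1)"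
    using cx_in[OF g _ p(1)] p(2,3) I(2)[OF i] c(3) by fastforce
next
  fix i j assume ij: "2 \<le> m" "i \<in> I" "j \<in> I" "i < j"
  then have im: "i \<le> m" and jm: "j \<le> m" using I by auto
  note pi = cface_props[OF c(1,2) im] and pj = cface_props[OF c(1,2) jm]
  have "bd D (m - 1) i (g (cface c j)) = g (map (nth (cface c j)) (face (m - 1) i))"
    by (rule cx_act[OF g pj(1) _ _ face_ops[of "m - 1" i]]) (use ij im jm I(2) pj(2,3) in auto)
  moreover have "bd D (m - 1) (j - 1) (g (cface c i)) = g (map (nth (cface c i)) (face (m - 1) (j-1)))"
    by (rule cx_act[OF g pi(1) _ _ face_ops[of "m - 1" "j - 1"]]) (use ij im jm I(2) pi(2,3) in auto)
  moreover have "map (nth (cface c j)) (face (m - 1) i) = map (nth (lst c)) (map (nth (face m j)) (face (m - 1) i))"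
    using c ij jm by (auto simp: cface_def set_face)
  moreover have "map (nth (cface c i)) (face (m - 1) (j - 1)) = map (nth (lst c)) (map (nth (face m i)) (face (m - 1) (j - 1)))"
    using c ij im by (auto simp: cface_def set_face)
  ultimately show "bd D (m - 1) i (g (cface c j)) = bd D (m - 1) (j - 1) (g (cface c i))"
    using face_face[OF ij(4) jm ij(1)] by metis
qed

text \<open>By \<open>cov\<close>, a simplex of c that lies in L already is contained in one of the
  prescribed faces; equality of \<sigma> and g on these faces therefore gives the agreement that
  \<open>cx_add\<close> asks for.\<close>

lemma cx_fill:
  assumes D: "is_sset D" and L: "closed_cx L" and g: "cx D L g" and c: "finite c" "card c = Suc m" "1 \<le> m"
    and I: "I \<subseteq> {..m}" "\<And>i. i \<in> I \<Longrightarrow> c - {lst c ! i} \<in> L"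
    and cov: "\<And>T. T \<in> L \<Longrightarrow> T \<subseteq> c \<Longrightarrow> \<exists>i\<in>I. T \<subseteq> c - {lst c ! i}"
    and \<sigma>: "\<sigma> \<in> cells D m" "\<And>i. i \<in> I \<Longrightarrow> bd D m i \<sigma> = g (cface c i)"
  shows "cx_ext D L g (L \<union> {T. T \<noteq> {} \<and> T \<subseteq> c})"
proof -
  have "g v = act D m (map (pos c) v) \<sigma>" if v: "v \<noteq> []" "sorted v" "set v \<subseteq> c" "set v \<in> L" for v
  proof -
    obtain i where i: "i \<in> I" "set v \<subseteq> c - {lst c ! i}" using cov v by blast
    then have im: "i \<le> m" using I by auto
    note p = cface_props[OF c(1,2) im]
    \<comment> \<open>The list is renumbered within the face opposite to position i; composing with
      the face operator gives its renumbering within c.\<close>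
    let ?p = "pos (c - {lst c ! i})"
    let ?\<theta> = "map ?p v"
    have fin: "finite (c - {lst c ! i})" and cd: "card (c - {lst c ! i}) = m"
      using c im p(3,4,2) distinct_card[of "cface c i"] by auto
    have l: "lst (c - {lst c ! i}) = cface c i"
      using p by (metis sorted_list_of_set.idem_if_sorted_distinct)
    obtain n where n: "length v = Suc n" using v(1) by (cases v) auto
    have th: "?\<theta> \<in> ops n (m - 1)"
      using v i(2) n pos_mono[OF fin] pos_less[OF fin] cd c(3)
      by (fastforce simp: ops_def sorted_iff_nth_mono_less subset_iff)
    have "map (nth (cface c i)) ?\<theta> = v"
      using nth_pos[OF fin] i(2) l by (auto simp: map_idI subset_iff)
    moreover have "act D (m - 1) ?\<theta> (g (cface c i)) = g (map (nth (cface c i)) ?\<theta>)"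
      by (rule cx_act[OF g p(1)]) (use p I i c th in auto)
    moreover have "act D (m - 1) ?\<theta> (bd D m i \<sigma>) = act D m (map (nth (face m i)) ?\<theta>) \<sigma>"
      by (rule sset_comp[OF D th face_ops \<sigma>(1)]) (use c im in auto)
    moreover have "map (nth (face m i)) ?\<theta> = map (pos c) v"
    proof -
      have "face m i ! ?p x = pos c x" if "x \<in> set v" for x
      proof -
        have xc: "x \<in> c - {lst c ! i}" using that i by auto
        have pm: "?p x < m" using pos_less[OF fin xc] cd by simp
        have "lst c ! (face m i ! ?p x) = cface c i ! ?p x"
          using pm im c by (simp add: cface_def)
        also have "\<dots> = x" using nth_pos[OF fin xc] l by simp
        finally have e: "lst c ! (face m i ! ?p x) = x" .
        have "face m i ! ?p x \<le> m" using pm im by (simp add: face_nth)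
        then have "pos (set (lst c)) (lst c ! (face m i ! ?p x)) = face m i ! ?p x"
          using c by (intro pos_nth) auto
        then show ?thesis using e c by simp
      qed
      then show ?thesis by simp
    qed
    ultimately show ?thesis using \<sigma>(2)[OF i(1)] by metis
  qed
  from cx_add[OF D L g c(1,2) \<sigma>(1) this] show ?thesis by blast
qed

lemma qcat_sset: "qcat D \<Longrightarrow> is_sset D" by (simp add: qcat_def)

text \<open>Every nonempty proper subset of c other than c - {k} misses a vertex different from k
  and hence lies in a facet from L; so filling the horn adds just c and c - {k}. The filler is a
  hypothesis, since inner horns and special outer horns are both treated in this way.\<close>

lemma cx_horn_gen:
  assumes D: "is_sset D" and L: "closed_cx L" and g: "cx D L g" and c: "finite c" 
    and k: "k \<in> c" "c \<noteq> {k}"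
    and fill: "\<And>m. card c = Suc m \<Longrightarrow> 1 \<le> m \<Longrightarrow> compatible D m ({..m} - {pos c k}) (\<lambda>i. g (cface c i)) \<Longrightarrow>
       \<exists>\<sigma>\<in>cells D m. \<forall>i\<in>{..m} - {pos c k}. bd D m i \<sigma> = g (cface c i)"
    and h: "\<And>i. i \<in> c \<Longrightarrow> i \<noteq> k \<Longrightarrow> c - {i} \<in> L" "c - {k} \<notin> L"
  shows "cx_ext D L g (L \<union> {c, c - {k}})"
proof -
  have "card c \<noteq> 0" "card c \<noteq> 1" using c k card_1_singletonE by auto
  then obtain m where m: "card c = Suc m" "1 \<le> m"
    by (metis One_nat_def Suc_leI not0_implies_Suc old.nat.distinct(2) zero_less_iff_neq_zero)
  let ?j = "pos c k"
  have j: "lst c ! ?j = k" by (rule nth_pos[OF c k(1)])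
  have jm: "?j \<le> m" using pos_less[OF c k(1)] m by simp
  have inj: "lst c ! i \<noteq> k" if "i \<le> m" "i \<noteq> ?j" for i
    using that j jm m c by (metis distinct_sorted_list_of_set length_sorted_list_of_set less_Suc_eq_le nth_eq_iff_index_eq)
  have memc: "lst c ! i \<in> c" if "i \<le> m" for i
    using that m c by (metis length_sorted_list_of_set less_Suc_eq_le nth_mem set_sorted_list_of_set)
  let ?I = "{..m} - {?j}"
  have I: "c - {lst c ! i} \<in> L" if "i \<in> ?I" for i
    using that h(1) inj memc by auto
  have comp: "compatible D m ?I (\<lambda>i. g (cface c i))"
    by (rule cface_compatible[OF D g c m]) (use I in auto)
  obtain \<sigma> where \<sigma>: "\<sigma> \<in> cells D m" "\<forall>i\<in>?I. bd D m i \<sigma> = g (cface c i)"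
    using fill[OF m comp] by blast
  have cL: "c \<notin> L" using h(2) closed_cxD[OF L, of c "c - {k}"] k by auto
  have "cx_ext D L g (L \<union> {T. T \<noteq> {} \<and> T \<subseteq> c})"
  proof (rule cx_fill[OF D L g c m, where I="?I" and \<sigma>=\<sigma>])
    fix T assume T: "T \<in> L" "T \<subseteq> c"
    then have "T \<noteq> c" "T \<noteq> c - {k}" using cL h(2) by auto
    with T obtain x where x: "x \<in> c" "x \<notin> T" "x \<noteq> k" by blast
    have "pos c x \<in> ?I" using x pos_less[OF c x(1)] m nth_pos[OF c x(1)] j by auto
    then show "\<exists>i\<in>?I. T \<subseteq> c - {lst c ! i}" using nth_pos[OF c x(1)] x T by (intro bexI[of _ "pos c x"]) auto
  qed (use I \<sigma> in auto)
  moreover have "L \<union> {T. T \<noteq> {} \<and> T \<subseteq> c} = L \<union> {c, c - {k}}"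
  proof -
    have "T \<in> L" if T: "T \<noteq> {}" "T \<subseteq> c" "T \<noteq> c" "T \<noteq> c - {k}" for T
    proof -
      obtain x where "x \<in> c" "x \<notin> T" "x \<noteq> k" using T by blast
      then show ?thesis using closed_cxD[OF L h(1)[of x]] T by blast
    qed
    moreover have "c \<noteq> {}" "c - {k} \<noteq> {}" using k by auto
    ultimately show ?thesis by blast
  qed
  ultimately show ?thesis by simp
qed

lemma cx_horn:
  assumes D: "qcat D" and L: "closed_cx L" and g: "cx D L g" and c: "finite c" 
    and k: "k \<in> c" "a \<in> c" "a < k" "b \<in> c" "k < b"
    and h: "\<And>i. i \<in> c \<Longrightarrow> i \<noteq> k \<Longrightarrow> c - {i} \<in> L" "c - {k} \<notin> L"
  shows "cx_ext D L g (L \<union> {c, c - {k}})"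
proof (rule cx_horn_gen[OF qcat_sset[OF D] L g c k(1)])
  fix m assume m: "card c = Suc m" and s: "compatible D m ({..m} - {pos c k}) (\<lambda>i. g (cface c i))"
  have j0: "0 < pos c k" unfolding pos_def using c k by (auto simp: card_gt_0_iff)
  have "pos c k < pos c b" unfolding pos_def using c k by (intro psubset_card_mono) auto
  then have "pos c k < m" using pos_less[OF c k(4)] m by simp
  then show "\<exists>\<sigma>\<in>cells D m. \<forall>i\<in>{..m} - {pos c k}. bd D m i \<sigma> = g (cface c i)"
    using D j0 s unfolding qcat_def by blast
qed (use k h in auto)

text \<open>The least vertex k of c comes first in the sphere formed by the facets, so initiality of
  its value supplies the filler.\<close>

lemma cx_init:
  assumes D: "is_sset D" and L: "closed_cx L" and g: "cx D L g" and c: "finite c" 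
    and k: "k \<in> c" "\<And>x. x \<in> c \<Longrightarrow> k \<le> x" "c \<noteq> {k}" and z: "initial D (g [k])"
    and h: "\<And>i. i \<in> c \<Longrightarrow> c - {i} \<in> L" "c \<notin> L"
  shows "cx_ext D L g (insert c L)"
proof -
  have "card c \<noteq> 0" "card c \<noteq> 1" using c k card_1_singletonE by auto
  then obtain m where m: "card c = Suc m" "1 \<le> m"
    by (metis One_nat_def Suc_leI not0_implies_Suc old.nat.distinct(2) zero_less_iff_neq_zero)
  have memc: "lst c ! i \<in> c" if "i \<le> m" for i
    using that m c by (metis length_sorted_list_of_set less_Suc_eq_le nth_mem set_sorted_list_of_set)
  have I: "c - {lst c ! i} \<in> L" if "i \<in> {..m}" for i using that h(1) memc by auto
  have comp: "compatible D m {..m} (\<lambda>i. g (cface c i))"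
    by (rule cface_compatible[OF D g c m]) (use I in auto)
  have "pos c k = 0" unfolding pos_def using k(2) by (simp add: card_eq_0_iff) (metis (mono_tags, lifting) empty_Collect_eq leD)
  then have l0: "lst c ! 0 = k" using nth_pos[OF c k(1)] by simp
  note p = cface_props[OF c m(1) order_refl]
  have "act D (m - 1) [0] (g (cface c m)) = g (map (nth (cface c m)) [0])"
    by (rule cx_act[OF g p(1)]) (use p I m in \<open>auto simp: ops_def\<close>)
  also have "map (nth (cface c m)) [0] = [k]" using m l0 by (simp add: cface_def face_nth)
  finally obtain \<sigma> where \<sigma>: "\<sigma> \<in> cells D m" "\<forall>i\<le>m. bd D m i \<sigma> = g (cface c i)"
    using z comp m unfolding initial_def by meson
  have "cx_ext D L g (L \<union> {T. T \<noteq> {} \<and> T \<subseteq> c})"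
  proof (rule cx_fill[OF D L g c m, where I="{..m}" and \<sigma>=\<sigma>])
    fix T assume T: "T \<in> L" "T \<subseteq> c"
    then have "T \<noteq> c" using h(2) by auto
    with T obtain x where x: "x \<in> c" "x \<notin> T" by blast
    have "pos c x \<in> {..m}" using x pos_less[OF c x(1)] m by auto
    then show "\<exists>i\<in>{..m}. T \<subseteq> c - {lst c ! i}" using nth_pos[OF c x(1)] x T by (intro bexI[of _ "pos c x"]) auto
  qed (use I \<sigma> in auto)
  moreover have "L \<union> {T. T \<noteq> {} \<and> T \<subseteq> c} = insert c L"
  proof -
    have "T \<in> L" if T: "T \<noteq> {}" "T \<subseteq> c" "T \<noteq> c" for T
    proof -
      obtain x where "x \<in> c" "x \<notin> T" using T by blast
      then show ?thesis using closed_cxD[OF L h(1)[of x]] T by blast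
    qed
    then show ?thesis using k by blast
  qed
  ultimately show ?thesis by simp
qed

text \<open>A list that misses i in I factors through the face opposite to i, where s i determines
  its value; the compatibility of s makes this value independent of i.\<close>

lemma cx_of_compatible:
  assumes D: "is_sset D" and n: "1 \<le> n" and I: "I \<subseteq> {..n}" and s: "compatible D n I s"
  shows "\<exists>g. cx D {S. S \<noteq> {} \<and> S \<subseteq> {..n} \<and> (\<exists>i\<in>I. i \<notin> S)} g \<and> (\<forall>i\<in>I. g (face n i) = s i)"
proof -
  \<comment> \<open>The left inverse of \<open>face n i\<close> on lists that avoid i. The index i
    is chosen by \<open>SOME\<close> in the definition of g; \<open>step\<close> removes the
    dependence on the choice.\<close>
  define cl where "cl i x = (if x < i then x else x - Suc 0)" for i x :: nat
  define g where "g v = (let i = (SOME i. i \<in> I \<and> i \<notin> set v) in act D (n - 1) (map (cl i) v) (s i))" for v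
  have clops: "map (cl i) v \<in> ops m (n - 1)"
    if "i \<le> n" "i \<notin> set v" "sorted v" "set v \<subseteq> {..n}" "length v = Suc m" for i v m
    using that unfolding ops_def sorted_iff_nth_mono_less
    by (auto simp: cl_def subset_iff) (metis Suc_leI Suc_pred diff_le_mono diff_le_self le_antisym le_neq_implies_less less_Suc_eq_le nat_less_le not_less_eq One_nat_def le_trans)+
  have step: "act D (n - 1) (map (cl i) v) (s i) = act D (n - 1) (map (cl j) v) (s j)"
    if v: "v \<noteq> []" "sorted v" "set v \<subseteq> {..n}" and ij: "i \<in> I" "j \<in> I" "i \<notin> set v" "j \<notin> set v" "i < j" for i j v
  proof -
    obtain m where m: "length v = Suc m" using v by (cases v) auto
    have ijn: "i \<le> n" "j \<le> n" using ij I by auto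
    \<comment> \<open>A nonempty list of vertices of the 1-simplex cannot avoid both of them; so two
      omitted indices force n \<ge> 2, where compatibility imposes a condition.\<close>
    have "n \<noteq> 1"
    proof
      assume "n = 1"
      then have "i = 0" "j = 1" using ij ijn by auto
      then show False using \<open>n = 1\<close> v ij by (cases v) (auto simp: le_Suc_eq)
    qed
    then have n2: "2 \<le> n" using n by auto
    \<comment> \<open>Both gaps i and j are closed; \<open>cl j\<close> and \<open>cl i\<close> of
      the list arise from ?w by putting one of the gaps back.\<close>
    let ?w = "map (\<lambda>x. if x < i then x else if x < j then x - 1 else x - 2) v"
    have w: "?w \<in> ops m (n - 2)"
    proof -
      have le: "(if x < i then x else if x < j then x - 1 else x - 2) \<le> n - 2" if "x \<in> set v" for x
      proof -
        have "x \<noteq> i" "x \<noteq> j" "x \<le> n" using that ij v by auto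
        then show ?thesis using ij ijn n2 by auto
      qed
      have mono: "(if x < i then x else if x < j then x - 1 else x - 2) \<le> (if y < i then y else if y < j then y - 1 else y - 2)"
        if "x \<in> set v" "y \<in> set v" "x \<le> y" for x y
      proof -
        have "x \<noteq> i" "x \<noteq> j" "y \<noteq> i" "y \<noteq> j" using that ij by auto
        then show ?thesis using ij that by auto
      qed
      have "sorted ?w" by (rule sorted_mapI[OF v(2)]) (rule mono)
      moreover have "set ?w \<subseteq> {..n - 2}" unfolding set_map image_subset_iff using le by blast
      ultimately show ?thesis unfolding ops_def using m by simp
    qed
    have e1: "map (cl j) v = map (nth (face (n - 1) i)) ?w"
    proof -
      have "cl j x = face (n - 1) i ! (if x < i then x else if x < j then x - 1 else x - 2)" if "x \<in> set v" for x
      proof -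
        have "x \<noteq> i" "x \<noteq> j" "x \<le> n" using that ij v by auto
        then show ?thesis using ij ijn n2 by (auto simp: face_nth cl_def)
      qed
      then show ?thesis by simp
    qed
    have e2: "map (cl i) v = map (nth (face (n - 1) (j - 1))) ?w"
    proof -
      have "cl i x = face (n - 1) (j - 1) ! (if x < i then x else if x < j then x - 1 else x - 2)" if "x \<in> set v" for x
      proof -
        have "x \<noteq> i" "x \<noteq> j" "x \<le> n" using that ij v by auto
        then show ?thesis using ij ijn n2 by (auto simp: face_nth cl_def)
      qed
      then show ?thesis by simp
    qed
    have f1: "face (n - 1) i \<in> ops (n - 2) (n - 1)" "face (n - 1) (j - 1) \<in> ops (n - 2) (n - 1)"
      using face_ops[of "n - 1" i] face_ops[of "n - 1" "j - 1"] n2 ij ijn by (auto simp: numeral_2_eq_2)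
    have sc: "s i \<in> cells D (n - 1)" "s j \<in> cells D (n - 1)" using s ij by (auto simp: compatible_def)
    have "bd D (n - 1) i (s j) = bd D (n - 1) (j - 1) (s i)"
      using s ij n2 by (auto simp: compatible_def)
    then show ?thesis unfolding e1 e2
      using sset_comp[OF D w f1(1) sc(2)] sset_comp[OF D w f1(2) sc(1)] by simp
  qed
  have g: "g v = act D (n - 1) (map (cl i) v) (s i)"
    if v: "v \<noteq> []" "sorted v" "set v \<subseteq> {..n}" and i: "i \<in> I" "i \<notin> set v" for i v
  proof -
    define j where "j = (SOME i. i \<in> I \<and> i \<notin> set v)"
    have j: "j \<in> I" "j \<notin> set v" using someI[of "\<lambda>i. i \<in> I \<and> i \<notin> set v"] i unfolding j_def by auto
    have "g v = act D (n - 1) (map (cl j) v) (s j)" by (simp add: g_def j_def Let_def)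
    then show ?thesis using step[OF v] i j by (metis linorder_neqE_nat)
  qed
  have "cx D {S. S \<noteq> {} \<and> S \<subseteq> {..n} \<and> (\<exists>i\<in>I. i \<notin> S)} g"
  proof (rule cxI)
    fix v m assume v: "length v = Suc m" "sorted v" "set v \<in> {S. S \<noteq> {} \<and> S \<subseteq> {..n} \<and> (\<exists>i\<in>I. i \<notin> S)}"
    then obtain i where i: "i \<in> I" "i \<notin> set v" by auto
    have sv: "set v \<subseteq> {..n}" using v by auto
    have vn: "v \<noteq> []" using v by auto
    have si: "s i \<in> cells D (n - 1)" using s i by (auto simp: compatible_def)
    have co: "map (cl i) v \<in> ops m (n - 1)" using clops[of i v m] i I v by auto
    show "g v \<in> cells D m" using g[OF vn v(2) sv i] sset_in[OF D co si] by simp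
    fix k \<theta> assume \<theta>: "\<theta> \<in> ops k m"
    have ss: "set (map (nth v) \<theta>) \<subseteq> set v" using set_map_nth[OF \<theta> v(1)] .
    have ne: "map (nth v) \<theta> \<noteq> []" using opsD[OF \<theta>] by auto
    have so: "sorted (map (nth v) \<theta>)" using sorted_nth_ops[OF \<theta> v(1,2)] .
    have "g (map (nth v) \<theta>) = act D (n - 1) (map (cl i) (map (nth v) \<theta>)) (s i)"
      by (rule g[OF ne so]) (use ss sv i in auto)
    also have "map (cl i) (map (nth v) \<theta>) = map (nth (map (cl i) v)) \<theta>"
      using opsD[OF \<theta>] v by auto
    finally show "act D m \<theta> (g v) = g (map (nth v) \<theta>)"
      using sset_comp[OF D \<theta> co si] g[OF vn v(2) sv i] by simp
  qed
  moreover have "g (face n i) = s i" if i: "i \<in> I" for i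
  proof -
    have "i \<le> n" using i I by auto
    then have "map (cl i) (face n i) = [0..<Suc (n - 1)]"
      using n by (intro nth_equalityI) (auto simp: face_nth cl_def simp del: upt_Suc)
    moreover have "g (face n i) = act D (n - 1) (map (cl i) (face n i)) (s i)"
      using n \<open>i \<le> n\<close> by (intro g) (auto simp: set_face sorted_face i simp flip: length_greater_0_conv)
    ultimately show ?thesis using sset_id[OF D, of "s i" "n - 1"] s i by (auto simp: compatible_def simp del: upt_Suc)
  qed
  ultimately show ?thesis by blast
qed

section \<open>Filling many horns: pairings and initial vertices\<close>

lemma closed_cx_Un:
  assumes "closed_cx L" "closed_cx K" shows "closed_cx (L \<union> K)"
  unfolding closed_cx_def
proof (intro ballI conjI allI impI)
  fix S T assume S: "S \<in> L \<union> K"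
  then show "finite S" "S \<noteq> {}" using assms unfolding closed_cx_def by blast+
  assume "T \<noteq> {} \<and> T \<subseteq> S"
  then show "T \<in> L \<union> K" using S closed_cxD[OF assms(1), of S T] closed_cxD[OF assms(2), of S T] by blast
qed

lemma closed_cx_horn:
  assumes "closed_cx L" "finite c" "\<And>i. i \<in> c \<Longrightarrow> i \<noteq> k \<Longrightarrow> c - {i} \<in> L" "k \<in> c" "c \<noteq> {k}"
  shows "closed_cx (L \<union> {c, c - {k}})"
  unfolding closed_cx_def
proof (intro ballI conjI allI impI)
  fix S assume S: "S \<in> L \<union> {c, c - {k}}"
  then show "finite S" "S \<noteq> {}" using assms unfolding closed_cx_def by blast+
  fix T assume T: "T \<noteq> {} \<and> T \<subseteq> S"
  show "T \<in> L \<union> {c, c - {k}}"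
  proof (cases "S \<in> L \<or> T = c \<or> T = c - {k}")
    case True
    then show ?thesis using T closed_cxD[OF assms(1)] by blast
  next
    case False
    then have "T \<subseteq> c" "T \<noteq> c" "T \<noteq> c - {k}" using S T by auto
    then obtain x where "x \<in> c" "x \<notin> T" "x \<noteq> k" by blast
    then show ?thesis using closed_cxD[OF assms(1) assms(3)[of x]] T \<open>T \<subseteq> c\<close> by blast
  qed
qed

lemma cx_hornE:
  assumes D: "qcat D" and L: "closed_cx L" and g: "cx D L g" and c: "finite c" 
    and k: "k \<in> c" "a \<in> c" "a < k" "b \<in> c" "k < b"
    and h: "\<And>i. i \<in> c \<Longrightarrow> i \<noteq> k \<Longrightarrow> c - {i} \<in> L" "c - {k} \<notin> L"
  obtains g' where "cx D (L \<union> {c, c - {k}}) g'" "\<And>v. set v \<in> L \<Longrightarrow> g' v = g v"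
    "closed_cx (L \<union> {c, c - {k}})"
  using cx_horn[OF assms] closed_cx_horn[OF L c h(1) k(1)] k by blast

text \<open>Inner horns are filled along a perfect matching of the missing simplices: S is matched with the
  simplex that differs from S by the vertex \<open>x S\<close>.\<close>

lemma cx_pairing:
  assumes D: "qcat D" and K: "finite K" "closed_cx K" and L: "closed_cx L" and g: "cx D L g"
    and x: "\<And>S. S \<in> K \<Longrightarrow> S \<notin> L \<Longrightarrow> insert (x S) S \<in> K \<and> S - {x S} \<notin> L \<and> x (insert (x S) S) = x S \<and> x (S - {x S}) = x S"
    and inner: "\<And>S. S \<in> K \<Longrightarrow> S \<notin> L \<Longrightarrow> (\<exists>a\<in>S. a < x S) \<and> (\<exists>b\<in>S. x S < b)"
    and ord: "\<And>S i. S \<in> K \<Longrightarrow> S \<notin> L \<Longrightarrow> x S \<in> S \<Longrightarrow> i \<in> S \<Longrightarrow> i \<noteq> x S \<Longrightarrow> S - {i} \<notin> L \<Longrightarrow> x (S - {i}) \<in> S \<or> r (x (S - {i})) < (r (x S) :: nat)"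
  shows "cx_ext D L g (L \<union> K)"
  using L g x inner ord
proof (induction "card (K - L)" arbitrary: L g rule: less_induct)
  case less
  note L = less.prems(1) and g = less.prems(2) and x = less.prems(3) and inner = less.prems(4) and ord = less.prems(5)
  show ?case
  proof (cases "K \<subseteq> L")
    case True then show ?thesis using g by (intro exI[of _ g]) (simp add: Un_absorb2)
  next
    case False
    let ?H = "{S \<in> K - L. x S \<in> S}"
    have ins: "insert (x S) S \<in> ?H" if "S \<in> K" "S \<notin> L" for S
    proof -
      have "S \<noteq> {}" using that(1) K(2) by (auto simp: closed_cx_def)
      then have "insert (x S) S \<notin> L" using closed_cxD[OF L, of "insert (x S) S" S] that(2) by blast
      then show ?thesis using x[OF that] by simp
    qed
    \<comment> \<open>A pair of least size, and among these with least r, is filled first: a further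
      missing facet of c would by \<open>ord\<close> belong to a smaller pair, so the horn of c
      opposite to \<open>x c\<close> lies in L.\<close>
    then obtain c where c: "c \<in> ?H" and min: "\<And>y. (y, c) \<in> measures [card, \<lambda>S. r (x S)] \<Longrightarrow> y \<notin> ?H"
      using wfE_min'[OF wf_measures, of ?H] False by blast
    have cK: "c \<in> K" "c \<notin> L" "x c \<in> c" "finite c" using c K(2) unfolding closed_cx_def by blast+
    have h1: "c - {i} \<in> L" if i: "i \<in> c" "i \<noteq> x c" for i
    proof (rule ccontr)
      let ?S = "c - {i}"
      assume n: "?S \<notin> L"
      have S: "?S \<in> K" using closed_cxD[OF K(2) cK(1), of ?S] i cK(3) by blast
      have card: "card ?S < card c" by (rule card_Diff1_less[OF cK(4) i(1)])
      have H: "insert (x ?S) ?S \<in> ?H" by (rule ins[OF S n])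
      have "card (insert (x ?S) ?S) < card c \<or> card (insert (x ?S) ?S) \<le> card c \<and> r (x (insert (x ?S) ?S)) < r (x c)"
      proof (cases "x ?S \<in> ?S")
        case True then show ?thesis using card by (simp only: insert_absorb simp_thms)
      next
        case False
        have "x ?S \<noteq> i" using H x[OF S n] False i cK n insert_Diff[OF i(1)] by (metis mem_Collect_eq)
        then have "r (x ?S) < r (x c)" using ord[OF cK(1-3) i n] False by blast
        moreover have "card (insert (x ?S) ?S) \<le> card c" using card cK(4) False by (subst card_insert_disjoint) (auto simp del: card_Diff_insert card_Diff_singleton)
        ultimately show ?thesis using x[OF S n] by simp
      qed
      then have "(insert (x ?S) ?S, c) \<in> measures [card, \<lambda>S. r (x S)]" by (metis in_measures(2) le_neq_implies_less)
      then show False using min H by blast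
    qed
    have h2: "c - {x c} \<notin> L" using x[OF cK(1,2)] by blast
    obtain a b where ab: "a \<in> c" "a < x c" "b \<in> c" "x c < b" using inner[OF cK(1,2)] by blast
    let ?L = "L \<union> {c, c - {x c}}"
    obtain h where h: "cx D ?L h" "\<And>v. set v \<in> L \<Longrightarrow> h v = g v" "closed_cx ?L"
      using cx_hornE[OF D L g cK(4,3) ab h1 h2] by blast
    \<comment> \<open>Filling one pair leaves the other missing simplices paired, since partners
      share the vertex x.\<close>
    have "cx_ext D ?L h (?L \<union> K)"
    proof (rule less.hyps[OF _ h(3,1)])
      have "K - ?L \<subset> K - L" using cK by blast
      then show "card (K - ?L) < card (K - L)" using K(1) by (intro psubset_card_mono) auto
    next
      fix S assume S: "S \<in> K" "S \<notin> ?L"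
      then have y: "insert (x S) S \<in> K" "S - {x S} \<notin> L" "x (insert (x S) S) = x S" "x (S - {x S}) = x S" using x by auto
      have "S - {x S} \<noteq> c" using y(4) cK(3) by blast
      moreover have "S - {x S} \<noteq> c - {x c}"
      proof
        assume e: "S - {x S} = c - {x c}"
        then have "x S = x c" using y(4) x[OF cK(1,2)] by simp
        then have "S - {x c} = c - {x c}" using e by simp
        then have "S = c \<or> S = c - {x c}" using cK(3) by (cases "x c \<in> S") (metis insert_Diff, simp)
        then show False using S by blast
      qed
      ultimately show "insert (x S) S \<in> K \<and> S - {x S} \<notin> ?L \<and> x (insert (x S) S) = x S \<and> x (S - {x S}) = x S" using y by blast
    qed (use inner ord in blast)+
    then obtain g' where g': "cx D (?L \<union> K) g'" "\<forall>v. set v \<in> ?L \<longrightarrow> g' v = h v" by blast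
    moreover have "cx D (L \<union> K) g'" by (rule cx_mono[OF g'(1)]) blast
    ultimately show ?thesis using h(2) by (intro exI[of _ g']) auto
  qed
qed

text \<open>A missing simplex of least size has all its facets in L and k as its first vertex, so
  \<open>cx_init\<close> adds it; the number of missing simplices drops.\<close>

lemma cx_init_fill:
  assumes D: "is_sset D" and K: "finite K" "closed_cx K" and L: "closed_cx L" "{k} \<in> L" and g: "cx D L g" and z: "initial D (g [k])"
    and k: "\<And>S. S \<in> K \<Longrightarrow> S \<notin> L \<Longrightarrow> k \<in> S \<and> (\<forall>x\<in>S. k \<le> x)"
  shows "cx_ext D L g (L \<union> K)"
  using L g z k
proof (induction "card (K - L)" arbitrary: L g rule: less_induct)
  case less
  note L = less.prems(1,2) and k = less.prems(5)
  show ?case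
  proof (cases "K \<subseteq> L")
    case True then show ?thesis using less.prems(3) by (intro exI[of _ g]) (simp add: Un_absorb2)
  next
    case False
    then obtain c where c: "c \<in> K - L" and min: "\<And>y. (y, c) \<in> measure card \<Longrightarrow> y \<notin> K - L"
      using wfE_min'[OF wf_measure, of "K - L"] by blast
    have cK: "c \<in> K" "c \<notin> L" "finite c" using c K(2) unfolding closed_cx_def by blast+
    have kc: "k \<in> c" "\<And>x. x \<in> c \<Longrightarrow> k \<le> x" "c \<noteq> {k}" using k[OF cK(1,2)] L(2) cK(2) by blast+
    have ne: "c - {i} \<noteq> {}" if "i \<in> c" for i using that kc(1) L(2) cK(2) kc(3) by blast
    have h: "c - {i} \<in> L" if "i \<in> c" for i
      using min[of "c - {i}"] closed_cxD[OF K(2) cK(1) _ ne[OF that]] card_Diff1_less[OF cK(3) that] by auto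
    obtain h' where h': "cx D (insert c L) h'" "\<And>v. set v \<in> L \<Longrightarrow> h' v = g v"
      using cx_init[OF D L(1) less.prems(3) cK(3) kc less.prems(4) h cK(2)] by blast
    have cl: "closed_cx (insert c L)"
      unfolding closed_cx_def
    proof (intro ballI conjI allI impI)
      fix S T assume S: "S \<in> insert c L"
      then show "finite S" "S \<noteq> {}" using L(1) cK(3) kc(1) unfolding closed_cx_def by blast+
      assume T: "T \<noteq> {} \<and> T \<subseteq> S"
      show "T \<in> insert c L"
      proof (cases "S \<in> L \<or> T = c")
        case True then show ?thesis using T closed_cxD[OF L(1)] by blast
      next
        case False
        then obtain x where "x \<in> c" "T \<subseteq> c - {x}" using S T by blast
        then show ?thesis using closed_cxD[OF L(1) h] T by blast
      qed
    qed
    have "K - insert c L \<subset> K - L" using c by blast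
    then have "card (K - insert c L) < card (K - L)" using K(1) by (intro psubset_card_mono) auto
    moreover have "initial D (h' [k])" using h'(2)[of "[k]"] L(2) less.prems(4) by simp
    ultimately have "cx_ext D (insert c L) h' (insert c L \<union> K)"
      using less.hyps[OF _ cl _ h'(1)] L(2) k by blast
    moreover have "insert c L \<union> K = L \<union> K" using cK(1) by blast
    ultimately show ?thesis using h'(2) by (metis insertCI)
  qed
qed

text \<open>Monotonicity of \<kappa> is asked on each simplex of L only. A vertex map that repeats
  vertices out of order is thus allowed as long as no simplex of L sees the disorder.\<close>

lemma cx_pull:
  assumes g: "cx D K g" and k: "\<And>S. S \<in> L \<Longrightarrow> \<kappa> ` S \<in> K" "\<And>S x y. S \<in> L \<Longrightarrow> x \<in> S \<Longrightarrow> y \<in> S \<Longrightarrow> x \<le> y \<Longrightarrow> \<kappa> x \<le> \<kappa> y"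
  shows "cx D L (\<lambda>v. g (map \<kappa> v))"
proof (rule cxI)
  fix v n assume v: "length v = Suc n" "sorted v" "set v \<in> L"
  have w: "sorted (map \<kappa> v)" "set (map \<kappa> v) \<in> K" "length (map \<kappa> v) = Suc n" "map \<kappa> v \<noteq> []"
    using sorted_mapI[OF v(2) k(2)[OF v(3)]] k(1)[OF v(3)] v by auto
  show "g (map \<kappa> v) \<in> cells D n" using cx_in[OF g w(4,1,2)] w(3) by simp
  fix m \<theta> assume t: "\<theta> \<in> ops m n"
  have "map (nth (map \<kappa> v)) \<theta> = map \<kappa> (map (nth v) \<theta>)" using opsD[OF t] v by (auto simp: less_Suc_eq_le)
  then show "act D n \<theta> (g (map \<kappa> v)) = g (map \<kappa> (map (nth v) \<theta>))" using cx_act[OF g w(1-3) t] by metis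
qed

text \<open>The simplices with P form a subcomplex; a list outside it may restrict into it, and
  \<open>ab\<close> compares the two maps precisely on such faces.\<close>

lemma cx_glue:
  assumes a: "cx D {S \<in> L. P S} a" and b: "cx D {S \<in> L. \<not> P S} b" and P: "\<And>S T. P S \<Longrightarrow> T \<subseteq> S \<Longrightarrow> P T"
    and ab: "\<And>v S. v \<noteq> [] \<Longrightarrow> sorted v \<Longrightarrow> P (set v) \<Longrightarrow> set v \<subseteq> S \<Longrightarrow> S \<in> L \<Longrightarrow> \<not> P S \<Longrightarrow> a v = b v"
  shows "cx D L (\<lambda>v. if P (set v) then a v else b v)"
proof (rule cxI)
  fix v n assume v: "length v = Suc n" "sorted v" "set v \<in> L"
  have vn: "v \<noteq> []" using v by auto
  show "(if P (set v) then a v else b v) \<in> cells D n"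
    using cx_in[OF a vn v(2)] cx_in[OF b vn v(2)] v by simp
  fix m \<theta> assume t: "\<theta> \<in> ops m n"
  let ?w = "map (nth v) \<theta>"
  have w: "set ?w \<subseteq> set v" "sorted ?w" "?w \<noteq> []" using set_map_nth[OF t v(1)] sorted_nth_ops[OF t v(1,2)] opsD(1)[OF t] by auto
  have "act D n \<theta> (a v) = a ?w" if "P (set v)" by (rule cx_act[OF a v(2) _ v(1) t]) (use v that in simp)
  moreover have "act D n \<theta> (b v) = b ?w" if "\<not> P (set v)" by (rule cx_act[OF b v(2) _ v(1) t]) (use v that in simp)
  moreover have "P (set ?w)" if "P (set v)" by (rule P[OF that w(1)])
  moreover have "a ?w = b ?w" if "\<not> P (set v)" "P (set ?w)" by (rule ab[OF w(3,2) that(2) w(1) v(3) that(1)])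
  ultimately show "act D n \<theta> (if P (set v) then a v else b v) = (if P (set ?w) then a ?w else b ?w)" by metis
qed

lemma set_map_face: "length c = Suc n \<Longrightarrow> distinct c \<Longrightarrow> i \<le> n \<Longrightarrow> set (map (nth c) (face n i)) = set c - {c ! i}"
proof -
  assume c: "length c = Suc n" "distinct c" and i: "i \<le> n"
  have "set (map (nth c) (face n i)) = nth c ` ({..n} - {i})" by (simp add: set_face)
  also have "\<dots> = nth c ` {..n} - {c ! i}" using c i by (auto simp: nth_eq_iff_index_eq)
  also have "nth c ` {..n} = set c" using c unfolding set_conv_nth by (auto simp: less_Suc_eq_le)
  finally show ?thesis .
qed

section \<open>Horns with a degenerate outer edge\<close>

text \<open>
  Let A be the set of the vertices below p, so that the last edge is \<open>e : p \<rightarrow> p + 1\<close>. Relative to the boundary of A one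
  first finds an inverse \<open>p + 1 \<rightarrow> p + 2\<close> of e, then an inverse \<open>p + 2 \<rightarrow> p + 3\<close> of the latter, where
  p + 2 and p + 3 are copies of p and p + 1; the two inverses extend over A, and a composite replaces
  the second one by e.
\<close>

lemma special_outer_horn_Suc:
  assumes D: "qcat D" and p: "1 \<le> p" and s: "compatible D (Suc p) {..p} s"
    and x0: "x0 \<in> cells D 0" and e: "act D p [p - 1, p] (s 0) = idn D x0"
  shows "\<exists>\<sigma>\<in>cells D (Suc p). \<forall>i\<le>p. bd D (Suc p) i \<sigma> = s i"
proof -
  note ss = qcat_sset[OF D]
  let ?K = "{S. S \<noteq> {} \<and> S \<subseteq> {..Suc p} \<and> (\<exists>i\<in>{..p}. i \<notin> S)}"
  obtain g0 where g0: "cx D ?K g0" and g0s: "\<forall>i\<in>{..p}. g0 (face (Suc p) i) = s i"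
    using cx_of_compatible[OF ss, of "Suc p" "{..p}" s] s by auto
  have e0: "g0 [p, Suc p] = idn D x0"
  proof -
    have "act D p [p - 1, p] (g0 (face (Suc p) 0)) = g0 (map (nth (face (Suc p) 0)) [p - 1, p])"
      by (rule cx_act[OF g0]) (use p in \<open>auto simp: ops_def sorted_face set_face\<close>)
    also have "map (nth (face (Suc p) 0)) [p - 1, p] = [p, Suc p]" using p by (simp add: face_nth)
    finally show ?thesis using g0s e by simp
  qed
  have deg: "g0 v = act D 0 (replicate (length v) 0) x0"
    if v: "v \<noteq> []" "sorted v" "set v \<subseteq> {p, Suc p}" for v
  proof -
    obtain n where n: "length v = Suc n" using v(1) by (cases v) auto
    let ?\<theta> = "map (\<lambda>x. x - p) v"
    have t: "?\<theta> \<in> ops n 1" unfolding ops_def using v n by (auto intro!: sorted_mapI)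
    have "act D 1 ?\<theta> (g0 [p, Suc p]) = g0 (map (nth [p, Suc p]) ?\<theta>)"
      by (rule cx_act[OF g0 _ _ _ t]) (use p in auto)
    also have "map (nth [p, Suc p]) ?\<theta> = v" using v(3) unfolding map_map by (intro map_idI) auto
    finally have "g0 v = act D 1 ?\<theta> (act D 0 [0, 0] x0)" using e0 by (simp add: idn_def)
    also have "\<dots> = act D 0 (map (nth [0, 0]) ?\<theta>) x0"
      by (rule sset_comp[OF ss t _ x0]) (auto simp: ops_def)
    also have "map (nth [0, 0]) ?\<theta> = replicate (length v) 0"
      using v(3) by (intro nth_equalityI) (auto simp: subset_iff less_Suc_eq nth_Cons split: nat.splits dest!: nth_mem)
    finally show ?thesis .
  qed
  \<comment> \<open>\<kappa> folds the copies back, so that the values of g0 can be reused; it is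
    not monotone on p + 1 < p + 2.\<close>
  define \<kappa> where "\<kappa> x = (if x = p + 2 then p else if x = p + 3 then p + 1 else x)" for x
  define Y where "Y = {p, p + 1, p + 2, p + 3}"
  define A where "A = {..<p}"
  define N where "N = {..p + 3}"
  have pA: "p \<notin> A" "p + 1 \<notin> A" "p + 2 \<notin> A" "p + 3 \<notin> A" "finite A" "0 \<in> A" using p by (auto simp: A_def)
  have AY: "x \<in> N \<longleftrightarrow> x \<in> A \<or> x \<in> Y" "x \<in> Y \<Longrightarrow> x \<notin> A" for x by (auto simp: N_def A_def Y_def)
  have Y: "x \<in> Y \<longleftrightarrow> x = p \<or> x = p + 1 \<or> x = p + 2 \<or> x = p + 3" for x by (auto simp: Y_def)
  have fN: "finite N" "finite Y" by (auto simp: N_def Y_def)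
  \<comment> \<open>Good sets contain neither the edge from p + 1 to p + 2 nor that from p + 2 to p
    + 3, the two inverses; on them \<kappa> is monotone.\<close>
  define good where "good U \<longleftrightarrow> p + 1 \<notin> U \<and> p + 3 \<notin> U \<or> p + 2 \<notin> U" for U :: "nat set"
  have good: "good S \<Longrightarrow> S' \<subseteq> S \<Longrightarrow> good S'" "good (A \<union> U) = good U" "T \<subseteq> A \<Longrightarrow> good (T \<union> U) = good U" for S S' T U
    using pA by (auto simp: good_def)
  \<comment> \<open>Prescribed are the simplices on Y, all degenerate at x0; those that miss a
    vertex of A and avoid the inverses; and the face of the horn opposite to p, with both copies of
    its last vertex.\<close>
  define L1 where "L1 = {S. S \<noteq> {} \<and> S \<subseteq> N \<and> (S \<subseteq> Y \<or> \<not> A \<subseteq> S \<and> good S \<or> p \<notin> S \<and> p + 2 \<notin> S)}"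
  define g1 where "g1 v = (if set v \<subseteq> Y then act D 0 (replicate (length v) 0) x0 else g0 (map \<kappa> v))" for v
  have L1c: "closed_cx L1"
    unfolding closed_cx_def
  proof (intro ballI conjI allI impI)
    fix S T assume S: "S \<in> L1"
    show "finite S" "S \<noteq> {}" using S finite_subset[OF _ fN(1)] by (auto simp: L1_def)
    assume "T \<noteq> {} \<and> T \<subseteq> S"
    then show "T \<in> L1" using S good(1)[of S T] unfolding L1_def by blast
  qed
  have mono: "\<kappa> x \<le> \<kappa> y" if S: "S \<in> L1" "\<not> S \<subseteq> Y" and xy: "x \<in> S" "y \<in> S" "x \<le> y" for S x y
  proof -
    have "x \<in> A \<or> x \<in> Y" "y \<in> A \<or> y \<in> Y" "good S \<or> p \<notin> S \<and> p + 2 \<notin> S" using S xy AY(1) by (auto simp: L1_def)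
    then show ?thesis using xy unfolding \<kappa>_def Y good_def A_def by (elim disjE) auto
  qed
  have inK: "\<kappa> ` S \<in> ?K" if S: "S \<in> L1" "\<not> S \<subseteq> Y" for S
  proof -
    have "\<exists>i\<in>{..p}. i \<notin> \<kappa> ` S"
    proof (cases "A \<subseteq> S")
      case False
      then obtain i where "i < p" "i \<notin> S" by (auto simp: A_def)
      then show ?thesis by (intro bexI[of _ i]) (auto simp: \<kappa>_def)
    next
      case True
      then have "p \<notin> S" "p + 2 \<notin> S" using S by (auto simp: L1_def)
      then show ?thesis by (intro bexI[of _ p]) (auto simp: \<kappa>_def)
    qed
    moreover have "\<kappa> x \<le> Suc p" if "x \<in> N" for x using that by (auto simp: \<kappa>_def N_def)
    then have "\<kappa> ` S \<subseteq> {..Suc p}" using S by (auto simp: L1_def)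
    ultimately show ?thesis using S by (auto simp: L1_def)
  qed
  have g1: "cx D L1 g1"
    unfolding g1_def
  proof (rule cx_glue[where P = "\<lambda>S. S \<subseteq> Y"])
    show "cx D {S \<in> L1. S \<subseteq> Y} (\<lambda>v. act D 0 (replicate (length v) 0) x0)"
    proof (rule cxI)
      fix v :: "nat list" and n m \<theta> assume v: "length v = Suc n"
      show "act D 0 (replicate (length v) 0) x0 \<in> cells D n" unfolding v by (rule sset_in[OF ss ops_replicate x0]) simp
      assume t: "\<theta> \<in> ops m n"
      have "map (nth (replicate (Suc n) 0)) \<theta> = replicate (length \<theta>) 0"
        using opsD[OF t] ops_nth[OF t] by (intro nth_equalityI) (auto simp: less_Suc_eq_le simp del: replicate_Suc)
      then show "act D n \<theta> (act D 0 (replicate (length v) 0) x0) = act D 0 (replicate (length (map (nth v) \<theta>)) 0) x0"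
        unfolding v sset_comp[OF ss t ops_replicate[OF le0] x0] length_map by (rule arg_cong)
    qed
    show "cx D {S \<in> L1. \<not> S \<subseteq> Y} (\<lambda>v. g0 (map \<kappa> v))" by (rule cx_pull[OF g0]) (use mono inK in auto)
    fix v S assume v: "v \<noteq> []" "sorted v" "set v \<subseteq> Y" "set v \<subseteq> S" "S \<in> L1" "\<not> S \<subseteq> Y"
    have "sorted (map \<kappa> v)" by (rule sorted_mapI[OF v(2)]) (use mono[OF v(5,6)] v(4) in auto)
    moreover have "set (map \<kappa> v) \<subseteq> {p, Suc p}" using v(3) by (auto simp: Y_def \<kappa>_def)
    ultimately show "act D 0 (replicate (length v) 0) x0 = g0 (map \<kappa> v)" using deg[of "map \<kappa> v"] v(1) by simp
  qed blast
  define K where "K = {S. S \<noteq> {} \<and> S \<subseteq> N \<and> (\<not> A \<subseteq> S \<or> p \<notin> S)}"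
  \<comment> \<open>Through p, the first inverse is extended over the proper faces of A; through p +
    1, the second inverse is extended, and both are extended over the whole of A.\<close>
  define x where "x S = (if A \<subseteq> S \<or> p + 3 \<in> S then p + 1 else p)" for S
  have Kc: "closed_cx K" unfolding closed_cx_def K_def using finite_subset[OF _ fN(1)] by blast
  have LK: "L1 \<union> K = K" using pA AY unfolding L1_def K_def by blast
  have xA: "x S \<notin> A" "x S \<in> Y" "x S \<noteq> p + 2" "x S \<noteq> p + 3" "p \<le> x S" "x S < p + 2" "A \<subseteq> S \<Longrightarrow> x S \<noteq> p" for S using pA by (auto simp: x_def Y_def)
  have xeq: "x S = x T" if "A \<subseteq> S \<longleftrightarrow> A \<subseteq> T" "p + 3 \<in> S \<longleftrightarrow> p + 3 \<in> T" for S T unfolding x_def that ..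
  have "cx_ext D L1 g1 (L1 \<union> K)"
  proof (rule cx_pairing[OF D _ Kc L1c g1, where x = x and r = id])
    show "finite K" by (rule finite_subset[of _ "Pow N"]) (use fN in \<open>auto simp: K_def\<close>)
    fix S assume S: "S \<in> K" "S \<notin> L1"
    have SN: "S \<subseteq> N" "\<not> A \<subseteq> S \<or> p \<notin> S" using S by (auto simp: K_def)
    obtain a where a: "a \<in> S" "a \<in> A" using S AY(1) unfolding K_def L1_def by blast
    have nL: "p + 2 \<in> S" "\<not> A \<subseteq> S \<Longrightarrow> p + 1 \<in> S \<or> p + 3 \<in> S" using S by (auto simp: K_def L1_def good_def)
    have "insert (x S) S \<in> K" using SN AY(1) xA(1,2,7)[of S] unfolding K_def by blast
    moreover have "S - {x S} \<notin> L1"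
    proof -
      have "a \<in> S - {x S}" "a \<notin> Y" "p + 2 \<in> S - {x S}" using a xA AY(2) nL(1) by (metis DiffI singletonD)+
      moreover have "A \<subseteq> S - {x S} \<or> \<not> good (S - {x S})"
      proof (cases "A \<subseteq> S")
        case True
        then show ?thesis using xA(1)[of S] by blast
      next
        case False
        then show ?thesis using nL by (auto simp: x_def good_def)
      qed
      ultimately show ?thesis unfolding L1_def by blast
    qed
    moreover have "x (insert (x S) S) = x S" "x (S - {x S}) = x S" using xA(1,4)[of S] by (intro xeq; auto)+
    ultimately show "insert (x S) S \<in> K \<and> S - {x S} \<notin> L1 \<and> x (insert (x S) S) = x S \<and> x (S - {x S}) = x S" by blast
    have "a < x S" using a(2) xA(5)[of S] by (simp add: A_def)
    then show "(\<exists>a\<in>S. a < x S) \<and> (\<exists>b\<in>S. x S < b)" using a(1) nL(1) xA(6) by blast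
    show "x (S - {i}) \<in> S \<or> id (x (S - {i})) < id (x S)" if "x S \<in> S" for i
      using that by (auto simp: x_def split: if_splits)
  qed
  then obtain g5 where g5: "cx D K g5" "\<And>v. set v \<in> L1 \<Longrightarrow> g5 v = g1 v" unfolding LK by blast
  \<comment> \<open>\<rho> identifies p with p + 2. The simplex on A, p + 2, p + 3 is carried to A,
    p, p + 3 across a horn in which the edge from p to p + 2 is degenerate.\<close>
  define \<rho> where "\<rho> x = (if x = p then p + 2 else x)" for x
  define L6 where "L6 = {S. S \<noteq> {} \<and> S \<subseteq> A \<union> {p, p + 2, p + 3} \<and> (p \<notin> S \<or> p + 3 \<notin> S \<or> \<not> A \<subseteq> S)}"
  define g6 where "g6 v = (if p + 3 \<notin> set v then g5 (map \<rho> v) else g5 v)" for v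
  have L6c: "closed_cx L6"
    unfolding closed_cx_def L6_def using finite_subset[of _ "A \<union> {p, p + 2, p + 3}"] pA(5) by blast
  have sN: "A \<union> {p, p + 2, p + 3} \<subseteq> N" using AY(1) by (auto simp: Y_def)
  have M: "S \<in> K" if "S \<noteq> {}" "S \<subseteq> A \<union> {p, p + 2, p + 3}" "p \<notin> S \<or> \<not> A \<subseteq> S" for S
    using that sN unfolding K_def by blast
  have \<rho>: "\<rho> ` S \<subseteq> A \<union> {p + 2, p + 3}" if "S \<subseteq> A \<union> {p, p + 2, p + 3}" for S
    using that by (auto simp: \<rho>_def)
  \<comment> \<open>Simplices that miss a vertex of A still carry the values of g1, and these do not
    distinguish p from p + 2.\<close>
  have cons: "g5 w = g5 (map \<rho> w)" if w: "w \<noteq> []" "sorted w" "set w \<subseteq> A \<union> {p, p + 2}" "\<not> A \<subseteq> set w" for w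
  proof -
    have L1I: "S \<in> L1" if "S \<noteq> {}" "S \<subseteq> A \<union> {p, p + 2}" "\<not> A \<subseteq> S" for S
      using that sN pA by (auto simp: L1_def good_def)
    have "\<not> A \<subseteq> \<rho> ` set w" "\<rho> ` set w \<subseteq> A \<union> {p, p + 2}" using w(3,4) pA(3) by (auto simp: \<rho>_def)
    then have "set w \<in> L1" "set (map \<rho> w) \<in> L1" using L1I[of "set w"] L1I[of "\<rho> ` set w"] w by simp_all
    then have "g5 w = g1 w" "g5 (map \<rho> w) = g1 (map \<rho> w)" using g5(2) by blast+
    moreover have "map \<kappa> (map \<rho> w) = map \<kappa> w" by (simp add: \<kappa>_def \<rho>_def)
    moreover have "(set (map \<rho> w) \<subseteq> Y) = (set w \<subseteq> Y)" by (auto simp: \<rho>_def Y_def split: if_splits)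
    ultimately show ?thesis unfolding g1_def by (simp del: map_map)
  qed
  have g6: "cx D L6 g6"
    unfolding g6_def
  proof (rule cx_glue[where P = "\<lambda>S. p + 3 \<notin> S"])
    show "cx D {S \<in> L6. p + 3 \<notin> S} (\<lambda>v. g5 (map \<rho> v))"
    proof (rule cx_pull[OF g5(1)])
      fix S assume S: "S \<in> {S \<in> L6. p + 3 \<notin> S}"
      then have S': "S \<noteq> {}" "S \<subseteq> A \<union> {p, p + 2, p + 3}" "p + 3 \<notin> S" by (auto simp: L6_def)
      have "p \<notin> \<rho> ` S" using \<rho>[OF S'(2)] pA by auto
      then show "\<rho> ` S \<in> K" using \<rho>[OF S'(2)] S'(1) by (intro M) blast+
      show "\<rho> x \<le> \<rho> y" if "x \<in> S" "y \<in> S" "x \<le> y" for x y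
        using that S' by (auto simp: \<rho>_def A_def subset_iff)
    qed
    show "cx D {S \<in> L6. \<not> p + 3 \<notin> S} g5" by (rule cx_mono[OF g5(1)], rule subsetI, rule M) (auto simp: L6_def)
    fix v S assume v: "v \<noteq> []" "sorted v" "p + 3 \<notin> set v" "set v \<subseteq> S" "S \<in> L6" "\<not> p + 3 \<notin> S"
    show "g5 (map \<rho> v) = g5 v"
    proof (cases "p \<in> set v")
      case True
      then show ?thesis using v by (intro cons[symmetric]) (auto simp: L6_def)
    next
      case False
      then have "map \<rho> v = v" by (auto simp: \<rho>_def intro: map_idI)
      then show ?thesis by (simp only:)
    qed
  qed blast
  let ?c6 = "A \<union> {p, p + 2, p + 3}"
  have d6: "?c6 - {p + 2} = A \<union> {p, p + 3}" using pA by auto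
  obtain g7 where g7: "cx D (L6 \<union> {?c6, ?c6 - {p + 2}}) g7" "\<And>v. set v \<in> L6 \<Longrightarrow> g7 v = g6 v"
  proof (rule cx_hornE[OF D L6c g6, of ?c6 "p + 2" 0 "p + 3"])
    show "?c6 - {i} \<in> L6" if "i \<in> ?c6" "i \<noteq> p + 2" for i
      using that pA by (auto simp: L6_def)
    show "?c6 - {p + 2} \<notin> L6" unfolding d6 by (auto simp: L6_def)
  qed (use pA p in auto)
  \<comment> \<open>The filler is read off at A, p and p + 3, the last standing for p + 1.\<close>
  define c where "c = [0..<Suc p] @ [p + 3]"
  have setc: "set c = A \<union> {p, p + 3}" by (auto simp: c_def A_def)
  have sc: "sorted c" "length c = Suc (Suc p)" by (auto simp: c_def sorted_append simp del: upt_Suc)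
  have cin: "set c \<in> L6 \<union> {?c6, ?c6 - {p + 2}}" unfolding d6 setc by simp
  have "g7 c \<in> cells D (Suc p)" using cx_in[OF g7(1) _ sc(1) cin] sc(2) by force
  moreover have "bd D (Suc p) i (g7 c) = s i" if i: "i \<le> p" for i
  proof -
    have fo: "face (Suc p) i \<in> ops p (Suc p)" using face_ops[of "Suc p" i] i by simp
    let ?v = "map (nth c) (face (Suc p) i)"
    have a: "bd D (Suc p) i (g7 c) = g7 ?v"
      by (rule cx_act[OF g7(1) sc(1) cin sc(2) fo])
    have setv: "set ?v = set c - {i}"
    proof -
      have "distinct c" by (auto simp: c_def simp del: upt_Suc)
      moreover have "c ! i = i" using i by (simp add: c_def nth_append del: upt_Suc)
      ultimately show ?thesis using set_map_face[OF sc(2)] i by simp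
    qed
    have kv: "map \<kappa> ?v = face (Suc p) i"
    proof (rule nth_equalityI)
      show "length (map \<kappa> ?v) = length (face (Suc p) i)" by simp
      fix j assume "j < length (map \<kappa> ?v)"
      then have j: "j < Suc p" using i by simp
      then have "face (Suc p) i ! j \<le> Suc p" using i by (simp add: face_nth)
      then have "\<kappa> (c ! (face (Suc p) i ! j)) = face (Suc p) i ! j"
        by (cases "face (Suc p) i ! j = Suc p") (auto simp: c_def nth_append \<kappa>_def less_Suc_eq_le simp del: upt_Suc)
      then show "map \<kappa> ?v ! j = face (Suc p) i ! j" using j i by simp
    qed
    have vne: "?v \<noteq> []" using i by (auto simp flip: length_greater_0_conv)
    have v6: "set ?v \<in> L6"
    proof -
      have "p \<notin> set ?v \<or> \<not> A \<subseteq> set ?v" unfolding setv using i le_neq_implies_less[OF i] by (cases "i = p") (simp, force simp: A_def)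
      moreover have "set ?v \<subseteq> A \<union> {p, p + 2, p + 3}" unfolding setv setc by auto
      moreover have "set ?v \<noteq> {}" using vne by simp
      ultimately show ?thesis unfolding L6_def by blast
    qed
    have p3: "p + 3 \<in> set ?v" unfolding setv setc using i by auto
    have L12: "set ?v \<in> L1"
    proof -
      have "\<not> A \<subseteq> set ?v \<or> p \<notin> set ?v" unfolding setv using i le_neq_implies_less[OF i] by (cases "i = p") (simp, force simp: A_def)
      moreover have "p + 2 \<notin> set ?v" unfolding setv setc using pA by auto
      moreover have "set ?v \<subseteq> N" unfolding setv setc using sN by auto
      ultimately show ?thesis using vne unfolding L1_def good_def by auto
    qed
    have "g7 ?v = g5 ?v" using g7(2)[OF v6] p3 by (simp add: g6_def)
    also have "\<dots> = g1 ?v" by (rule g5(2)[OF L12])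
    also have "\<dots> = g0 (map \<kappa> ?v)"
    proof (cases "set ?v \<subseteq> Y")
      case True
      have "set (map \<kappa> ?v) \<subseteq> {p, Suc p}" using True by (auto simp: Y_def \<kappa>_def)
      then have "g0 (map \<kappa> ?v) = act D 0 (replicate (length (map \<kappa> ?v)) 0) x0"
        by (intro deg) (use kv sorted_face vne in \<open>auto simp del: map_map\<close>)
      then show ?thesis using True by (simp add: g1_def)
    qed (simp add: g1_def)
    also have "\<dots> = s i" using g0s i kv by simp
    finally show ?thesis using a by simp
  qed
  ultimately show ?thesis by blast
qed

section \<open>Opposite simplicial sets, and special outer horns in complexes\<close>

definition flip :: "nat \<Rightarrow> nat list \<Rightarrow> nat list" where "flip n \<theta> = rev (map (\<lambda>i. n - i) \<theta>)"

lemma op_sset_simps [simp]: "cells (op_sset X) = cells X" "act (op_sset X) n \<theta> x = act X n (flip n \<theta>) x"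
  by (simp_all add: op_sset_def flip_def)

lemma flip_nth: "\<theta> \<in> ops m n \<Longrightarrow> i \<le> m \<Longrightarrow> flip n \<theta> ! i = n - \<theta> ! (m - i)"
  by (simp add: flip_def opsD rev_nth)

lemma length_flip [simp]: "length (flip n \<theta>) = length \<theta>" by (simp add: flip_def)

lemma flip_ops: "\<theta> \<in> ops m n \<Longrightarrow> flip n \<theta> \<in> ops m n"
proof -
  assume t: "\<theta> \<in> ops m n"
  have "sorted (flip n \<theta>)"
    unfolding sorted_iff_nth_mono_less
  proof (intro allI impI)
    fix i j assume ij: "i < j" "j < length (flip n \<theta>)"
    then have jm: "j \<le> m" using opsD(1)[OF t] by simp
    have "\<theta> ! (m - j) \<le> \<theta> ! (m - i)" using sorted_nth_mono[OF opsD(2)[OF t]] ij jm opsD(1)[OF t] by simp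
    then show "flip n \<theta> ! i \<le> flip n \<theta> ! j" using flip_nth[OF t] ij jm by simp
  qed
  moreover have "set (flip n \<theta>) \<subseteq> {..n}" by (auto simp: flip_def)
  ultimately show ?thesis using t by (simp add: ops_def)
qed

lemma flip_id: "flip n [0..<Suc n] = [0..<Suc n]"
proof -
  have "flip n [0..<Suc n] ! i = i" if "i < Suc n" for i
    using flip_nth[OF ops_id, of i n] that by (simp del: upt_Suc)
  then show ?thesis by (intro nth_equalityI) (simp_all del: upt_Suc)
qed

lemma flip_comp: "\<psi> \<in> ops k m \<Longrightarrow> \<theta> \<in> ops m n \<Longrightarrow> flip n (map (nth \<theta>) \<psi>) = map (nth (flip n \<theta>)) (flip m \<psi>)"
proof (rule nth_equalityI)
  assume a: "\<psi> \<in> ops k m" "\<theta> \<in> ops m n"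
  show "length (flip n (map (nth \<theta>) \<psi>)) = length (map (nth (flip n \<theta>)) (flip m \<psi>))" by simp
  fix i assume "i < length (flip n (map (nth \<theta>) \<psi>))"
  then have i: "i \<le> k" using opsD[OF a(1)] by simp
  then have "map (nth (flip n \<theta>)) (flip m \<psi>) ! i = flip n \<theta> ! (m - \<psi> ! (k - i))"
    using flip_nth[OF a(1) i] opsD[OF a(1)] by simp
  then show "flip n (map (nth \<theta>) \<psi>) ! i = map (nth (flip n \<theta>)) (flip m \<psi>) ! i"
    using flip_nth[OF ops_comp[OF a] i] flip_nth[OF a(2), of "m - \<psi> ! (k - i)"] opsD[OF a(1)] i ops_nth[OF a(1), of "k - i"]
    by simp
qed

lemma flip_face: "1 \<le> n \<Longrightarrow> i \<le> n \<Longrightarrow> flip n (face n i) = face n (n - i)"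
proof (rule nth_equalityI)
  assume a: "1 \<le> n" "i \<le> n"
  show "length (flip n (face n i)) = length (face n (n - i))" using a by simp
  fix j assume "j < length (flip n (face n i))"
  then have j: "j \<le> n - 1" using a by auto
  show "flip n (face n i) ! j = face n (n - i) ! j"
    using flip_nth[OF face_ops[OF a] j] j a by (auto simp: face_nth)
qed

lemma op_is_sset:
  assumes "is_sset X" shows "is_sset (op_sset X)"
proof (rule is_ssetI)
  fix k m n \<psi> \<theta> x assume a: "\<psi> \<in> ops k m" "\<theta> \<in> ops m n" "x \<in> cells (op_sset X) n"
  show "act (op_sset X) m \<psi> (act (op_sset X) n \<theta> x) = act (op_sset X) n (map (nth \<theta>) \<psi>) x"
    using sset_comp[OF assms flip_ops[OF a(1)] flip_ops[OF a(2)]] a(3) by (simp add: flip_comp[OF a(1,2)])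
next
  fix m n \<theta> x assume "\<theta> \<in> ops m n" "x \<in> cells (op_sset X) n"
  then show "act (op_sset X) n \<theta> x \<in> cells (op_sset X) m" using sset_in[OF assms flip_ops] by simp
next
  fix n x assume "x \<in> cells (op_sset X) n"
  then show "act (op_sset X) n [0..<Suc n] x = x" using sset_id[OF assms] by (simp add: flip_id del: upt_Suc)
qed

lemma op_compatible:
  assumes I: "I \<subseteq> {..n}" and s: "compatible D n I s"
  shows "compatible (op_sset D) n ((\<lambda>i. n - i) ` I) (\<lambda>i. s (n - i))"
  unfolding compatible_def
proof (intro conjI ballI impI)
  fix i assume "i \<in> (\<lambda>i. n - i) ` I"
  then show "s (n - i) \<in> cells (op_sset D) (n - 1)" using s I by (auto simp: compatible_def subset_iff)
next
  fix i j assume n: "2 \<le> n" and ij: "i \<in> (\<lambda>i. n - i) ` I" "j \<in> (\<lambda>i. n - i) ` I" "i < j"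
  from ij(1) obtain i' where i': "i' \<in> I" "i = n - i'" by blast
  from ij(2) obtain j' where j': "j' \<in> I" "j = n - j'" by blast
  have "i' \<le> n" "j' \<le> n" using i'(1) j'(1) I by blast+
  with i' j' have i': "i' \<in> I" "i = n - i'" "i' = n - i" "i' \<le> n" and j': "j' \<in> I" "j = n - j'" "j' = n - j" "j' \<le> n"
    by simp_all
  have lt: "j' < i'" using ij(3) i'(2) j'(2) by arith
  have "bd D (n - 1) j' (s i') = bd D (n - 1) (i' - 1) (s j')"
    using s n lt i'(1) j'(1) by (auto simp: compatible_def)
  moreover have "flip (n - 1) (face (n - 1) i) = face (n - 1) (i' - 1)"
    using flip_face[of "n - 1" i] n i'(2,4) lt by auto
  moreover have "flip (n - 1) (face (n - 1) (j - 1)) = face (n - 1) j'"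
    using flip_face[of "n - 1" "j - 1"] n j'(2,4) lt i'(4) by auto
  ultimately show "bd (op_sset D) (n - 1) i (s (n - j)) =
      bd (op_sset D) (n - 1) (j - 1) (s (n - i))"
    using i'(3) j'(3) by simp
qed

lemma op_qcat: assumes D: "qcat D" shows "qcat (op_sset D)"
  unfolding qcat_def
proof (intro conjI allI impI)
  show "is_sset (op_sset D)" by (rule op_is_sset[OF qcat_sset[OF D]])
  fix n k s assume a: "0 < k \<and> k < n \<and> compatible (op_sset D) n ({..n} - {k}) s"
  have "compatible (op_sset (op_sset D)) n ((\<lambda>i. n - i) ` ({..n} - {k})) (\<lambda>i. s (n - i))"
    by (rule op_compatible) (use a in auto)
  moreover have "(\<lambda>i. n - i) ` ({..n} - {k}) = {..n} - {n - k}"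
  proof (intro equalityI subsetI)
    fix x assume "x \<in> {..n} - {n - k}"
    then show "x \<in> (\<lambda>i. n - i) ` ({..n} - {k})" by (intro image_eqI[of _ _ "n - x"]) auto
  qed (use a in auto)
  \<comment> \<open>Passing to the opposite twice restores the action for operators with values in
    range, and the face operators are of this kind.\<close>
  moreover have "compatible D n I s" if "compatible (op_sset (op_sset D)) n I s" "I \<subseteq> {..n}" for I s
  proof -
    have "flip (n - 1) (flip (n - 1) (face (n - 1) i)) = face (n - 1) i" if "2 \<le> n" "i \<le> n - 1" for i
      using that flip_face[of "n - 1" i] flip_face[of "n - 1" "n - 1 - i"] by simp
    then have f: "bd (op_sset (op_sset D)) (n - 1) i x = bd D (n - 1) i x"
      if "2 \<le> n" "i \<le> n - 1" for i x using that by simp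
    show ?thesis
      unfolding compatible_def
    proof (intro conjI ballI impI)
      fix i j assume n: "2 \<le> n" and ij: "i \<in> I" "j \<in> I" "i < j"
      then have b: "i \<le> n - 1" "j - 1 \<le> n - 1" using that(2) by auto
      have "bd (op_sset (op_sset D)) (n - 1) i (s j) = bd (op_sset (op_sset D)) (n - 1) (j - 1) (s i)"
        using that(1) n ij unfolding compatible_def by blast
      then show "bd D (n - 1) i (s j) = bd D (n - 1) (j - 1) (s i)"
        unfolding f[OF n b(1)] f[OF n b(2)] .
    qed (use that in \<open>auto simp: compatible_def\<close>)
  qed
  ultimately have "compatible D n ({..n} - {n - k}) (\<lambda>i. s (n - i))" by (metis Diff_subset)
  moreover have "0 < n - k" "n - k < n" using a by auto
  ultimately obtain \<sigma> where s: "\<sigma> \<in> cells D n" "\<forall>i\<in>{..n} - {n - k}. bd D n i \<sigma> = s (n - i)"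
    using D unfolding qcat_def by meson
  have "bd (op_sset D) n i \<sigma> = s i" if "i \<in> {..n} - {k}" for i
    using that s(2)[rule_format, of "n - i"] flip_face[of n i] a by (auto simp: Suc_le_eq)
  then show "\<exists>\<sigma>\<in>cells (op_sset D) n. \<forall>i\<in>{..n} - {k}. bd (op_sset D) n i \<sigma> = s i"
    using s(1) by auto
qed

lemma pos_strict: "finite c \<Longrightarrow> x \<in> c \<Longrightarrow> x < y \<Longrightarrow> pos c x < pos c y"
  unfolding pos_def
proof (rule psubset_card_mono)
  assume "x \<in> c" "x < y"
  then have "x \<in> {z \<in> c. z < y}" "x \<notin> {z \<in> c. z < x}" "{z \<in> c. z < x} \<subseteq> {z \<in> c. z < y}" by auto
  then show "{z \<in> c. z < x} \<subset> {z \<in> c. z < y}" by blast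
qed simp

text \<open>As k' and k are the last two vertices of c, the last edge of the horn is degenerate, as
  in \<open>special_outer_horn_Suc\<close>; the vertex b below k' makes the dimension at least
  2.\<close>

lemma cx_horn_last:
  assumes D: "qcat D" and L: "closed_cx L" and g: "cx D L g" and c: "finite c" 
    and k: "k \<in> c" "k' \<in> c" "{x \<in> c. k' < x} = {k}" "b \<in> c" "b < k'"
    and x0: "x0 \<in> cells D 0" "g [k', k] = idn D x0"
    and h: "\<And>i. i \<in> c \<Longrightarrow> i \<noteq> k \<Longrightarrow> c - {i} \<in> L" "c - {k} \<notin> L"
  shows "cx_ext D L g (L \<union> {c, c - {k}})"
proof (rule cx_horn_gen[OF qcat_sset[OF D] L g c k(1)])
  have kk: "k' < k" using k(3) by auto
  show "c \<noteq> {k}" using k kk by auto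
  fix m assume m: "card c = Suc m" and s: "compatible D m ({..m} - {pos c k}) (\<lambda>i. g (cface c i))"
  have le: "x \<le> k" if "x \<in> c" for x
  proof (cases "k' < x")
    case True then have "x \<in> {x \<in> c. k' < x}" using that by simp
    then show ?thesis unfolding k(3) by simp
  qed (use kk in auto)
  have "{x \<in> c. x < k} = c - {k}" using le by force
  then have pk: "pos c k = m" using m c k by (simp add: pos_def)
  have "{x \<in> c. x < k'} = c - {k, k'}"
  proof -
    have "x < k' \<or> x = k' \<or> x = k" if "x \<in> c" for x
      using that k(3) by (metis (mono_tags, lifting) linorder_neqE_nat mem_Collect_eq singletonD)
    then show ?thesis using kk by auto
  qed
  then have pk': "pos c k' = m - 1" using m c k kk by (simp add: pos_def card_Diff_subset)
  have "pos c b < pos c k'" using c k by (intro pos_strict)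
  then have m2: "2 \<le> m" using pk' by linarith
  then obtain p where p: "m = Suc p" "1 \<le> p" by (cases m) auto
  have I: "{..Suc p} - {pos c k} = {..p}" using pk p by auto
  have l: "lst c ! m = k" "lst c ! p = k'" using nth_pos[OF c k(1)] nth_pos[OF c k(2)] pk pk' p by auto
  have lm: "lst c ! 0 \<in> c" "lst c ! 0 \<noteq> k"
  proof -
    show "lst c ! 0 \<in> c" using m c by (metis length_sorted_list_of_set zero_less_Suc nth_mem set_sorted_list_of_set)
    show "lst c ! 0 \<noteq> k" using l(1) m c m2 nth_eq_iff_index_eq[of "lst c" m 0] by auto
  qed
  note cp = cface_props[OF c m le0]
  have "act D p [p - 1, p] (g (cface c 0)) = g (map (nth (cface c 0)) [p - 1, p])"
    by (rule cx_act[OF g cp(1)]) (use cp p h(1)[OF lm] in \<open>auto simp: ops_def\<close>)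
  also have "map (nth (cface c 0)) [p - 1, p] = [k', k]"
    using m p l by (simp add: cface_def face_nth)
  finally have e: "act D p [p - 1, p] (g (cface c 0)) = idn D x0" using x0 p by simp
  show "\<exists>\<sigma>\<in>cells D m. \<forall>i\<in>{..m} - {pos c k}. bd D m i \<sigma> = g (cface c i)"
    using special_outer_horn_Suc[OF D p(2), of "\<lambda>i. g (cface c i)" x0] s x0(1) e unfolding p(1) I by blast
qed (use k h in auto)

lemma flip_flip: "set \<theta> \<subseteq> {..n} \<Longrightarrow> flip n (flip n \<theta>) = \<theta>"
  unfolding flip_def rev_map[symmetric] rev_rev_ident map_map by (intro map_idI) auto

text \<open>The map x \<mapsto> N - x reverses the order of the vertices; \<open>flip\<close> also
  reverses the list, which keeps it increasing.\<close>

lemma cx_op: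
  assumes g: "cx D L g" and K: "\<And>S. S \<in> K \<Longrightarrow> S \<subseteq> {..N} \<and> (\<lambda>x. N - x) ` S \<in> L"
  shows "cx (op_sset D) K (\<lambda>v. g (flip N v))"
proof (rule cxI)
  fix v n assume v: "length v = Suc n" "sorted v" "set v \<in> K"
  then have o: "v \<in> ops n N" using K by (simp add: ops_def)
  have "set (flip N v) = (\<lambda>x. N - x) ` set v" by (auto simp: flip_def)
  then have w: "sorted (flip N v)" "length (flip N v) = Suc n" "set (flip N v) \<in> L" "flip N v \<noteq> []"
    using opsD[OF flip_ops[OF o]] K[OF v(3)] by auto
  show "g (flip N v) \<in> cells (op_sset D) n" using cx_in[OF g w(4,1,3)] w(2) by simp
  fix m \<theta> assume t: "\<theta> \<in> ops m n"
  show "act (op_sset D) n \<theta> (g (flip N v)) = g (flip N (map (nth v) \<theta>))"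
    using cx_act[OF g w(1,3,2) flip_ops[OF t]] flip_comp[OF t o] by simp
qed

lemma cx_op_op:
  assumes g: "cx (op_sset (op_sset D)) L g" shows "cx D L g"
proof (rule cxI)
  fix v n assume v: "length v = Suc n" "sorted v" "set v \<in> L"
  show "g v \<in> cells D n" using cx_in[OF g _ v(2,3)] v(1) by (cases v) auto
  show "act D n \<theta> (g v) = g (map (nth v) \<theta>)" if "\<theta> \<in> ops m n" for m \<theta>
    using cx_act[OF g v(2,3,1) that] flip_flip[OF opsD(3)[OF that]] by simp
qed

section \<open>Arrow categories\<close>

lemma simplex_cells [simp]: "cells (simplex n) m = ops m n"
  by (auto simp: simplex_def nerve_def ops_def)

lemma simplex_act [simp]: "act (simplex n) m \<theta> v = map (nth v) \<theta>"
  by (simp add: simplex_def nerve_def)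

lemma prod_sset_simps [simp]: "cells (X \<otimes>\<^sub>s Y) n = cells X n \<times> cells Y n"
  "act (X \<otimes>\<^sub>s Y) n \<theta> (x, y) = (act X n \<theta> x, act Y n \<theta> y)"
  by (simp_all add: prod_sset_def)

lemma smapsI:
  assumes "\<And>n x. x \<in> cells K n \<Longrightarrow> f n x \<in> cells C n"
    "\<And>m n \<theta> x. \<theta> \<in> ops m n \<Longrightarrow> x \<in> cells K n \<Longrightarrow> f m (act K n \<theta> x) = act C n \<theta> (f n x)"
    "\<And>n x. x \<notin> cells K n \<Longrightarrow> f n x = undefined"
  shows "f \<in> smaps K C"
  unfolding smaps_def using assms by blast

lemma smaps_in: "f \<in> smaps K C \<Longrightarrow> x \<in> cells K n \<Longrightarrow> f n x \<in> cells C n"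
  unfolding smaps_def by blast

lemma smaps_act: "f \<in> smaps K C \<Longrightarrow> \<theta> \<in> ops m n \<Longrightarrow> x \<in> cells K n \<Longrightarrow> f m (act K n \<theta> x) = act C n \<theta> (f n x)"
  unfolding smaps_def by blast

lemma smaps_undef: "f \<in> smaps K C \<Longrightarrow> x \<notin> cells K n \<Longrightarrow> f n x = undefined"
  unfolding smaps_def by blast

lemma smaps_ext: "f \<in> smaps K C \<Longrightarrow> g \<in> smaps K C \<Longrightarrow> (\<And>n x. x \<in> cells K n \<Longrightarrow> f n x = g n x) \<Longrightarrow> f = g"
  by (intro ext) (metis smaps_undef)

lemma srestrict_in [simp]: "x \<in> cells K n \<Longrightarrow> srestrict K f n x = f n x"
  by (simp add: srestrict_def)

lemma srestrict_smaps:
  assumes "\<And>n x. x \<in> cells K n \<Longrightarrow> f n x \<in> cells C n"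
    "\<And>m n \<theta> x. \<theta> \<in> ops m n \<Longrightarrow> x \<in> cells K n \<Longrightarrow> act K n \<theta> x \<in> cells K m"
    "\<And>m n \<theta> x. \<theta> \<in> ops m n \<Longrightarrow> x \<in> cells K n \<Longrightarrow> f m (act K n \<theta> x) = act C n \<theta> (f n x)"
  shows "srestrict K f \<in> smaps K C"
  by (rule smapsI) (use assms in \<open>auto simp: srestrict_def\<close>)

lemma fun_cells: "cells (fun_sset K C) n = smaps (simplex n \<otimes>\<^sub>s K) C"
  by (simp add: fun_sset_def)

lemma fun_act: "\<theta> \<in> ops j n \<Longrightarrow> act (fun_sset K C) n \<theta> h =
    srestrict (simplex j \<otimes>\<^sub>s K) (\<lambda>m (\<psi>, k). h m (map (nth \<theta>) \<psi>, k))"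
  by (simp add: fun_sset_def opsD)

lemma fun_act_app: "\<theta> \<in> ops j n \<Longrightarrow> \<psi> \<in> ops m j \<Longrightarrow> k \<in> cells K m \<Longrightarrow>
    act (fun_sset K C) n \<theta> h m (\<psi>, k) = h m (map (nth \<theta>) \<psi>, k)"
  by (simp add: fun_act)

lemma map_nth_map: "\<psi> \<in> ops k m \<Longrightarrow> \<theta> \<in> ops m n \<Longrightarrow> map (nth (map f \<theta>)) \<psi> = map f (map (nth \<theta>) \<psi>)"
  using ops_nth[of \<psi> k m] by (auto simp: ops_def subset_iff less_Suc_eq_le)

lemma map_nth_assoc: "\<chi> \<in> ops k m \<Longrightarrow> \<psi> \<in> ops m j \<Longrightarrow>
    map (nth \<theta>) (map (nth \<psi>) \<chi>) = map (nth (map (nth \<theta>) \<psi>)) \<chi>"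
  by (simp only: map_nth_map)

text \<open>This holds for all K and C: a simplicial map is undefined at the faces and degeneracies that
  are missing in its domain.\<close>

lemma fun_is_sset: "is_sset (fun_sset K C)"
proof (rule is_ssetI)
  fix m n \<theta> h assume t: "\<theta> \<in> ops m n" and h: "h \<in> cells (fun_sset K C) n"
  then have h': "h \<in> smaps (simplex n \<otimes>\<^sub>s K) C" by (simp add: fun_cells)
  show "act (fun_sset K C) n \<theta> h \<in> cells (fun_sset K C) m"
    unfolding fun_cells fun_act[OF t]
  proof (rule smapsI)
    fix j x assume "x \<in> cells (simplex m \<otimes>\<^sub>s K) j"
    then show "srestrict (simplex m \<otimes>\<^sub>s K) (\<lambda>m (\<psi>, k). h m (map (nth \<theta>) \<psi>, k)) j x \<in> cells C j"
      using smaps_in[OF h'] ops_comp[OF _ t] by (auto simp: srestrict_def)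
  next
    fix i j \<chi> x assume c: "\<chi> \<in> ops i j" and x: "x \<in> cells (simplex m \<otimes>\<^sub>s K) j"
    obtain \<psi> k where xk: "x = (\<psi>, k)" "\<psi> \<in> ops j m" "k \<in> cells K j" using x by auto
    have a: "map (nth \<theta>) \<psi> \<in> ops j n" by (rule ops_comp[OF xk(2) t])
    have b: "map (nth \<psi>) \<chi> \<in> ops i m" by (rule ops_comp[OF c xk(2)])
    have e: "h i (map (nth \<theta>) (map (nth \<psi>) \<chi>), act K j \<chi> k) = act C j \<chi> (h j (map (nth \<theta>) \<psi>, k))"
      using smaps_act[OF h' c, of "(map (nth \<theta>) \<psi>, k)"] a xk(3)
      unfolding map_nth_assoc[OF c xk(2)] by (simp del: map_map)
    show "srestrict (simplex m \<otimes>\<^sub>s K) (\<lambda>m (\<psi>, k). h m (map (nth \<theta>) \<psi>, k)) i (act (simplex m \<otimes>\<^sub>s K) j \<chi> x) =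
      act C j \<chi> (srestrict (simplex m \<otimes>\<^sub>s K) (\<lambda>m (\<psi>, k). h m (map (nth \<theta>) \<psi>, k)) j x)"
    proof (cases "act K j \<chi> k \<in> cells K i")
      case True
      then show ?thesis using e xk b by (simp add: srestrict_def del: map_map)
    next
      case False
      then have "h i (map (nth \<theta>) (map (nth \<psi>) \<chi>), act K j \<chi> k) = undefined"
        using smaps_undef[OF h'] by auto
      then show ?thesis using e xk False by (simp add: srestrict_def del: map_map)
    qed
  qed (simp add: srestrict_def)
next
  fix n h assume h: "h \<in> cells (fun_sset K C) n"
  then have h': "h \<in> smaps (simplex n \<otimes>\<^sub>s K) C" by (simp add: fun_cells)
  show "act (fun_sset K C) n [0..<Suc n] h = h"
    unfolding fun_act[OF ops_id]
    by (intro ext) (use ops_map_nth_id smaps_undef[OF h'] in \<open>auto simp: srestrict_def split: prod.splits simp del: upt_Suc\<close>)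
next
  fix k m n \<psi> \<theta> h assume p: "\<psi> \<in> ops k m" and t: "\<theta> \<in> ops m n" and h: "h \<in> cells (fun_sset K C) n"
  have "srestrict (simplex k \<otimes>\<^sub>s K) (\<lambda>i (\<chi>, x). srestrict (simplex m \<otimes>\<^sub>s K) (\<lambda>i (\<psi>, x). h i (map (nth \<theta>) \<psi>, x)) i (map (nth \<psi>) \<chi>, x)) =
    srestrict (simplex k \<otimes>\<^sub>s K) (\<lambda>i (\<chi>, x). h i (map (nth (map (nth \<theta>) \<psi>)) \<chi>, x))"
  proof (intro ext)
    fix i y
    show "srestrict (simplex k \<otimes>\<^sub>s K) (\<lambda>i (\<chi>, x). srestrict (simplex m \<otimes>\<^sub>s K) (\<lambda>i (\<psi>, x). h i (map (nth \<theta>) \<psi>, x)) i (map (nth \<psi>) \<chi>, x)) i y =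
      srestrict (simplex k \<otimes>\<^sub>s K) (\<lambda>i (\<chi>, x). h i (map (nth (map (nth \<theta>) \<psi>)) \<chi>, x)) i y"
    proof (cases y)
      case (Pair \<chi> x)
      show ?thesis
      proof (cases "\<chi> \<in> ops i k \<and> x \<in> cells K i")
        case True
        then have "map (nth \<psi>) \<chi> \<in> ops i m" using ops_comp[OF _ p] by simp
        then show ?thesis using True Pair map_nth_assoc[of \<chi> i k \<psi> m \<theta>] p by (simp add: srestrict_def del: map_map)
      qed (use Pair in \<open>auto simp: srestrict_def\<close>)
    qed
  qed
  then show "act (fun_sset K C) m \<psi> (act (fun_sset K C) n \<theta> h) = act (fun_sset K C) n (map (nth \<theta>) \<psi>) h"
    unfolding fun_act[OF t] fun_act[OF p] fun_act[OF ops_comp[OF p t]] .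
qed

lemma Ar_is_sset: "is_sset (Ar C)" by (simp add: Ar_def fun_is_sset)

lemma Ar_cells: "cells (Ar C) n = smaps (simplex n \<otimes>\<^sub>s simplex 1) C" by (simp add: Ar_def fun_cells)

lemma Ar_act_app: "\<theta> \<in> ops j n \<Longrightarrow> \<psi> \<in> ops m j \<Longrightarrow> \<epsilon> \<in> ops m 1 \<Longrightarrow>
    act (Ar C) n \<theta> h m (\<psi>, \<epsilon>) = h m (map (nth \<theta>) \<psi>, \<epsilon>)"
  by (simp add: Ar_def fun_act_app)

lemma Ar_in: "h \<in> cells (Ar C) n \<Longrightarrow> \<psi> \<in> ops m n \<Longrightarrow> \<epsilon> \<in> ops m 1 \<Longrightarrow> h m (\<psi>, \<epsilon>) \<in> cells C m"
  by (rule smaps_in[of h "simplex n \<otimes>\<^sub>s simplex 1"]) (auto simp: Ar_cells)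

lemma Ar_nat: "h \<in> cells (Ar C) n \<Longrightarrow> \<psi> \<in> ops m n \<Longrightarrow> \<epsilon> \<in> ops m 1 \<Longrightarrow> \<chi> \<in> ops k m \<Longrightarrow>
    act C m \<chi> (h m (\<psi>, \<epsilon>)) = h k (map (nth \<psi>) \<chi>, map (nth \<epsilon>) \<chi>)"
  using smaps_act[of h "simplex n \<otimes>\<^sub>s simplex 1" C \<chi> k m "(\<psi>, \<epsilon>)"] by (simp add: Ar_cells)

lemma Ar_ext: "h \<in> cells (Ar C) n \<Longrightarrow> h' \<in> cells (Ar C) n \<Longrightarrow>
   (\<And>m \<psi> \<epsilon>. \<psi> \<in> ops m n \<Longrightarrow> \<epsilon> \<in> ops m 1 \<Longrightarrow> h m (\<psi>, \<epsilon>) = h' m (\<psi>, \<epsilon>)) \<Longrightarrow> h = h'"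
  by (rule smaps_ext[of _ "simplex n \<otimes>\<^sub>s simplex 1" C]) (auto simp: Ar_cells)

lemma map_nth_replicate: "\<psi> \<in> ops k m \<Longrightarrow> map (nth (replicate (Suc m) a)) \<psi> = replicate (Suc k) a"
  using ops_nth[of \<psi> k m] by (intro nth_equalityI) (auto simp: opsD less_Suc_eq_le simp del: replicate_Suc)

lemma ev_in: "a \<le> 1 \<Longrightarrow> h \<in> cells (Ar C) n \<Longrightarrow> ev a n h \<in> cells C n"
  unfolding ev_def by (rule Ar_in[OF _ ops_id ops_replicate])

lemma ev_act: "a \<le> 1 \<Longrightarrow> h \<in> cells (Ar C) n \<Longrightarrow> \<theta> \<in> ops m n \<Longrightarrow> ev a m (act (Ar C) n \<theta> h) = act C n \<theta> (ev a n h)"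
  unfolding ev_def
  by (simp add: Ar_act_app[OF _ ops_id ops_replicate] Ar_nat[OF _ ops_id ops_replicate] map_nth_replicate
      map_nth_upt opsD ops_map_nth_id del: upt_Suc replicate_Suc)

text \<open>The vertex (i, a) of the prism on the n-simplex is coded by 2i + a.\<close>

definition prism :: "nat \<Rightarrow> nat set set" where
  "prism n = {S. S \<noteq> {} \<and> S \<subseteq> {..2 * n + 1} \<and> (\<forall>u\<in>S. \<forall>v\<in>S. u \<le> v \<longrightarrow> u mod 2 \<le> v mod 2)}"

text \<open>Where an arrow between n-simplices is prescribed: over the faces opposite to I, and at
  the ends E.\<close>

definition part_prism :: "nat \<Rightarrow> nat set \<Rightarrow> nat set \<Rightarrow> nat set set" where
  "part_prism n I E = {S \<in> prism n. (\<exists>i\<in>I. i \<notin> (\<lambda>x. x div 2) ` S) \<or> (\<exists>a\<in>E. \<forall>x\<in>S. x mod 2 = a)}"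

abbreviation code :: "nat list \<Rightarrow> nat list \<Rightarrow> nat list" where
  "code \<psi> \<epsilon> \<equiv> map2 (\<lambda>i a. 2 * i + a) \<psi> \<epsilon>"

lemma prism_closed: "closed_cx (prism n)"
  unfolding closed_cx_def
proof (intro ballI conjI allI impI)
  fix S assume S: "S \<in> prism n"
  then show "finite S" "S \<noteq> {}" using finite_subset[of S "{..2 * n + 1}"] by (auto simp: prism_def)
  fix T assume "T \<noteq> {} \<and> T \<subseteq> S"
  then show "T \<in> prism n" using S unfolding prism_def by blast
qed

lemma part_prism_closed: "closed_cx (part_prism n I E)"
  unfolding closed_cx_def
proof (intro ballI conjI allI impI)
  fix S assume S: "S \<in> part_prism n I E"
  then show "finite S" "S \<noteq> {}" using prism_closed[of n] by (auto simp: closed_cx_def part_prism_def)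
  fix T assume T: "T \<noteq> {} \<and> T \<subseteq> S"
  then have "T \<in> prism n" using S closed_cxD[OF prism_closed] by (auto simp: part_prism_def)
  then show "T \<in> part_prism n I E" using S T unfolding part_prism_def by blast
qed

lemma code_props:
  assumes "\<psi> \<in> ops m n" "\<epsilon> \<in> ops m 1"
  shows "sorted (code \<psi> \<epsilon>)" "length (code \<psi> \<epsilon>) = Suc m" "set (code \<psi> \<epsilon>) \<in> prism n"
    "map (\<lambda>x. x div 2) (code \<psi> \<epsilon>) = \<psi>" "map (\<lambda>x. x mod 2) (code \<psi> \<epsilon>) = \<epsilon>"
proof -
  show l: "length (code \<psi> \<epsilon>) = Suc m" using assms by (simp add: opsD)
  have e: "\<epsilon> ! i \<le> 1" if "i \<le> m" for i using ops_nth[OF assms(2) that] .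
  have nth: "code \<psi> \<epsilon> ! i = 2 * \<psi> ! i + \<epsilon> ! i" if "i \<le> m" for i using that assms by (simp add: opsD)
  have mono: "\<psi> ! i \<le> \<psi> ! j" "\<epsilon> ! i \<le> \<epsilon> ! j" if "i \<le> j" "j \<le> m" for i j
    using that assms by (auto intro!: sorted_nth_mono simp: opsD)
  show s: "sorted (code \<psi> \<epsilon>)"
    unfolding sorted_iff_nth_mono_less
  proof (intro allI impI)
    fix i j assume "i < j" "j < length (code \<psi> \<epsilon>)"
    then have ij: "i \<le> j" "j \<le> m" "i \<le> m" using l by auto
    show "code \<psi> \<epsilon> ! i \<le> code \<psi> \<epsilon> ! j" using mono[OF ij(1,2)] nth[OF ij(2)] nth[OF ij(3)] by linarith
  qed
  show d: "map (\<lambda>x. x div 2) (code \<psi> \<epsilon>) = \<psi>"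
  proof (rule nth_equalityI)
    fix i assume "i < length (map (\<lambda>x. x div 2) (code \<psi> \<epsilon>))"
    then have "i \<le> m" unfolding length_map[of _ "code \<psi> \<epsilon>"] l by simp
    then show "map (\<lambda>x. x div 2) (code \<psi> \<epsilon>) ! i = \<psi> ! i" using nth[of i] e[of i] l by simp
  qed (use l assms in \<open>simp add: opsD\<close>)
  show md: "map (\<lambda>x. x mod 2) (code \<psi> \<epsilon>) = \<epsilon>"
  proof (rule nth_equalityI)
    fix i assume "i < length (map (\<lambda>x. x mod 2) (code \<psi> \<epsilon>))"
    then have "i \<le> m" unfolding length_map[of _ "code \<psi> \<epsilon>"] l by simp
    then have "(2 * \<psi> ! i + \<epsilon> ! i) mod 2 = \<epsilon> ! i" using e[of i] by presburger
    then show "map (\<lambda>x. x mod 2) (code \<psi> \<epsilon>) ! i = \<epsilon> ! i" using nth[of i] \<open>i \<le> m\<close> l by simp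
  qed (use l assms in \<open>simp add: opsD\<close>)
  have mem: "\<exists>i\<le>m. u = code \<psi> \<epsilon> ! i" if "u \<in> set (code \<psi> \<epsilon>)" for u
    using that unfolding in_set_conv_nth l less_Suc_eq_le by blast
  have "u mod 2 \<le> v mod 2" if uv: "u \<in> set (code \<psi> \<epsilon>)" "v \<in> set (code \<psi> \<epsilon>)" "u \<le> v" for u v
  proof -
    obtain i where i: "i \<le> m" "u = code \<psi> \<epsilon> ! i" using mem[OF uv(1)] by blast
    obtain j where j: "j \<le> m" "v = code \<psi> \<epsilon> ! j" using mem[OF uv(2)] by blast
    have m: "u mod 2 = \<epsilon> ! i" "v mod 2 = \<epsilon> ! j" using arg_cong[OF md, of "\<lambda>l. l ! i"] arg_cong[OF md, of "\<lambda>l. l ! j"] i j l by simp_all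
    show ?thesis
    proof (cases "i \<le> j")
      case True then show ?thesis using m mono j by simp
    next
      case False
      then have "v \<le> u" unfolding i(2) j(2) by (intro sorted_nth_mono[OF s]) (use i(1) in \<open>simp_all only: l\<close>)
      then show ?thesis using uv by simp
    qed
  qed
  moreover have "u \<le> 2 * n + 1" if um: "u \<in> set (code \<psi> \<epsilon>)" for u
  proof -
    obtain i where i: "i \<le> m" "u = code \<psi> \<epsilon> ! i" using mem[OF um] by blast
    then show ?thesis using ops_nth[OF assms(1) i(1)] e[OF i(1)] nth[OF i(1)] by linarith
  qed
  moreover have "code \<psi> \<epsilon> \<noteq> []" using arg_cong[of "code \<psi> \<epsilon>" "[]" length] unfolding l by auto
  then have "set (code \<psi> \<epsilon>) \<noteq> {}" unfolding set_empty .
  moreover have "set (code \<psi> \<epsilon>) \<subseteq> {..2 * n + 1}" using calculation(2) by blast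
  ultimately show "set (code \<psi> \<epsilon>) \<in> prism n" unfolding prism_def by blast
qed

lemma prism_list:
  assumes "length v = Suc m" "sorted v" "set v \<in> prism n"
  shows "map (\<lambda>x. x div 2) v \<in> ops m n" "map (\<lambda>x. x mod 2) v \<in> ops m 1"
    "code (map (\<lambda>x. x div 2) v) (map (\<lambda>x. x mod 2) v) = v"
proof -
  have "sorted (map (\<lambda>x. x div 2) v)" by (rule sorted_mapI[OF assms(2)]) (simp add: div_le_mono)
  then show "map (\<lambda>x. x div 2) v \<in> ops m n" using assms by (auto simp: ops_def prism_def)
  have "sorted (map (\<lambda>x. x mod 2) v)" by (rule sorted_mapI[OF assms(2)]) (use assms(3) in \<open>auto simp: prism_def\<close>)
  then show "map (\<lambda>x. x mod 2) v \<in> ops m 1" using assms by (auto simp: ops_def)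
  show "code (map (\<lambda>x. x div 2) v) (map (\<lambda>x. x mod 2) v) = v"
    by (rule nth_equalityI) simp_all
qed

lemma code_act: "\<psi> \<in> ops m n \<Longrightarrow> \<epsilon> \<in> ops m 1 \<Longrightarrow> \<chi> \<in> ops k m \<Longrightarrow>
   code (map (nth \<psi>) \<chi>) (map (nth \<epsilon>) \<chi>) = map (nth (code \<psi> \<epsilon>)) \<chi>"
  by (rule nth_equalityI) (auto simp: opsD ops_nth less_Suc_eq_le)

text \<open>\<open>code\<close> turns pairs of monotone lists into the increasing lists of the
  prism, so a map on this complex is a simplicial map on the product with the interval.\<close>

lemma Ar_of_cx:
  assumes g: "cx D (prism n) g"
  shows "srestrict (simplex n \<otimes>\<^sub>s simplex 1) (\<lambda>m (\<psi>, \<epsilon>). g (code \<psi> \<epsilon>)) \<in> cells (Ar D) n"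
  unfolding Ar_cells
proof (rule srestrict_smaps)
  fix m x assume "x \<in> cells (simplex n \<otimes>\<^sub>s simplex 1) m"
  then obtain \<psi> \<epsilon> where x: "x = (\<psi>, \<epsilon>)" "\<psi> \<in> ops m n" "\<epsilon> \<in> ops m 1" by auto
  note p = code_props[OF x(2,3)]
  have "code \<psi> \<epsilon> \<noteq> []" using arg_cong[of "code \<psi> \<epsilon>" "[]" length] unfolding p(2) by auto
  then show "(case x of (\<psi>, \<epsilon>) \<Rightarrow> g (code \<psi> \<epsilon>)) \<in> cells D m"
    using cx_in[OF g _ p(1,3)] p(2) x(1) by (simp del: length_map)
next
  fix k m \<chi> x assume c: "\<chi> \<in> ops k m" and "x \<in> cells (simplex n \<otimes>\<^sub>s simplex 1) m"
  then obtain \<psi> \<epsilon> where x: "x = (\<psi>, \<epsilon>)" "\<psi> \<in> ops m n" "\<epsilon> \<in> ops m 1" by auto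
  show "act (simplex n \<otimes>\<^sub>s simplex 1) m \<chi> x \<in> cells (simplex n \<otimes>\<^sub>s simplex 1) k"
    using x c by (simp add: ops_comp)
  show "(case act (simplex n \<otimes>\<^sub>s simplex 1) m \<chi> x of (\<psi>, \<epsilon>) \<Rightarrow> g (code \<psi> \<epsilon>)) = act D m \<chi> (case x of (\<psi>, \<epsilon>) \<Rightarrow> g (code \<psi> \<epsilon>))"
    using cx_act[OF g code_props(1,3,2)[OF x(2,3)] c] x code_act[OF x(2,3) c] by simp
qed

text \<open>Gluing: the faces \<open>s i\<close>, \<open>i \<in> I\<close>, and the ends \<open>e a\<close>, \<open>a \<in> E\<close>, of an arrow between n-simplices
  extend to an arrow if the map that they define on a part of the prism extends to the whole prism.\<close>

lemma Ar_fill: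
  assumes D: "is_sset D" and n: "1 \<le> n" and I: "I \<subseteq> {..n}" and E: "E \<subseteq> {0, 1}" 
    and s: "compatible (Ar D) n I s" and e: "\<And>a. a \<in> E \<Longrightarrow> e a \<in> cells D n"
    and se: "\<And>i a. i \<in> I \<Longrightarrow> a \<in> E \<Longrightarrow> ev a (n - 1) (s i) = bd D n i (e a)"
    and fill: "\<And>g. cx D (part_prism n I E) g \<Longrightarrow>
      (\<And>i j. i \<in> I \<Longrightarrow> j \<le> n - 1 \<Longrightarrow> g [2 * (face n i ! j), 2 * (face n i ! j) + 1] = s i 1 ([j, j], [0, 1])) \<Longrightarrow>
      cx_ext D (part_prism n I E) g (prism n)"
  shows "\<exists>\<tau>\<in>cells (Ar D) n. (\<forall>i\<in>I. bd (Ar D) n i \<tau> = s i) \<and> (\<forall>a\<in>E. ev a n \<tau> = e a)"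
proof -
  let ?K = "{S. S \<noteq> {} \<and> S \<subseteq> {..n} \<and> (\<exists>i\<in>I. i \<notin> S)}"
  obtain h where h: "cx (Ar D) ?K h" "\<And>i. i \<in> I \<Longrightarrow> h (face n i) = s i"
    using cx_of_compatible[OF Ar_is_sset n I s] by blast
  let ?d = "map (\<lambda>x::nat. x div 2)" and ?m = "map (\<lambda>x::nat. x mod 2)"
  define g where "g v = (if \<exists>a\<in>E. \<forall>x\<in>set v. x mod 2 = a then act D n (?d v) (e (hd v mod 2))
     else h (?d v) (length v - 1) ([0..<length v], ?m v))" for v
  have hK: "h w m (\<psi>, \<epsilon>) = h (map (nth w) \<psi>) k ([0..<Suc k], \<epsilon>)"
    if "length w = Suc l" "sorted w" "set w \<in> ?K" "\<psi> \<in> ops k l" "\<epsilon> \<in> ops k 1" "m = k" for w l m k \<psi> \<epsilon>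
  proof -
    have "h (map (nth w) \<psi>) = act (Ar D) l \<psi> (h w)" using cx_act[OF h(1) that(2,3,1,4)] by simp
    then show ?thesis using Ar_act_app[OF that(4) ops_id that(5), of D "h w"] that(4,6) map_nth_upt[of \<psi> k] opsD(1)[OF that(4)]
      by (simp del: upt_Suc)
  qed
  have pd: "?d v \<in> ops m n" "?m v \<in> ops m 1" "set v \<in> prism n" if "length v = Suc m" "sorted v" "set v \<in> part_prism n I E" for v m
    using prism_list[OF that(1,2)] that(3) by (auto simp: part_prism_def)
  have dK: "set (?d v) \<in> ?K" if "length v = Suc m" "set v \<in> part_prism n I E" "\<exists>i\<in>I. i \<notin> (\<lambda>x. x div 2) ` set v" for v m
  proof -
    have "v \<noteq> []" using that(1) by auto
    moreover have "x div 2 \<le> n" if "x \<in> set v" for x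
      using that \<open>set v \<in> part_prism n I E\<close> by (auto simp: part_prism_def prism_def subset_iff)
    ultimately show ?thesis using that(3) by auto
  qed
  \<comment> \<open>Where a face and an end overlap, both definitions give the same value; this is
    the compatibility \<open>se\<close>.\<close>
  have gh: "g v = h (?d v) (length v - 1) ([0..<length v], ?m v)"
    if v: "length v = Suc m" "sorted v" "set v \<in> part_prism n I E" "\<exists>i\<in>I. i \<notin> (\<lambda>x. x div 2) ` set v" for v m
  proof (cases "\<exists>a\<in>E. \<forall>x\<in>set v. x mod 2 = a")
    case True
    then obtain a where a: "a \<in> E" "\<forall>x\<in>set v. x mod 2 = a" by blast
    have a1: "a \<le> 1" using a E by auto
    have "hd v mod 2 = a" using a v by (cases v) auto
    moreover have "?m v = replicate (Suc m) a" using a v(1) by (intro nth_equalityI) (auto simp del: replicate_Suc)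
    ultimately have eq: "g v = act D n (?d v) (e a)" using True by (simp add: g_def)
    obtain i where i: "i \<in> I" "i \<notin> (\<lambda>x. x div 2) ` set v" using v(4) by blast
    have "i \<le> n" using i I by auto
    let ?\<theta> = "map (\<lambda>x. if x < i then x else x - 1) (?d v)"
    have dv: "x \<noteq> i" "x \<le> n" if "x \<in> set (?d v)" for x
      using that i opsD(3)[OF pd(1)[OF v(1-3)]] by auto
    have t: "?\<theta> \<in> ops m (n - 1)"
    proof -
      have "sorted ?\<theta>" by (rule sorted_mapI[OF opsD(2)[OF pd(1)[OF v(1-3)]]]) (use dv in auto)
      moreover have "(if x < i then x else x - 1) \<le> n - 1" if "x \<in> set (?d v)" for x
        using dv[OF that] \<open>i \<le> n\<close> by auto
      then have "set ?\<theta> \<subseteq> {..n - 1}" unfolding set_map[of _ "?d v"] by blast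
      ultimately show ?thesis using v(1) unfolding ops_def by simp
    qed
    have fw: "map (nth (face n i)) ?\<theta> = ?d v"
    proof -
      have "face n i ! (if x < i then x else x - 1) = x" if "x \<in> set (?d v)" for x
        using dv[OF that] \<open>i \<le> n\<close> by (auto simp: face_nth)
      then show ?thesis by (auto intro: map_idI simp: comp_def)
    qed
    have si: "s i \<in> cells (Ar D) (n - 1)" using s i by (auto simp: compatible_def)
    have fK: "set (face n i) \<in> ?K" using i \<open>i \<le> n\<close> n by (auto simp: set_face)
    have "h (?d v) = act (Ar D) (n - 1) ?\<theta> (s i)"
      using cx_act[OF h(1) sorted_face fK _ t] h(2)[OF i(1)] n \<open>i \<le> n\<close> unfolding fw by simp
    then have "ev a m (h (?d v)) = act D (n - 1) ?\<theta> (ev a (n - 1) (s i))"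
      using ev_act[OF a1 si t] by simp
    also have "\<dots> = act D (n - 1) ?\<theta> (bd D n i (e a))" using se[OF i(1) a(1)] by simp
    also have "\<dots> = act D n (?d v) (e a)"
      using sset_comp[OF D t face_ops[OF n \<open>i \<le> n\<close>] e[OF a(1)]] unfolding fw .
    finally show ?thesis using eq v(1) \<open>?m v = replicate (Suc m) a\<close> by (simp add: ev_def)
  next
    case False
    then show ?thesis unfolding g_def by (simp only: if_False)
  qed
  have ge: "g v = act D n (?d v) (e a)" if "v \<noteq> []" "a \<in> E" "\<forall>x\<in>set v. x mod 2 = a" for v a
    using that by (cases v) (auto simp: g_def)
  have g: "cx D (part_prism n I E) g"
  proof (rule cxI)
    fix v m assume v: "length v = Suc m" "sorted v" "set v \<in> part_prism n I E"
    have vn: "v \<noteq> []" using v by auto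
    have c: "(\<exists>i\<in>I. i \<notin> (\<lambda>x. x div 2) ` set v) \<or> (\<exists>a\<in>E. \<forall>x\<in>set v. x mod 2 = a)"
      using v by (auto simp: part_prism_def)
    note pd = pd[OF v]
    show "g v \<in> cells D m"
    proof (cases "\<exists>a\<in>E. \<forall>x\<in>set v. x mod 2 = a")
      case True
      then show ?thesis using ge[OF vn] sset_in[OF D pd(1) e] by metis
    next
      case False
      then have F: "\<exists>i\<in>I. i \<notin> (\<lambda>x. x div 2) ` set v" using c by blast
      have "h (?d v) \<in> cells (Ar D) m" using cx_in[OF h(1) _ opsD(2)[OF pd(1)] dK[OF v(1,3) F]] v(1) vn by simp
      then show ?thesis using gh[OF v F] Ar_in[OF _ ops_id pd(2)] v(1) by simp
    qed
    fix k \<theta> assume t: "\<theta> \<in> ops k m"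
    have sub: "set (map (nth v) \<theta>) \<subseteq> set v" by (rule set_map_nth[OF t v(1)])
    have ne: "map (nth v) \<theta> \<noteq> []" using opsD[OF t] by auto
    have le: "length (map (nth v) \<theta>) = Suc k" using opsD[OF t] by simp
    have so: "sorted (map (nth v) \<theta>)" by (rule sorted_nth_ops[OF t v(1,2)])
    have pp: "set (map (nth v) \<theta>) \<in> part_prism n I E" using closed_cxD[OF part_prism_closed v(3) sub] ne by simp
    have dm: "?d (map (nth v) \<theta>) = map (nth (?d v)) \<theta>" "?m (map (nth v) \<theta>) = map (nth (?m v)) \<theta>"
      using t v by (auto simp: ops_def subset_iff less_Suc_eq_le)
    show "act D m \<theta> (g v) = g (map (nth v) \<theta>)"
    proof (cases "\<exists>a\<in>E. \<forall>x\<in>set v. x mod 2 = a")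
      case True
      then obtain a where a: "a \<in> E" "\<forall>x\<in>set v. x mod 2 = a" by blast
      have a': "\<forall>x\<in>set (map (nth v) \<theta>). x mod 2 = a" using a sub by blast
      show ?thesis unfolding ge[OF vn a] ge[OF ne a(1) a'] dm by (rule sset_comp[OF D t pd(1) e[OF a(1)]])
    next
      case False
      then have F: "\<exists>i\<in>I. i \<notin> (\<lambda>x. x div 2) ` set v" using c by blast
      then have F': "\<exists>i\<in>I. i \<notin> (\<lambda>x. x div 2) ` set (map (nth v) \<theta>)" using sub by blast
      have hd: "h (?d v) \<in> cells (Ar D) m" using cx_in[OF h(1) _ opsD(2)[OF pd(1)] dK[OF v(1,3) F]] v(1) vn by simp
      have "act D m \<theta> (g v) = h (?d v) k (\<theta>, map (nth (?m v)) \<theta>)"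
        using gh[OF v F] Ar_nat[OF hd ops_id pd(2) t] v(1) ops_map_nth_id[OF t] by (simp del: upt_Suc)
      also have "\<dots> = h (map (nth (?d v)) \<theta>) k ([0..<Suc k], map (nth (?m v)) \<theta>)"
        by (rule hK[OF _ opsD(2)[OF pd(1)] dK[OF v(1,3) F] t ops_comp[OF t pd(2)]]) (use v(1) in auto)
      also have "\<dots> = g (map (nth v) \<theta>)" using gh[OF le so pp F'] unfolding dm le by (simp del: upt_Suc)
      finally show ?thesis .
    qed
  qed
  \<comment> \<open>The values at the edges over single vertices are recorded, because the special
    fillings require one of them to be an identity.\<close>
  have edge: "g [2 * (face n i ! j), 2 * (face n i ! j) + 1] = s i 1 ([j, j], [0, 1])" if i: "i \<in> I" "j \<le> n - 1" for i j
  proof -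
    have iN: "i \<le> n" using i I by auto
    let ?x = "face n i ! j"
    let ?v = "[2 * ?x, 2 * ?x + 1]"
    have x: "?x \<noteq> i" "?x \<le> n" using iN i n by (auto simp: face_nth)
    have "i \<notin> (\<lambda>x. x div 2) ` set ?v" using x by auto
    then have F: "\<exists>i\<in>I. i \<notin> (\<lambda>x. x div 2) ` set ?v" using i(1) by blast
    have "(2 * ?x) mod 2 = 0" "(2 * ?x + 1) mod 2 = 1" by presburger+
    then have "set ?v \<in> prism n" using x by (auto simp: prism_def)
    then have pp: "set ?v \<in> part_prism n I E" using F by (auto simp: part_prism_def)
    have gv: "g ?v = h [?x, ?x] 1 ([0, 1], [0, 1])" using gh[OF _ _ pp F, of 1] by (simp add: upt_rec)
    have jj: "[j, j] \<in> ops 1 (n - 1)" using i by (auto simp: ops_def)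
    have ee: "[0, 1] \<in> ops 1 1" by (auto simp: ops_def)
    have fK: "set (face n i) \<in> ?K" using i iN n by (auto simp: set_face)
    have "h (face n i) 1 ([j, j], [0, 1]) = h (map (nth (face n i)) [j, j]) 1 ([0..<Suc 1], [0, 1])"
      by (rule hK[OF _ sorted_face fK jj ee]) (use iN n in auto)
    then show ?thesis using gv h(2)[OF i(1)] by (simp add: upt_rec)
  qed
  obtain g' where g': "cx D (prism n) g'" "\<And>v. set v \<in> part_prism n I E \<Longrightarrow> g' v = g v"
    using fill[OF g edge] by blast
  let ?\<tau> = "srestrict (simplex n \<otimes>\<^sub>s simplex 1) (\<lambda>m (\<psi>, \<epsilon>). g' (code \<psi> \<epsilon>))"
  have \<tau>: "?\<tau> \<in> cells (Ar D) n" by (rule Ar_of_cx[OF g'(1)])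
  have "bd (Ar D) n i ?\<tau> = s i" if i: "i \<in> I" for i
  proof -
    have iN: "i \<le> n" using i I by auto
    have f: "face n i \<in> ops (n - 1) n" by (rule face_ops[OF n iN])
    have si: "s i \<in> cells (Ar D) (n - 1)" using s i by (auto simp: compatible_def)
    have fK: "set (face n i) \<in> ?K" using i iN n by (auto simp: set_face)
    show ?thesis
    proof (rule Ar_ext[OF sset_in[OF Ar_is_sset f \<tau>] si])
      fix m \<psi> \<epsilon> assume pe: "\<psi> \<in> ops m (n - 1)" "\<epsilon> \<in> ops m 1"
      let ?w = "map (nth (face n i)) \<psi>"
      have w: "?w \<in> ops m n" by (rule ops_comp[OF pe(1) f])
      note cp = code_props[OF w pe(2)]
      have "set ?w \<subseteq> set (face n i)" by (rule set_map_nth[OF pe(1)]) (use n iN in auto)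
      then have "i \<notin> set ?w" by (auto simp: set_face)
      then have F: "\<exists>i\<in>I. i \<notin> (\<lambda>x. x div 2) ` set (code ?w \<epsilon>)" using i cp(4) by (metis list.set_map)
      then have pp: "set (code ?w \<epsilon>) \<in> part_prism n I E" using cp(3) by (simp add: part_prism_def)
      have "bd (Ar D) n i ?\<tau> m (\<psi>, \<epsilon>) = g' (code ?w \<epsilon>)"
        unfolding Ar_act_app[OF f pe] using w pe by simp
      also have "\<dots> = g (code ?w \<epsilon>)" by (rule g'(2)[OF pp])
      also have "\<dots> = h ?w m ([0..<Suc m], \<epsilon>)" using gh[OF cp(2,1) pp F] unfolding cp(4,5) cp(2) by simp
      also have "\<dots> = h (face n i) m (\<psi>, \<epsilon>)"
        by (rule hK[symmetric, OF _ sorted_face fK pe]) (use n iN in auto)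
      finally show "bd (Ar D) n i ?\<tau> m (\<psi>, \<epsilon>) = s i m (\<psi>, \<epsilon>)" using h(2)[OF i] by simp
    qed
  qed
  moreover have "ev a n ?\<tau> = e a" if a: "a \<in> E" for a
  proof -
    have a1: "a \<le> 1" using a E by auto
    let ?c = "code [0..<Suc n] (replicate (Suc n) a)"
    note cp = code_props[OF ops_id ops_replicate[OF a1], of n]
    have mod: "x mod 2 = a" if "x \<in> set ?c" for x
    proof -
      have "x mod 2 \<in> set (map (\<lambda>x. x mod 2) ?c)" using that by (metis image_eqI list.set_map)
      then show ?thesis unfolding cp(5) by (auto split: if_splits)
    qed
    then have pp: "set ?c \<in> part_prism n I E" using cp(3) a by (auto simp: part_prism_def)
    have cn: "?c \<noteq> []" using arg_cong[of ?c "[]" length] unfolding cp(2) by auto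
    have "ev a n ?\<tau> = g' ?c" using ops_id ops_replicate[OF a1] by (simp add: ev_def del: upt_Suc replicate_Suc)
    also have "\<dots> = act D n (?d ?c) (e a)" using g'(2)[OF pp] ge[OF cn a] mod by simp
    also have "\<dots> = e a" using cp(4) sset_id[OF D e[OF a]] by simp
    finally show ?thesis .
  qed
  ultimately show ?thesis using \<tau> by blast
qed

section \<open>Fillings of the prism\<close>

lemma proj_iff: "i \<in> (\<lambda>x::nat. x div 2) ` S \<longleftrightarrow> 2 * i \<in> S \<or> Suc (2 * i) \<in> S"
proof
  assume "i \<in> (\<lambda>x. x div 2) ` S"
  then obtain x where "x \<in> S" "i = x div 2" by blast
  moreover have "x = 2 * (x div 2) \<or> x = Suc (2 * (x div 2))" by presburger
  ultimately show "2 * i \<in> S \<or> Suc (2 * i) \<in> S" by auto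
next
  assume "2 * i \<in> S \<or> Suc (2 * i) \<in> S"
  moreover have "i = (2 * i) div 2" "i = Suc (2 * i) div 2" by simp_all
  ultimately show "i \<in> (\<lambda>x. x div 2) ` S" by blast
qed

lemma prism_iff: "S \<in> prism n \<longleftrightarrow> S \<noteq> {} \<and> S \<subseteq> {..2 * n + 1} \<and> (\<forall>u\<in>S. \<forall>v\<in>S. u \<le> v \<longrightarrow> odd u \<longrightarrow> odd v)"
proof -
  have "(u mod 2 \<le> v mod 2) = (odd u \<longrightarrow> odd v)" for u v :: nat by presburger
  then show ?thesis by (simp add: prism_def imp_conjL)
qed

lemma part_prism_iff: "S \<in> part_prism n I E \<longleftrightarrow> S \<in> prism n \<and>
   ((\<exists>i\<in>I. 2 * i \<notin> S \<and> Suc (2 * i) \<notin> S) \<or> (\<exists>a\<in>E. \<forall>x\<in>S. x mod 2 = a))"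
  unfolding part_prism_def proj_iff by blast

lemma not_part_prism:
  assumes "\<And>i. i \<in> I \<Longrightarrow> 2 * i \<in> S \<or> Suc (2 * i) \<in> S" "\<And>a. a \<in> E \<Longrightarrow> \<exists>x\<in>S. x mod 2 \<noteq> a"
  shows "S \<notin> part_prism n I E"
  unfolding part_prism_iff using assms by blast

lemma finite_prism: "finite (prism n)"
  by (rule finite_subset[of _ "Pow {..2 * n + 1}"]) (auto simp: prism_def)

lemma part_prism_sub: "S \<in> part_prism n I E \<Longrightarrow> S \<in> prism n"
  by (simp add: part_prism_def)

lemma insert_prism:
  assumes S: "S \<in> prism n" and x: "x \<le> 2 * n + 1" and o: "\<And>u. u \<in> S \<Longrightarrow> odd x \<Longrightarrow> x \<le> u \<Longrightarrow> odd u" "\<And>u. u \<in> S \<Longrightarrow> even x \<Longrightarrow> u \<le> x \<Longrightarrow> even u"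
  shows "insert x S \<in> prism n"
  using S x o unfolding prism_iff by blast

text \<open>The vertex \<open>2t + 1\<close> is matched, 2t being the last vertex at the source of the arrow; this leaves
  a horn opposite to the last vertex.\<close>

lemma fill_last:
  assumes D: "qcat D" and n: "1 \<le> n" and g: "cx D (part_prism n {..n} {1}) g"
    and x0: "x0 \<in> cells D 0" "g [2 * n, 2 * n + 1] = idn D x0"
  shows "cx_ext D (part_prism n {..n} {1}) g (prism n)"
proof -
  let ?L = "part_prism n {..n} {1}"
  \<comment> \<open>The vertex 2n is spared: the simplices without it are paired first, and then a
    single horn is left.\<close>
  define K where "K = {S \<in> prism n. S \<in> ?L \<or> 2 * n \<notin> S}"
  define x where "x S = Suc (Max {u \<in> S. even u})" for S :: "nat set"
  have LK: "?L \<subseteq> K" using part_prism_sub by (auto simp: K_def)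
  have Kc: "closed_cx K"
    unfolding closed_cx_def
  proof (intro ballI conjI allI impI)
    fix S T assume S: "S \<in> K"
    show "finite S" "S \<noteq> {}" using S prism_closed[of n] by (auto simp: K_def closed_cx_def)
    show "T \<in> K" if "T \<noteq> {} \<and> T \<subseteq> S"
      using S that closed_cxD[OF prism_closed, of S n T] closed_cxD[OF part_prism_closed, of S n "{..n}" "{1}" T] by (auto simp: K_def)
  qed
  have ev: "x mod 2 \<noteq> 1 \<longleftrightarrow> even x" for x :: nat by presburger
  have nL: "S \<notin> ?L \<longleftrightarrow> (\<forall>i\<le>n. 2 * i \<in> S \<or> Suc (2 * i) \<in> S) \<and> (\<exists>u\<in>S. even u)" if "S \<in> prism n" for S
    using that ev unfolding part_prism_iff by auto
  have miss: "x S - 1 \<in> S" "even (x S - 1)" "odd (x S)" "x S - 1 < x S" "x S < 2 * n" "Suc (2 * n) \<in> S"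
    "\<And>u. u \<in> S \<Longrightarrow> even u \<Longrightarrow> u < x S" if S: "S \<in> K" "S \<notin> ?L" for S
  proof -
    have "finite S" using S(1) Kc unfolding closed_cx_def by blast
    then have f: "finite {u \<in> S. even u}" by simp
    have e: "{u \<in> S. even u} \<noteq> {}" using nL[of S] S by (auto simp: K_def)
    show m: "x S - 1 \<in> S" "even (x S - 1)" "odd (x S)" "x S - 1 < x S" using Max_in[OF f e] by (auto simp: x_def)
    show "u < x S" if "u \<in> S" "even u" for u using Max_ge[OF f, of u] that by (simp add: x_def)
    have "S \<subseteq> {..2 * n + 1}" "2 * n \<notin> S" using S by (auto simp: K_def prism_iff)
    then have "x S - 1 \<le> 2 * n + 1" "x S - 1 \<noteq> 2 * n" using m(1) by auto
    then show "x S < 2 * n" using m(2,3) by presburger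
    show "Suc (2 * n) \<in> S" using nL[of S] S by (auto simp: K_def)
  qed
  have xe: "x S = x T" if "{u \<in> S. even u} = {u \<in> T. even u}" for S T using that by (simp add: x_def)
  have xo: "x (insert (x S) S) = x S" "x (S - {x S}) = x S" if "odd (x S)" for S
    using that by (auto intro!: xe)
  obtain g1 where g1: "cx D (?L \<union> K) g1" "\<And>v. set v \<in> ?L \<Longrightarrow> g1 v = g v"
  proof -
    have "cx_ext D ?L g (?L \<union> K)"
    proof (rule cx_pairing[OF D _ Kc part_prism_closed g, where x = x and r = id])
      show "finite K" using finite_prism by (rule rev_finite_subset) (auto simp: K_def)
      fix S assume S: "S \<in> K" "S \<notin> ?L"
      note m = miss[OF S]
      have p: "S \<in> prism n" "2 * n \<notin> S" using S by (auto simp: K_def)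
      have "insert (x S) S \<in> prism n" using m by (intro insert_prism[OF p(1)]) force+
      moreover have "2 * n \<notin> insert (x S) S" using p m by auto
      moreover have "S - {x S} \<notin> ?L"
      proof (rule not_part_prism)
        fix i assume "i \<in> {..n}"
        then have "2 * i \<in> S \<or> Suc (2 * i) \<in> S" using nL[OF p(1)] S by simp
        moreover have "Suc (2 * i) = x S \<Longrightarrow> 2 * i \<in> S" using m(1) by (metis diff_Suc_1)
        moreover have "2 * i \<noteq> x S" using m(3) by (metis dvd_triv_left)
        ultimately show "2 * i \<in> S - {x S} \<or> Suc (2 * i) \<in> S - {x S}" by auto
      next
        fix a :: nat assume "a \<in> {1}"
        then have "(x S - 1) mod 2 \<noteq> a" using m(2) ev by simp
        then show "\<exists>u\<in>S - {x S}. u mod 2 \<noteq> a" using m(1,4) by (intro bexI[of _ "x S - 1"]) auto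
      qed
      ultimately show "insert (x S) S \<in> K \<and> S - {x S} \<notin> ?L \<and> x (insert (x S) S) = x S \<and> x (S - {x S}) = x S"
        using xo[OF m(3)] by (simp add: K_def)
      show "(\<exists>a\<in>S. a < x S) \<and> (\<exists>b\<in>S. x S < b)" using m(1,4-6) by (intro conjI bexI[of _ "x S - 1"] bexI[of _ "Suc (2 * n)"]) auto
      fix i assume i: "x S \<in> S" "i \<noteq> x S" "S - {i} \<notin> ?L"
      have T: "S - {i} \<in> K" using closed_cxD[OF Kc S(1), of "S - {i}"] i by blast
      have "x (S - {i}) - 1 < x S" using m(7) miss(1,2)[OF T i(3)] by blast
      then have "x (S - {i}) \<le> x S" using miss(4)[OF T i(3)] by linarith
      then show "x (S - {i}) \<in> S \<or> id (x (S - {i})) < id (x S)" using i(1) by (cases "x (S - {i}) = x S") auto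
    qed
    then show ?thesis using that by blast
  qed
  have LK': "?L \<union> K = K" using LK by blast
  \<comment> \<open>The source end followed by the last vertex of the target end: the last edge of
    this simplex lies over n, where the arrow is an identity.\<close>
  let ?c = "insert (2 * n + 1) {u. u \<le> 2 * n \<and> even u}"
  have "{2 * n, 2 * n + 1} \<in> ?L"
    using n unfolding part_prism_iff prism_iff by (intro conjI disjI1 bexI[of _ 0]) auto
  then have e: "g1 [2 * n, 2 * n + 1] = idn D x0" using g1(2)[of "[2 * n, 2 * n + 1]"] x0 by simp
  have s0: "{x \<in> ?c. 2 * n < x} = {2 * n + 1}" by auto
  have cp: "?c \<in> prism n" unfolding prism_iff by auto
  have "cx_ext D K g1 (K \<union> {?c, ?c - {2 * n + 1}})"
  proof (rule cx_horn_last[OF D Kc g1(1)[unfolded LK'] _ _ _ s0 _ _ x0(1) e])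
    show "2 * n + 1 \<in> ?c" "2 * n \<in> ?c" "0 \<in> ?c" "0 < 2 * n" "finite ?c" using n by auto
    have "2 * n \<in> ?c - {2 * n + 1}" by simp
    moreover have "?c - {2 * n + 1} \<notin> ?L" by (rule not_part_prism) (auto intro!: bexI[of _ 0])
    ultimately show "?c - {2 * n + 1} \<notin> K" by (simp add: K_def)
    fix i assume i: "i \<in> ?c" "i \<noteq> 2 * n + 1"
    have p: "?c - {i} \<in> prism n" by (rule closed_cxD[OF prism_closed cp]) (use i in auto)
    show "?c - {i} \<in> K"
    proof (cases "i = 2 * n")
      case False
      then obtain j where j: "i = 2 * j" "j < n" using i by (auto elim!: evenE)
      then have "2 * j \<notin> ?c - {i} \<and> Suc (2 * j) \<notin> ?c - {i}" by auto
      moreover have "j \<in> {..n}" using j(2) by simp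
      ultimately have "?c - {i} \<in> ?L" using p unfolding part_prism_iff by blast
      then show ?thesis using LK by blast
    qed (use p in \<open>simp add: K_def\<close>)
  qed
  then obtain g2 where g2: "cx D (K \<union> {?c, ?c - {2 * n + 1}}) g2" "\<And>v. set v \<in> K \<Longrightarrow> g2 v = g1 v" by blast
  have "prism n \<subseteq> K \<union> {?c, ?c - {2 * n + 1}}"
  proof
    fix S assume S: "S \<in> prism n"
    show "S \<in> K \<union> {?c, ?c - {2 * n + 1}}"
    proof (cases "S \<in> K")
      case False
      then have "S \<notin> ?L" "2 * n \<in> S" using S by (auto simp: K_def)
      then have c: "2 * i \<in> S \<or> Suc (2 * i) \<in> S" if "i \<le> n" for i using nL[OF S] that by blast
      have o: "u = 2 * n + 1" if "u \<in> S" "odd u" for u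
      proof -
        have "\<not> u \<le> 2 * n" using S that \<open>2 * n \<in> S\<close> unfolding prism_iff by (metis dvd_triv_left)
        moreover have "u \<le> 2 * n + 1" using S that by (auto simp: prism_iff)
        ultimately show ?thesis by simp
      qed
      have "u \<in> S" if u: "u \<le> 2 * n" "even u" for u
      proof -
        obtain j where "u = 2 * j" using u(2) by blast
        then show ?thesis using u(1) c[of j] o[of "Suc (2 * j)"] \<open>2 * n \<in> S\<close> by auto
      qed
      moreover have "u \<in> ?c" if "u \<in> S" for u
      proof (cases "odd u")
        case False
        have "u \<le> 2 * n + 1" using S that by (auto simp: prism_iff)
        moreover have "u \<noteq> 2 * n + 1" using False by auto
        ultimately show ?thesis using False by simp
      qed (use o that in simp)
      ultimately have "S = ?c \<or> S = ?c - {2 * n + 1}" by (cases "2 * n + 1 \<in> S") auto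
      then show ?thesis by blast
    qed simp
  qed
  then have "cx D (prism n) g2" by (rule cx_mono[OF g2(1)])
  moreover have "g2 v = g v" if "set v \<in> ?L" for v using g2(2)[of v] g1(2)[OF that] LK that by auto
  ultimately show ?thesis by blast
qed

text \<open>x \<mapsto> 2n + 1 - x sends the vertex (i, a) to (n - i, 1 - a), which reverses the
  order and exchanges the two ends.\<close>

lemma prism_flip:
  assumes S: "S \<in> prism n" shows "(\<lambda>x. 2 * n + 1 - x) ` S \<in> prism n"
proof -
  let ?f = "\<lambda>x. 2 * n + 1 - x"
  have o: "odd (?f v)" if "u \<in> S" "v \<in> S" "?f u \<le> ?f v" "odd (?f u)" for u v
  proof -
    have b: "u \<le> 2 * n + 1" "v \<le> 2 * n + 1" using S that by (auto simp: prism_iff)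
    then have "v \<le> u" using that(3) by linarith
    then have "odd v \<longrightarrow> odd u" using S that unfolding prism_iff by blast
    then show ?thesis using that(4) b by simp
  qed
  have "?f ` S \<noteq> {}" "?f ` S \<subseteq> {..2 * n + 1}" using S by (auto simp: prism_iff)
  then show ?thesis unfolding prism_iff using o by blast
qed

lemma part_prism_flip:
  assumes S: "S \<in> part_prism n {..n} {a}" and a: "a \<le> 1"
  shows "(\<lambda>x. 2 * n + 1 - x) ` S \<in> part_prism n {..n} {1 - a}"
proof -
  let ?f = "\<lambda>x. 2 * n + 1 - x"
  have p: "S \<in> prism n" "S \<subseteq> {..2 * n + 1}" using S unfolding part_prism_iff prism_iff by blast+
  consider i where "i \<le> n" "2 * i \<notin> S" "Suc (2 * i) \<notin> S" | "\<forall>x\<in>S. x mod 2 = a" using S unfolding part_prism_iff by blast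
  then show ?thesis
  proof cases
    case 1
    have "2 * (n - i) \<noteq> ?f x \<and> Suc (2 * (n - i)) \<noteq> ?f x" if "x \<in> S" for x
    proof -
      have "x \<noteq> 2 * i" "x \<noteq> Suc (2 * i)" "x \<le> 2 * n + 1" using that 1 p by auto
      then show ?thesis using 1(1) by linarith
    qed
    then have "2 * (n - i) \<notin> ?f ` S \<and> Suc (2 * (n - i)) \<notin> ?f ` S" by blast
    then show ?thesis using prism_flip[OF p(1)] unfolding part_prism_iff by (metis atMost_iff diff_le_self)
  next
    case 2
    have "?f x mod 2 = 1 - a" if "x \<in> S" for x
    proof -
      have "x mod 2 = a" "x \<le> 2 * n + 1" using 2 p that by auto
      then show ?thesis using a by (auto simp: mod2_eq_if split: if_splits)
    qed
    then have "\<forall>x\<in>?f ` S. x mod 2 = 1 - a" by blast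
    then show ?thesis using prism_flip[OF p(1)] unfolding part_prism_iff by blast
  qed
qed

text \<open>The reversal of the prism turns the problem into that of \<open>fill_last\<close> for
  the opposite quasicategory.\<close>

lemma fill_first:
  assumes D: "qcat D" and n: "1 \<le> n" and g: "cx D (part_prism n {..n} {0}) g"
    and x0: "x0 \<in> cells D 0" "g [0, 1] = idn D x0"
  shows "cx_ext D (part_prism n {..n} {0}) g (prism n)"
proof -
  let ?f = "flip (2 * n + 1)"
  have P: "S \<subseteq> {..2 * n + 1}" if "S \<in> prism n" for S using that by (simp add: prism_def)
  have L: "S \<in> prism n" if "S \<in> part_prism n I E" for S I E using that by (simp add: part_prism_def)
  have "cx (op_sset D) (part_prism n {..n} {1}) (\<lambda>v. g (?f v))"
    by (rule cx_op[OF g]) (use P[OF L] part_prism_flip[of _ n 1] in simp)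
  moreover have "g (?f [2 * n, 2 * n + 1]) = idn (op_sset D) x0" using x0 by (simp add: flip_def idn_def)
  ultimately obtain h where h: "cx (op_sset D) (prism n) h" "\<And>v. set v \<in> part_prism n {..n} {1} \<Longrightarrow> h v = g (?f v)"
    using fill_last[OF op_qcat[OF D] n, of "\<lambda>v. g (?f v)" x0] x0(1) by auto
  have "cx D (prism n) (\<lambda>v. h (?f v))" by (rule cx_op_op, rule cx_op[OF h(1)]) (use P prism_flip in blast)
  moreover have "h (?f v) = g v" if v: "set v \<in> part_prism n {..n} {0}" for v
    using part_prism_flip[OF v] h(2)[of "?f v"] flip_flip[OF P[OF L[OF v]]] by (simp add: flip_def)
  ultimately show ?thesis by blast
qed

text \<open>The vertex over k is matched: the one at the target of the arrow if an earlier vertex lies there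
  already, otherwise the one at the source.\<close>

lemma fill_inner:
  assumes D: "qcat D" and k: "0 < k" "k < n" and g: "cx D (part_prism n ({..n} - {k}) {0, 1}) g"
  shows "cx_ext D (part_prism n ({..n} - {k}) {0, 1}) g (prism n)"
proof -
  let ?L = "part_prism n ({..n} - {k}) {0, 1}"
  \<comment> \<open>If a vertex over an index below k lies at the target, it is not comparable with
    the vertex 2k at the source, and 2k + 1 has to be taken; otherwise 2k is admissible.\<close>
  define x where "x S = (if \<exists>u\<in>S. odd u \<and> u < 2 * k then Suc (2 * k) else 2 * k)" for S
  have ev: "x mod 2 \<noteq> 0 \<longleftrightarrow> odd x" "x mod 2 \<noteq> 1 \<longleftrightarrow> even x" for x :: nat by presburger+
  have nL: "(\<And>i. i \<le> n \<Longrightarrow> i \<noteq> k \<Longrightarrow> 2 * i \<in> S \<or> Suc (2 * i) \<in> S)" "\<exists>u\<in>S. odd u" "\<exists>u\<in>S. even u"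
    if "S \<in> prism n" "S \<notin> ?L" for S
  proof -
    have "\<forall>i\<in>{..n} - {k}. 2 * i \<in> S \<or> Suc (2 * i) \<in> S" "\<exists>x\<in>S. x mod 2 \<noteq> 0" "\<exists>x\<in>S. x mod 2 \<noteq> 1"
      using that unfolding part_prism_iff by blast+
    then show "\<And>i. i \<le> n \<Longrightarrow> i \<noteq> k \<Longrightarrow> 2 * i \<in> S \<or> Suc (2 * i) \<in> S" "\<exists>u\<in>S. odd u" "\<exists>u\<in>S. even u"
      unfolding ev by auto
  qed
  have x_eq: "x S = x T" if "(\<exists>u\<in>S. odd u \<and> u < 2 * k) = (\<exists>u\<in>T. odd u \<and> u < 2 * k)" for S T
    unfolding x_def that ..
  have "\<not> (odd (x S) \<and> x S < 2 * k)" for S by (simp add: x_def)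
  then have x: "x (insert (x S) S) = x S" "x (S - {x S}) = x S" for S by (intro x_eq; blast)+
  have "cx_ext D ?L g (?L \<union> prism n)"
  proof (rule cx_pairing[OF D finite_prism prism_closed part_prism_closed g, where x = x and r = id])
    fix S assume S: "S \<in> prism n" "S \<notin> ?L"
    note c = nL(1)[OF S]
    have 0: "0 \<in> S \<or> 1 \<in> S" and n: "2 * n \<in> S \<or> Suc (2 * n) \<in> S" using c[of 0] c[of n] k by auto
    have i: "insert (x S) S \<in> prism n"
    proof (cases "\<exists>u\<in>S. odd u \<and> u < 2 * k")
      case True
      then obtain u where u: "u \<in> S" "odd u" "u < 2 * k" by blast
      have "odd v" if "v \<in> S" "Suc (2 * k) \<le> v" for v
      proof -
        have "u \<le> v" using u(3) that(2) by linarith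
        then show ?thesis using S(1) u(1,2) that(1) unfolding prism_iff by blast
      qed
      moreover have "x S = Suc (2 * k)" using True by (simp add: x_def)
      ultimately show ?thesis using k by (intro insert_prism[OF S(1)]) auto
    next
      case False
      have "even v" if "v \<in> S" "v \<le> 2 * k" for v using False that by (metis dvd_triv_left le_neq_implies_less)
      moreover have "x S = 2 * k" unfolding x_def using False by (rule if_not_P)
      ultimately show ?thesis using k by (intro insert_prism[OF S(1)]) auto
    qed
    have "S - {x S} \<notin> ?L"
    proof (rule not_part_prism)
      fix i assume "i \<in> {..n} - {k}"
      then have "2 * i \<in> S \<or> Suc (2 * i) \<in> S" "i \<noteq> k" using c by auto
      then show "2 * i \<in> S - {x S} \<or> Suc (2 * i) \<in> S - {x S}" by (auto simp: x_def)
    next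
      fix a :: nat assume "a \<in> {0, 1}"
      then have "a = 0 \<or> a = 1" by simp
      moreover have "(\<exists>u\<in>S - {x S}. odd u) \<and> (\<exists>u\<in>S - {x S}. even u)"
      proof (cases "\<exists>u\<in>S. odd u \<and> u < 2 * k")
        case True
        then have e: "x S = Suc (2 * k)" unfolding x_def by (rule if_P)
        obtain u v where "u \<in> S" "odd u" "u < 2 * k" "v \<in> S" "even v" using True nL(3)[OF S] by blast
        then show ?thesis unfolding e by (intro conjI bexI[of _ u] bexI[of _ v]) auto
      next
        case False
        have e: "x S = 2 * k" unfolding x_def using False by (rule if_not_P)
        have "\<not> (1 \<in> S \<and> odd (1::nat) \<and> 1 < 2 * k)" using False by blast
        then have "0 \<in> S" using 0 k by simp
        moreover obtain u where "u \<in> S" "odd u" using nL(2)[OF S] by blast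
        ultimately show ?thesis using k unfolding e by (intro conjI bexI[of _ u] bexI[of _ 0]) auto
      qed
      ultimately show "\<exists>u\<in>S - {x S}. u mod 2 \<noteq> a" by (elim disjE conjE) (simp_all only: ev)
    qed
    then show "insert (x S) S \<in> prism n \<and> S - {x S} \<notin> ?L \<and> x (insert (x S) S) = x S \<and> x (S - {x S}) = x S" using i x by blast
    obtain a b where "a \<in> S" "a \<le> 1" "b \<in> S" "2 * n \<le> b" using 0 n by (metis le_SucI le_zero_eq linear order_refl)
    moreover have "2 * k \<le> x S" "x S \<le> Suc (2 * k)" by (auto simp: x_def)
    ultimately show "(\<exists>a\<in>S. a < x S) \<and> (\<exists>b\<in>S. x S < b)" using k by (intro conjI bexI[of _ a] bexI[of _ b]) auto
    show "x (S - {i}) \<in> S \<or> id (x (S - {i})) < id (x S)" if "x S \<in> S" for i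
      using that by (auto simp: x_def split: if_splits)
  qed
  then show ?thesis using cx_mono[of D "?L \<union> prism n" _ "prism n"] by blast
qed

text \<open>The sphere and the source end leave the problem of \<open>fill_first\<close>, which asks
  for an identity at the vertex 0; this vertex is visible on the face opposite to n.\<close>

lemma Ar_fill_first:
  assumes D: "qcat D" and n: "1 \<le> n" and s: "compatible (Ar D) n {..n} s" and b: "b \<in> cells D n"
    and sb: "\<And>i. i \<le> n \<Longrightarrow> ev 0 (n - 1) (s i) = bd D n i b"
    and x0: "x0 \<in> cells D 0" "s n 1 ([0, 0], [0, 1]) = idn D x0"
  shows "\<exists>\<tau>\<in>cells (Ar D) n. (\<forall>i\<le>n. bd (Ar D) n i \<tau> = s i) \<and> ev 0 n \<tau> = b"
proof -
  have "\<exists>\<tau>\<in>cells (Ar D) n. (\<forall>i\<in>{..n}. bd (Ar D) n i \<tau> = s i) \<and> (\<forall>a\<in>{0}. ev a n \<tau> = b)"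
  proof (rule Ar_fill[OF qcat_sset[OF D] n _ _ s])
    fix g assume g: "cx D (part_prism n {..n} {0}) g"
      and e: "\<And>i j. i \<in> {..n} \<Longrightarrow> j \<le> n - 1 \<Longrightarrow> g [2 * (face n i ! j), 2 * (face n i ! j) + 1] = s i 1 ([j, j], [0, 1])"
    have "g [0, 1] = idn D x0" using e[of n 0] n x0 by (simp add: face_nth)
    then show "cx_ext D (part_prism n {..n} {0}) g (prism n)"
      by (rule fill_first[OF D n g x0(1)])
  qed (use b sb in auto)
  then show ?thesis by auto
qed

text \<open>Dual to \<open>Ar_fill_first\<close>: the last vertex n appears as the vertex n - 1 of
  the face opposite to 0.\<close>

lemma Ar_fill_last:
  assumes D: "qcat D" and n: "1 \<le> n" and s: "compatible (Ar D) n {..n} s" and b: "b \<in> cells D n"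
    and sb: "\<And>i. i \<le> n \<Longrightarrow> ev 1 (n - 1) (s i) = bd D n i b"
    and x0: "x0 \<in> cells D 0" "s 0 1 ([n - 1, n - 1], [0, 1]) = idn D x0"
  shows "\<exists>\<tau>\<in>cells (Ar D) n. (\<forall>i\<le>n. bd (Ar D) n i \<tau> = s i) \<and> ev 1 n \<tau> = b"
proof -
  have "\<exists>\<tau>\<in>cells (Ar D) n. (\<forall>i\<in>{..n}. bd (Ar D) n i \<tau> = s i) \<and> (\<forall>a\<in>{1}. ev a n \<tau> = b)"
  proof (rule Ar_fill[OF qcat_sset[OF D] n _ _ s])
    fix g assume g: "cx D (part_prism n {..n} {1}) g"
      and e: "\<And>i j. i \<in> {..n} \<Longrightarrow> j \<le> n - 1 \<Longrightarrow> g [2 * (face n i ! j), 2 * (face n i ! j) + 1] = s i 1 ([j, j], [0, 1])"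
    have "g [2 * n, 2 * n + 1] = idn D x0" using e[of 0 "n - 1"] n x0 by (simp add: face_nth)
    then show "cx_ext D (part_prism n {..n} {1}) g (prism n)"
      by (rule fill_last[OF D n g x0(1)])
  qed (use b sb in auto)
  then show ?thesis by auto
qed

lemma ev_compatible:
  assumes a: "a \<le> 1" and I: "I \<subseteq> {..n}" and s: "compatible (Ar D) n I s"
  shows "compatible D n I (\<lambda>i. ev a (n - 1) (s i))"
  unfolding compatible_def
proof (intro conjI ballI impI)
  fix i assume "i \<in> I"
  then show "ev a (n - 1) (s i) \<in> cells D (n - 1)" using s ev_in[OF a] by (auto simp: compatible_def)
next
  fix i j assume n: "2 \<le> n" and ij: "i \<in> I" "j \<in> I" "i < j"
  have b: "i \<le> n - 1" "j - 1 \<le> n - 1" using ij I by auto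
  have f: "face (n - 1) i \<in> ops (n - 2) (n - 1)" "face (n - 1) (j - 1) \<in> ops (n - 2) (n - 1)"
    using face_ops[OF _ b(1)] face_ops[OF _ b(2)] n by (simp_all add: numeral_2_eq_2)
  have c: "s i \<in> cells (Ar D) (n - 1)" "s j \<in> cells (Ar D) (n - 1)" using s ij by (auto simp: compatible_def)
  have "bd (Ar D) (n - 1) i (s j) = bd (Ar D) (n - 1) (j - 1) (s i)"
    using s ij n by (auto simp: compatible_def)
  then show "bd D (n - 1) i (ev a (n - 1) (s j)) = bd D (n - 1) (j - 1) (ev a (n - 1) (s i))"
    using ev_act[OF a c(2) f(1)] ev_act[OF a c(1) f(2)] by simp
qed

text \<open>An inner horn of arrows is filled at its two ends first; \<open>fill_inner\<close> then
  extends over the prism between them.\<close>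

lemma Ar_qcat:
  assumes D: "qcat D" shows "qcat (Ar D)"
  unfolding qcat_def
proof (intro conjI allI impI Ar_is_sset)
  fix n k s assume a: "0 < k \<and> k < n \<and> compatible (Ar D) n ({..n} - {k}) s"
  then have k: "0 < k" "k < n" and s: "compatible (Ar D) n ({..n} - {k}) s" by auto
  have "\<exists>\<sigma>\<in>cells D n. \<forall>i\<in>{..n} - {k}. bd D n i \<sigma> = ev a (n - 1) (s i)" if "a \<le> 1" for a
    using D k ev_compatible[OF that _ s] unfolding qcat_def by blast
  then obtain e where e: "\<And>a. a \<le> 1 \<Longrightarrow> e a \<in> cells D n"
    "\<And>a i. a \<le> 1 \<Longrightarrow> i \<in> {..n} - {k} \<Longrightarrow> bd D n i (e a) = ev a (n - 1) (s i)" by metis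
  have "\<exists>\<tau>\<in>cells (Ar D) n. (\<forall>i\<in>{..n} - {k}. bd (Ar D) n i \<tau> = s i) \<and> (\<forall>a\<in>{0, 1}. ev a n \<tau> = e a)"
    by (rule Ar_fill[OF qcat_sset[OF D] _ _ _ s]) (use k e fill_inner[OF D k] in auto)
  then show "\<exists>\<sigma>\<in>cells (Ar D) n. \<forall>i\<in>{..n} - {k}. bd (Ar D) n i \<sigma> = s i" by blast
qed

section \<open>Degenerate squares are pullbacks\<close>

text \<open>Leg b of the cospan runs from (b, 1 - b) to (1, 1); \<open>lev\<close> below forgets the
  leg and keeps the position on it.\<close>

definition emb :: "nat \<Rightarrow> nat list \<Rightarrow> (nat \<times> nat) list" where
  "emb b \<epsilon> = map (\<lambda>a. if a = 0 then (b, 1 - b) else (1, 1)) \<epsilon>"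

definition lev :: "(nat \<times> nat) list \<Rightarrow> nat list" where
  "lev v = map (\<lambda>p. if p = (1, 1) then 1 else 0) v"

lemma nerve_simps [simp]: "cells (nerve P le) n = {v. length v = Suc n \<and> set v \<subseteq> P \<and> sorted_wrt le v}"
  "act (nerve P le) n \<theta> v = map (nth v) \<theta>"
  by (simp_all add: nerve_def)

lemma nerve_act:
  assumes "v \<in> cells (nerve P le) n" "\<theta> \<in> ops m n" "\<And>p. p \<in> P \<Longrightarrow> le p p"
  shows "map (nth v) \<theta> \<in> cells (nerve P le) m"
proof -
  have l: "length v = Suc n" and s: "set v \<subseteq> P" and so: "sorted_wrt le v" using assms(1) by auto
  have "sorted_wrt le (map (nth v) \<theta>)"
    unfolding sorted_wrt_iff_nth_less
  proof (intro allI impI)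
    fix i j assume ij: "i < j" "j < length (map (nth v) \<theta>)"
    then have jm: "j \<le> m" "i \<le> m" using opsD(1)[OF assms(2)] by auto
    have le: "\<theta> ! i \<le> \<theta> ! j" using sorted_nth_mono[OF opsD(2)[OF assms(2)]] ij by simp
    have b: "\<theta> ! j < length v" using ops_nth[OF assms(2) jm(1)] l by simp
    have "le (v ! (\<theta> ! i)) (v ! (\<theta> ! j))"
    proof (cases "\<theta> ! i = \<theta> ! j")
      case True
      have "v ! (\<theta> ! j) \<in> P" using b s nth_mem by blast
      then show ?thesis using assms(3) True by simp
    next
      case False then show ?thesis using so b le unfolding sorted_wrt_iff_nth_less by simp
    qed
    then show "le (map (nth v) \<theta> ! i) (map (nth v) \<theta> ! j)" using ij by simp
  qed
  moreover have "set (map (nth v) \<theta>) \<subseteq> set v" by (rule set_map_nth[OF assms(2) l])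
  ultimately show ?thesis using s opsD(1)[OF assms(2)] by auto
qed

lemma cospan_emb: "b \<le> 1 \<Longrightarrow> \<epsilon> \<in> ops m 1 \<Longrightarrow> emb b \<epsilon> \<in> cells cospan m"
proof -
  assume b: "b \<le> 1" and e: "\<epsilon> \<in> ops m 1"
  have "sorted_wrt le2 (emb b \<epsilon>)"
    unfolding emb_def sorted_wrt_map
    by (rule sorted_wrt_mono_rel[OF _ opsD(2)[OF e]]) (use b in \<open>auto simp: le2_def\<close>)
  moreover have "b = 0 \<or> b = 1" using b by auto
  ultimately show ?thesis using e by (auto simp: cospan_def opsD emb_def)
qed

text \<open>Since (0, 1) and (1, 0) are incomparable, a chain in the cospan stays on one leg; lists
  constant at (1, 1) lie on both and are attributed to leg 0.\<close>

lemma cospan_cases: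
  assumes v: "v \<in> cells cospan m"
  shows "lev v \<in> ops m 1" "(1, 0) \<in> set v \<Longrightarrow> v = emb 1 (lev v)" "(1, 0) \<notin> set v \<Longrightarrow> v = emb 0 (lev v)"
proof -
  have l: "length v = Suc m" and s: "set v \<subseteq> {(0, 1), (1, 0), (1, 1)}" and so: "sorted_wrt le2 v"
    using v by (auto simp: cospan_def)
  have "sorted (lev v)"
    unfolding lev_def sorted_map
  proof (rule sorted_wrt_mono_rel[OF _ so])
    fix x y assume xy: "x \<in> set v" "y \<in> set v" "le2 x y"
    have "x \<in> {(0, 1), (1, 0), (1, 1)}" "y \<in> {(0, 1), (1, 0), (1, 1)}" using s xy by blast+
    then show "(if x = (1, 1) then 1 else 0) \<le> (if y = (1, 1) then 1 else (0::nat))"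
      using xy(3) by (auto simp: le2_def)
  qed
  moreover have "set (lev v) \<subseteq> {..1}" "length (lev v) = Suc m" using l by (auto simp: lev_def)
  ultimately show "lev v \<in> ops m 1" by (simp add: ops_def)
  show "v = emb 0 (lev v)" if "(1, 0) \<notin> set v"
  proof -
    have "(if (if p = (1, 1) then 1 else 0) = (0::nat) then (0, 1 - 0) else (1, 1)) = p" if "p \<in> set v" for p
      using s that \<open>(1, 0) \<notin> set v\<close> by auto
    then show ?thesis unfolding emb_def lev_def map_map comp_def by (intro map_idI[symmetric])
  qed
  show "v = emb 1 (lev v)" if v10: "(1, 0) \<in> set v"
  proof -
    have n01: "(0, 1) \<notin> set v"
    proof
      assume "(0, 1) \<in> set v"
      then obtain i where i: "i < length v" "v ! i = (0, 1)" by (metis in_set_conv_nth)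
      obtain j where j: "j < length v" "v ! j = (1, 0)" using v10 by (metis in_set_conv_nth)
      have "i \<noteq> j" using i j by auto
      then have "i < j \<or> j < i" by linarith
      then have "le2 (v ! i) (v ! j) \<or> le2 (v ! j) (v ! i)" using so i(1) j(1) unfolding sorted_wrt_iff_nth_less by blast
      then show False unfolding i(2) j(2) by (simp add: le2_def)
    qed
    have "(if (if p = (1, 1) then 1 else 0) = (0::nat) then (1, 1 - 1) else (1, 1)) = p" if "p \<in> set v" for p
      using s that n01 by auto
    then show ?thesis unfolding emb_def lev_def map_map comp_def by (intro map_idI[symmetric])
  qed
qed

lemma cospan_act: "v \<in> cells cospan m \<Longrightarrow> \<theta> \<in> ops k m \<Longrightarrow> map (nth v) \<theta> \<in> cells cospan k"
  unfolding cospan_def by (rule nerve_act) (auto simp: le2_def)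

lemma cospan_simp [simp]: "act cospan m \<theta> v = map (nth v) \<theta>" by (simp add: cospan_def)

lemma emb_act: "\<epsilon> \<in> ops m 1 \<Longrightarrow> \<theta> \<in> ops k m \<Longrightarrow> map (nth (emb b \<epsilon>)) \<theta> = emb b (map (nth \<epsilon>) \<theta>)"
  by (rule nth_equalityI) (auto simp: emb_def opsD less_Suc_eq_le ops_nth)

text \<open>A simplex of the functor category from the cospan consists of two arrows with the same target,
  its restrictions to the two legs.\<close>

definition leg :: "nat \<Rightarrow> (nat list \<times> (nat \<times> nat) list, 'c) smap \<Rightarrow> nat \<Rightarrow> 'c arr" where
  "leg b h n = srestrict (simplex n \<otimes>\<^sub>s simplex 1) (\<lambda>m (\<psi>, \<epsilon>). h m (\<psi>, emb b \<epsilon>))"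

lemma leg_app: "\<psi> \<in> ops m n \<Longrightarrow> \<epsilon> \<in> ops m 1 \<Longrightarrow> leg b h n m (\<psi>, \<epsilon>) = h m (\<psi>, emb b \<epsilon>)"
  by (simp add: leg_def)

lemma leg_in:
  assumes b: "b \<le> 1" and h: "h \<in> cells (fun_sset cospan D) n"
  shows "leg b h n \<in> cells (Ar D) n"
  unfolding Ar_cells leg_def
proof (rule srestrict_smaps)
  have h': "h \<in> smaps (simplex n \<otimes>\<^sub>s cospan) D" using h by (simp add: fun_cells)
  fix m x assume "x \<in> cells (simplex n \<otimes>\<^sub>s simplex 1) m"
  then obtain \<psi> \<epsilon> where x: "x = (\<psi>, \<epsilon>)" "\<psi> \<in> ops m n" "\<epsilon> \<in> ops m 1" by auto
  note e = cospan_emb[OF b x(3)]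
  show "(case x of (\<psi>, \<epsilon>) \<Rightarrow> h m (\<psi>, emb b \<epsilon>)) \<in> cells D m"
    using smaps_in[OF h', of "(\<psi>, emb b \<epsilon>)" m] x e by simp
  fix k \<theta> assume t: "\<theta> \<in> ops k m"
  show "act (simplex n \<otimes>\<^sub>s simplex 1) m \<theta> x \<in> cells (simplex n \<otimes>\<^sub>s simplex 1) k"
    using x t by (simp add: ops_comp)
  show "(case act (simplex n \<otimes>\<^sub>s simplex 1) m \<theta> x of (\<psi>, \<epsilon>) \<Rightarrow> h k (\<psi>, emb b \<epsilon>)) =
       act D m \<theta> (case x of (\<psi>, \<epsilon>) \<Rightarrow> h m (\<psi>, emb b \<epsilon>))"
    using smaps_act[OF h' t, of "(\<psi>, emb b \<epsilon>)"] x e emb_act[OF x(3) t, of b] by simp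
qed

lemma leg_act:
  assumes b: "b \<le> 1" and h: "h \<in> cells (fun_sset cospan D) n" and t: "\<theta> \<in> ops m n"
  shows "leg b (act (fun_sset cospan D) n \<theta> h) m = act (Ar D) n \<theta> (leg b h n)"
proof (rule Ar_ext[OF leg_in[OF b sset_in[OF fun_is_sset t h]] sset_in[OF Ar_is_sset t leg_in[OF b h]]])
  fix k \<psi> \<epsilon> assume pe: "\<psi> \<in> ops k m" "\<epsilon> \<in> ops k 1"
  show "leg b (act (fun_sset cospan D) n \<theta> h) m k (\<psi>, \<epsilon>) = act (Ar D) n \<theta> (leg b h n) k (\<psi>, \<epsilon>)"
    unfolding Ar_act_app[OF t pe] leg_app[OF pe] leg_app[OF ops_comp[OF pe(1) t] pe(2)]
    by (rule fun_act_app[OF t pe(1) cospan_emb[OF b pe(2)]])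
qed

lemma leg_ext:
  assumes h: "h \<in> cells (fun_sset cospan D) n" "h' \<in> cells (fun_sset cospan D) n"
    and e: "leg 0 h n = leg 0 h' n" "leg 1 h n = leg 1 h' n"
  shows "h = h'"
proof (rule smaps_ext[of _ "simplex n \<otimes>\<^sub>s cospan" D])
  show "h \<in> smaps (simplex n \<otimes>\<^sub>s cospan) D" "h' \<in> smaps (simplex n \<otimes>\<^sub>s cospan) D" using h by (simp_all add: fun_cells)
  fix m x assume "x \<in> cells (simplex n \<otimes>\<^sub>s cospan) m"
  then obtain \<psi> v where x: "x = (\<psi>, v)" "\<psi> \<in> ops m n" "v \<in> cells cospan m" by auto
  note c = cospan_cases[OF x(3)]
  obtain b :: nat where "leg b h n = leg b h' n" "v = emb b (lev v)" using c(2,3) e by blast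
  then show "h m x = h' m x" using leg_app[OF x(2) c(1), of b h] leg_app[OF x(2) c(1), of b h'] x(1) by metis
qed

text \<open>The cospan is the union of its two legs along (1, 1), where the hypothesis
  \<open>ev\<close> makes the arrows agree.\<close>

lemma leg_glue:
  assumes \<tau>: "\<tau>0 \<in> cells (Ar D) n" "\<tau>1 \<in> cells (Ar D) n" and ev: "ev 1 n \<tau>0 = ev 1 n \<tau>1"
  shows "\<exists>h\<in>cells (fun_sset cospan D) n. leg 0 h n = \<tau>0 \<and> leg 1 h n = \<tau>1"
proof -
  define h where "h = srestrict (simplex n \<otimes>\<^sub>s cospan) (\<lambda>m (\<psi>, v). (if (1, 0) \<in> set v then \<tau>1 else \<tau>0) m (\<psi>, lev v))"
  have one: "\<tau> m (\<psi>, replicate (Suc m) 1) = act D n \<psi> (ev 1 n \<tau>)"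
    if "\<tau> \<in> cells (Ar D) n" "\<psi> \<in> ops m n" for \<tau> m \<psi>
    unfolding ev_def Ar_nat[OF that(1) ops_id ops_replicate[OF order_refl] that(2)]
      ops_map_nth_id[OF that(2)] map_nth_replicate[OF that(2)] by (rule refl)
  have h: "h \<in> cells (fun_sset cospan D) n"
    unfolding fun_cells h_def
  proof (rule srestrict_smaps)
    fix m x assume "x \<in> cells (simplex n \<otimes>\<^sub>s cospan) m"
    then obtain \<psi> v where x: "x = (\<psi>, v)" "\<psi> \<in> ops m n" "v \<in> cells cospan m" by auto
    note c = cospan_cases[OF x(3)]
    show "(case x of (\<psi>, v) \<Rightarrow> (if (1, 0) \<in> set v then \<tau>1 else \<tau>0) m (\<psi>, lev v)) \<in> cells D m"
      using Ar_in[OF \<tau>(1) x(2) c(1)] Ar_in[OF \<tau>(2) x(2) c(1)] x(1) by simp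
    fix k \<theta> assume t: "\<theta> \<in> ops k m"
    show "act (simplex n \<otimes>\<^sub>s cospan) m \<theta> x \<in> cells (simplex n \<otimes>\<^sub>s cospan) k"
      using x t cospan_act[OF x(3) t] by (simp add: ops_comp)
    have lv: "length v = Suc m" using x(3) by (simp add: cospan_def)
    have le: "lev (map (nth v) \<theta>) = map (nth (lev v)) \<theta>"
      using t lv by (auto simp: lev_def ops_def subset_iff less_Suc_eq_le)
    note t' = ops_comp[OF t x(2)]
    \<comment> \<open>A face of a simplex on leg 1 may be constant at (1, 1) and is then read off
      leg 0; the common target makes this consistent.\<close>
    have A: "\<tau>1 k (map (nth \<psi>) \<theta>, lev (map (nth v) \<theta>)) = \<tau>0 k (map (nth \<psi>) \<theta>, lev (map (nth v) \<theta>))"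
      if v10: "(1, 0) \<in> set v" "(1, 0) \<notin> set (map (nth v) \<theta>)"
    proof -
      have "p = (1, 1)" if p: "p \<in> set (map (nth v) \<theta>)" for p
      proof -
        have "p \<in> set v" using p set_map_nth[OF t lv] by blast
        then have "p \<in> set (emb 1 (lev v))" using c(2)[OF \<open>(1, 0) \<in> set v\<close>] by metis
        then have "p = (1, 0) \<or> p = (1, 1)" by (auto simp: emb_def split: if_splits)
        then show ?thesis using p v10(2) by metis
      qed
      then have "lev (map (nth v) \<theta>) = replicate (Suc k) 1"
        using opsD(1)[OF t] by (intro nth_equalityI) (auto simp: lev_def simp del: replicate_Suc)
      then show ?thesis using one[OF \<tau>(1) t'] one[OF \<tau>(2) t'] ev by simp
    qed
    have sub: "(1, 0) \<in> set (map (nth v) \<theta>) \<Longrightarrow> (1, 0) \<in> set v" using set_map_nth[OF t lv] by blast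
    show "(case act (simplex n \<otimes>\<^sub>s cospan) m \<theta> x of (\<psi>, v) \<Rightarrow> (if (1, 0) \<in> set v then \<tau>1 else \<tau>0) k (\<psi>, lev v)) =
       act D m \<theta> (case x of (\<psi>, v) \<Rightarrow> (if (1, 0) \<in> set v then \<tau>1 else \<tau>0) m (\<psi>, lev v))"
    proof (cases "(1, 0) \<in> set v")
      case True
      have "act D m \<theta> (\<tau>1 m (\<psi>, lev v)) = \<tau>1 k (map (nth \<psi>) \<theta>, lev (map (nth v) \<theta>))"
        unfolding le by (rule Ar_nat[OF \<tau>(2) x(2) c(1) t])
      then show ?thesis using True A x(1) by (cases "(1, 0) \<in> set (map (nth v) \<theta>)") (simp_all del: set_map)
    next
      case False
      have "act D m \<theta> (\<tau>0 m (\<psi>, lev v)) = \<tau>0 k (map (nth \<psi>) \<theta>, lev (map (nth v) \<theta>))"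
        unfolding le by (rule Ar_nat[OF \<tau>(1) x(2) c(1) t])
      then show ?thesis using False sub x(1) by (auto simp del: set_map)
    qed
  qed
  have lev_emb: "lev (emb b \<epsilon>) = \<epsilon>" if "b \<le> 1" "\<epsilon> \<in> ops m 1" for b \<epsilon> m
  proof -
    have "(if (if a = 0 then (b, 1 - b) else (1, 1)) = (1, 1) then 1 else 0) = a" if "a \<in> set \<epsilon>" for a
      using opsD(3)[OF \<open>\<epsilon> \<in> ops m 1\<close>] that by (auto simp: subset_iff)
    then show ?thesis unfolding emb_def lev_def map_map comp_def by (intro map_idI) simp
  qed
  have l0: "leg 0 h n = \<tau>0"
  proof (rule Ar_ext[OF leg_in[OF _ h] \<tau>(1)])
    fix m \<psi> \<epsilon> assume pe: "\<psi> \<in> ops m n" "\<epsilon> \<in> ops m 1"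
    have "(1, 0) \<notin> set (emb 0 \<epsilon>)" by (auto simp: emb_def)
    then show "leg 0 h n m (\<psi>, \<epsilon>) = \<tau>0 m (\<psi>, \<epsilon>)"
      using lev_emb[of 0, OF _ pe(2)] pe cospan_emb[of 0, OF _ pe(2)] by (simp add: leg_app h_def)
  qed simp
  have l1: "leg 1 h n = \<tau>1"
  proof (rule Ar_ext[OF leg_in[OF _ h] \<tau>(2)])
    fix m \<psi> \<epsilon> assume pe: "\<psi> \<in> ops m n" "\<epsilon> \<in> ops m 1"
    have "leg 1 h n m (\<psi>, \<epsilon>) = (if (1, 0) \<in> set (emb 1 \<epsilon>) then \<tau>1 else \<tau>0) m (\<psi>, \<epsilon>)"
      unfolding leg_app[OF pe] using lev_emb[of 1, OF _ pe(2)] pe cospan_emb[of 1, OF _ pe(2)] by (simp add: h_def)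
    moreover have "\<tau>0 m (\<psi>, \<epsilon>) = \<tau>1 m (\<psi>, \<epsilon>)" if "(1, 0) \<notin> set (emb 1 \<epsilon>)"
    proof -
      have "a = 1" if "a \<in> set \<epsilon>" for a
        using opsD(3)[OF pe(2)] that \<open>(1, 0) \<notin> set (emb 1 \<epsilon>)\<close> by (cases "a = 0") (force simp: emb_def)+
      then have "\<epsilon> = replicate (Suc m) 1"
        using opsD(1)[OF pe(2)] by (intro nth_equalityI) (auto simp del: replicate_Suc)
      then show ?thesis using one[OF \<tau>(1) pe(1)] one[OF \<tau>(2) pe(1)] ev by simp
    qed
    ultimately show "leg 1 h n m (\<psi>, \<epsilon>) = \<tau>1 m (\<psi>, \<epsilon>)" by (simp split: if_splits)
  qed simp
  show ?thesis using h l0 l1 by blast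
qed

definition cst_arr :: "'c sset \<Rightarrow> nat \<Rightarrow> 'c \<Rightarrow> 'c arr" where
  "cst_arr D n x = srestrict (simplex n \<otimes>\<^sub>s simplex 1) (\<lambda>m (\<psi>, \<epsilon>). act D n \<psi> x)"

lemma cst_arr_app: "\<psi> \<in> ops m n \<Longrightarrow> \<epsilon> \<in> ops m 1 \<Longrightarrow> cst_arr D n x m (\<psi>, \<epsilon>) = act D n \<psi> x"
  by (simp add: cst_arr_def)

lemma cst_arr_in:
  assumes D: "is_sset D" and x: "x \<in> cells D n" shows "cst_arr D n x \<in> cells (Ar D) n"
  unfolding Ar_cells cst_arr_def
  by (rule srestrict_smaps) (use sset_in[OF D _ x] sset_comp[OF D _ _ x] in \<open>auto simp: ops_comp\<close>)

lemma cst_arr_act: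
  assumes D: "is_sset D" and x: "x \<in> cells D n" and t: "\<theta> \<in> ops m n"
  shows "act (Ar D) n \<theta> (cst_arr D n x) = cst_arr D m (act D n \<theta> x)"
proof (rule Ar_ext[OF sset_in[OF Ar_is_sset t cst_arr_in[OF D x]] cst_arr_in[OF D sset_in[OF D t x]]])
  fix k \<psi> \<epsilon> assume pe: "\<psi> \<in> ops k m" "\<epsilon> \<in> ops k 1"
  show "act (Ar D) n \<theta> (cst_arr D n x) k (\<psi>, \<epsilon>) = cst_arr D m (act D n \<theta> x) k (\<psi>, \<epsilon>)"
    unfolding Ar_act_app[OF t pe] cst_arr_app[OF pe] cst_arr_app[OF ops_comp[OF pe(1) t] pe(2)]
    using sset_comp[OF D pe(1) t x] by simp
qed

lemma cst_arr_ev: "is_sset D \<Longrightarrow> x \<in> cells D n \<Longrightarrow> a \<le> 1 \<Longrightarrow> ev a n (cst_arr D n x) = x"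
  unfolding ev_def cst_arr_app[OF ops_id ops_replicate] by (rule sset_id)

lemma leg_const_cell:
  assumes b: "b \<le> 1" shows "leg b (const_cell cospan D n x) n = cst_arr D n x"
  unfolding leg_def cst_arr_def srestrict_def const_cell_def
  using cospan_emb[OF b] by (intro ext) auto

lemma const_cell_in:
  assumes D: "is_sset D" and x: "x \<in> cells D n"
  shows "const_cell cospan D n x \<in> cells (fun_sset cospan D) n"
  unfolding fun_cells const_cell_def
proof (rule srestrict_smaps)
  fix m y assume y: "y \<in> cells (simplex n \<otimes>\<^sub>s cospan) m"
  then show "(case y of (\<psi>, k) \<Rightarrow> act D n \<psi> x) \<in> cells D m" using sset_in[OF D _ x] by auto
  fix k \<theta> assume t: "\<theta> \<in> ops k m"
  show "act (simplex n \<otimes>\<^sub>s cospan) m \<theta> y \<in> cells (simplex n \<otimes>\<^sub>s cospan) k"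
    using y t cospan_act[OF _ t] by (cases y) (simp add: ops_comp)
  show "(case act (simplex n \<otimes>\<^sub>s cospan) m \<theta> y of (\<psi>, k) \<Rightarrow> act D n \<psi> x) = act D m \<theta> (case y of (\<psi>, k) \<Rightarrow> act D n \<psi> x)"
    using y sset_comp[OF D t _ x] by (cases y) simp
qed

lemma face_snoc: "i \<le> n \<Longrightarrow> face n i @ [Suc n] = face (Suc n) i"
  by (rule nth_equalityI) (auto simp: face_nth nth_append less_Suc_eq)

lemma face_last: "face (Suc n) (Suc n) = [0..<Suc n]"
  by (rule nth_equalityI) (auto simp: face_nth nth_append less_Suc_eq)

lemma square_cells_ops:
  assumes "v \<in> cells square m"
  shows "map fst v \<in> ops m 1" "map snd v \<in> ops m 1"
  using assms by (auto simp: square_def ops_def le2_def sorted_wrt_map elim: sorted_wrt_mono_rel[rotated])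

lemma square_act: "v \<in> cells square m \<Longrightarrow> \<theta> \<in> ops k m \<Longrightarrow> map (nth v) \<theta> \<in> cells square k"
  unfolding square_def by (rule nerve_act) (auto simp: le2_def)

lemma square_simp [simp]: "act square m \<theta> v = map (nth v) \<theta>" by (simp add: square_def)

lemma slice_simps [simp]:
  "cells (slice C x) n = {\<sigma> \<in> cells C (Suc n). act C (Suc n) [Suc n] \<sigma> = x}"
  "act (slice C x) n \<theta> = act C (Suc n) (\<theta> @ [Suc n])"
  by (simp_all add: slice_def)

text \<open>The edge e pulled back along the second projection of the square; the two sides in the
  first direction are degenerate.\<close>

definition snd_square :: "'c sset \<Rightarrow> 'c \<Rightarrow> ((nat \<times> nat) list, 'c) smap" where
  "snd_square D e = srestrict square (\<lambda>m v. act D 1 (map snd v) e)"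

lemma snd_square_smaps:
  assumes D: "is_sset D" and e: "e \<in> cells D 1"
  shows "snd_square D e \<in> smaps square D"
  unfolding snd_square_def
proof (rule srestrict_smaps)
  fix m v assume v: "v \<in> cells square m"
  note s = square_cells_ops(2)[OF v]
  show "act D 1 (map snd v) e \<in> cells D m" by (rule sset_in[OF D s e])
  fix k \<theta> assume t: "\<theta> \<in> ops k m"
  show "act square m \<theta> v \<in> cells square k" using square_act[OF v t] by simp
  have "length v = Suc m" using v by (simp add: square_def)
  then have "map snd (map (nth v) \<theta>) = map (nth (map snd v)) \<theta>"
    using t by (auto simp: ops_def subset_iff less_Suc_eq_le)
  then show "act D 1 (map snd (act square m \<theta> v)) e = act D m \<theta> (act D 1 (map snd v) e)"
    using sset_comp[OF D t s e] unfolding square_simp by metis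
qed

text \<open>
  The tip and the leg to (1, 0) of a cone are filled first; the arrow from (1, 0) to (1, 1) and then
  the arrow from (0, 1) to (1, 1) are filled starting from their known ends.
\<close>

lemma snd_square_pullback:
  assumes D: "qcat D" and e: "e \<in> cells D 1"
  shows "is_pullback D (snd_square D e)"
proof -
  note ss = qcat_sset[OF D]
  let ?q = "snd_square D e"
  let ?u = "act D 1 [0] e"
  let ?F = "fun_sset cospan D"
  have u: "?u \<in> cells D 0" by (rule sset_in[OF ss _ e]) (auto simp: ops_def)
  have v: "act D 1 [1] e \<in> cells D 0" by (rule sset_in[OF ss _ e]) (auto simp: ops_def)
  have q00: "?q 0 [(0, 0)] = ?u" by (simp add: snd_square_def srestrict_def square_def)
  \<comment> \<open>The cone over the cospan that \<open>is_pullback\<close> extracts from the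
    square.\<close>
  define H where "H = srestrict (simplex 1 \<otimes>\<^sub>s cospan) (\<lambda>m (\<psi>, v). ?q m (map2 (\<lambda>i p. if i = 0 then (0, 0) else p) \<psi> v))"
  have Hcone: "map2 (\<lambda>i p. if i = 0 then (0, 0) else p) \<psi> v \<in> cells square m"
    if "\<psi> \<in> ops m 1" "v \<in> cells cospan m" for m \<psi> v
  proof -
    let ?w = "map2 (\<lambda>i p. if i = 0 then (0, 0) else p) \<psi> v"
    have v: "length v = Suc m" "set v \<subseteq> {(0, 1), (1, 0), (1, 1)}" "sorted_wrt le2 v" using that(2) by (auto simp: cospan_def)
    have w: "?w ! i = (if \<psi> ! i = 0 then (0, 0) else v ! i)" if "i \<le> m" for i
      using that \<open>\<psi> \<in> ops m 1\<close> v by (simp add: opsD)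
    have "sorted_wrt le2 ?w"
      unfolding sorted_wrt_iff_nth_less
    proof (intro allI impI)
      fix i j assume "i < j" "j < length ?w"
      then have ij: "i < j" "j \<le> m" "i \<le> m" using v that by (auto simp: opsD)
      have "\<psi> ! i \<le> \<psi> ! j" using sorted_nth_mono[OF opsD(2)[OF that(1)]] ij opsD(1)[OF that(1)] by simp
      moreover have "le2 (v ! i) (v ! j)" using v(3) ij v(1) unfolding sorted_wrt_iff_nth_less by simp
      ultimately show "le2 (?w ! i) (?w ! j)" unfolding w[OF ij(2)] w[OF ij(3)] by (auto simp: le2_def)
    qed
    moreover have "set ?w \<subseteq> {0, 1} \<times> {0, 1}"
    proof
      fix p assume "p \<in> set ?w"
      then obtain i where "i < length ?w" "p = ?w ! i" by (metis in_set_conv_nth)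
      then have "i \<le> m" "p = (if \<psi> ! i = 0 then (0, 0) else v ! i)" using w v that(1) by (auto simp: opsD)
      moreover have "v ! i \<in> set v" using v(1) \<open>i \<le> m\<close> by simp
      then have "v ! i \<in> {(0, 1), (1, 0), (1, 1)}" using v(2) by blast
      ultimately show "p \<in> {0, 1} \<times> {0, 1}" by (auto split: if_splits)
    qed
    moreover have "length ?w = Suc m" using v that by (simp add: opsD)
    ultimately show ?thesis by (simp add: square_def)
  qed
  have H: "H \<in> cells ?F 1"
    unfolding fun_cells H_def
  proof (rule srestrict_smaps)
    fix m x assume "x \<in> cells (simplex 1 \<otimes>\<^sub>s cospan) m"
    then obtain \<psi> v where x: "x = (\<psi>, v)" "\<psi> \<in> ops m 1" "v \<in> cells cospan m" by auto
    let ?w = "map2 (\<lambda>i p. if i = 0 then (0, 0) else p) \<psi> v"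
    note w = Hcone[OF x(2,3)]
    show "(case x of (\<psi>, v) \<Rightarrow> ?q m (map2 (\<lambda>i p. if i = 0 then (0, 0) else p) \<psi> v)) \<in> cells D m"
      using smaps_in[OF snd_square_smaps[OF ss e] w] x by simp
    fix k \<theta> assume t: "\<theta> \<in> ops k m"
    show "act (simplex 1 \<otimes>\<^sub>s cospan) m \<theta> x \<in> cells (simplex 1 \<otimes>\<^sub>s cospan) k"
      using x t cospan_act[OF x(3) t] by (simp add: ops_comp)
    have "length v = Suc m" using x(3) by (simp add: cospan_def)
    then have "map2 (\<lambda>i p. if i = 0 then (0, 0) else p) (map (nth \<psi>) \<theta>) (map (nth v) \<theta>) = map (nth ?w) \<theta>"
      using x(2) t ops_nth[OF t] by (intro nth_equalityI) (auto simp: opsD less_Suc_eq_le)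
    then show "(case act (simplex 1 \<otimes>\<^sub>s cospan) m \<theta> x of (\<psi>, v) \<Rightarrow> ?q k (map2 (\<lambda>i p. if i = 0 then (0, 0) else p) \<psi> v)) =
       act D m \<theta> (case x of (\<psi>, v) \<Rightarrow> ?q m (map2 (\<lambda>i p. if i = 0 then (0, 0) else p) \<psi> v))"
      using smaps_act[OF snd_square_smaps[OF ss e] t w] x(1) by simp
  qed
  have legH: "leg b H 1 m (\<psi>, \<epsilon>) = act D 1 (map2 (\<lambda>i a. if i = 0 then 0 else if a = 0 then 1 - b else 1) \<psi> \<epsilon>) e"
    if "b \<le> 1" "\<psi> \<in> ops m 1" "\<epsilon> \<in> ops m 1" for b m \<psi> \<epsilon>
  proof -
    note c = cospan_emb[OF that(1,3)]
    let ?w = "map2 (\<lambda>i p. if i = 0 then (0, 0) else p) \<psi> (emb b \<epsilon>)"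
    have "map snd ?w = map2 (\<lambda>i a. if i = 0 then 0 else if a = 0 then 1 - b else 1) \<psi> \<epsilon>"
      using that by (intro nth_equalityI) (auto simp: emb_def opsD)
    then show ?thesis using leg_app[OF that(2,3), of b H] c that(2) Hcone[OF that(2) c]
      by (simp add: H_def snd_square_def)
  qed
  let ?p = "tgt ?F H"
  have p: "?p \<in> cells ?F 0" unfolding tgt_def by (rule sset_in[OF fun_is_sset _ H]) (auto simp: ops_def)
  have cone_cell: "(x, h) \<in> cells (cones cospan D ?p) n \<longleftrightarrow> x \<in> cells D n \<and> h \<in> cells ?F (Suc n) \<and>
     act ?F (Suc n) [Suc n] h = ?p \<and> act ?F (Suc n) [0..<Suc n] h = const_cell cospan D n x" for x h n
    by (simp add: cones_def sub_sset_def forget_def del: upt_Suc)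
  have cone_act: "act (cones cospan D ?p) n \<theta> (x, h) = (act D n \<theta> x, act ?F (Suc n) (\<theta> @ [Suc n]) h)" for n \<theta> x h
    by (simp add: cones_def sub_sset_def)
  have "terminal (cones cospan D ?p) (?u, H)"
    unfolding terminal_def
  proof (intro conjI allI impI)
    have o0: "[0] \<in> ops 0 1" by (auto simp: ops_def)
    have "act ?F 1 [0] H = const_cell cospan D 0 ?u"
    proof (rule leg_ext[OF sset_in[OF fun_is_sset o0 H] const_cell_in[OF ss u]])
      have "leg b (act ?F 1 [0] H) 0 = leg b (const_cell cospan D 0 ?u) 0" if b: "b \<le> 1" for b
        unfolding leg_act[OF b H o0] leg_const_cell[OF b]
      proof (rule Ar_ext[OF sset_in[OF Ar_is_sset o0 leg_in[OF b H]] cst_arr_in[OF ss u]])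
        fix m \<psi> \<epsilon> assume pe: "\<psi> \<in> ops m 0" "\<epsilon> \<in> ops m 1"
        have z: "\<psi> = replicate (Suc m) 0" using ops_nth[OF pe(1)] opsD(1)[OF pe(1)]
          by (intro nth_equalityI) (auto simp: less_Suc_eq_le simp del: replicate_Suc)
        have m: "map (nth [0]) \<psi> = replicate (Suc m) 0" unfolding z by simp
        have l: "map2 (\<lambda>i a. if i = 0 then 0 else if a = 0 then 1 - b else 1) (replicate (Suc m) 0) \<epsilon> = replicate (Suc m) 0"
          using opsD(1)[OF pe(2)] by (intro nth_equalityI) (auto simp del: replicate_Suc)
        have "act D 0 \<psi> (act D 1 [0] e) = act D 1 (map (nth [0]) \<psi>) e" by (rule sset_comp[OF ss pe(1) o0 e])
        then show "act (Ar D) 1 [0] (leg b H 1) m (\<psi>, \<epsilon>) = cst_arr D 0 ?u m (\<psi>, \<epsilon>)"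
          unfolding Ar_act_app[OF o0 pe] cst_arr_app[OF pe] m legH[OF b ops_replicate[OF le0] pe(2)] l by simp
      qed
      then show "leg 0 (act ?F 1 [0] H) 0 = leg 0 (const_cell cospan D 0 ?u) 0"
        "leg 1 (act ?F 1 [0] H) 0 = leg 1 (const_cell cospan D 0 ?u) 0" by simp_all
    qed
    then show "(?u, H) \<in> cells (cones cospan D ?p) 0" unfolding cone_cell using u H by (simp add: tgt_def)
  next
    fix n s assume n: "1 \<le> n" and "compatible (cones cospan D ?p) n {..n} s \<and> act (cones cospan D ?p) (n - 1) [n - 1] (s 0) = (?u, H)"
    then have s: "compatible (cones cospan D ?p) n {..n} s" and sl: "act (cones cospan D ?p) (n - 1) [n - 1] (s 0) = (?u, H)" by auto
    define w h where "w j = fst (s j)" and "h j = snd (s j)" for j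
    have swh: "s j = (w j, h j)" for j by (simp add: w_def h_def)
    have Sn: "Suc (n - 1) = n" using n by simp
    have cell: "w j \<in> cells D (n - 1)" "h j \<in> cells ?F n" "act ?F n [n] (h j) = ?p"
      "act ?F n [0..<n] (h j) = const_cell cospan D (n - 1) (w j)" if "j \<le> n" for j
    proof -
      have "s j \<in> cells (cones cospan D ?p) (n - 1)" using s that by (auto simp: compatible_def)
      then show "w j \<in> cells D (n - 1)" "h j \<in> cells ?F n" "act ?F n [n] (h j) = ?p"
        "act ?F n [0..<n] (h j) = const_cell cospan D (n - 1) (w j)" unfolding swh cone_cell Sn by auto
    qed
    let ?L = "\<lambda>b j. leg b (h j) n"
    have hc: "bd ?F n i (h j) = bd ?F n (j - 1) (h i)" if ij: "i < j" "j \<le> n" for i j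
    proof (cases "n = 1")
      case True
      then have "i = 0" "j = 1" using ij by auto
      then show ?thesis using cell(3)[of 0] cell(3)[of 1] True by (simp add: face_def)
    next
      case False
      then have "2 \<le> n" using n by simp
      then have "bd (cones cospan D ?p) (n - 1) i (s j) = bd (cones cospan D ?p) (n - 1) (j - 1) (s i)"
        using s ij unfolding compatible_def by auto
      then have "act ?F n (face (n - 1) i @ [n]) (h j) = act ?F n (face (n - 1) (j - 1) @ [n]) (h i)"
        unfolding swh cone_act Sn by simp
      then show ?thesis using face_snoc[of i "n - 1"] face_snoc[of "j - 1" "n - 1"] ij Sn by simp
    qed
    have lin: "?L b j \<in> cells (Ar D) n" if "b \<le> 1" "j \<le> n" for b j by (rule leg_in[OF that(1) cell(2)[OF that(2)]])
    have lc: "bd (Ar D) n i (?L b j) = bd (Ar D) n (j - 1) (?L b i)" if "b \<le> 1" "i < j" "j \<le> n" for b i j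
      using leg_act[OF that(1) cell(2)[OF that(3)] face_ops[OF n, of i]] leg_act[OF that(1) cell(2)[of i] face_ops[OF n, of "j - 1"]]
        hc[OF that(2,3)] that by simp
    have ll: "bd (Ar D) n n (?L b j) = cst_arr D (n - 1) (w j)" if "b \<le> 1" "j \<le> n" for b j
      using leg_act[OF that(1) cell(2)[OF that(2)] face_ops[OF n, of n]] cell(4)[OF that(2)] leg_const_cell[OF that(1), of D "n - 1"]
        face_last[of "n - 1"] Sn by simp
    have lastH: "act ?F n [n - 1, n] (h 0) = H" using sl unfolding swh cone_act Sn by simp
    have o: "[n - 1, n] \<in> ops 1 n" by (auto simp: ops_def)
    have L0H: "act (Ar D) n [n - 1, n] (?L b 0) = leg b H 1" if "b \<le> 1" for b
      using leg_act[OF that cell(2)[OF le0] o] lastH by simp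
    have cI: "compatible (Ar D) (Suc n) {..n} (?L b)" if "b \<le> 1" for b
      unfolding compatible_def using lin[OF that] lc[OF that] by auto
    \<comment> \<open>At (1, 0) the given cones form a horn opposite to the last vertex; its last
      edge is a side of the square in the first direction, hence an identity. The last face W of the
      filler is the new tip.\<close>
    define bb where "bb j = ev 0 n (?L 1 j)" for j
    have bbc: "compatible D (Suc n) {..n} bb"
      using ev_compatible[OF _ _ cI[of 1], of 0] unfolding bb_def by simp
    have "act D n [n - 1, n] (bb 0) = ev 0 1 (leg 1 H 1)"
      unfolding bb_def using ev_act[OF _ lin[of 1 0] o, of 0] L0H[of 1] by simp
    also have "\<dots> = act D 1 [0, 0] e"
      unfolding ev_def using legH[of 1 "[0, 1]" 1 "[0, 0]"] by (simp add: ops_def upt_rec)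
    also have "\<dots> = idn D ?u"
    proof -
      have "act D 0 [0, 0] (act D 1 [0] e) = act D 1 (map (nth [0]) [0, 0]) e"
        by (rule sset_comp[OF ss _ _ e]) (auto simp: ops_def)
      then show ?thesis by (simp add: idn_def)
    qed
    finally obtain \<beta> where \<beta>: "\<beta> \<in> cells D (Suc n)" "\<And>i. i \<le> n \<Longrightarrow> bd D (Suc n) i \<beta> = bb i"
      using special_outer_horn_Suc[OF D n bbc u] by blast
    define W where "W = bd D (Suc n) (Suc n) \<beta>"
    have fo: "face (Suc n) i \<in> ops n (Suc n)" if "i \<le> Suc n" for i using face_ops[of "Suc n" i] that by simp
    have W: "W \<in> cells D n" unfolding W_def by (rule sset_in[OF ss fo \<beta>(1)]) simp
    have fW: "bd D n i W = w i" if "i \<le> n" for i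
    proof -
      have "bd D n i W = act D (Suc n) (map (nth (face (Suc n) (Suc n))) (face n i)) \<beta>"
        unfolding W_def by (rule sset_comp[OF ss face_ops[OF n that] fo \<beta>(1)]) simp
      also have "map (nth (face (Suc n) (Suc n))) (face n i) = map (nth (face (Suc n) i)) (face n n)"
        using face_face[of i "Suc n" "Suc n"] that n by simp
      also have "act D (Suc n) \<dots> \<beta> = bd D n n (bb i)"
        using sset_comp[OF ss face_ops[OF n order_refl] fo \<beta>(1), of i] \<beta>(2)[OF that] that by simp
      also have "\<dots> = ev 0 (n - 1) (bd (Ar D) n n (?L 1 i))"
        unfolding bb_def using ev_act[OF _ lin[of 1 i] face_ops[OF n order_refl], of 0] that by simp
      also have "\<dots> = w i" unfolding ll[OF order_refl that] using cst_arr_ev[OF ss cell(1)[OF that]] by simp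
      finally show ?thesis .
    qed
    \<comment> \<open>The missing last face of either leg is constant on the tip W, as the
      definition of a cone requires.\<close>
    define t where "t b j = (if j \<le> n then ?L b j else cst_arr D n W)" for b j
    have tin: "t b j \<in> cells (Ar D) n" if "b \<le> 1" for b j unfolding t_def using lin[OF that] cst_arr_in[OF ss W] by simp
    have tc: "compatible (Ar D) (Suc n) {..Suc n} (t b)" if b: "b \<le> 1" for b
      unfolding compatible_def
    proof (intro conjI ballI impI)
      fix i assume "i \<in> {..Suc n}" then show "t b i \<in> cells (Ar D) (Suc n - 1)" using tin[OF b] by simp
    next
      fix i j assume ij: "i \<in> {..Suc n}" "j \<in> {..Suc n}" "i < j"
      show "bd (Ar D) (Suc n - 1) i (t b j) = bd (Ar D) (Suc n - 1) (j - 1) (t b i)"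
      proof (cases "j = Suc n")
        case True
        then have "bd (Ar D) n i (t b j) = cst_arr D (n - 1) (w i)"
          using cst_arr_act[OF ss W face_ops[OF n, of i]] fW[of i] ij by (simp add: t_def)
        then show ?thesis using ll[OF b, of i] ij True by (simp add: t_def)
      next
        case False
        then show ?thesis using lc[OF b, of i j] ij by (simp add: t_def)
      qed
    qed
    have "ev 0 n (t 1 i) = bd D (Suc n) i \<beta>" if "i \<le> Suc n" for i
      using \<beta>(2)[of i] that cst_arr_ev[OF ss W, of 0] W_def by (cases "i = Suc n") (auto simp: t_def bb_def)
    \<comment> \<open>At the first vertex the cone is constant, which gives the identity that
      \<open>Ar_fill_first\<close> asks for.\<close>
    moreover have "t 1 (Suc n) 1 ([0, 0], [0, 1]) = idn D (act D n [0] W)"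
    proof -
      have "act D 0 [0, 0] (act D n [0] W) = act D n (map (nth [0]) [0, 0]) W"
        by (rule sset_comp[OF ss _ _ W]) (auto simp: ops_def)
      then show ?thesis using cst_arr_app[of "[0, 0]" 1 n "[0, 1]" D W] by (simp add: t_def idn_def ops_def)
    qed
    moreover have "act D n [0] W \<in> cells D 0" by (rule sset_in[OF ss _ W]) (auto simp: ops_def)
    ultimately obtain \<tau>1 where \<tau>1: "\<tau>1 \<in> cells (Ar D) (Suc n)" "\<And>i. i \<le> Suc n \<Longrightarrow> bd (Ar D) (Suc n) i \<tau>1 = t 1 i"
      using Ar_fill_first[OF D _ tc[of 1] \<beta>(1), of "act D n [0] W"] by auto
    \<comment> \<open>The simplex at (1, 1), determined by leg 1 and then prescribed as the target
      of leg 0.\<close>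
    define \<gamma> where "\<gamma> = ev 1 (Suc n) \<tau>1"
    have \<gamma>: "\<gamma> \<in> cells D (Suc n)" unfolding \<gamma>_def by (rule ev_in[OF _ \<tau>1(1)]) simp
    have "ev 1 n (t 0 i) = bd D (Suc n) i \<gamma>" if i: "i \<le> Suc n" for i
    proof -
      have "emb 0 (replicate (Suc n) 1) = emb 1 (replicate (Suc n) 1)" by (simp add: emb_def)
      then have "ev 1 n (t 0 i) = ev 1 n (t 1 i)"
        unfolding t_def ev_def using leg_app[OF ops_id ops_replicate[of 1 1 n], of 0 "h i"] leg_app[OF ops_id ops_replicate[of 1 1 n], of 1 "h i"]
        by (simp del: upt_Suc replicate_Suc)
      then show ?thesis unfolding \<gamma>_def using ev_act[OF _ \<tau>1(1) fo[OF i], of 1] \<tau>1(2)[OF i] by simp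
    qed
    \<comment> \<open>At the last vertex, which is the diagram itself, leg 0 is the other identity
      side of the square; this is what \<open>Ar_fill_last\<close> asks for.\<close>
    moreover have "t 0 0 1 ([n, n], [0, 1]) = idn D (act D 1 [1] e)"
    proof -
      have "t 0 0 1 ([n, n], [0, 1]) = act (Ar D) n [n - 1, n] (?L 0 0) 1 ([1, 1], [0, 1])"
        using Ar_act_app[OF o, of "[1, 1]" 1 "[0, 1]" D "?L 0 0"] by (simp add: t_def ops_def)
      also have "\<dots> = act D 1 [1, 1] e"
        unfolding L0H[OF le0] using legH[of 0 "[1, 1]" 1 "[0, 1]"] by (simp add: ops_def)
      also have "\<dots> = idn D (act D 1 [1] e)"
      proof -
        have "act D 0 [0, 0] (act D 1 [1] e) = act D 1 (map (nth [1]) [0, 0]) e"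
          by (rule sset_comp[OF ss _ _ e]) (auto simp: ops_def)
        then show ?thesis by (simp add: idn_def)
      qed
      finally show ?thesis .
    qed
    ultimately obtain \<tau>0 where \<tau>0: "\<tau>0 \<in> cells (Ar D) (Suc n)" "\<And>i. i \<le> Suc n \<Longrightarrow> bd (Ar D) (Suc n) i \<tau>0 = t 0 i"
      "ev 1 (Suc n) \<tau>0 = \<gamma>"
      using Ar_fill_last[OF D _ tc[of 0] \<gamma>, of "act D 1 [1] e"] v by auto
    obtain g where g: "g \<in> cells ?F (Suc n)" "leg 0 g (Suc n) = \<tau>0" "leg 1 g (Suc n) = \<tau>1"
      using leg_glue[OF \<tau>0(1) \<tau>1(1)] \<tau>0(3) \<gamma>_def by auto
    have lg: "bd (Ar D) (Suc n) i (leg b g (Suc n)) = t b i" if "b \<le> 1" "i \<le> Suc n" for b i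
    proof -
      have "b = 0 \<or> b = 1" using that by auto
      then show ?thesis using \<tau>0(2)[OF that(2)] \<tau>1(2)[OF that(2)] g by auto
    qed
    have gf: "bd ?F (Suc n) i g = h i" if i: "i \<le> n" for i
    proof (rule leg_ext[OF sset_in[OF fun_is_sset fo g(1)] cell(2)[OF i]])
      show "i \<le> Suc n" using i by simp
      have "leg b (bd ?F (Suc n) i g) n = leg b (h i) n" if "b \<le> 1" for b
        using leg_act[OF that g(1) fo, of i] lg[OF that, of i] i by (simp add: t_def)
      then show "leg 0 (bd ?F (Suc n) i g) n = leg 0 (h i) n"
        "leg 1 (bd ?F (Suc n) i g) n = leg 1 (h i) n" by simp_all
    qed
    have gW: "act ?F (Suc n) [0..<Suc n] g = const_cell cospan D n W"
      unfolding face_last[symmetric]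
    proof (rule leg_ext[OF sset_in[OF fun_is_sset fo g(1)] const_cell_in[OF ss W]])
      have "leg b (bd ?F (Suc n) (Suc n) g) n = leg b (const_cell cospan D n W) n" if "b \<le> 1" for b
        using leg_act[OF that g(1) fo, of "Suc n"] lg[OF that, of "Suc n"] leg_const_cell[OF that, of D n W] by (simp add: t_def)
      then show "leg 0 (bd ?F (Suc n) (Suc n) g) n = leg 0 (const_cell cospan D n W) n"
        "leg 1 (bd ?F (Suc n) (Suc n) g) n = leg 1 (const_cell cospan D n W) n" by simp_all
    qed simp
    have gp: "act ?F (Suc n) [Suc n] g = ?p"
    proof -
      have "act ?F n [n] (bd ?F (Suc n) 0 g) = act ?F (Suc n) (map (nth (face (Suc n) 0)) [n]) g"
        by (rule sset_comp[OF fun_is_sset _ fo g(1)]) (auto simp: ops_def)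
      then show ?thesis using gf[of 0] cell(3)[of 0] by (simp add: face_nth)
    qed
    have "(W, g) \<in> cells (cones cospan D ?p) n" unfolding cone_cell using W g(1) gp gW by simp
    moreover have "bd (cones cospan D ?p) n i (W, g) = s i" if "i \<le> n" for i
      unfolding cone_act face_snoc[OF that] swh using fW[OF that] gf[OF that] by simp
    ultimately show "\<exists>\<sigma>\<in>cells (cones cospan D ?p) n. \<forall>i\<le>n. bd (cones cospan D ?p) n i \<sigma> = s i" by blast
  qed
  then show ?thesis
    unfolding is_pullback_def is_limit_def q00 H_def[symmetric] using snd_square_smaps[OF ss e] by simp
qed

lemma initial_fill: "initial X t \<Longrightarrow> 1 \<le> n \<Longrightarrow> compatible X n {..n} s \<Longrightarrow> act X (n - 1) [0] (s n) = t \<Longrightarrow>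
   \<exists>\<sigma>\<in>cells X n. \<forall>i\<le>n. bd X n i \<sigma> = s i"
  unfolding initial_def by blast

text \<open>Spheres are moved along \<psi> and their fillers back along \<phi>. The hypothesis
  \<open>nat\<close> includes closure of X under the action, because cocones are not known
  beforehand to form a simplicial set.\<close>

lemma initial_transfer:
  assumes \<phi>: "\<And>n x. x \<in> cells X n \<Longrightarrow> \<phi> n x \<in> cells Y n" and \<psi>: "\<And>n y. y \<in> cells Y n \<Longrightarrow> \<psi> n y \<in> cells X n"
    and inv: "\<And>n x. x \<in> cells X n \<Longrightarrow> \<psi> n (\<phi> n x) = x" "\<And>n y. y \<in> cells Y n \<Longrightarrow> \<phi> n (\<psi> n y) = y"
    and nat: "\<And>m n \<theta> x. \<theta> \<in> ops m n \<Longrightarrow> x \<in> cells X n \<Longrightarrow> act X n \<theta> x \<in> cells X m \<and> \<phi> m (act X n \<theta> x) = act Y n \<theta> (\<phi> n x)"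
    and t: "initial X t"
  shows "initial Y (\<phi> 0 t)"
  unfolding initial_def
proof (intro conjI allI impI)
  show "\<phi> 0 t \<in> cells Y 0" using t \<phi> by (simp add: initial_def)
  fix n s assume n: "1 \<le> n" and "compatible Y n {..n} s \<and> act Y (n - 1) [0] (s n) = \<phi> 0 t"
  then have s: "compatible Y n {..n} s" and s0: "act Y (n - 1) [0] (s n) = \<phi> 0 t" by auto
  have nat': "\<psi> m (act Y n \<theta> y) = act X n \<theta> (\<psi> n y)" if "\<theta> \<in> ops m n" "y \<in> cells Y n" for m n \<theta> y
    using nat[OF that(1) \<psi>[OF that(2)]] inv that by metis
  have sc: "s i \<in> cells Y (n - 1)" if "i \<le> n" for i using s that by (auto simp: compatible_def)
  have "compatible X n {..n} (\<lambda>i. \<psi> (n - 1) (s i))"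
    unfolding compatible_def
  proof (intro conjI ballI impI)
    fix i j assume n2: "2 \<le> n" and ij: "i \<in> {..n}" "j \<in> {..n}" "i < j"
    have f: "face (n - 1) i \<in> ops (n - 1 - 1) (n - 1)" "face (n - 1) (j - 1) \<in> ops (n - 1 - 1) (n - 1)"
      using n2 ij face_ops[of "n - 1" i] face_ops[of "n - 1" "j - 1"] by auto
    have "bd Y (n - 1) i (s j) = bd Y (n - 1) (j - 1) (s i)"
      using s n2 ij by (auto simp: compatible_def)
    then show "bd X (n - 1) i (\<psi> (n - 1) (s j)) = bd X (n - 1) (j - 1) (\<psi> (n - 1) (s i))"
      using nat'[OF f(1) sc[of j]] nat'[OF f(2) sc[of i]] ij by simp
  qed (use \<psi> sc in auto)
  moreover have "act X (n - 1) [0] (\<psi> (n - 1) (s n)) = t"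
    using nat'[of "[0]" 0 "n - 1" "s n"] sc[of n] s0 inv(1)[of t 0] t by (simp add: ops_def initial_def)
  ultimately obtain \<sigma> where \<sigma>: "\<sigma> \<in> cells X n" "\<And>i. i \<le> n \<Longrightarrow> bd X n i \<sigma> = \<psi> (n - 1) (s i)"
    using initial_fill[OF t n] by blast
  have "bd Y n i (\<phi> n \<sigma>) = s i" if "i \<le> n" for i
    using nat[OF face_ops[OF n that] \<sigma>(1)] \<sigma>(2)[OF that] inv(2)[OF sc[OF that]] by simp
  then show "\<exists>\<sigma>\<in>cells Y n. \<forall>i\<le>n. bd Y n i \<sigma> = s i" using \<phi>[OF \<sigma>(1)] by blast
qed

section \<open>Coproducts and slices\<close>

text \<open>The operator extended by a new first vertex, as it acts on coslices.\<close>

definition sh :: "nat list \<Rightarrow> nat list" where "sh \<theta> = 0 # map Suc \<theta>"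

lemma sh_ops: "\<theta> \<in> ops m n \<Longrightarrow> sh \<theta> \<in> ops (Suc m) (Suc n)"
  by (auto simp: ops_def sh_def sorted_map image_subset_iff subset_iff)

lemma sh_nth: "sh \<theta> ! 0 = 0" "i < length \<theta> \<Longrightarrow> sh \<theta> ! Suc i = Suc (\<theta> ! i)"
  by (simp_all add: sh_def)

lemma sh_comp: "\<psi> \<in> ops k m \<Longrightarrow> \<theta> \<in> ops m n \<Longrightarrow> map (nth (sh \<theta>)) (sh \<psi>) = sh (map (nth \<theta>) \<psi>)"
  by (auto simp: sh_def ops_def subset_iff less_Suc_eq_le)

lemma sh_id: "sh [0..<n] = [0..<Suc n]"
  by (simp add: sh_def map_Suc_upt upt_conv_Cons del: upt_Suc)

lemma sh_face: "i \<le> n \<Longrightarrow> sh (face n i) = face (Suc n) (Suc i)"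
proof (rule nth_equalityI)
  assume i: "i \<le> n"
  then show "length (sh (face n i)) = length (face (Suc n) (Suc i))" by (simp add: sh_def)
  fix j assume "j < length (sh (face n i))"
  then have "j < Suc n" using i by (simp add: sh_def)
  then show "sh (face n i) ! j = face (Suc n) (Suc i) ! j" using i by (cases j) (auto simp: sh_nth face_nth)
qed

lemma face_0: "face (Suc n) 0 = map Suc [0..<Suc n]"
  by (rule nth_equalityI) (auto simp: face_nth simp del: upt_Suc)

text \<open>The fibre product over C of the coslices under \<open>p 0, \<dots>, p (k - 1)\<close>; its vertices are the cocones on
  the discrete diagram p.\<close>

definition under :: "'c sset \<Rightarrow> nat \<Rightarrow> (nat \<Rightarrow> 'c) \<Rightarrow> ('c \<times> (nat \<Rightarrow> 'c)) sset" where
  "under C k p = \<lparr>cells = (\<lambda>n. {(y, g). y \<in> cells C n \<and> (\<forall>i. if i < k then g i \<in> cells C (Suc n) \<and>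
       bd C (Suc n) 0 (g i) = y \<and> act C (Suc n) [0] (g i) = p i else g i = undefined)}),
     act = (\<lambda>n \<theta> (y, g). (act C n \<theta> y, \<lambda>i. if i < k then act C (Suc n) (sh \<theta>) (g i) else undefined))\<rparr>"

lemma under_cells: "(y, g) \<in> cells (under C k p) n \<longleftrightarrow> y \<in> cells C n \<and> (\<forall>i. if i < k then g i \<in> cells C (Suc n) \<and>
       bd C (Suc n) 0 (g i) = y \<and> act C (Suc n) [0] (g i) = p i else g i = undefined)"
  by (simp add: under_def)

lemma under_act: "act (under C k p) n \<theta> (y, g) = (act C n \<theta> y, \<lambda>i. if i < k then act C (Suc n) (sh \<theta>) (g i) else undefined)"
  by (simp add: under_def)

lemma face0_sh: "\<theta> \<in> ops m n \<Longrightarrow> map (nth (sh \<theta>)) (face (Suc m) 0) = map (nth (face (Suc n) 0)) \<theta>"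
  by (intro nth_equalityI) (auto simp: face_0 opsD sh_nth ops_nth less_Suc_eq_le nth_append simp del: upt_Suc)

lemma under_sset:
  assumes C: "is_sset C" shows "is_sset (under C k p)"
proof (rule is_ssetI)
  fix m n \<theta> x assume t: "\<theta> \<in> ops m n" and "x \<in> cells (under C k p) n"
  then obtain y g where x: "x = (y, g)" "y \<in> cells C n" "\<And>i. i < k \<Longrightarrow> g i \<in> cells C (Suc n)"
    "\<And>i. i < k \<Longrightarrow> bd C (Suc n) 0 (g i) = y" "\<And>i. i < k \<Longrightarrow> act C (Suc n) [0] (g i) = p i"
    by (cases x) (auto simp: under_cells split: if_splits)
  have f: "face (Suc j) 0 \<in> ops j (Suc j)" for j using face_ops[of "Suc j" 0] by simp
  have "bd C (Suc m) 0 (act C (Suc n) (sh \<theta>) (g i)) = act C n \<theta> y" if i: "i < k" for i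
    using sset_comp[OF C f sh_ops[OF t] x(3)[OF i]] sset_comp[OF C t f x(3)[OF i]] face0_sh[OF t] x(4)[OF i] by simp
  moreover have "act C (Suc m) [0] (act C (Suc n) (sh \<theta>) (g i)) = p i" if i: "i < k" for i
    using sset_comp[OF C _ sh_ops[OF t] x(3)[OF i], of "[0]" 0] x(5)[OF i] by (simp add: ops_def sh_def)
  ultimately show "act (under C k p) n \<theta> x \<in> cells (under C k p) m"
    unfolding x(1) under_act under_cells using sset_in[OF C t x(2)] sset_in[OF C sh_ops[OF t] x(3)] by simp
next
  fix n x assume "x \<in> cells (under C k p) n"
  then obtain y g where x: "x = (y, g)" "y \<in> cells C n" "\<And>i. i < k \<Longrightarrow> g i \<in> cells C (Suc n)" "\<And>i. \<not> i < k \<Longrightarrow> g i = undefined"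
    by (cases x) (auto simp: under_cells split: if_splits)
  show "act (under C k p) n [0..<Suc n] x = x"
    unfolding x(1) under_act sh_id using sset_id[OF C x(2)] sset_id[OF C x(3)] x(4) by (simp add: fun_eq_iff del: upt_Suc)
next
  fix j m n \<psi> \<theta> x assume p: "\<psi> \<in> ops j m" and t: "\<theta> \<in> ops m n" and "x \<in> cells (under C k p) n"
  then obtain y g where x: "x = (y, g)" "y \<in> cells C n" "\<And>i. i < k \<Longrightarrow> g i \<in> cells C (Suc n)"
    by (cases x) (auto simp: under_cells split: if_splits)
  show "act (under C k p) m \<psi> (act (under C k p) n \<theta> x) = act (under C k p) n (map (nth \<theta>) \<psi>) x"
    unfolding x(1) under_act using sset_comp[OF C p t x(2)] sset_comp[OF C sh_ops[OF p] sh_ops[OF t] x(3)] sh_comp[OF p t]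
    by (simp add: fun_eq_iff)
qed

text \<open>The base of the horn is filled first; it then serves as the face opposite to the new
  vertex 0, so that each of the k components becomes an inner horn one dimension higher.\<close>

lemma under_qcat:
  assumes C: "qcat C" shows "qcat (under C k p)"
  unfolding qcat_def
proof (intro conjI allI impI under_sset[OF qcat_sset[OF C]])
  note ss = qcat_sset[OF C]
  fix n m s assume a: "0 < m \<and> m < n \<and> compatible (under C k p) n ({..n} - {m}) s"
  let ?I = "{..n} - {m}"
  have n2: "2 \<le> n" using a by auto
  define y g where "y j = fst (s j)" and "g j = snd (s j)" for j
  have sj: "s j = (y j, g j)" for j by (simp add: y_def g_def)
  have c: "y j \<in> cells C (n - 1)" "i < k \<Longrightarrow> g j i \<in> cells C n" "i < k \<Longrightarrow> bd C n 0 (g j i) = y j"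
    "i < k \<Longrightarrow> act C n [0] (g j i) = p i" if "j \<in> ?I" for i j
  proof -
    have "(y j, g j) \<in> cells (under C k p) (n - 1)" using a that unfolding compatible_def sj by blast
    then show "y j \<in> cells C (n - 1)" "i < k \<Longrightarrow> g j i \<in> cells C n" "i < k \<Longrightarrow> bd C n 0 (g j i) = y j"
      "i < k \<Longrightarrow> act C n [0] (g j i) = p i" using n2 unfolding under_cells by (auto split: if_splits)
  qed
  have co: "bd C (n - 1) i (y j) = bd C (n - 1) (j - 1) (y i)"
    "l < k \<Longrightarrow> bd C n (Suc i) (g j l) = bd C n j (g i l)" if ij: "i \<in> ?I" "j \<in> ?I" "i < j" for i j l
  proof -
    have e: "bd (under C k p) (n - 1) i (s j) = bd (under C k p) (n - 1) (j - 1) (s i)"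
      using a n2 ij unfolding compatible_def by blast
    then show "bd C (n - 1) i (y j) = bd C (n - 1) (j - 1) (y i)"
      unfolding sj under_act by simp
    have "sh (face (n - 1) i) = face n (Suc i)" "sh (face (n - 1) (j - 1)) = face n j"
      using sh_face[of i "n - 1"] sh_face[of "j - 1" "n - 1"] ij n2 by auto
    then show "l < k \<Longrightarrow> bd C n (Suc i) (g j l) = bd C n j (g i l)"
      using fun_cong[OF arg_cong[OF e[unfolded sj under_act], of snd], of l] n2 by simp
  qed
  have "compatible C n ?I y" unfolding compatible_def using c(1) co(1) by blast
  then obtain Y where Y: "Y \<in> cells C n" "\<And>i. i \<in> ?I \<Longrightarrow> bd C n i Y = y i" using C a unfolding qcat_def by meson
  have "\<exists>G\<in>cells C (Suc n). bd C (Suc n) 0 G = Y \<and> (\<forall>j\<in>?I. bd C (Suc n) (Suc j) G = g j l)"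
    if l: "l < k" for l
  proof -
    define u where "u j = (if j = 0 then Y else g (j - 1) l)" for j
    have "compatible C (Suc n) ({..Suc n} - {Suc m}) u"
      unfolding compatible_def
    proof (intro conjI ballI impI)
      fix i assume "i \<in> {..Suc n} - {Suc m}"
      then show "u i \<in> cells C (Suc n - 1)" using Y(1) c(2)[of "i - 1", OF _ l] by (cases i) (auto simp: u_def)
    next
      fix i j assume ij: "i \<in> {..Suc n} - {Suc m}" "j \<in> {..Suc n} - {Suc m}" "i < j"
      then have jI: "j - 1 \<in> ?I" by auto
      show "bd C (Suc n - 1) i (u j) = bd C (Suc n - 1) (j - 1) (u i)"
      proof (cases "i = 0")
        case True
        then show ?thesis using c(3)[OF jI l] Y(2)[OF jI] ij by (simp add: u_def)
      next
        case False
        then have iI: "i - 1 \<in> ?I" "i - 1 < j - 1" using ij by auto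
        then show ?thesis using co(2)[OF iI(1) jI iI(2) l] False ij by (simp add: u_def)
      qed
    qed
    then obtain G where G: "G \<in> cells C (Suc n)" "\<And>i. i \<in> {..Suc n} - {Suc m} \<Longrightarrow> bd C (Suc n) i G = u i"
      using C a unfolding qcat_def by (metis Suc_less_eq zero_less_Suc)
    have "bd C (Suc n) (Suc j) G = g j l" if "j \<in> ?I" for j using G(2)[of "Suc j"] that by (simp add: u_def)
    then show ?thesis using G(1) G(2)[of 0] by (auto simp: u_def)
  qed
  then obtain G where G: "\<And>l. l < k \<Longrightarrow> G l \<in> cells C (Suc n)" "\<And>l. l < k \<Longrightarrow> bd C (Suc n) 0 (G l) = Y"
    "\<And>l j. l < k \<Longrightarrow> j \<in> ?I \<Longrightarrow> bd C (Suc n) (Suc j) (G l) = g j l" by metis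
  have v0: "act C (Suc n) [0] (G l) = p l" if l: "l < k" for l
  proof -
    have nI: "n \<in> ?I" using a by auto
    have "act C n [0] (bd C (Suc n) (Suc n) (G l)) = act C (Suc n) (map (nth (face (Suc n) (Suc n))) [0]) (G l)"
      by (rule sset_comp[OF ss _ _ G(1)[OF l]]) (use face_ops[of "Suc n" "Suc n"] in \<open>auto simp: ops_def\<close>)
    then show ?thesis using G(3)[OF l nI] c(4)[OF nI l] by (simp add: face_nth)
  qed
  let ?\<sigma> = "(Y, \<lambda>l. if l < k then G l else undefined)"
  have "?\<sigma> \<in> cells (under C k p) n" unfolding under_cells using Y(1) G(1,2) v0 by simp
  moreover have "bd (under C k p) n j ?\<sigma> = s j" if j: "j \<in> ?I" for j
  proof -
    have "j \<le> n" using j by auto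
    have "g j l = undefined" if "\<not> l < k" for l
    proof -
      have "(y j, g j) \<in> cells (under C k p) (n - 1)" using a j unfolding compatible_def sj by blast
      then show ?thesis using that unfolding under_cells by (auto split: if_splits)
    qed
    then show ?thesis unfolding sj under_act sh_face[OF \<open>j \<le> n\<close>] using Y(2)[OF j] G(3)[OF _ j] by (auto simp: fun_eq_iff)
  qed
  ultimately show "\<exists>\<sigma>\<in>cells (under C k p) n. \<forall>i\<in>?I. bd (under C k p) n i \<sigma> = s i" by blast
qed

text \<open>Adding a first vertex and adding a last vertex commute strictly, so a cocone under q in
  the slice is literally a map from a cocone under p to the cocone (x, q).\<close>

lemma slice_under:
  assumes "\<And>i. i < k \<Longrightarrow> q i \<in> cells C 1 \<and> act C 1 [0] (q i) = p i \<and> act C 1 [1] (q i) = x"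
    and "\<And>i. \<not> i < k \<Longrightarrow> q i = undefined" and C: "is_sset C"
  shows "slice (under C k p) (x, q) = under (slice C x) k q"
proof -
  have f: "face (Suc (Suc n)) 0 @ [] = face (Suc n) 0 @ [Suc (Suc n)]" for n
    using face_snoc[of 0 "Suc n"] by simp
  have "cells (slice (under C k p) (x, q)) n = cells (under (slice C x) k q) n" for n
  proof (intro set_eqI)
    fix yg :: "'a \<times> (nat \<Rightarrow> 'a)"
    obtain y g where yg: "yg = (y, g)" by (cases yg)
    have v: "act C (Suc (Suc n)) [0] (g i) = p i"
      if "i < k" "g i \<in> cells C (Suc (Suc n))" "act C (Suc (Suc n)) [0, Suc (Suc n)] (g i) = q i" for i
      using sset_comp[OF C _ _ that(2), of "[0]" 0 1 "[0, Suc (Suc n)]"] that assms(1)[OF that(1)] by (simp add: ops_def)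
    have w: "act C (Suc (Suc n)) [Suc (Suc n)] (g i) = x"
      if "i < k" "g i \<in> cells C (Suc (Suc n))" "act C (Suc (Suc n)) [0, Suc (Suc n)] (g i) = q i" for i
      using sset_comp[OF C _ _ that(2), of "[1]" 0 1 "[0, Suc (Suc n)]"] that assms(1)[OF that(1)] by (simp add: ops_def)
    show "yg \<in> cells (slice (under C k p) (x, q)) n \<longleftrightarrow> yg \<in> cells (under (slice C x) k q) n"
      unfolding yg under_cells slice_simps mem_Collect_eq under_act prod.inject fun_eq_iff
      using v w assms(2) f[of n, symmetric] by (auto simp: sh_def split: if_splits)
  qed
  moreover have "act (slice (under C k p) (x, q)) n \<theta> yg = act (under (slice C x) k q) n \<theta> yg" for n \<theta> yg
  proof (cases yg)
    case (Pair y g)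
    have "sh (\<theta> @ [Suc n]) = sh \<theta> @ [Suc (Suc n)]" by (simp add: sh_def)
    then show ?thesis unfolding Pair slice_simps under_act by (simp only:)
  qed
  ultimately show ?thesis by (intro sset.equality ext) simp_all
qed

lemma slice_sset:
  assumes C: "is_sset C" shows "is_sset (slice C x)"
proof (rule is_ssetI)
  have sn: "\<theta> @ [Suc n] \<in> ops (Suc m) (Suc n)" if "\<theta> \<in> ops m n" for \<theta> m n
    using that by (auto simp: ops_def sorted_append subset_iff)
  {
    fix m n \<theta> \<sigma> assume t: "\<theta> \<in> ops m n" and s: "\<sigma> \<in> cells (slice C x) n"
    have "act C (Suc m) [Suc m] (act C (Suc n) (\<theta> @ [Suc n]) \<sigma>) = act C (Suc n) (map (nth (\<theta> @ [Suc n])) [Suc m]) \<sigma>"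
      by (rule sset_comp[OF C _ sn[OF t]]) (use s in \<open>auto simp: ops_def\<close>)
    then show "act (slice C x) n \<theta> \<sigma> \<in> cells (slice C x) m"
      using s sset_in[OF C sn[OF t]] opsD(1)[OF t] by (simp add: nth_append)
  }
  fix n \<sigma> assume s: "\<sigma> \<in> cells (slice C x) n"
  show "act (slice C x) n [0..<Suc n] \<sigma> = \<sigma>" using s sset_id[OF C, of \<sigma> "Suc n"] by simp
next
  fix k m n \<psi> \<theta> \<sigma> assume p: "\<psi> \<in> ops k m" and t: "\<theta> \<in> ops m n" and s: "\<sigma> \<in> cells (slice C x) n"
  have sn: "\<theta> @ [Suc n] \<in> ops (Suc m) (Suc n)" if "\<theta> \<in> ops m n" for \<theta> m n
    using that by (auto simp: ops_def sorted_append subset_iff)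
  have "map (nth (\<theta> @ [Suc n])) (\<psi> @ [Suc m]) = map (nth \<theta>) \<psi> @ [Suc n]"
    using p t by (auto simp: ops_def nth_append subset_iff less_Suc_eq_le)
  then show "act (slice C x) m \<psi> (act (slice C x) n \<theta> \<sigma>) = act (slice C x) n (map (nth \<theta>) \<psi>) \<sigma>"
    using sset_comp[OF C sn[OF p] sn[OF t], of \<sigma>] s unfolding slice_simps by (metis (mono_tags, lifting) mem_Collect_eq)
qed

section \<open>Coproducts as initial cocones\<close>

lemma disc_simps [simp]: "cells (disc I) n = I" "act (disc I) n \<theta> i = i"
  by (simp_all add: disc_def)

text \<open>A simplex of the functor category on a discrete set is the same as a family of
  simplices; this is the passage from the family to the simplex.\<close>

definition dmap :: "nat set \<Rightarrow> 'c sset \<Rightarrow> nat \<Rightarrow> (nat \<Rightarrow> 'c) \<Rightarrow> (nat list \<times> nat, 'c) smap" where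
  "dmap I C n g = srestrict (simplex n \<otimes>\<^sub>s disc I) (\<lambda>m (\<psi>, i). act C n \<psi> (g i))"

lemma dmap_in:
  assumes C: "is_sset C" and g: "\<And>i. i \<in> I \<Longrightarrow> g i \<in> cells C n"
  shows "dmap I C n g \<in> cells (fun_sset (disc I) C) n"
  unfolding fun_cells dmap_def
proof (rule srestrict_smaps)
  fix m y assume y: "y \<in> cells (simplex n \<otimes>\<^sub>s disc I) m"
  then show "(case y of (\<psi>, i) \<Rightarrow> act C n \<psi> (g i)) \<in> cells C m" using sset_in[OF C _ g] by auto
  fix k \<theta> assume t: "\<theta> \<in> ops k m"
  show "act (simplex n \<otimes>\<^sub>s disc I) m \<theta> y \<in> cells (simplex n \<otimes>\<^sub>s disc I) k"
    using y t by (cases y) (simp add: ops_comp)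
  show "(case act (simplex n \<otimes>\<^sub>s disc I) m \<theta> y of (\<psi>, i) \<Rightarrow> act C n \<psi> (g i)) = act C m \<theta> (case y of (\<psi>, i) \<Rightarrow> act C n \<psi> (g i))"
    using y sset_comp[OF C t _ g] by (cases y) simp
qed

lemma dmap_app: "i \<in> I \<Longrightarrow> \<psi> \<in> ops m n \<Longrightarrow> dmap I C n g m (\<psi>, i) = act C n \<psi> (g i)"
  by (simp add: dmap_def)

lemma dmap_id: "is_sset C \<Longrightarrow> i \<in> I \<Longrightarrow> g i \<in> cells C n \<Longrightarrow> dmap I C n g n ([0..<Suc n], i) = g i"
  using dmap_app[OF _ ops_id] sset_id by metis

lemma dmap_cong: "(\<And>i. i \<in> I \<Longrightarrow> g i = g' i) \<Longrightarrow> dmap I C n g = dmap I C n g'"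
  by (auto simp: dmap_def srestrict_def fun_eq_iff)

lemma dmap_surj:
  assumes h: "h \<in> cells (fun_sset (disc I) C) n"
  shows "h = dmap I C n (\<lambda>i. h n ([0..<Suc n], i))" "i \<in> I \<Longrightarrow> h n ([0..<Suc n], i) \<in> cells C n"
proof -
  have h': "h \<in> smaps (simplex n \<otimes>\<^sub>s disc I) C" using h by (simp add: fun_cells)
  show "i \<in> I \<Longrightarrow> h n ([0..<Suc n], i) \<in> cells C n" using smaps_in[OF h', of "([0..<Suc n], i)" n] ops_id by simp
  show "h = dmap I C n (\<lambda>i. h n ([0..<Suc n], i))"
  proof (intro ext)
    fix m x
    show "h m x = dmap I C n (\<lambda>i. h n ([0..<Suc n], i)) m x"
    proof (cases "x \<in> cells (simplex n \<otimes>\<^sub>s disc I) m")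
      case True
      then obtain \<psi> i where x: "x = (\<psi>, i)" "\<psi> \<in> ops m n" "i \<in> I" by auto
      have "h m (act (simplex n \<otimes>\<^sub>s disc I) n \<psi> ([0..<Suc n], i)) = act C n \<psi> (h n ([0..<Suc n], i))"
        by (rule smaps_act[OF h' x(2)]) (use ops_id x in simp)
      then show ?thesis using x ops_map_nth_id[OF x(2)] by (simp add: dmap_app del: upt_Suc)
    next
      case False
      then show ?thesis using smaps_undef[OF h' False] by (simp add: dmap_def srestrict_def del: prod_sset_simps)
    qed
  qed
qed

lemma dmap_act:
  assumes C: "is_sset C" and g: "\<And>i. i \<in> I \<Longrightarrow> g i \<in> cells C n" and t: "\<theta> \<in> ops m n"
  shows "act (fun_sset (disc I) C) n \<theta> (dmap I C n g) = dmap I C m (\<lambda>i. act C n \<theta> (g i))"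
  unfolding fun_act[OF t] dmap_def[of I C m] srestrict_def
  using ops_comp[OF _ t] sset_comp[OF C _ t g] by (intro ext) (auto simp: dmap_app)

lemma fan_dmap: "fan C k e = dmap {..<k} C 1 e"
  by (simp add: fan_def dmap_def)

lemma const_dmap: "const_cell (disc I) C n x = dmap I C n (\<lambda>i. x)"
  by (simp add: const_cell_def dmap_def)

text \<open>Cocones on a discrete diagram are families of simplices with a common base, so
  \<open>dmap\<close> gives an isomorphism between \<open>cocones\<close> and \<open>under\<close>,
  and \<open>initial_transfer\<close> applies in both directions.\<close>

lemma is_coproduct_under:
  assumes C: "is_sset C"
  shows "is_coproduct C k e z \<longleftrightarrow> (\<forall>i<k. e i \<in> cells C 1) \<and>
    initial (under C k (\<lambda>i. src C (e i))) (z, \<lambda>i. if i < k then e i else undefined)"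
proof (cases "\<forall>i<k. e i \<in> cells C 1")
  case False then show ?thesis unfolding is_coproduct_def by blast
next
  case True
  let ?I = "{..<k}"
  let ?F = "fun_sset (disc ?I) C"
  let ?U = "under C k (\<lambda>i. src C (e i))"
  let ?P = "src ?F (fan C k e)"
  let ?K = "cocones (disc ?I) C ?P"
  define \<phi> where "\<phi> n xh = (fst xh, \<lambda>i. if i < k then snd xh (Suc n) ([0..<Suc (Suc n)], i) else undefined)"
    for n and xh :: "'a \<times> (nat list \<times> nat, 'a) smap"
  define \<psi> where "\<psi> n yg = (fst yg, dmap ?I C (Suc n) (snd yg))" for n and yg :: "'a \<times> (nat \<Rightarrow> 'a)"
  have o0: "[0] \<in> ops 0 n" for n by (auto simp: ops_def)
  have P: "?P = dmap ?I C 0 (\<lambda>i. src C (e i))"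
    unfolding src_def fan_dmap by (rule dmap_act[OF C _ o0]) (use True in auto)
  have f0: "face (Suc n) 0 = [1..<Suc (Suc n)]" for n by (simp add: face_0 map_Suc_upt del: upt_Suc)
  have fo: "[1..<Suc (Suc n)] \<in> ops n (Suc n)" for n using face_ops[of "Suc n" 0] f0 by (simp del: upt_Suc)
  have Kc: "(x, h) \<in> cells ?K n \<longleftrightarrow> x \<in> cells C n \<and> h \<in> cells ?F (Suc n) \<and> act ?F (Suc n) [0] h = ?P \<and>
    act ?F (Suc n) [1..<Suc (Suc n)] h = const_cell (disc ?I) C n x" for x h n
    by (simp add: cocones_def sub_sset_def coslice_def del: upt_Suc)
  have Ka: "act ?K n \<theta> (x, h) = (act C n \<theta> x, act ?F (Suc n) (sh \<theta>) h)" for n \<theta> x h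
    by (simp add: cocones_def sub_sset_def coslice_def sh_def)
  have eqd: "dmap ?I C n g = dmap ?I C n g' \<longleftrightarrow> (\<forall>i<k. g i = g' i)" if "\<forall>i<k. g i \<in> cells C n" "\<forall>i<k. g' i \<in> cells C n" for n g g'
  proof
    assume "dmap ?I C n g = dmap ?I C n g'"
    then show "\<forall>i<k. g i = g' i" using dmap_id[OF C, of _ ?I g n] dmap_id[OF C, of _ ?I g' n] that by fastforce
  qed (auto intro: dmap_cong)
  have cond: "(x, dmap ?I C (Suc n) g) \<in> cells ?K n \<longleftrightarrow> x \<in> cells C n \<and>
     (\<forall>i<k. bd C (Suc n) 0 (g i) = x \<and> act C (Suc n) [0] (g i) = src C (e i))"
    if g: "\<forall>i<k. g i \<in> cells C (Suc n)" for x n g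
  proof -
    have d: "act ?F (Suc n) [0] (dmap ?I C (Suc n) g) = dmap ?I C 0 (\<lambda>i. act C (Suc n) [0] (g i))"
      "act ?F (Suc n) [1..<Suc (Suc n)] (dmap ?I C (Suc n) g) = dmap ?I C n (\<lambda>i. act C (Suc n) [1..<Suc (Suc n)] (g i))"
      by (rule dmap_act[OF C _ o0], use g in simp) (rule dmap_act[OF C _ fo], use g in simp)
    have s: "src C (e i) \<in> cells C 0" if "i < k" for i unfolding src_def using True that by (intro sset_in[OF C o0]) auto
    have "(act ?F (Suc n) [0] (dmap ?I C (Suc n) g) = ?P) = (\<forall>i<k. act C (Suc n) [0] (g i) = src C (e i))"
      unfolding P d
      using g s sset_in[OF C o0] by (intro eqd) auto
    moreover have "(act ?F (Suc n) [1..<Suc (Suc n)] (dmap ?I C (Suc n) g) = const_cell (disc ?I) C n x) =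
       (\<forall>i<k. bd C (Suc n) 0 (g i) = x)" if "x \<in> cells C n"
      unfolding const_dmap d f0
      using g that sset_in[OF C fo] by (intro eqd) auto
    ultimately show ?thesis unfolding Kc using dmap_in[OF C, of ?I g "Suc n"] g by auto
  qed
  have \<phi>c: "\<phi> n xh \<in> cells ?U n" "\<psi> n (\<phi> n xh) = xh" if "xh \<in> cells ?K n" for n xh
  proof -
    obtain x h where xh: "xh = (x, h)" by (cases xh)
    have h: "h \<in> cells ?F (Suc n)" using that xh Kc by simp
    let ?g = "\<lambda>i. h (Suc n) ([0..<Suc (Suc n)], i)"
    have g: "\<forall>i<k. ?g i \<in> cells C (Suc n)" using dmap_surj(2)[OF h] by simp
    have hg: "h = dmap ?I C (Suc n) ?g" by (rule dmap_surj(1)[OF h])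
    have "(x, dmap ?I C (Suc n) ?g) \<in> cells ?K n" using that xh hg by simp
    then show "\<phi> n xh \<in> cells ?U n" unfolding cond[OF g] \<phi>_def xh under_cells using g by (simp del: upt_Suc)
    have "dmap ?I C (Suc n) (snd (\<phi> n xh)) = dmap ?I C (Suc n) ?g" by (rule dmap_cong) (simp add: \<phi>_def xh del: upt_Suc)
    then show "\<psi> n (\<phi> n xh) = xh" using hg by (simp add: \<psi>_def \<phi>_def xh del: upt_Suc)
  qed
  have \<psi>c: "\<psi> n yg \<in> cells ?K n" "\<phi> n (\<psi> n yg) = yg" if "yg \<in> cells ?U n" for n yg
  proof -
    obtain y g where yg: "yg = (y, g)" by (cases yg)
    have g: "\<forall>i<k. g i \<in> cells C (Suc n)" "\<And>i. \<not> i < k \<Longrightarrow> g i = undefined" using that by (auto simp: yg under_cells split: if_splits)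
    show "\<psi> n yg \<in> cells ?K n" unfolding \<psi>_def yg fst_conv snd_conv cond[OF g(1)] using that by (auto simp: yg under_cells split: if_splits)
    show "\<phi> n (\<psi> n yg) = yg" unfolding \<psi>_def \<phi>_def yg using dmap_id[OF C, of _ ?I g "Suc n"] g by (auto simp: fun_eq_iff simp del: upt_Suc)
  qed
  have Knat: "act ?K n \<theta> xh \<in> cells ?K m \<and> \<phi> m (act ?K n \<theta> xh) = act ?U n \<theta> (\<phi> n xh)" if t: "\<theta> \<in> ops m n" and x: "xh \<in> cells ?K n" for m n \<theta> xh
  proof -
    obtain y g where yg: "\<phi> n xh = (y, g)" by (cases "\<phi> n xh")
    have u: "(y, g) \<in> cells ?U n" using \<phi>c(1)[OF x] yg by simp
    have g: "\<forall>i<k. g i \<in> cells C (Suc n)" "\<And>i. \<not> i < k \<Longrightarrow> g i = undefined" using u by (auto simp: under_cells split: if_splits)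
    have xh: "xh = (y, dmap ?I C (Suc n) g)" using \<phi>c(2)[OF x] yg by (simp add: \<psi>_def)
    have "act ?K n \<theta> xh = (act C n \<theta> y, dmap ?I C (Suc m) (\<lambda>i. act C (Suc n) (sh \<theta>) (g i)))"
      unfolding xh Ka using dmap_act[OF C _ sh_ops[OF t], of ?I g] g(1) by simp
    also have "\<dots> = \<psi> m (act ?U n \<theta> (y, g))" unfolding \<psi>_def under_act by (auto intro: dmap_cong)
    finally have e: "act ?K n \<theta> xh = \<psi> m (act ?U n \<theta> (y, g))" .
    show ?thesis using \<psi>c[OF sset_in[OF under_sset[OF C] t u]] unfolding e yg by simp
  qed
  have Unat: "act ?U n \<theta> yg \<in> cells ?U m \<and> \<psi> m (act ?U n \<theta> yg) = act ?K n \<theta> (\<psi> n yg)" if t: "\<theta> \<in> ops m n" and y: "yg \<in> cells ?U n" for m n \<theta> yg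
    using Knat[OF t \<psi>c(1)[OF y]] \<psi>c(2)[OF y] sset_in[OF under_sset[OF C] t y] \<phi>c(2) by metis
  have z: "\<phi> 0 (z, fan C k e) = (z, \<lambda>i. if i < k then e i else undefined)"
    unfolding \<phi>_def fan_dmap using dmap_id[OF C, of _ ?I e 1] True by (auto simp: fun_eq_iff)
  have z': "\<psi> 0 (z, \<lambda>i. if i < k then e i else undefined) = (z, fan C k e)"
    unfolding \<psi>_def fan_dmap by (auto intro: dmap_cong)
  have "initial ?K (z, fan C k e) \<longleftrightarrow> initial ?U (z, \<lambda>i. if i < k then e i else undefined)"
  proof
    assume "initial ?K (z, fan C k e)"
    then show "initial ?U (z, \<lambda>i. if i < k then e i else undefined)"
      unfolding z[symmetric] by (rule initial_transfer[where \<phi>=\<phi> and \<psi>=\<psi>, rotated -1]) (use \<phi>c \<psi>c Knat in blast)+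
  next
    assume "initial ?U (z, \<lambda>i. if i < k then e i else undefined)"
    then show "initial ?K (z, fan C k e)"
      unfolding z'[symmetric] by (rule initial_transfer[where \<phi>=\<psi> and \<psi>=\<phi>, rotated -1]) (use \<phi>c \<psi>c Unat in blast)+
  qed
  then show ?thesis using True unfolding is_coproduct_def is_colimit_def by simp
qed

section \<open>Initial objects and slices\<close>

lemma op1 [simp]: "[a] \<in> ops 0 n \<longleftrightarrow> a \<le> n" "[a, b] \<in> ops (Suc 0) n \<longleftrightarrow> a \<le> b \<and> b \<le> n"
  "[a, b, c] \<in> ops 2 n \<longleftrightarrow> a \<le> b \<and> b \<le> c \<and> c \<le> n"
  by (auto simp: ops_def)

text \<open>First fill the image of the given sphere, then the sphere itself together with this filler.\<close>

lemma initial_slice: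
  assumes Q: "is_sset Q" and \<sigma>: "\<sigma> \<in> cells Q 1" and z: "initial Q (act Q 1 [0] \<sigma>)"
  shows "initial (slice Q (act Q 1 [1] \<sigma>)) \<sigma>"
  unfolding initial_def
proof (intro conjI allI impI)
  let ?w = "act Q 1 [1] \<sigma>"
  show "\<sigma> \<in> cells (slice Q ?w) 0" using \<sigma> by simp
  fix n s assume n: "1 \<le> n" and "compatible (slice Q ?w) n {..n} s \<and> act (slice Q ?w) (n - 1) [0] (s n) = \<sigma>"
  then have s: "compatible (slice Q ?w) n {..n} s" and s0: "act (slice Q ?w) (n - 1) [0] (s n) = \<sigma>" by auto
  have Sn: "Suc (n - 1) = n" using n by simp
  have c: "s i \<in> cells Q n" "act Q n [n] (s i) = ?w" if "i \<le> n" for i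
    using s that Sn by (auto simp: compatible_def)
  have co: "bd Q n i (s j) = bd Q n (j - 1) (s i)" if ij: "i < j" "j \<le> n" for i j
  proof (cases "n = 1")
    case True
    then have "i = 0" "j = 1" using ij by auto
    then show ?thesis using c(2)[of 0] c(2)[of 1] True by (simp add: face_def)
  next
    case False
    then have "2 \<le> n" using n by simp
    then have "bd (slice Q ?w) (n - 1) i (s j) = bd (slice Q ?w) (n - 1) (j - 1) (s i)"
      using s ij unfolding compatible_def by auto
    then show ?thesis using face_snoc[of i "n - 1"] face_snoc[of "j - 1" "n - 1"] ij Sn by simp
  qed
  define t where "t i = bd Q n n (s i)" for i
  have fo: "face n i \<in> ops (n - 1) n" if "i \<le> n" for i by (rule face_ops[OF n that])
  have ct: "compatible Q n {..n} t"
    unfolding compatible_def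
  proof (intro conjI ballI impI)
    fix i assume "i \<in> {..n}" then show "t i \<in> cells Q (n - 1)" unfolding t_def using sset_in[OF Q fo c(1)] by simp
  next
    fix i j assume n2: "2 \<le> n" and ij: "i \<in> {..n}" "j \<in> {..n}" "i < j"
    have f: "face (n - 1) l \<in> ops (n - 1 - 1) (n - 1)" if "l \<le> n - 1" for l using face_ops[of "n - 1" l] that n2 by simp
    have e: "bd Q (n - 1) l (t m) = bd Q (n - 1) (n - 1) (bd Q n l (s m))"
      if "l \<le> n - 1" "m \<le> n" for l m
      unfolding t_def using sset_comp[OF Q f[OF that(1)] fo[OF order_refl] c(1)[OF that(2)]]
        sset_comp[OF Q f[OF order_refl] fo c(1)[OF that(2)], of l] face_face[of l n n] that n2 by simp
    show "bd Q (n - 1) i (t j) = bd Q (n - 1) (j - 1) (t i)"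
      using e[of i j] e[of "j - 1" i] co[of i j] ij by simp
  qed
  have z0: "act Q n [0] (s n) = act Q 1 [0] \<sigma>"
    using sset_comp[OF Q _ _ c(1)[OF order_refl], of "[0]" 0 1 "[0, n]"] s0 Sn by simp
  have "act Q (n - 1) [0] (t n) = act Q 1 [0] \<sigma>"
    unfolding t_def using sset_comp[OF Q _ fo[OF order_refl] c(1)[OF order_refl], of "[0]" 0] z0 n by (simp add: face_nth)
  then obtain \<omega> where \<omega>: "\<omega> \<in> cells Q n" "\<And>i. i \<le> n \<Longrightarrow> bd Q n i \<omega> = t i"
    using initial_fill[OF z n ct] by blast
  define u where "u i = (if i \<le> n then s i else \<omega>)" for i
  have cu: "compatible Q (Suc n) {..Suc n} u"
    unfolding compatible_def
  proof (intro conjI ballI impI)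
    fix i assume "i \<in> {..Suc n}" then show "u i \<in> cells Q (Suc n - 1)" using c(1) \<omega>(1) by (simp add: u_def)
  next
    fix i j assume ij: "i \<in> {..Suc n}" "j \<in> {..Suc n}" "i < j"
    show "bd Q (Suc n - 1) i (u j) = bd Q (Suc n - 1) (j - 1) (u i)"
    proof (cases "j = Suc n")
      case True then show ?thesis using \<omega>(2)[of i] ij by (simp add: u_def t_def)
    next
      case False then show ?thesis using co[of i j] ij by (simp add: u_def)
    qed
  qed
  have "act Q n [0] \<omega> = act Q (n - 1) [0] (bd Q n n \<omega>)"
    using sset_comp[OF Q _ fo[OF order_refl] \<omega>(1), of "[0]" 0] n by (simp add: face_nth)
  then have "act Q (Suc n - 1) [0] (u (Suc n)) = act Q 1 [0] \<sigma>"
    using \<omega>(2)[of n] \<open>act Q (n - 1) [0] (t n) = act Q 1 [0] \<sigma>\<close> by (simp add: u_def)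
  then obtain \<rho> where \<rho>: "\<rho> \<in> cells Q (Suc n)" "\<And>i. i \<le> Suc n \<Longrightarrow> bd Q (Suc n) i \<rho> = u i"
    using initial_fill[OF z _ cu] by auto
  have f0: "face (Suc n) 0 \<in> ops n (Suc n)" using face_ops[of "Suc n" 0] by simp
  have "act Q n [n] (bd Q (Suc n) 0 \<rho>) = act Q (Suc n) [Suc n] \<rho>"
    using sset_comp[OF Q _ f0 \<rho>(1), of "[n]" 0] by (simp add: face_nth)
  then have "\<rho> \<in> cells (slice Q ?w) n" using \<rho>(1) \<rho>(2)[of 0] c(2)[of 0] by (simp add: u_def)
  moreover have "bd (slice Q ?w) n i \<rho> = s i" if "i \<le> n" for i
    using \<rho>(2)[of i] that face_snoc[OF that] by (simp add: u_def)
  ultimately show "\<exists>\<sigma>\<in>cells (slice Q ?w) n. \<forall>i\<le>n. bd (slice Q ?w) n i \<sigma> = s i" by blast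
qed

text \<open>A sphere with first vertex z is composed with the
  retraction \<open>z' \<rightarrow> z\<close>, filled, and composed with the section \<open>z \<rightarrow> z'\<close>: in the following complex, 0 and 2
  are copies of z, 1 is z', and x > 2 is the vertex x - 2 of the sphere.\<close>

lemma initial_retract:
  assumes Q: "qcat Q" and \<zeta>: "\<zeta> \<in> cells Q 2" "act Q 2 [0, 2] \<zeta> = idn Q z" and z: "z \<in> cells Q 0"
    and z': "initial Q (act Q 2 [1] \<zeta>)"
  shows "initial Q z"
  unfolding initial_def
proof (intro conjI allI impI z)
  note ss = qcat_sset[OF Q]
  fix n s assume n: "1 \<le> n" and "compatible Q n {..n} s \<and> act Q (n - 1) [0] (s n) = z"
  then have s: "compatible Q n {..n} s" and s0: "act Q (n - 1) [0] (s n) = z" by auto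
  let ?K = "{S. S \<noteq> {} \<and> S \<subseteq> {..n} \<and> (\<exists>i\<in>{..n}. i \<notin> S)}"
  obtain g0 where g0: "cx Q ?K g0" and g0s: "\<And>i. i \<le> n \<Longrightarrow> g0 (face n i) = s i"
    using cx_of_compatible[OF ss n _ s] by auto
  define A where "A = {3..n + 2}"
  define Y where "Y = {0, 1, 2 :: nat}"
  define N where "N = {..n + 2}"
  have A: "x \<in> A \<longleftrightarrow> 2 < x \<and> x \<le> n + 2" for x by (auto simp: A_def)
  have AY: "x \<in> N \<longleftrightarrow> x \<in> A \<or> x \<in> Y" "x \<in> Y \<Longrightarrow> x \<notin> A" for x by (auto simp: N_def A Y_def)
  have fin: "finite N" "finite A" "n + 2 \<in> A" "A \<subseteq> N" using n AY by (auto simp: N_def A_def)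
  have Y: "0 \<in> Y" "1 \<in> Y" "2 \<in> Y" by (simp_all add: Y_def)
  have A012: "0 \<notin> A" "1 \<notin> A" "2 \<notin> A" using AY(2) Y by blast+
  define \<kappa> where "\<kappa> x = x - 2" for x :: nat
  \<comment> \<open>Known are the retraction \<zeta> on Y, the sphere with either copy of z as long
    as a vertex of A is missing, and the face of the sphere opposite to its first vertex.\<close>
  define L1 where "L1 = {S. S \<noteq> {} \<and> S \<subseteq> N \<and> (S \<subseteq> Y \<or> 1 \<notin> S \<and> \<not> A \<subseteq> S \<or> S \<subseteq> A)}"
  define g1 where "g1 v = (if set v \<subseteq> Y then act Q 2 v \<zeta> else g0 (map \<kappa> v))" for v
  have L1c: "closed_cx L1"
    unfolding closed_cx_def L1_def using finite_subset[OF _ fin(1)] by blast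
  have g00: "g0 [0] = z"
  proof -
    have "act Q (n - 1) [0] (g0 (face n n)) = g0 (map (nth (face n n)) [0])"
      by (rule cx_act[OF g0 sorted_face, where m = 0]) (use n in \<open>auto simp: set_face\<close>)
    then show ?thesis using g0s[of n] s0 n by (simp add: face_nth)
  qed
  have deg: "act Q 2 v \<zeta> = g0 (map \<kappa> v)" if v: "v \<noteq> []" "sorted v" "set v \<subseteq> {0, 2}" for v
  proof -
    obtain m where m: "length v = Suc m" using v(1) by (cases v) auto
    have vo: "map (\<lambda>x. x div 2) v \<in> ops m 1"
      unfolding ops_def using v m by (auto intro!: sorted_mapI div_le_mono)
    have zo: "replicate (Suc m) 0 \<in> ops m 0" by (rule ops_replicate) simp
    have "v = map (nth [0, 2]) (map (\<lambda>x. x div 2) v)" using v(3) unfolding map_map by (intro map_idI[symmetric]) auto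
    then have "act Q 2 v \<zeta> = act Q 1 (map (\<lambda>x. x div 2) v) (act Q 2 [0, 2] \<zeta>)"
      using sset_comp[OF ss vo _ \<zeta>(1), of "[0, 2]"] by (metis One_nat_def le0 op1(2) order_refl)
    also have "\<dots> = act Q 0 (map (nth [0, 0]) (map (\<lambda>x. x div 2) v)) z"
      unfolding \<zeta>(2) idn_def by (rule sset_comp[OF ss vo _ z]) simp
    also have "map (nth [0::nat, 0]) (map (\<lambda>x. x div 2) v) = replicate (Suc m) 0"
    proof (rule nth_equalityI)
      fix i assume "i < length (map (nth [0::nat, 0]) (map (\<lambda>x. x div 2) v))"
      then have i: "i < Suc m" using m by simp
      then have "v ! i \<in> set v" using m by simp
      then have "v ! i \<in> {0, 2}" using v(3) by blast
      then show "map (nth [0::nat, 0]) (map (\<lambda>x. x div 2) v) ! i = replicate (Suc m) (0::nat) ! i" using i m by (auto simp del: replicate_Suc)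
    qed (use m in simp)
    also have "act Q 0 (replicate (Suc m) 0) z = g0 (map (nth [0]) (replicate (Suc m) 0))"
      unfolding g00[symmetric] by (rule cx_act[OF g0 _ _ _ zo]) (use n in auto)
    also have "map (nth [0]) (replicate (Suc m) 0) = map \<kappa> v"
    proof (rule nth_equalityI)
      fix i assume "i < length (map (nth [0::nat]) (replicate (Suc m) 0))"
      then have i: "i < Suc m" by simp
      then have "v ! i \<in> set v" using m by simp
      then have "v ! i \<in> {0, 2}" using v(3) by blast
      then show "map (nth [0]) (replicate (Suc m) 0) ! i = map \<kappa> v ! i" using i m by (auto simp: \<kappa>_def simp del: replicate_Suc)
    qed (use m in simp)
    finally show ?thesis .
  qed
  have inK: "\<kappa> ` S \<in> ?K" if S: "S \<in> L1" "\<not> S \<subseteq> Y" for S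
  proof -
    have "\<exists>i\<in>{..n}. i \<notin> \<kappa> ` S"
    proof (cases "S \<subseteq> A")
      case True
      then have "\<kappa> x \<noteq> 0" if "x \<in> S" for x using that A unfolding \<kappa>_def by fastforce
      then have "0 \<notin> \<kappa> ` S" by (metis imageE)
      then show ?thesis by blast
    next
      case False
      then obtain i where i: "i \<in> A" "i \<notin> S" using S by (auto simp: L1_def)
      then have "i - 2 \<noteq> x - 2" if "x \<in> S" for x
      proof -
        have "x \<noteq> i" "2 < i" using that i A by blast+
        then show ?thesis by arith
      qed
      then show ?thesis using i A[of i] by (intro bexI[of _ "i - 2"]) (auto simp: \<kappa>_def)
    qed
    moreover have "\<kappa> ` S \<subseteq> {..n}" using S by (auto simp: L1_def N_def \<kappa>_def)
    ultimately show ?thesis using S by (auto simp: L1_def)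
  qed
  have g1: "cx Q L1 g1"
    unfolding g1_def
  proof (rule cx_glue[where P = "\<lambda>S. S \<subseteq> Y"])
    show "cx Q {S \<in> L1. S \<subseteq> Y} (\<lambda>v. act Q 2 v \<zeta>)"
    proof (rule cxI)
      fix v m assume v: "length v = Suc m" "sorted v" "set v \<in> {S \<in> L1. S \<subseteq> Y}"
      then have o: "v \<in> ops m 2" by (auto simp: ops_def Y_def)
      show "act Q 2 v \<zeta> \<in> cells Q m" by (rule sset_in[OF ss o \<zeta>(1)])
      show "act Q m \<theta> (act Q 2 v \<zeta>) = act Q 2 (map (nth v) \<theta>) \<zeta>" if "\<theta> \<in> ops k m" for k \<theta> by (rule sset_comp[OF ss that o \<zeta>(1)])
    qed
    show "cx Q {S \<in> L1. \<not> S \<subseteq> Y} (\<lambda>v. g0 (map \<kappa> v))"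
      by (rule cx_pull[OF g0]) (use inK in \<open>auto simp: \<kappa>_def diff_le_mono\<close>)
    fix v S assume v: "v \<noteq> []" "sorted v" "set v \<subseteq> Y" "set v \<subseteq> S" "S \<in> L1" "\<not> S \<subseteq> Y"
    have "1 \<notin> S" using v(5,6) A012 by (auto simp: L1_def)
    then have "set v \<subseteq> {0, 2}" using v(3,4) by (auto simp: Y_def)
    then show "act Q 2 v \<zeta> = g0 (map \<kappa> v)" by (rule deg[OF v(1,2)])
  qed blast
  define K where "K = {S. S \<noteq> {} \<and> S \<subseteq> N \<and> (\<not> A \<subseteq> S \<or> 2 \<notin> S)}"
  define K1 where "K1 = {S \<in> K. 0 \<notin> S}"
  \<comment> \<open>The simplices with first vertex 1 come from initiality of z'. With 0 present,
    proper parts of A are reached through 2, and the whole of A through 1, which composes with the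
    section.\<close>
  define x where "x S = (if A \<subseteq> S then 1 else 2 :: nat)" for S
  have Kc: "closed_cx K" "closed_cx K1" unfolding closed_cx_def K1_def K_def using finite_subset[OF _ fin(1)] by blast+
  have Kf: "finite K" "finite K1" by (rule finite_subset[of _ "Pow N"]; use fin in \<open>auto simp: K1_def K_def\<close>)+
  have K1L: "1 \<in> S" if "S \<in> K1" "S \<notin> L1" for S using that AY unfolding K1_def K_def L1_def Y_def by blast
  have L1K: "L1 \<subseteq> K" using A012 fin(3) AY(2) unfolding L1_def K_def by blast
  have "{1} \<in> L1" using Y AY by (auto simp: L1_def)
  moreover have "initial Q (g1 [1])" using z' Y by (simp add: g1_def)
  moreover have "1 \<le> y" if "S \<in> K1" "y \<in> S" for S y using that by (cases y) (auto simp: K1_def)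
  ultimately have "cx_ext Q L1 g1 (L1 \<union> K1)"
    using cx_init_fill[OF ss Kf(2) Kc(2) L1c _ g1, of 1] K1L by blast
  then obtain g2 where g2: "cx Q (L1 \<union> K1) g2" "\<And>v. set v \<in> L1 \<Longrightarrow> g2 v = g1 v" by blast
  let ?L = "L1 \<union> K1"
  have Lc: "closed_cx ?L" by (rule closed_cx_Un[OF L1c Kc(2)])
  have "cx_ext Q ?L g2 (?L \<union> K)"
  proof (rule cx_pairing[OF Q Kf(1) Kc(1) Lc g2(1), where x = x and r = "\<lambda>i. 2 - i"])
    have xeq: "x S = x T" if "A \<subseteq> S \<longleftrightarrow> A \<subseteq> T" for S T unfolding x_def that ..
    have xA: "x S \<notin> A" "x S \<noteq> 0" "x S \<le> 2" for S using A012 by (auto simp: x_def)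
    fix S assume S: "S \<in> K" "S \<notin> ?L"
    then have m: "0 \<in> S" "S \<subseteq> N" "\<not> S \<subseteq> Y" "A \<subseteq> S \<and> 2 \<notin> S \<or> \<not> A \<subseteq> S \<and> 1 \<in> S" unfolding K1_def K_def L1_def by blast+
    then obtain a where a: "a \<in> S" "a \<in> A" using AY(1) by blast
    have "insert (x S) S \<in> K"
    proof (cases "A \<subseteq> S")
      case True
      then have e: "x S = 1" and "2 \<notin> S" using m(4) by (simp_all add: x_def)
      then show ?thesis unfolding e using m(1,2) AY(1) Y by (simp add: K_def)
    next
      case False
      then have "\<not> A \<subseteq> insert (x S) S" using xA(1) by blast
      then show ?thesis using m(1,2) AY(1)[of "x S"] xA(3)[of S] by (simp add: K_def N_def)
    qed
    moreover have "S - {x S} \<notin> ?L"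
    proof -
      have "0 \<in> S - {x S}" "a \<in> S - {x S}" "a \<notin> Y" "0 \<notin> A" using m(1) a xA AY(2) A012 by (metis DiffI singletonD)+
      moreover have "A \<subseteq> S - {x S} \<or> 1 \<in> S - {x S}" using m(4) xA(1)[of S] by (auto simp: x_def)
      ultimately show ?thesis unfolding L1_def K1_def by blast
    qed
    moreover have "x (insert (x S) S) = x S" "x (S - {x S}) = x S" by (intro xeq; use xA(1)[of S] in blast)+
    ultimately show "insert (x S) S \<in> K \<and> S - {x S} \<notin> ?L \<and> x (insert (x S) S) = x S \<and> x (S - {x S}) = x S" by blast
    have "x S < a" using a(2) A[of a] xA(3)[of S] by linarith
    then show "(\<exists>a\<in>S. a < x S) \<and> (\<exists>b\<in>S. x S < b)" using m(1) a(1) xA(2)[of S] by blast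
    show "x (S - {i}) \<in> S \<or> 2 - x (S - {i}) < 2 - x S" if "x S \<in> S" for i
      using that by (cases "A \<subseteq> S"; cases "A \<subseteq> S - {i}") (auto simp: x_def)
  qed
  moreover have "?L \<union> K = K" using L1K unfolding K1_def by blast
  ultimately obtain g5 where g5: "cx Q K g5" "\<And>v. set v \<in> L1 \<Longrightarrow> g5 v = g1 v" using g2(2) by (metis UnI1)
  \<comment> \<open>0 takes the place of the first vertex of the sphere, and the numbers above 2
    that of the other vertices.\<close>
  define c where "c = 0 # [3..<n + 3]"
  have setc: "set c = A \<union> {0}" by (auto simp: c_def A_def)
  have sc: "sorted c" "length c = Suc n" "distinct c" by (auto simp: c_def)
  have cnth: "c ! j = (if j = 0 then 0 else j + 2)" if "j \<le> n" for j using that by (cases j) (auto simp: c_def)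
  have cin: "set c \<in> K" unfolding setc using A012 fin(4) by (auto simp: K_def N_def)
  have "g5 c \<in> cells Q n" using cx_in[OF g5(1) _ sc(1) cin] sc(2) by force
  moreover have "bd Q n i (g5 c) = s i" if i: "i \<le> n" for i
  proof -
    have fo: "face n i \<in> ops (n - 1) n" by (rule face_ops[OF n i])
    let ?v = "map (nth c) (face n i)"
    have a: "bd Q n i (g5 c) = g5 ?v" by (rule cx_act[OF g5(1) sc(1) cin sc(2) fo])
    have setv: "set ?v = set c - {c ! i}" by (rule set_map_face[OF sc(2,3) i])
    have kv: "map \<kappa> ?v = face n i"
    proof (rule nth_equalityI)
      fix j assume "j < length (map \<kappa> ?v)"
      then have j: "j < n" using i by simp
      then have "face n i ! j \<le> n" using i by (simp add: face_nth)
      then show "map \<kappa> ?v ! j = face n i ! j" using cnth[of "face n i ! j"] j i by (simp add: \<kappa>_def)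
    qed simp
    have vne: "?v \<noteq> []" using i n by (auto simp flip: length_greater_0_conv)
    have vso: "sorted ?v" by (rule sorted_nth_ops[OF fo sc(2,1)])
    have v: "set ?v \<in> L1"
    proof (cases "i = 0")
      case True
      then have "set ?v = A" unfolding setv setc using A012 cnth[of 0] by auto
      then show ?thesis using fin by (auto simp: L1_def)
    next
      case False
      then have "c ! i \<in> A" using cnth[OF i] i by (auto simp: A)
      then have "\<not> A \<subseteq> set ?v" "1 \<notin> set ?v" "set ?v \<subseteq> N" unfolding setv setc using A012 fin(4) by (auto simp: N_def)
      then show ?thesis using vne by (simp only: L1_def mem_Collect_eq set_empty simp_thms)
    qed
    have "g5 ?v = g1 ?v" by (rule g5(2)[OF v])
    also have "\<dots> = g0 (map \<kappa> ?v)"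
    proof (cases "set ?v \<subseteq> Y")
      case True
      then have "set ?v \<subseteq> {0, 2}" unfolding setv setc using A012 AY(2) by (auto simp: Y_def)
      from deg[OF vne vso this] show ?thesis using True by (simp only: g1_def if_True)
    next
      case False then show ?thesis by (simp only: g1_def if_False)
    qed
    also have "\<dots> = s i" unfolding kv by (rule g0s[OF i])
    finally show ?thesis using a by simp
  qed
  ultimately show "\<exists>\<sigma>\<in>cells Q n. \<forall>i\<le>n. bd Q n i \<sigma> = s i" by blast
qed

text \<open>An edge from z' to w is a second initial object of the slice by
  \<open>initial_slice\<close>, so \<sigma> is a retract of it; on sources this makes
  \<open>act Q 1 [0] \<sigma>\<close> a retract of z', and \<open>initial_retract\<close>
  applies.\<close>

lemma initial_of_slice:
  assumes Q: "qcat Q" and z': "initial Q z'" and w: "w \<in> cells Q 0" and \<sigma>: "initial (slice Q w) \<sigma>"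
  shows "initial Q (act Q 1 [0] \<sigma>)"
proof -
  note ss = qcat_sset[OF Q]
  let ?S = "slice Q w"
  note sS = slice_sset[OF ss, of w]
  have s1: "\<sigma> \<in> cells ?S 0" using \<sigma> by (simp add: initial_def)
  have z'c: "z' \<in> cells Q 0" using z' by (simp add: initial_def)
  have f1: "face 1 0 = [1]" "face 1 1 = [0]" "face 2 0 = [1, 2]" "face 2 1 = [0, 2]" "face 2 2 = [0, 1]"
    by (auto simp: face_def upt_rec)
  have "\<exists>a\<in>cells Q 1. \<forall>i\<le>1. bd Q 1 i a = (if i = 0 then w else z')"
  proof (rule initial_fill[OF z' order_refl])
    show "act Q (1 - 1) [0] (if 1 = (0::nat) then w else z') = z'" using sset_id[OF ss z'c] by (simp add: upt_rec)
  qed (use w z'c in \<open>auto simp: compatible_def\<close>)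
  then obtain a where a: "a \<in> cells Q 1" "act Q 1 [1] a = w" "act Q 1 [0] a = z'"
    using f1 by (metis le_numeral_extra(4) zero_le zero_neq_one)
  have ai: "initial ?S a" using initial_slice[OF ss a(1)] z' a by simp
  have ac: "a \<in> cells ?S 0" using ai by (simp add: initial_def)
  have ed: "\<exists>v\<in>cells ?S 1. act ?S 1 [0] v = x \<and> act ?S 1 [1] v = y" if x: "initial ?S x" and y: "y \<in> cells ?S 0" for x y
  proof -
    have xc: "x \<in> cells ?S 0" using x by (simp add: initial_def)
    have "\<exists>v\<in>cells ?S 1. \<forall>i\<le>1. bd ?S 1 i v = (if i = 0 then y else x)"
    proof (rule initial_fill[OF x order_refl])
      show "act ?S (1 - 1) [0] (if 1 = (0::nat) then y else x) = x" using sset_id[OF sS xc] by (simp add: upt_rec)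
    qed (use xc y in \<open>auto simp: compatible_def\<close>)
    then obtain v where v: "v \<in> cells ?S 1" "\<forall>i\<le>1. bd ?S 1 i v = (if i = 0 then y else x)" by blast
    have "act ?S 1 [0] v = x" "act ?S 1 [1] v = y" using v(2)[rule_format, of 0] v(2)[rule_format, of 1] unfolding f1 by simp_all
    then show ?thesis using v(1) by blast
  qed
  obtain v where v: "v \<in> cells ?S 1" "act ?S 1 [0] v = \<sigma>" "act ?S 1 [1] v = a" using ed[OF \<sigma> ac] by blast
  obtain u where u: "u \<in> cells ?S 1" "act ?S 1 [0] u = a" "act ?S 1 [1] u = \<sigma>" using ed[OF ai s1] by blast
  have ic: "idn ?S \<sigma> \<in> cells ?S 1" unfolding idn_def by (rule sset_in[OF sS _ s1]) simp
  have iv: "act ?S 1 [i] (idn ?S \<sigma>) = \<sigma>" if "i \<le> 1" for i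
  proof -
    have "act ?S 1 [i] (act ?S 0 [0, 0] \<sigma>) = act ?S 0 (map (nth [0, 0]) [i]) \<sigma>" by (rule sset_comp[OF sS _ _ s1, where k = 0 and m = 1]) (use that in simp_all)
    also have "map (nth [0, 0]) [i] = [0..<Suc 0]" using that by (cases i) (auto simp: upt_rec)
    finally show ?thesis unfolding idn_def using sset_id[OF sS s1] by simp
  qed
  \<comment> \<open>The boundary of a triangle from \<sigma> to a and back, with the identity as
    long edge; it starts at the initial object \<sigma> of the slice and hence is filled.\<close>
  define s where "s i = (if i = 0 then u else if i = 1 then idn ?S \<sigma> else v)" for i :: nat
  have "compatible ?S 2 {..2} s"
    unfolding compatible_def
  proof (intro conjI ballI impI)
    fix i :: nat assume "i \<in> {..2}" then show "s i \<in> cells ?S (2 - 1)" using u v ic by (simp add: s_def del: slice_simps)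
  next
    fix i j :: nat assume "i \<in> {..2}" "j \<in> {..2}" "i < j"
    then have "i = 0 \<and> j = 1 \<or> i = 0 \<and> j = 2 \<or> i = 1 \<and> j = 2" by auto
    then show "bd ?S (2 - 1) i (s j) = bd ?S (2 - 1) (j - 1) (s i)"
      using u v iv[of 0] iv[of 1] f1 by (auto simp: s_def simp del: slice_simps)
  qed
  then obtain \<xi> where \<xi>: "\<xi> \<in> cells ?S 2" "\<And>i. i \<le> 2 \<Longrightarrow> bd ?S 2 i \<xi> = s i"
    using initial_fill[OF \<sigma>, of 2 s] v(2) by (auto simp: s_def simp del: slice_simps)
  have \<xi>3: "\<xi> \<in> cells Q 3" using \<xi>(1) by (simp add: numeral_3_eq_3 numeral_2_eq_2)
  define \<zeta> where "\<zeta> = act Q 3 [0, 1, 2] \<xi>"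
  have \<zeta>: "\<zeta> \<in> cells Q 2" unfolding \<zeta>_def by (rule sset_in[OF ss _ \<xi>3]) simp
  have S2: "act ?S 2 \<theta> \<xi> = act Q 3 (\<theta> @ [3]) \<xi>" for \<theta> by (simp add: numeral_3_eq_3 numeral_2_eq_2)
  have s1Q: "\<sigma> \<in> cells Q 1" using s1 by simp
  let ?z = "act Q 1 [0] \<sigma>"
  have zc: "?z \<in> cells Q 0" by (rule sset_in[OF ss _ s1Q]) simp
  have e1: "act Q 3 [0, 2, 3] \<xi> = act Q 1 [0, 0, 1] \<sigma>"
    using \<xi>(2)[of 1] f1(4) S2[of "[0, 2]"] by (simp add: s_def idn_def)
  have "act Q 2 [0, 2] \<zeta> = act Q 3 [0, 2] \<xi>"
    unfolding \<zeta>_def using sset_comp[OF ss _ _ \<xi>3, of "[0, 2]" 1 2 "[0, 1, 2]"] by simp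
  also have "\<dots> = act Q 2 [0, 1] (act Q 3 [0, 2, 3] \<xi>)"
    using sset_comp[OF ss _ _ \<xi>3, of "[0, 1]" 1 2 "[0, 2, 3]"] by simp
  also have "\<dots> = act Q 1 [0, 0] \<sigma>"
    unfolding e1 using sset_comp[OF ss _ _ s1Q, of "[0, 1]" 1 2 "[0, 0, 1]"] by simp
  also have "\<dots> = idn Q ?z"
    unfolding idn_def using sset_comp[OF ss _ _ s1Q, of "[0, 0]" 1 0 "[0]"] by simp
  finally have z02: "act Q 2 [0, 2] \<zeta> = idn Q ?z" .
  have "act Q 2 [1] \<zeta> = act Q 3 [1] \<xi>"
    unfolding \<zeta>_def using sset_comp[OF ss _ _ \<xi>3, of "[1]" 0 2 "[0, 1, 2]"] by simp
  also have "\<dots> = act Q 2 [1] (act Q 3 [0, 1, 3] \<xi>)"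
    using sset_comp[OF ss _ _ \<xi>3, of "[1]" 0 2 "[0, 1, 3]"] by simp
  also have "act Q 3 [0, 1, 3] \<xi> = v" using \<xi>(2)[of 2] f1(5) S2[of "[0, 1]"] by (simp add: s_def)
  also have "act Q 2 [1] v = act Q 1 [0] (act Q 2 [1, 2] v)"
  proof -
    have "v \<in> cells Q 2" using v(1) by (simp add: numeral_2_eq_2)
    then show ?thesis using sset_comp[OF ss _ _, of "[0]" 0 1 "[1, 2]" 2 v] by simp
  qed
  also have "act Q 2 [1, 2] v = a" using v(3) by (simp add: numeral_2_eq_2)
  finally have "act Q 2 [1] \<zeta> = z'" using a by simp
  then show ?thesis using initial_retract[OF Q \<zeta> z02 zc] z' by simp
qed

section \<open>Coproducts in slices\<close>

lemma under_cong: "(\<And>i. i < k \<Longrightarrow> p i = p' i) \<Longrightarrow> under C k p = under C k p'"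
  by (auto simp: under_def fun_eq_iff intro!: sset.equality)

lemma face_small [simp]: "face (Suc 0) 0 = [1]" "face (Suc 0) (Suc 0) = [0]" "face 2 0 = [1, 2]"
  by (auto simp: face_def upt_rec)

lemma forget_simps: "forget C 0 \<sigma> = act C 1 [0] \<sigma>" "forget C 1 \<sigma> = act C 2 [0, 1] \<sigma>"
  by (simp_all add: forget_def upt_rec numeral_2_eq_2)

text \<open>By \<open>slice_under\<close>, a coproduct in the slice is an initial object of a slice
  of \<open>under C k p\<close>. The coproduct of the underlying objects, which exists by
  \<open>fc\<close>, is initial in \<open>under C k p\<close> itself, so
  \<open>initial_of_slice\<close> makes the underlying cocone initial.\<close>

lemma coproduct_forget:
  assumes C: "qcat C" and fc: "has_finite_coproducts C" and co: "is_coproduct (slice C x) k e z"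
  shows "is_coproduct C k (\<lambda>i. forget C 1 (e i)) (forget C 0 z)"
proof -
  note ss = qcat_sset[OF C]
  define q where "q i = (if i < k then src (slice C x) (e i) else undefined)" for i
  define p where "p i = act C 1 [0] (q i)" for i
  let ?e = "\<lambda>i. if i < k then e i else undefined"
  have e: "e i \<in> cells (slice C x) 1" if "i < k" for i using co that unfolding is_coproduct_def by blast
  have e2: "e i \<in> cells C 2" if "i < k" for i using e[OF that] by (simp add: numeral_2_eq_2)
  have i1: "initial (under (slice C x) k q) (z, ?e)"
    using co unfolding is_coproduct_under[OF slice_sset[OF ss]] q_def by (subst under_cong[of k _ "\<lambda>i. src (slice C x) (e i)"]) auto
  then have zs: "z \<in> cells C 1" "act C 1 [1] z = x" by (auto simp: initial_def under_cells)
  have xc: "x \<in> cells C 0" using sset_in[OF ss _ zs(1), of "[1]" 0] zs(2) by simp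
  have qe: "q i = act C 2 [0, 2] (e i)" if "i < k" for i using that by (simp add: q_def src_def numeral_2_eq_2)
  have q: "q i \<in> cells C 1 \<and> act C 1 [0] (q i) = p i \<and> act C 1 [1] (q i) = x" if i: "i < k" for i
  proof -
    have "act C 1 [1] (act C 2 [0, 2] (e i)) = act C 2 [2] (e i)"
      using sset_comp[OF ss _ _ e2[OF i], of "[1]" 0 1 "[0, 2]"] by simp
    moreover have "act C 2 [2] (e i) = x" using e[OF i] by (simp add: numeral_2_eq_2)
    ultimately show ?thesis using sset_in[OF ss _ e2[OF i], of "[0, 2]" 1] qe[OF i] by (simp add: p_def)
  qed
  have pc: "p i \<in> cells C 0" if "i < k" for i
    unfolding p_def using q[OF that] by (intro sset_in[OF ss, of "[0]" 0 1]) auto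
  obtain e' z' where ez: "is_coproduct C k e' z'" "\<forall>i<k. src C (e' i) = p i"
    using fc pc unfolding has_finite_coproducts_def by blast
  then have iz: "initial (under C k p) (z', \<lambda>i. if i < k then e' i else undefined)"
    unfolding is_coproduct_under[OF ss] by (subst under_cong[of k p "\<lambda>i. src C (e' i)"]) auto
  have w: "(x, q) \<in> cells (under C k p) 0" unfolding under_cells using xc q by (simp add: q_def)
  have "initial (slice (under C k p) (x, q)) (z, ?e)"
    by (subst slice_under[OF q _ ss]) (use i1 q_def in auto)
  from initial_of_slice[OF under_qcat[OF C] iz w this]
  have "initial (under C k p) (act C 1 [0] z, \<lambda>i. if i < k then act C 2 [0, 1] (e i) else undefined)"
    by (simp add: under_act sh_def numeral_2_eq_2 cong: if_cong)
  moreover have "src C (forget C 1 (e i)) = p i" if i: "i < k" for i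
    unfolding forget_simps src_def p_def qe[OF i]
    using sset_comp[OF ss _ _ e2[OF i], of "[0]" 0 1 "[0, 1]"] sset_comp[OF ss _ _ e2[OF i], of "[0]" 0 1 "[0, 2]"] by simp
  moreover have "forget C 1 (e i) \<in> cells C 1" if "i < k" for i
    unfolding forget_simps by (rule sset_in[OF ss _ e2[OF that]]) simp
  ultimately show ?thesis
    unfolding is_coproduct_under[OF ss] by (subst under_cong[of k "\<lambda>i. src C (forget C 1 (e i))" p]) (simp_all add: forget_simps forget_simps(2)[unfolded One_nat_def] cong: if_cong)
qed

text \<open>The underlying cocone is initial in \<open>under C k p\<close>; a map out of it is then
  initial in the slice over its target, by \<open>initial_slice\<close>.\<close>

lemma coproduct_reflect:
  assumes C: "is_sset C" and e: "\<And>i. i < k \<Longrightarrow> e i \<in> cells (slice C x) 1" and z: "z \<in> cells (slice C x) 0"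
    and t: "\<And>i. i < k \<Longrightarrow> act (slice C x) 1 [1] (e i) = z"
    and co: "is_coproduct C k (\<lambda>i. forget C 1 (e i)) (forget C 0 z)"
  shows "is_coproduct (slice C x) k e z"
proof -
  define q where "q i = (if i < k then src (slice C x) (e i) else undefined)" for i
  define p where "p i = act C 1 [0] (q i)" for i
  let ?e = "\<lambda>i. if i < k then e i else undefined"
  have e2: "e i \<in> cells C 2" if "i < k" for i using e[OF that] by (simp add: numeral_2_eq_2)
  have zs: "z \<in> cells C 1" "act C 1 [1] z = x" using z by auto
  have qe: "q i = act C 2 [0, 2] (e i)" if "i < k" for i using that by (simp add: q_def src_def numeral_2_eq_2)
  have q: "q i \<in> cells C 1 \<and> act C 1 [0] (q i) = p i \<and> act C 1 [1] (q i) = x" if i: "i < k" for i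
  proof -
    have "act C 1 [1] (act C 2 [0, 2] (e i)) = act C 2 [2] (e i)"
      using sset_comp[OF C _ _ e2[OF i], of "[1]" 0 1 "[0, 2]"] by simp
    moreover have "act C 2 [2] (e i) = x" using e[OF i] by (simp add: numeral_2_eq_2)
    ultimately show ?thesis using sset_in[OF C _ e2[OF i], of "[0, 2]" 1] qe[OF i] by (simp add: p_def)
  qed
  have sf: "src C (forget C 1 (e i)) = p i" if i: "i < k" for i
    unfolding forget_simps src_def p_def qe[OF i]
    using sset_comp[OF C _ _ e2[OF i], of "[0]" 0 1 "[0, 1]"] sset_comp[OF C _ _ e2[OF i], of "[0]" 0 1 "[0, 2]"] by simp
  have pe: "act C 2 [0] (e i) = p i" if i: "i < k" for i
    using sset_comp[OF C _ _ e2[OF i], of "[0]" 0 1 "[0, 2]"] by (simp add: p_def qe[OF i])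
  have a0: "act (under C k p) 1 [0] (z, ?e) = (forget C 0 z, \<lambda>i. if i < k then forget C 1 (e i) else undefined)"
    unfolding forget_simps by (simp add: under_act sh_def numeral_2_eq_2 cong: if_cong)
  have a1: "act (under C k p) 1 [1] (z, ?e) = (x, q)"
    using zs qe by (auto simp: under_act sh_def numeral_2_eq_2 q_def fun_eq_iff)
  have "(z, ?e) \<in> cells (under C k p) 1"
    unfolding under_cells using zs e2 t pe by (auto simp: numeral_2_eq_2[symmetric])
  moreover have "initial (under C k p) (forget C 0 z, \<lambda>i. if i < k then forget C 1 (e i) else undefined)"
    using co sf unfolding is_coproduct_under[OF C] by (subst under_cong[of k p "\<lambda>i. src C (forget C 1 (e i))"]) auto
  ultimately have "initial (slice (under C k p) (x, q)) (z, ?e)"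
    using initial_slice[OF under_sset[OF C], of "(z, ?e)" k p] unfolding a0 a1 by blast
  then have "initial (under (slice C x) k q) (z, ?e)"
    by (subst (asm) slice_under[OF q _ C]) (auto simp: q_def)
  then show ?thesis
    unfolding is_coproduct_under[OF slice_sset[OF C]] using e
    by (subst under_cong[of k "\<lambda>i. src (slice C x) (e i)" q]) (auto simp: q_def)
qed

text \<open>The extension of the face opposite to 0 fills the sphere: each other face has the same
  first vertex t and the same 0-th face as the prescribed one, so uniqueness identifies them. The
  criterion is made for nerves of ordinary categories such as \<open>Fin\<close>.\<close>

lemma initial_unique_extension:
  assumes Q: "is_sset Q" and t: "t \<in> cells Q 0"
    and ex: "\<And>n y. y \<in> cells Q n \<Longrightarrow> \<exists>s\<in>cells Q (Suc n). act Q (Suc n) [0] s = t \<and> bd Q (Suc n) 0 s = y"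
    and un: "\<And>n s s'. s \<in> cells Q (Suc n) \<Longrightarrow> s' \<in> cells Q (Suc n) \<Longrightarrow> act Q (Suc n) [0] s = t \<Longrightarrow> act Q (Suc n) [0] s' = t \<Longrightarrow>
      bd Q (Suc n) 0 s = bd Q (Suc n) 0 s' \<Longrightarrow> s = s'"
  shows "initial Q t"
  unfolding initial_def
proof (intro conjI t allI impI)
  fix n s assume n: "1 \<le> n" and "compatible Q n {..n} s \<and> act Q (n - 1) [0] (s n) = t"
  then have s: "compatible Q n {..n} s" and s0: "act Q (n - 1) [0] (s n) = t" by auto
  obtain m where m: "n = Suc m" using n by (cases n) auto
  have c: "s i \<in> cells Q m" if "i \<le> n" for i using s that m by (auto simp: compatible_def)
  obtain \<sigma> where \<sigma>: "\<sigma> \<in> cells Q n" "act Q n [0] \<sigma> = t" "bd Q n 0 \<sigma> = s 0" using ex[OF c[of 0]] m by auto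
  have fo: "face n i \<in> ops m n" if "i \<le> n" for i using face_ops[OF n that] m by simp
  have "bd Q n i \<sigma> = s i" if i: "i \<le> n" for i
  proof (cases "i = 0")
    case False
    have v: "act Q m [0] (bd Q n i \<sigma>) = t"
      using sset_comp[OF Q _ fo[OF i] \<sigma>(1), of "[0]" 0] \<sigma>(2) False i n by (simp add: face_nth)
    show ?thesis
    \<comment> \<open>If the faces are vertices, they have no 0-th face; the only face left is then
      t itself.\<close>
    proof (cases m)
      case 0
      then have "i = n" using False i m by simp
      then show ?thesis using v s0 sset_id[OF Q, of _ 0] c[of n] sset_in[OF Q fo[OF i] \<sigma>(1)] m 0 by (simp add: upt_rec)
    next
      case (Suc l)
      have n2: "2 \<le> n" using m Suc by simp
      have co: "bd Q m i' (s j) = bd Q m (j - 1) (s i')" if "i' < j" "j \<le> n" for i' j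
        using s n2 that m unfolding compatible_def by auto
      have fm: "face m j \<in> ops l m" if "j \<le> m" for j using face_ops[of m j] that Suc by simp
      have vi: "act Q m [0] (s i) = t"
      proof (cases "i = n")
        case True then show ?thesis using s0 m by simp
      next
        case F: False
        then have "i < n" using i by simp
        have "act Q l [0] (bd Q m i (s n)) = act Q m [0] (s n)"
          using sset_comp[OF Q _ fm[of i] c[of n], of "[0]" 0] False \<open>i < n\<close> m Suc by (simp add: face_nth)
        moreover have "act Q l [0] (bd Q m m (s i)) = act Q m [0] (s i)"
          using sset_comp[OF Q _ fm[of m] c[OF i], of "[0]" 0] m Suc by (simp add: face_nth)
        ultimately show ?thesis using co[OF \<open>i < n\<close> order_refl] s0 m by simp
      qed
      have "bd Q m 0 (bd Q n i \<sigma>) = act Q n (map (nth (face n i)) (face m 0)) \<sigma>"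
        by (rule sset_comp[OF Q fm fo[OF i] \<sigma>(1)]) simp
      also have "\<dots> = act Q n (map (nth (face n 0)) (face m (i - 1))) \<sigma>"
        using face_face[of 0 i n] False i n2 m by simp
      also have "\<dots> = bd Q m (i - 1) (s 0)"
        using sset_comp[OF Q fm fo \<sigma>(1), of "i - 1" 0] \<sigma>(3) i m by simp
      also have "\<dots> = bd Q m 0 (s i)" using co[of 0 i] False i by simp
      finally show ?thesis
        using un[of "bd Q n i \<sigma>" l "s i"] sset_in[OF Q fo[OF i] \<sigma>(1)] c[OF i] v vi Suc by simp
    qed
  qed (use \<sigma> in simp)
  then show "\<exists>\<sigma>\<in>cells Q n. \<forall>i\<le>n. bd Q n i \<sigma> = s i" using \<sigma>(1) by blast
qed

section \<open>Finite sets\<close>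

lemma Fin_cells: "F \<in> cells Fin n \<longleftrightarrow> (\<forall>i\<le>n. F i i = [0..<length (F i i)]) \<and>
        (\<forall>i j. i \<le> j \<and> j \<le> n \<longrightarrow> length (F i j) = length (F i i) \<and> set (F i j) \<subseteq> set (F j j)) \<and>
        (\<forall>i j k. i \<le> j \<and> j \<le> k \<and> k \<le> n \<longrightarrow> F i k = map (nth (F j k)) (F i j)) \<and>
        (\<forall>i j. \<not> (i \<le> j \<and> j \<le> n) \<longrightarrow> F i j = [])"
  by (simp add: Fin_def)

lemma FinD:
  assumes "F \<in> cells Fin n"
  shows "i \<le> n \<Longrightarrow> F i i = [0..<length (F i i)]" "i \<le> j \<Longrightarrow> j \<le> n \<Longrightarrow> length (F i j) = length (F i i)"
    "i \<le> j \<Longrightarrow> j \<le> n \<Longrightarrow> set (F i j) \<subseteq> set (F j j)"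
    "i \<le> j \<Longrightarrow> j \<le> k \<Longrightarrow> k \<le> n \<Longrightarrow> F i k = map (nth (F j k)) (F i j)" "\<not> (i \<le> j \<and> j \<le> n) \<Longrightarrow> F i j = []"
  using assms unfolding Fin_cells by blast+

lemma FinI:
  assumes "\<And>i. i \<le> n \<Longrightarrow> F i i = [0..<length (F i i)]" "\<And>i j. i \<le> j \<Longrightarrow> j \<le> n \<Longrightarrow> length (F i j) = length (F i i)"
    "\<And>i j. i \<le> j \<Longrightarrow> j \<le> n \<Longrightarrow> set (F i j) \<subseteq> set (F j j)"
    "\<And>i j k. i \<le> j \<Longrightarrow> j \<le> k \<Longrightarrow> k \<le> n \<Longrightarrow> F i k = map (nth (F j k)) (F i j)" "\<And>i j. \<not> (i \<le> j \<and> j \<le> n) \<Longrightarrow> F i j = []"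
  shows "F \<in> cells Fin n"
  unfolding Fin_cells using assms by blast

lemma Fin_act: "act Fin n \<theta> F i j = (if i \<le> j \<and> j < length \<theta> then F (\<theta> ! i) (\<theta> ! j) else [])"
  by (simp add: Fin_def)

lemma Fin_sset: "is_sset Fin"
proof (rule is_ssetI)
  fix m n \<theta> F assume t: "\<theta> \<in> ops m n" and F: "F \<in> cells Fin n"
  have le: "\<theta> ! i \<le> \<theta> ! j" if "i \<le> j" "j \<le> m" for i j using that t by (auto intro!: sorted_nth_mono simp: opsD)
  note b = ops_nth[OF t] and l = opsD(1)[OF t]
  show "act Fin n \<theta> F \<in> cells Fin m"
  proof (rule FinI)
    fix i j k assume a: "i \<le> j" "j \<le> k" "k \<le> m"
    then show "act Fin n \<theta> F i k = map (nth (act Fin n \<theta> F j k)) (act Fin n \<theta> F i j)"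
      using FinD(4)[OF F le le b, of i j k] l by (simp add: Fin_act)
  next
    fix i assume a: "i \<le> m"
    then show "act Fin n \<theta> F i i = [0..<length (act Fin n \<theta> F i i)]" using FinD(1)[OF F b[OF a]] l by (simp add: Fin_act)
  next
    fix i j assume a: "i \<le> j" "j \<le> m"
    then show "length (act Fin n \<theta> F i j) = length (act Fin n \<theta> F i i)"
      using FinD(2)[OF F le[OF a] b[OF a(2)]] l by (simp add: Fin_act)
    show "set (act Fin n \<theta> F i j) \<subseteq> set (act Fin n \<theta> F j j)"
      using a FinD(3)[OF F le[OF a] b[OF a(2)]] l by (simp add: Fin_act)
  qed (use l in \<open>auto simp: Fin_act\<close>)
next
  fix n F assume F: "F \<in> cells Fin n"
  show "act Fin n [0..<Suc n] F = F"
    by (intro ext) (use FinD(5)[OF F] in \<open>auto simp: Fin_act less_Suc_eq_le simp del: upt_Suc\<close>)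
next
  fix k m n \<psi> \<theta> F assume p: "\<psi> \<in> ops k m" and t: "\<theta> \<in> ops m n" and F: "F \<in> cells Fin n"
  have le: "\<psi> ! i \<le> \<psi> ! j" if "i \<le> j" "j \<le> k" for i j using that p by (auto intro!: sorted_nth_mono simp: opsD)
  show "act Fin m \<psi> (act Fin n \<theta> F) = act Fin n (map (nth \<theta>) \<psi>) F"
    by (intro ext) (use le ops_nth[OF p] opsD(1)[OF p] opsD(1)[OF t] in \<open>auto simp: Fin_act less_Suc_eq_le\<close>)
qed

definition fin_ob :: "nat \<Rightarrow> nat \<Rightarrow> nat \<Rightarrow> nat list" where
  "fin_ob a = (\<lambda>i j. if i = 0 \<and> j = 0 then [0..<a] else [])"

definition fin_chain :: "nat \<Rightarrow> nat \<Rightarrow> nat \<Rightarrow> nat list \<Rightarrow> nat list \<Rightarrow> nat \<Rightarrow> nat \<Rightarrow> nat list" where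
  "fin_chain a b c f g = (\<lambda>i j. if i = 0 \<and> j = 0 then [0..<a] else if i = 1 \<and> j = 1 then [0..<b] else if i = 2 \<and> j = 2 then [0..<c]
     else if i = 0 \<and> j = 1 then f else if i = 1 \<and> j = 2 then g else if i = 0 \<and> j = 2 then map (nth g) f else [])"

lemma map_nth_upt_self: "map (nth [0..<a]) [0..<a] = [0..<a]"
  by (rule nth_equalityI) auto

lemma fin_ob_cell: "fin_ob a \<in> cells Fin 0"
  by (rule FinI) (auto simp: fin_ob_def map_nth_upt_self)

text \<open>A chain of maps, extended on the left by the map with value list f. If \<open>Y j j\<close> is empty, then
  j is beyond the chain or f is empty.\<close>

definition fcons :: "nat list \<Rightarrow> (nat \<Rightarrow> nat \<Rightarrow> nat list) \<Rightarrow> nat \<Rightarrow> nat \<Rightarrow> nat list" where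
  "fcons f Y i j = (case i of 0 \<Rightarrow> (case j of 0 \<Rightarrow> [0..<length f] | Suc j \<Rightarrow> if Y j j = [] then [] else map (nth (Y 0 j)) f)
     | Suc i \<Rightarrow> (case j of 0 \<Rightarrow> [] | Suc j \<Rightarrow> Y i j))"

lemma fcons_simps [simp]: "fcons f Y 0 0 = [0..<length f]" "fcons f Y (Suc i) 0 = []" "fcons f Y (Suc i) (Suc j) = Y i j"
  by (simp_all add: fcons_def)

lemma fcons_0:
  assumes Y: "Y \<in> cells Fin n" and f: "set f \<subseteq> set (Y 0 0)"
  shows "j \<le> n \<Longrightarrow> fcons f Y 0 (Suc j) = map (nth (Y 0 j)) f" "fcons f Y 0 (Suc 0) = f"
proof -
  show 1: "fcons f Y 0 (Suc j) = map (nth (Y 0 j)) f" if j: "j \<le> n" for j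
    using FinD(2,3)[OF Y le0 j] f by (auto simp: fcons_def)
  have "map (nth (Y 0 0)) f = f" using f FinD(1)[OF Y le0] by (intro map_idI) (metis nth_upt add_0 atLeastLessThan_iff set_upt subsetD)
  then show "fcons f Y 0 (Suc 0) = f" using 1[of 0] by simp
qed

lemma fcons_cell:
  assumes Y: "Y \<in> cells Fin n" and f: "set f \<subseteq> set (Y 0 0)"
  shows "fcons f Y \<in> cells Fin (Suc n)"
proof (rule FinI)
  note c = fcons_0[OF Y f]
  have lt: "x < length (Y 0 j)" if "x \<in> set f" "j \<le> n" for x j
    using that f FinD(1)[OF Y le0] FinD(2)[OF Y le0 that(2)] by (metis atLeastLessThan_iff set_upt subsetD)
  show "fcons f Y i i = [0..<length (fcons f Y i i)]" if "i \<le> Suc n" for i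
    using that FinD(1)[OF Y, of "i - 1"] by (cases i) auto
  show "length (fcons f Y i j) = length (fcons f Y i i)" if "i \<le> j" "j \<le> Suc n" for i j
    using that FinD(2)[OF Y, of "i - 1" "j - 1"] c(1)[of "j - 1"] by (cases i; cases j) auto
  show "set (fcons f Y i j) \<subseteq> set (fcons f Y j j)" if "i \<le> j" "j \<le> Suc n" for i j
    using that FinD(3)[OF Y, of "i - 1" "j - 1"] FinD(3)[OF Y, of 0 "j - 1"] c(1)[of "j - 1"] lt[of _ "j - 1"]
    by (cases i; cases j) (auto dest!: nth_mem)
  show "fcons f Y i k = map (nth (fcons f Y j k)) (fcons f Y i j)" if a: "i \<le> j" "j \<le> k" "k \<le> Suc n" for i j k
  proof (cases "j = 0")
    case True
    then show ?thesis using a c(1)[of "k - 1"] map_nth[of f] map_nth_upt_self by (cases k) (auto intro!: nth_equalityI)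
  next
    case False
    then obtain j' k' where j: "j = Suc j'" "k = Suc k'" using a by (metis Suc_le_D not0_implies_Suc)
    then have "map (nth (Y 0 k')) f = map (nth (Y j' k')) (map (nth (Y 0 j')) f)"
      using a FinD(4)[OF Y, of 0 j' k'] lt[of _ j'] by simp
    then show ?thesis using a j c(1) FinD(4)[OF Y, of "i - 1" j' k'] by (cases i) (auto simp del: map_map)
  qed
  show "fcons f Y i j = []" if "\<not> (i \<le> j \<and> j \<le> Suc n)" for i j
    using that FinD(5)[OF Y, of "i - 1" "j - 1"] FinD(5)[OF Y, of "j - 1" "j - 1"] by (cases i; cases j) (auto simp: fcons_def)
qed

lemma fcons_eq:
  assumes F: "F \<in> cells Fin (Suc n)"
  shows "F = fcons (F 0 1) (bd Fin (Suc n) 0 F)" "bd Fin (Suc n) 0 F \<in> cells Fin n"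
    "set (F 0 1) \<subseteq> set (bd Fin (Suc n) 0 F 0 0)"
proof -
  let ?Y = "bd Fin (Suc n) 0 F"
  have y: "?Y i j = F (Suc i) (Suc j)" for i j
    using FinD(5)[OF F] by (auto simp: Fin_act face_nth less_Suc_eq_le)
  show Y: "?Y \<in> cells Fin n" by (rule sset_in[OF Fin_sset _ F]) (use face_ops[of "Suc n" 0] in simp)
  show s: "set (F 0 1) \<subseteq> set (?Y 0 0)" unfolding y using FinD(3)[OF F, of 0 1] by simp
  show "F = fcons (F 0 1) ?Y"
  proof (intro ext)
    fix i j
    have ye: "?Y = (\<lambda>i j. F (Suc i) (Suc j))" using y by (intro ext)
    show "F i j = fcons (F 0 1) ?Y i j"
    proof (cases "i \<le> j \<and> j \<le> Suc n")
      case True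
      then show ?thesis using FinD(1)[OF F le0] FinD(2)[OF F, of 0 1] FinD(4)[OF F, of 0 1 j] fcons_0(1)[OF Y s, of "j - 1"]
        unfolding ye by (cases i; cases j) auto
    next
      case False
      then show ?thesis using FinD(5)[OF F, of i j] FinD(5)[OF fcons_cell[OF Y s], of i j] by simp
    qed
  qed
qed

lemma fcons_acts:
  assumes Y: "Y \<in> cells Fin n"
  shows "bd Fin (Suc n) 0 (fcons f Y) = Y" "act Fin (Suc n) [0] (fcons f Y) = fin_ob (length f)"
    "set g \<subseteq> {..<length f} \<Longrightarrow> bd Fin (Suc (Suc n)) 1 (fcons g (fcons f Y)) = fcons (map (nth f) g) Y"
proof -
  show "bd Fin (Suc n) 0 (fcons f Y) = Y"
    using FinD(5)[OF Y] by (auto simp: fun_eq_iff Fin_act face_nth less_Suc_eq_le)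
  show "act Fin (Suc n) [0] (fcons f Y) = fin_ob (length f)" by (auto simp: fun_eq_iff Fin_act fin_ob_def)
  show "bd Fin (Suc (Suc n)) 1 (fcons g (fcons f Y)) = fcons (map (nth f) g) Y" if g: "set g \<subseteq> {..<length f}"
  proof (intro ext)
    fix i j
    show "bd Fin (Suc (Suc n)) 1 (fcons g (fcons f Y)) i j = fcons (map (nth f) g) Y i j"
      using g FinD(5)[OF Y, of "i - 1" "j - 1"] FinD(5)[OF Y, of "j - 1" "j - 1"]
      by (cases i; cases j) (auto simp: Fin_act face_nth fcons_def)
  qed
qed

lemma fin_map_cell: "length f = a \<Longrightarrow> set f \<subseteq> {..<b} \<Longrightarrow> fin_map a b f \<in> cells Fin 1"
proof -
  assume f: "length f = a" "set f \<subseteq> {..<b}"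
  then have s: "set f \<subseteq> set (fin_ob b 0 0)" by (auto simp: fin_ob_def)
  have "fin_map a b f = fcons f (fin_ob b)"
  proof (intro ext)
    fix i j
    show "fin_map a b f i j = fcons f (fin_ob b) i j"
      using f fcons_0(2)[OF fin_ob_cell s] by (cases i; cases "j - 1"; cases j) (auto simp: fin_map_def fin_ob_def fcons_def)
  qed
  then show ?thesis using fcons_cell[OF fin_ob_cell s] by simp
qed

lemma fin_chain_cell:
  assumes f: "length f = a" "set f \<subseteq> {..<b}" and g: "length g = b" "set g \<subseteq> {..<c}"
  shows "fin_chain a b c f g \<in> cells Fin 2"
proof -
  have s: "set f \<subseteq> set (fin_map b c g 0 0)" using f by (auto simp: fin_map_def)
  note g1 = fin_map_cell[OF g] note c = fcons_0[OF g1 s]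
  have "fin_chain a b c f g i j = fcons f (fin_map b c g) i j" for i j
    using f(1) c(1)[of 1] c(2) by (cases i; cases j) (auto simp: fin_chain_def fin_map_def fcons_def)
  then have "fin_chain a b c f g = fcons f (fin_map b c g)" by (intro ext)
  then show ?thesis using fcons_cell[OF g1 s] by (simp add: numeral_2_eq_2)
qed

lemma fin_acts:
  "act Fin 1 [0] (fin_map a b f) = fin_ob a" "act Fin 1 [1] (fin_map a b f) = fin_ob b"
  "act Fin 2 [0, 1] (fin_chain a b c f g) = fin_map a b f" "act Fin 2 [1, 2] (fin_chain a b c f g) = fin_map b c g"
  "act Fin 2 [0, 2] (fin_chain a b c f g) = fin_map a c (map (nth g) f)"
  "act Fin 0 [0, 0] (fin_ob a) = fin_map a a [0..<a]"
  by (intro ext; auto simp: Fin_act fin_map_def fin_ob_def fin_chain_def nth_Cons less_Suc_eq split: nat.splits)+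

text \<open>A cocone from two points to a chain Y is a pair of elements of its first set, and this
  pair is the value list of the unique map from the two-element set that induces it; so
  \<open>initial_unique_extension\<close> applies.\<close>

lemma Fin_two: "is_coproduct Fin 2 (\<lambda>i. fin_map 1 2 [i]) (fin_ob 2)"
  unfolding is_coproduct_under[OF Fin_sset]
proof
  show "\<forall>i<2. fin_map 1 2 [i] \<in> cells Fin 1" by (intro allI impI fin_map_cell) auto
  have p: "src Fin (fin_map 1 2 [i]) = fin_ob 1" for i by (simp add: src_def fin_acts[unfolded One_nat_def])
  let ?e = "\<lambda>i. if i < 2 then fin_map 1 2 [i] else undefined"
  let ?Q = "under Fin 2 (\<lambda>i. fin_ob 1)"
  have "initial ?Q (fin_ob 2, ?e)"
  proof (rule initial_unique_extension[OF under_sset[OF Fin_sset]])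
    show "(fin_ob 2, ?e) \<in> cells ?Q 0"
      unfolding under_cells using fin_map_cell[of "[i]" 1 2 for i] fin_ob_cell by (auto simp: fin_acts[unfolded One_nat_def])
  next
    fix n y assume "y \<in> cells ?Q n"
    then obtain Y G where y: "y = (Y, G)" and Y: "Y \<in> cells Fin n" and G: "\<And>i. i < 2 \<Longrightarrow> G i \<in> cells Fin (Suc n)"
       "\<And>i. i < 2 \<Longrightarrow> bd Fin (Suc n) 0 (G i) = Y" "\<And>i. i < 2 \<Longrightarrow> act Fin (Suc n) [0] (G i) = fin_ob 1"
       "\<And>i. \<not> i < 2 \<Longrightarrow> G i = undefined"
      by (cases y) (auto simp: under_cells)
    define d where "d i = hd (G i 0 1)" for i
    have d: "G i = fcons [d i] Y" "d i \<in> set (Y 0 0)" if i: "i < 2" for i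
    proof -
      have "G i 0 0 = [0]" using fun_cong[OF fun_cong[OF G(3)[OF i], of 0], of 0] by (simp add: Fin_act fin_ob_def)
      then have "G i 0 1 = [d i]" using FinD(2)[OF G(1)[OF i], of 0 1] by (cases "G i 0 1") (auto simp: d_def)
      then show "G i = fcons [d i] Y" "d i \<in> set (Y 0 0)" using fcons_eq(1,3)[OF G(1)[OF i]] G(2)[OF i] by auto
    qed
    define Y' where "Y' = fcons [d 0, d 1] Y"
    have Y': "Y' \<in> cells Fin (Suc n)" unfolding Y'_def by (rule fcons_cell[OF Y]) (use d in auto)
    have Y0: "Y' 0 0 = [0, 1]" by (simp add: Y'_def upt_rec)
    let ?s = "(Y', \<lambda>i. if i < 2 then fcons [i] Y' else undefined)"
    have e: "set [i] \<subseteq> set (Y' 0 0)" if "i < 2" for i using that Y0 by auto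
    have sc: "?s \<in> cells ?Q (Suc n)" unfolding under_cells using Y' fcons_cell[OF Y' e] fcons_acts[OF Y'] by simp
    have "act Fin (Suc (Suc n)) [0, 1] (fcons [i] Y') = fin_map 1 2 [i]" if "i < 2" for i
      using fcons_0(2)[OF Y' e[OF that]] Y0 by (auto simp: fun_eq_iff Fin_act fin_map_def nth_Cons less_Suc_eq upt_rec split: nat.splits)
    moreover have "act Fin (Suc n) [0] Y' = fin_ob 2" using fcons_acts(2)[OF Y, of "[d 0, d 1]"] by (simp add: Y'_def numeral_2_eq_2)
    ultimately have "act ?Q (Suc n) [0] ?s = (fin_ob 2, ?e)" unfolding under_act by (auto simp: fun_eq_iff sh_def)
    moreover have "fcons [[d 0, d 1] ! i] Y = G i" if "i < 2" for i using d(1)[OF that] that by (auto simp: less_2_cases_iff)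
    then have "bd ?Q (Suc n) 0 ?s = y"
      unfolding under_act y sh_face[OF le0] using G(4) fcons_acts(1)[OF Y] fcons_acts(3)[OF Y, of "[i]" "[d 0, d 1]" for i]
      by (auto simp: fun_eq_iff Y'_def)
    ultimately show "\<exists>s\<in>cells ?Q (Suc n). act ?Q (Suc n) [0] s = (fin_ob 2, ?e) \<and> bd ?Q (Suc n) 0 s = y" using sc by blast
  next
    fix n s s' assume s: "s \<in> cells ?Q (Suc n)" "s' \<in> cells ?Q (Suc n)"
      and v: "act ?Q (Suc n) [0] s = (fin_ob 2, ?e)" "act ?Q (Suc n) [0] s' = (fin_ob 2, ?e)"
      and d: "bd ?Q (Suc n) 0 s = bd ?Q (Suc n) 0 s'"
    \<comment> \<open>An extension is determined by the value list f of its first map, and f can be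
      read off the 0-th face.\<close>
    have main: "\<exists>f Z. fst s = fcons f Z \<and> length f = 2 \<and> Z \<in> cells Fin n \<and> set f \<subseteq> set (Z 0 0) \<and> (\<forall>i. snd s i = (if i < 2 then fcons [i] (fst s) else undefined)) \<and>
        bd ?Q (Suc n) 0 s = (Z, \<lambda>i. if i < 2 then fcons [f ! i] Z else undefined)"
      if s: "s \<in> cells ?Q (Suc n)" and v: "act ?Q (Suc n) [0] s = (fin_ob 2, ?e)" for s
    proof -
      obtain Y G where yg: "s = (Y, G)" by (cases s)
      have Y: "Y \<in> cells Fin (Suc n)" and G: "\<And>i. i < 2 \<Longrightarrow> G i \<in> cells Fin (Suc (Suc n))" "\<And>i. i < 2 \<Longrightarrow> bd Fin (Suc (Suc n)) 0 (G i) = Y"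
        "\<And>i. \<not> i < 2 \<Longrightarrow> G i = undefined"
        using s unfolding yg under_cells by meson+
      have vY: "act Fin (Suc n) [0] Y = fin_ob 2"
        and "(\<lambda>i. if i < 2 then act Fin (Suc (Suc n)) (sh [0]) (G i) else undefined) = ?e"
        using v unfolding yg under_act by simp_all
      then have vG: "act Fin (Suc (Suc n)) (sh [0]) (G i) = fin_map 1 2 [i]" if "i < 2" for i using that by meson
      define f Z where "f = Y 0 1" and "Z = bd Fin (Suc n) 0 Y"
      have YZ: "Y = fcons f Z" "Z \<in> cells Fin n" "set f \<subseteq> set (Z 0 0)" using fcons_eq[OF Y] by (simp_all only: f_def Z_def)
      have "Y 0 0 = [0, 1]" using fun_cong[OF fun_cong[OF vY, of 0], of 0] by (simp add: Fin_act fin_ob_def upt_rec)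
      then have lf: "length f = 2" using FinD(2)[OF Y, of 0 1] by (simp add: f_def)
      have "G i 0 1 = [i]" if "i < 2" for i using fun_cong[OF fun_cong[OF vG[OF that], of 0], of 1] by (simp add: Fin_act sh_def fin_map_def)
      then have Gi: "G i = fcons [i] Y" if "i < 2" for i using fcons_eq(1)[OF G(1)[OF that]] G(2)[OF that] that by simp
      have a: "bd Fin (Suc (Suc n)) 1 (G i) = fcons [f ! i] Z" if "i < 2" for i
        using fcons_acts(3)[OF YZ(2), of "[i]" f] lf that unfolding Gi[OF that] YZ(1)[symmetric] by simp
      have "bd ?Q (Suc n) 0 s = (Z, \<lambda>i. if i < 2 then fcons [f ! i] Z else undefined)"
        unfolding yg under_act sh_face[OF le0] Z_def[symmetric] using a by (simp add: fun_eq_iff)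
      then show ?thesis using YZ lf Gi G(3) unfolding yg by auto
    qed
    obtain f Z where f: "fst s = fcons f Z" "length f = 2" "Z \<in> cells Fin n" "set f \<subseteq> set (Z 0 0)" "\<forall>i. snd s i = (if i < 2 then fcons [i] (fst s) else undefined)"
      "bd ?Q (Suc n) 0 s = (Z, \<lambda>i. if i < 2 then fcons [f ! i] Z else undefined)" using main[OF s(1) v(1)] by blast
    obtain f' Z' where f': "fst s' = fcons f' Z'" "length f' = 2" "Z' \<in> cells Fin n" "set f' \<subseteq> set (Z' 0 0)" "\<forall>i. snd s' i = (if i < 2 then fcons [i] (fst s') else undefined)"
      "bd ?Q (Suc n) 0 s' = (Z', \<lambda>i. if i < 2 then fcons [f' ! i] Z' else undefined)" using main[OF s(2) v(2)] by blast
    have Z: "Z = Z'" and "(\<lambda>i. if i < 2 then fcons [f ! i] Z else undefined) = (\<lambda>i. if i < 2 then fcons [f' ! i] Z else undefined)"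
      using d unfolding f(6) f'(6) by auto
    then have c: "fcons [f ! i] Z = fcons [f' ! i] Z" if "i < 2" for i using that by meson
    have "f ! i = f' ! i" if i: "i < 2" for i
    proof -
      have "set [f ! i] \<subseteq> set (Z 0 0)" "set [f' ! i] \<subseteq> set (Z 0 0)" using f(2,4) f'(2,4) i Z by (auto dest!: subsetD)
      then show ?thesis using fcons_0(2)[OF f(3)] c[OF i] by (metis list.inject)
    qed
    then have "f = f'" using f(2) f'(2) by (intro nth_equalityI) auto
    then have "fst s = fst s'" using f(1) f'(1) Z by simp
    moreover have "snd s = snd s'" using f(5) f'(5) calculation by (intro ext) simp
    ultimately show "s = s'" by (rule prod_eqI)
  qed
  then show "initial (under Fin 2 (\<lambda>i. src Fin (fin_map 1 2 [i]))) (fin_ob 2, ?e)" unfolding p .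
qed

section \<open>Spans in a fibre\<close>

lemma idn_in: "is_sset C \<Longrightarrow> x \<in> cells C 0 \<Longrightarrow> idn C x \<in> cells C 1"
  unfolding idn_def by (rule sset_in) (auto simp: ops_def)

lemma act_idn: "is_sset C \<Longrightarrow> x \<in> cells C 0 \<Longrightarrow> i \<le> 1 \<Longrightarrow> act C 1 [i] (idn C x) = x"
  unfolding idn_def using sset_comp[of C "[i]" 0 1 "[0, 0]" 0 x] sset_id[of C x 0] by (cases "i = 0") (auto simp: ops_def)

lemma triangle_id_left: "is_sset C \<Longrightarrow> f \<in> cells C 1 \<Longrightarrow> triangle C (idn C (src C f)) f f"
  unfolding triangle_def
proof (intro bexI conjI)
  assume C: "is_sset C" and f: "f \<in> cells C 1"
  have o: "[0, 0, 1] \<in> ops 2 1" by (auto simp: ops_def)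
  show "act C 1 [0, 0, 1] f \<in> cells C 2" by (rule sset_in[OF C o f])
  show "act C 2 [0, 1] (act C 1 [0, 0, 1] f) = idn C (src C f)"
    using sset_comp[OF C _ o f, of "[0, 1]" 1] sset_comp[OF C _ _ f, of "[0, 0]" 1 0 "[0]"] by (simp add: idn_def src_def ops_def)
  show "act C 2 [1, 2] (act C 1 [0, 0, 1] f) = f" "act C 2 [0, 2] (act C 1 [0, 0, 1] f) = f"
    using sset_comp[OF C _ o f, of "[1, 2]" 1] sset_comp[OF C _ o f, of "[0, 2]" 1] sset_id[OF C f] by (simp_all add: ops_def upt_rec)
qed

lemma triangle_id_right: "is_sset C \<Longrightarrow> f \<in> cells C 1 \<Longrightarrow> triangle C f (idn C (tgt C f)) f"
  unfolding triangle_def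
proof (intro bexI conjI)
  assume C: "is_sset C" and f: "f \<in> cells C 1"
  have o: "[0, 1, 1] \<in> ops 2 1" by (auto simp: ops_def)
  show "act C 1 [0, 1, 1] f \<in> cells C 2" by (rule sset_in[OF C o f])
  show "act C 2 [1, 2] (act C 1 [0, 1, 1] f) = idn C (tgt C f)"
    using sset_comp[OF C _ o f, of "[1, 2]" 1] sset_comp[OF C _ _ f, of "[0, 0]" 1 0 "[1]"] by (simp add: idn_def tgt_def ops_def)
  show "act C 2 [0, 1] (act C 1 [0, 1, 1] f) = f" "act C 2 [0, 2] (act C 1 [0, 1, 1] f) = f"
    using sset_comp[OF C _ o f, of "[0, 1]" 1] sset_comp[OF C _ o f, of "[0, 2]" 1] sset_id[OF C f] by (simp_all add: ops_def upt_rec)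
qed

lemma idn_equiv: "is_sset C \<Longrightarrow> x \<in> cells C 0 \<Longrightarrow> is_equiv C (idn C x)"
  unfolding is_equiv_def using triangle_id_left[of C "idn C x"] idn_in[of C x] act_idn[of C x]
  by (auto simp: src_def tgt_def)

lemma act_degenerate:
  assumes C: "is_sset C" and s: "\<sigma> \<in> cells C n" and i: "i \<le> n"
  shows "act C n [i, i] \<sigma> = idn C (act C n [i] \<sigma>)" "act C n [i] \<sigma> \<in> cells C 0"
  unfolding idn_def using sset_comp[OF C _ _ s, of "[0, 0]" 1 0 "[i]"] sset_in[OF C _ s, of "[i]" 0] i by (simp_all add: ops_def)

section \<open>Diagrams on twisted arrow categories\<close>

lemma Tw_cells: "v \<in> cells (Tw n) l \<longleftrightarrow> length v = Suc l \<and> (\<forall>i\<le>l. fst (v ! i) \<le> snd (v ! i) \<and> snd (v ! i) \<le> n) \<and>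
    (\<forall>i j. i < j \<longrightarrow> j \<le> l \<longrightarrow> fst (v ! i) \<le> fst (v ! j) \<and> snd (v ! j) \<le> snd (v ! i))"
  unfolding Tw_def sub_interval_def by (auto simp: sorted_wrt_iff_nth_less less_Suc_eq_le subset_iff in_set_conv_nth split: prod.splits) (metis prod.collapse)+

lemma Tw_act: "act (Tw n) l \<theta> v = map (nth v) \<theta>" by (simp add: Tw_def)

lemma Tw_in: "v \<in> cells (Tw n) l \<Longrightarrow> \<theta> \<in> ops m l \<Longrightarrow> map (nth v) \<theta> \<in> cells (Tw n) m"
  unfolding Tw_def by (rule nerve_act) (auto simp: sub_interval_def)

text \<open>The monotone vertex maps from \<open>Tw n\<close> to the k-simplex. Reindexing a simplex
  by such a map is \<open>tw\<close> below, with \<open>bw\<close> and \<open>fw\<close> as the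
  cases n - j and i.\<close>

definition mono_tw :: "nat \<Rightarrow> nat \<Rightarrow> (nat \<times> nat \<Rightarrow> nat) \<Rightarrow> bool" where
  "mono_tw n k g \<longleftrightarrow> (\<forall>i i' j' j. i \<le> i' \<and> i' \<le> j' \<and> j' \<le> j \<and> j \<le> n \<longrightarrow> g (i, j) \<le> g (i', j') \<and> g (i', j') \<le> k)"

lemma mono_tw_ops: "mono_tw n k g \<Longrightarrow> v \<in> cells (Tw n) l \<Longrightarrow> map g v \<in> ops l k"
proof -
  assume g: "mono_tw n k g" and v: "v \<in> cells (Tw n) l"
  have "g (v ! i) \<le> g (v ! j) \<and> g (v ! j) \<le> k" if "i \<le> j" "j \<le> l" for i j
  proof -
    have "fst (v ! i) \<le> fst (v ! j)" "snd (v ! j) \<le> snd (v ! i)" using v that by (cases "i = j"; auto simp: Tw_cells)+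
    moreover have "fst (v ! j) \<le> snd (v ! j)" "snd (v ! i) \<le> n" using v that by (auto simp: Tw_cells)
    ultimately show ?thesis
      using g[unfolded mono_tw_def, rule_format, of "fst (v ! i)" "fst (v ! j)" "snd (v ! j)" "snd (v ! i)"] by simp
  qed
  then have "sorted (map g v)" "\<forall>i\<le>l. g (v ! i) \<le> k" using v unfolding sorted_iff_nth_mono by (auto simp: Tw_cells less_Suc_eq_le)
  then show ?thesis using v unfolding ops_def by (auto simp: Tw_cells in_set_conv_nth less_Suc_eq_le image_iff) metis
qed

definition tw :: "'c sset \<Rightarrow> nat \<Rightarrow> (nat \<times> nat \<Rightarrow> nat) \<Rightarrow> nat \<Rightarrow> 'c \<Rightarrow> 'c spn" where
  "tw C n g k \<sigma> = srestrict (Tw n) (\<lambda>l v. act C k (map g v) \<sigma>)"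

lemma tw_smaps: "is_sset C \<Longrightarrow> \<sigma> \<in> cells C k \<Longrightarrow> mono_tw n k g \<Longrightarrow> tw C n g k \<sigma> \<in> smaps (Tw n) C"
  unfolding tw_def
proof (rule srestrict_smaps)
  assume C: "is_sset C" and s: "\<sigma> \<in> cells C k" and g: "mono_tw n k g"
  fix l v assume v: "v \<in> cells (Tw n) l"
  note o = mono_tw_ops[OF g v]
  show "act C k (map g v) \<sigma> \<in> cells C l" by (rule sset_in[OF C o s])
  fix m \<theta> assume t: "\<theta> \<in> ops m l"
  show "act (Tw n) l \<theta> v \<in> cells (Tw n) m" unfolding Tw_act by (rule Tw_in[OF v t])
  have "map g (map (nth v) \<theta>) = map (nth (map g v)) \<theta>"
    using ops_nth[OF t] opsD(1)[OF t] v by (intro nth_equalityI) (auto simp: Tw_cells less_Suc_eq_le)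
  then show "act C k (map g (act (Tw n) l \<theta> v)) \<sigma> = act C l \<theta> (act C k (map g v) \<sigma>)"
    unfolding Tw_act sset_comp[OF C t o s] by (rule arg_cong)
qed

lemma bw_tw: "bw C n \<sigma> = tw C n (\<lambda>p. n - snd p) n \<sigma>" and fw_tw: "fw C n \<sigma> = tw C n fst n \<sigma>"
  by (simp_all add: bw_def fw_def tw_def)

lemma mono_tw_bw: "mono_tw n n (\<lambda>p. n - snd p)" and mono_tw_fw: "mono_tw n n fst"
  by (auto simp: mono_tw_def)

lemma tw_edge: "i \<le> i' \<Longrightarrow> i' \<le> j' \<Longrightarrow> j' \<le> j \<Longrightarrow> j \<le> n \<Longrightarrow> tw C n g k \<sigma> 1 [(i, j), (i', j')] = act C k [g (i, j), g (i', j')] \<sigma>"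
proof -
  assume "i \<le> i'" "i' \<le> j'" "j' \<le> j" "j \<le> n"
  then have "[(i, j), (i', j')] \<in> cells (Tw n) 1" by (auto simp: Tw_cells nth_Cons split: nat.splits)
  then show ?thesis unfolding tw_def by simp
qed

lemma tw_square_in: "v \<in> cells square m \<Longrightarrow> i \<le> i' \<Longrightarrow> i' \<le> j' \<Longrightarrow> j' \<le> j \<Longrightarrow> j \<le> n \<Longrightarrow>
    map (\<lambda>(a, b). (if a = 0 then i else i', if b = 0 then j else j')) v \<in> cells (Tw n) m"
  unfolding square_def Tw_def sub_interval_def le2_def by (auto simp: sorted_wrt_map split: if_splits intro: sorted_wrt_mono_rel[rotated])

text \<open>In a span made of backward maps the objects depend on the right end of an interval only,
  so its squares are degenerate in the direction of the left end, and
  \<open>snd_square_pullback\<close> makes them cartesian.\<close>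

lemma bw_span:
  assumes D: "qcat D" and W: "\<And>x. x \<in> cells D 0 \<Longrightarrow> idn D x \<in> W" and t: "\<tau> \<in> cells D k"
  shows "bw D k \<tau> \<in> cells (Span D W) k"
proof -
  note ss = qcat_sset[OF D]
  have sm: "bw D k \<tau> \<in> smaps (Tw k) D" unfolding bw_tw by (rule tw_smaps[OF ss t mono_tw_bw])
  have "bw D k \<tau> 1 [(i, j), (i', j)] \<in> W" if "i \<le> i' \<and> i' \<le> j \<and> j \<le> k" for i i' j
    unfolding bw_tw using tw_edge[of i i' j j k D "\<lambda>p. k - snd p" k \<tau>] act_degenerate[OF ss t, of "k - j"] W that by simp
  moreover have "is_pullback D (tw_square (bw D k \<tau>) i i' j' j)" if a: "i < i' \<and> i' \<le> j' \<and> j' < j \<and> j \<le> k" for i i' j' j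
  proof -
    have o: "[k - j, k - j'] \<in> ops 1 k" using a by (auto simp: ops_def)
    have "tw_square (bw D k \<tau>) i i' j' j = snd_square D (act D k [k - j, k - j'] \<tau>)"
      unfolding tw_square_def snd_square_def
    proof (intro ext)
      fix m v
      let ?f = "\<lambda>(a, b). (if a = 0 then i else i', if b = 0 then j else j')"
      have "bw D k \<tau> m (map ?f v) = act D 1 (map snd v) (act D k [k - j, k - j'] \<tau>)" if v: "v \<in> cells square m"
      proof -
        have sv: "map snd v \<in> ops m 1" by (rule square_cells_ops(2)[OF v])
        have "bw D k \<tau> m (map ?f v) = act D k (map (\<lambda>p. k - snd p) (map ?f v)) \<tau>"
          unfolding bw_def using tw_square_in[OF v, of i i' j' j k] a by simp
        moreover have "map (\<lambda>p. k - snd p) (map ?f v) = map (nth [k - j, k - j']) (map snd v)"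
          using v by (auto simp: square_def)
        ultimately show ?thesis unfolding sset_comp[OF ss sv o t] by metis
      qed
      then show "srestrict square (\<lambda>m v. bw D k \<tau> m (map ?f v)) m v =
        srestrict square (\<lambda>m v. act D 1 (map snd v) (act D k [k - j, k - j'] \<tau>)) m v" unfolding srestrict_def by simp
    qed
    then show ?thesis using snd_square_pullback[OF D sset_in[OF ss o t]] by simp
  qed
  ultimately show ?thesis using sm unfolding Span_def by simp
qed

lemma Span_act: "\<theta> \<in> ops m n \<Longrightarrow> act (Span C W) n \<theta> h = srestrict (Tw m) (\<lambda>l v. h l (map (map_prod (nth \<theta>) (nth \<theta>)) v))"
  by (simp add: Span_def opsD)

lemma Tw_map: "\<theta> \<in> ops m n \<Longrightarrow> v \<in> cells (Tw m) l \<Longrightarrow> map (map_prod (nth \<theta>) (nth \<theta>)) v \<in> cells (Tw n) l"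
proof -
  assume t: "\<theta> \<in> ops m n" and v: "v \<in> cells (Tw m) l"
  have le: "\<theta> ! a \<le> \<theta> ! b" if "a \<le> b" "b \<le> m" for a b using sorted_nth_mono[OF opsD(2)[OF t]] opsD(1)[OF t] that by simp
  have "fst (v ! i) \<le> snd (v ! i)" "snd (v ! i) \<le> m" if "i \<le> l" for i using v that by (auto simp: Tw_cells)
  moreover have "fst (v ! i) \<le> fst (v ! j)" "snd (v ! j) \<le> snd (v ! i)" if "i < j" "j \<le> l" for i j using v that by (auto simp: Tw_cells)
  ultimately show ?thesis using v le ops_nth[OF t] unfolding Tw_cells
    by (auto simp: less_Suc_eq_le)
qed

text \<open>The index n - j of \<open>bw\<close> and the reversal \<open>flip\<close> cancel; for
  this reason \<open>bw\<close> takes values in the opposite of the span category.\<close>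

lemma bw_act:
  assumes C: "is_sset C" and s: "\<sigma> \<in> cells C n" and t: "\<theta> \<in> ops m n"
  shows "act (op_sset (Span C W)) n \<theta> (bw C n \<sigma>) = bw C m (act C n \<theta> \<sigma>)"
  unfolding op_sset_simps Span_act[OF flip_ops[OF t]] bw_def
proof (intro ext)
  fix l v
  have "srestrict (Tw n) (\<lambda>l v. act C n (map (\<lambda>p. n - snd p) v) \<sigma>) l (map (map_prod (nth (flip n \<theta>)) (nth (flip n \<theta>))) v) =
     act C m (map (\<lambda>p. m - snd p) v) (act C n \<theta> \<sigma>)" if v: "v \<in> cells (Tw m) l"
  proof -
    have "map (\<lambda>p. n - snd p) (map (map_prod (nth (flip n \<theta>)) (nth (flip n \<theta>))) v) = map (nth \<theta>) (map (\<lambda>p. m - snd p) v)"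
    proof -
      have "n - flip n \<theta> ! snd p = \<theta> ! (m - snd p)" if "p \<in> set v" for p
      proof -
        have "snd p \<le> m" using v that by (auto simp: Tw_cells in_set_conv_nth less_Suc_eq_le)
        then show ?thesis using flip_nth[OF t, of "snd p"] ops_nth[OF t, of "m - snd p"] by simp
      qed
      then show ?thesis by simp
    qed
    then show ?thesis unfolding srestrict_in[OF Tw_map[OF flip_ops[OF t] v]] sset_comp[OF C mono_tw_ops[OF mono_tw_bw v] t s] by (rule arg_cong)
  qed
  then show "srestrict (Tw m) (\<lambda>l v. srestrict (Tw n) (\<lambda>l v. act C n (map (\<lambda>p. n - snd p) v) \<sigma>) l (map (map_prod (nth (flip n \<theta>)) (nth (flip n \<theta>))) v)) l v =
    srestrict (Tw m) (\<lambda>l v. act C m (map (\<lambda>p. m - snd p) v) (act C n \<theta> \<sigma>)) l v" unfolding srestrict_def[of "Tw m"] by simp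
qed

lemma slice_arr_ops:
  assumes p: "\<psi> \<in> ops m k" "\<epsilon> \<in> ops m 1"
  shows "map2 (\<lambda>i a. if a = 0 then i else Suc k) \<psi> \<epsilon> \<in> ops m (Suc k)"
proof -
  let ?v = "map2 (\<lambda>i a. if a = 0 then i else Suc k) \<psi> \<epsilon>"
  have v: "?v ! i = (if \<epsilon> ! i = 0 then \<psi> ! i else Suc k)" if "i \<le> m" for i using opsD(1)[OF p(1)] opsD(1)[OF p(2)] that by simp
  have l: "length ?v = Suc m" using opsD(1)[OF p(1)] opsD(1)[OF p(2)] by simp
  have "?v ! i \<le> ?v ! j" if ij: "i \<le> j" "j \<le> m" for i j
  proof -
    have "\<psi> ! i \<le> \<psi> ! j" "\<epsilon> ! i \<le> \<epsilon> ! j" using sorted_nth_mono[OF opsD(2)[OF p(1)]] sorted_nth_mono[OF opsD(2)[OF p(2)]] opsD(1)[OF p(1)] opsD(1)[OF p(2)] ij by auto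
    then show ?thesis using v[of i] v[of j] ij ops_nth[OF p(1), of i] by auto
  qed
  moreover have "?v ! i \<le> Suc k" if "i \<le> m" for i using v[OF that] ops_nth[OF p(1) that] by simp
  ultimately show ?thesis unfolding ops_def sorted_iff_nth_mono using l by (auto simp only: in_set_conv_nth mem_Collect_eq less_Suc_eq_le atMost_iff)
qed

lemma slice_arr_cell:
  assumes C: "is_sset C" and s: "\<sigma> \<in> cells (slice C x) k"
  shows "slice_arr C k \<sigma> \<in> cells (Ar C) k"
  unfolding Ar_cells slice_arr_def
proof (rule srestrict_smaps)
  let ?g = "\<lambda>i a::nat. if a = 0 then i else Suc k"
  have sc: "\<sigma> \<in> cells C (Suc k)" using s by simp
  note o = slice_arr_ops
  fix m y assume "y \<in> cells (simplex k \<otimes>\<^sub>s simplex 1) m"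
  then obtain \<psi> \<epsilon> where y: "y = (\<psi>, \<epsilon>)" and p: "\<psi> \<in> ops m k" "\<epsilon> \<in> ops m 1" by auto
  show "(case y of (\<psi>, \<epsilon>) \<Rightarrow> act C (Suc k) (map2 ?g \<psi> \<epsilon>) \<sigma>) \<in> cells C m" unfolding y using sset_in[OF C o[OF p] sc] by simp
  fix l \<theta> assume t: "\<theta> \<in> ops l m"
  show "act (simplex k \<otimes>\<^sub>s simplex 1) m \<theta> y \<in> cells (simplex k \<otimes>\<^sub>s simplex 1) l" unfolding y using ops_comp[OF t p(1)] ops_comp[OF t p(2)] by simp
  have "map2 ?g (map (nth \<psi>) \<theta>) (map (nth \<epsilon>) \<theta>) = map (nth (map2 ?g \<psi> \<epsilon>)) \<theta>"
    using ops_nth[OF t] opsD(1)[OF t] opsD(1)[OF p(1)] opsD(1)[OF p(2)] by (intro nth_equalityI) (auto simp: less_Suc_eq_le)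
  then show "(case act (simplex k \<otimes>\<^sub>s simplex 1) m \<theta> y of (\<psi>, \<epsilon>) \<Rightarrow> act C (Suc k) (map2 ?g \<psi> \<epsilon>) \<sigma>) =
    act C m \<theta> (case y of (\<psi>, \<epsilon>) \<Rightarrow> act C (Suc k) (map2 ?g \<psi> \<epsilon>) \<sigma>)"
    unfolding y using sset_comp[OF C t o[OF p] sc] by simp
qed

lemma slice_arr_app: "\<psi> \<in> ops m k \<Longrightarrow> \<epsilon> \<in> ops m 1 \<Longrightarrow>
    slice_arr C k \<sigma> m (\<psi>, \<epsilon>) = act C (Suc k) (map2 (\<lambda>i a. if a = 0 then i else Suc k) \<psi> \<epsilon>) \<sigma>"
  by (simp add: slice_arr_def)

lemma slice_arr_act:
  assumes C: "is_sset C" and s: "\<sigma> \<in> cells (slice C x) k" and t: "\<theta> \<in> ops m k"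
  shows "slice_arr C m (act (slice C x) k \<theta> \<sigma>) = act (Ar C) k \<theta> (slice_arr C k \<sigma>)"
proof (rule Ar_ext)
  have A: "is_sset (Ar C)" unfolding Ar_def by (rule fun_is_sset)
  show "slice_arr C m (act (slice C x) k \<theta> \<sigma>) \<in> cells (Ar C) m"
    by (rule slice_arr_cell[OF C sset_in[OF slice_sset[OF C] t s]])
  show "act (Ar C) k \<theta> (slice_arr C k \<sigma>) \<in> cells (Ar C) m" by (rule sset_in[OF A t slice_arr_cell[OF C s]])
  fix j \<psi> \<epsilon> assume p: "\<psi> \<in> ops j m" "\<epsilon> \<in> ops j 1"
  let ?g = "\<lambda>k i (a::nat). if a = 0 then i else Suc k"
  note o = slice_arr_ops[OF p]
  have to: "\<theta> @ [Suc k] \<in> ops (Suc m) (Suc k)" using t by (auto simp: ops_def sorted_append subset_iff)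
  have e: "map (nth (\<theta> @ [Suc k])) (map2 (?g m) \<psi> \<epsilon>) = map2 (?g k) (map (nth \<theta>) \<psi>) \<epsilon>"
    using opsD(1)[OF p(1)] opsD(1)[OF p(2)] opsD(1)[OF t] ops_nth[OF p(1)] by (intro nth_equalityI) (auto simp: nth_append less_Suc_eq_le)
  have "slice_arr C m (act (slice C x) k \<theta> \<sigma>) j (\<psi>, \<epsilon>) = act C (Suc m) (map2 (?g m) \<psi> \<epsilon>) (act C (Suc k) (\<theta> @ [Suc k]) \<sigma>)"
    by (simp add: slice_arr_app[OF p])
  also have "\<dots> = act C (Suc k) (map2 (?g k) (map (nth \<theta>) \<psi>) \<epsilon>) \<sigma>"
    using sset_comp[OF C o to, of \<sigma>] s e by simp
  finally show "slice_arr C m (act (slice C x) k \<theta> \<sigma>) j (\<psi>, \<epsilon>) = act (Ar C) k \<theta> (slice_arr C k \<sigma>) j (\<psi>, \<epsilon>)"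
    by (simp add: Ar_act_app[OF t p] slice_arr_app[OF ops_comp[OF p(1) t] p(2)])
qed

definition cst :: "'c sset \<Rightarrow> 'c \<Rightarrow> nat \<Rightarrow> 'c" where "cst C x n = act C 0 (replicate (Suc n) 0) x"

lemma cst_in: "is_sset C \<Longrightarrow> x \<in> cells C 0 \<Longrightarrow> cst C x n \<in> cells C n"
  unfolding cst_def by (rule sset_in[OF _ ops_replicate]) auto

lemma cst_act: "is_sset C \<Longrightarrow> x \<in> cells C 0 \<Longrightarrow> \<theta> \<in> ops m n \<Longrightarrow> act C n \<theta> (cst C x n) = cst C x m"
  unfolding cst_def using sset_comp[of C \<theta> m n "replicate (Suc n) 0" 0 x] ops_replicate[of 0 0 n] by (simp only: map_nth_replicate)

lemma cst_vertex: "is_sset C \<Longrightarrow> \<sigma> \<in> cells C n \<Longrightarrow> i \<le> n \<Longrightarrow> act C n (replicate (Suc m) i) \<sigma> = cst C (act C n [i] \<sigma>) m"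
  unfolding cst_def using sset_comp[of C "replicate (Suc m) 0" m 0 "[i]" n \<sigma>] ops_replicate[of 0 0 m]
  by (simp add: map_replicate_const ops_def del: replicate_Suc)

lemma ev_slice_arr:
  assumes C: "is_sset C" and s: "\<sigma> \<in> cells (slice C x) k"
  shows "ev 0 k (slice_arr C k \<sigma>) = forget C k \<sigma>" "ev 1 k (slice_arr C k \<sigma>) = cst C x k"
proof -
  have 0: "map2 (\<lambda>i a. if a = 0 then i else Suc k) [0..<Suc k] (replicate (Suc k) (0::nat)) = [0..<Suc k]"
    by (intro nth_equalityI) (auto simp del: upt_Suc replicate_Suc)
  show "ev 0 k (slice_arr C k \<sigma>) = forget C k \<sigma>"
    unfolding ev_def forget_def slice_arr_app[OF ops_id ops_replicate[OF le0]] 0 ..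
  have 1: "map2 (\<lambda>i a. if a = 0 then i else Suc k) [0..<Suc k] (replicate (Suc k) (1::nat)) = replicate (Suc k) (Suc k)"
    by (intro nth_equalityI) (auto simp del: upt_Suc replicate_Suc)
  show "ev 1 k (slice_arr C k \<sigma>) = cst C x k"
    unfolding ev_def slice_arr_app[OF ops_id ops_replicate[OF order_refl]] 1 using cst_vertex[OF C, of \<sigma> "Suc k" "Suc k" k] s by simp
qed

text \<open>As a square, the identity of an arrow is a \<open>snd_square\<close>, hence a
  pullback.\<close>

lemma idn_ar_pb:
  assumes C: "qcat C" and M: "wide C M" and a: "a \<in> cells (Ar C) 0"
  shows "idn (Ar C) a \<in> ar_pb C M"
proof -
  note ss = qcat_sset[OF C]
  have A: "is_sset (Ar C)" unfolding Ar_def by (rule fun_is_sset)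
  have o: "[0, 0] \<in> ops 1 0" by (simp add: ops_def)
  let ?e = "a 1 ([0, 0], [0, 1])"
  have o1: "[0, 1] \<in> ops 1 1" by (simp add: ops_def)
  have e: "?e \<in> cells C 1" by (rule Ar_in[OF a o o1])
  have "sq_of (idn (Ar C) a) = snd_square C ?e"
    unfolding sq_of_def snd_square_def
  proof (intro ext)
    fix m v
    have "idn (Ar C) a m (map fst v, map snd v) = act C 1 (map snd v) ?e" if v: "v \<in> cells square m"
    proof -
      have v2: "map fst v \<in> ops m 1" "map snd v \<in> ops m 1" using square_cells_ops[OF v] by auto
      have e1: "map (nth [0, 0]) (map fst v) = map (nth [0, 0]) (map snd v)" using v by (auto simp: square_def)
      have e2: "map (nth [0, 1]) (map snd v) = map snd v" using v by (auto simp: square_def intro!: map_idI)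
      show ?thesis
        unfolding idn_def Ar_act_app[OF o v2] Ar_nat[OF a o o1 v2(2)] by (subst e1, subst e2) (rule refl)
    qed
    then show "srestrict square (\<lambda>m v. idn (Ar C) a m (map fst v, map snd v)) m v = srestrict square (\<lambda>m v. act C 1 (map snd v) ?e) m v"
      unfolding srestrict_def by simp
  qed
  moreover have "ev 1 1 (idn (Ar C) a) = idn C (ev 1 0 a)" unfolding idn_def by (rule ev_act[OF order_refl a o])
  moreover have "idn C (ev 1 0 a) \<in> M" using M idn_equiv[OF ss ev_in[OF order_refl a]] unfolding wide_def by blast
  ultimately show ?thesis using idn_in[OF A a] snd_square_pullback[OF C e] unfolding ar_pb_def by simp
qed

lemma ring_contextD:
  assumes "ring_context C M A"
  shows "qcat C" "is_sset C" "wide C M" "wide C A" "has_finite_coproducts C" "extensive_pair C A"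
proof -
  have "weakly_extensive_pair C M" "extensive_pair C A" using assms unfolding ring_context_def by auto
  then have "span_pair C M" "span_pair C A" "extensive C" unfolding weakly_extensive_pair_def extensive_pair_def by auto
  then show "qcat C" "is_sset C" "wide C M" "wide C A" "has_finite_coproducts C" "extensive_pair C A"
    using \<open>extensive_pair C A\<close> qcat_sset unfolding span_pair_def extensive_def by auto
qed

lemma idn_wide: "is_sset C \<Longrightarrow> wide C W \<Longrightarrow> x \<in> cells C 0 \<Longrightarrow> idn C x \<in> W"
  using idn_equiv[of C x] unfolding wide_def by auto

lemma forget_in: "is_sset C \<Longrightarrow> \<sigma> \<in> cells (slice C x) n \<Longrightarrow> forget C n \<sigma> \<in> cells C n"
  unfolding forget_def by (rule sset_in[of _ _ n "Suc n"]) (auto simp: ops_def simp del: upt_Suc)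

lemma forget_act: "is_sset C \<Longrightarrow> \<sigma> \<in> cells (slice C x) n \<Longrightarrow> \<theta> \<in> ops m n \<Longrightarrow>
    forget C m (act (slice C x) n \<theta> \<sigma>) = act C n \<theta> (forget C n \<sigma>)"
proof -
  assume C: "is_sset C" and s: "\<sigma> \<in> cells (slice C x) n" and t: "\<theta> \<in> ops m n"
  have sc: "\<sigma> \<in> cells C (Suc n)" using s by simp
  have o: "[0..<Suc m] \<in> ops m (Suc m)" "[0..<Suc n] \<in> ops n (Suc n)" by (auto simp: ops_def simp del: upt_Suc)
  have to: "\<theta> @ [Suc n] \<in> ops (Suc m) (Suc n)" using t by (auto simp: ops_def sorted_append subset_iff)
  have "map (nth (\<theta> @ [Suc n])) [0..<Suc m] = \<theta>"
    using opsD(1)[OF t] by (intro nth_equalityI) (auto simp: nth_append simp del: upt_Suc)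
  then show ?thesis unfolding forget_def slice_simps sset_comp[OF C o(1) to sc] sset_comp[OF C t o(2) sc] ops_map_nth_id[OF t]
    by (rule arg_cong)
qed

section \<open>Functoriality of spans, and the fibre over an object\<close>

lemma span_map_in: "v \<in> cells (Tw n) m \<Longrightarrow> span_map f n s m v = f m (s m v)"
  by (simp add: span_map_def)

lemma span_map_smaps:
  assumes s: "s \<in> smaps (Tw n) K" and f: "\<And>m x. x \<in> cells K m \<Longrightarrow> f m x \<in> cells L m"
    "\<And>m k \<theta> x. \<theta> \<in> ops k m \<Longrightarrow> x \<in> cells K m \<Longrightarrow> f k (act K m \<theta> x) = act L m \<theta> (f m x)"
  shows "span_map f n s \<in> smaps (Tw n) L"
  unfolding span_map_def by (rule srestrict_smaps) (use smaps_in[OF s] smaps_act[OF s] f Tw_in in \<open>auto simp: Tw_act\<close>)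

lemma srestrict_cong: "(\<And>m v. v \<in> cells K m \<Longrightarrow> f m v = g m v) \<Longrightarrow> srestrict K f = srestrict K g"
  unfolding srestrict_def by (intro ext) auto

lemma span_map_eqI: "(\<And>m v. v \<in> cells (Tw n) m \<Longrightarrow> f m (s m v) = g m (s' m v)) \<Longrightarrow> span_map f n s = span_map g n s'"
  unfolding span_map_def srestrict_def by (intro ext) auto

lemma Span_act_span_map: "\<theta> \<in> ops m n \<Longrightarrow> act (Span L W) n \<theta> (span_map f n s) = span_map f m (act (Span K W') n \<theta> s)"
  unfolding Span_act span_map_def srestrict_def by (intro ext) (auto simp: Tw_map)

lemma ev_bw: "a \<le> 1 \<Longrightarrow> h \<in> cells (Ar C) k \<Longrightarrow> span_map (ev a) k (bw (Ar C) k h) = bw C k (ev a k h)"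
  unfolding span_map_def bw_def srestrict_def
  by (intro ext) (auto simp: ev_act[OF _ _ mono_tw_ops[OF mono_tw_bw]])

text \<open>The simplicial set in which the bispans of arrows are spans.\<close>

definition arc :: "'c sset \<Rightarrow> 'c set \<Rightarrow> 'c arr spn sset" where
  "arc C M = op_sset (Span (Ar C) (ar_pb C M))"

text \<open>The totally degenerate simplices at x in the span category; the fibre over x lies above
  them.\<close>

definition cspan :: "'c sset \<Rightarrow> 'c \<Rightarrow> nat \<Rightarrow> 'c spn" where "cspan C x n = bw C n (cst C x n)"

lemma cspan_in: "qcat C \<Longrightarrow> wide C M \<Longrightarrow> x \<in> cells C 0 \<Longrightarrow> cspan C x n \<in> cells (Span C M) n"
  unfolding cspan_def by (rule bw_span[OF _ idn_wide cst_in]) (auto simp: qcat_sset)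

lemma cspan_act: "is_sset C \<Longrightarrow> x \<in> cells C 0 \<Longrightarrow> \<theta> \<in> ops m n \<Longrightarrow> act (op_sset (Span C M)) n \<theta> (cspan C x n) = cspan C x m"
  unfolding cspan_def by (simp only: bw_act[OF _ cst_in] cst_act)

lemma cspan_act': "is_sset C \<Longrightarrow> x \<in> cells C 0 \<Longrightarrow> \<theta> \<in> ops m n \<Longrightarrow> act (Span C M) n \<theta> (cspan C x n) = cspan C x m"
  using cspan_act[of C x "flip n \<theta>" m n M] flip_ops[of \<theta> m n]
  by (simp add: flip_def rev_map o_def) (metis (mono_tags, lifting) atMost_iff diff_diff_cancel map_idI opsD(3) subsetD)

lemma fibre_incl_in: "v \<in> cells (Tw n) m \<Longrightarrow> fibre_incl C n s m v = bw (Ar C) m (slice_arr C m (s m v))"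
  unfolding fibre_incl_def by (rule span_map_in)

lemma arc_cell:
  assumes C: "qcat C" and M: "wide C M" and s: "\<sigma> \<in> cells (slice C x) k"
  shows "bw (Ar C) k (slice_arr C k \<sigma>) \<in> cells (arc C M) k"
  unfolding arc_def op_sset_simps by (rule bw_span[OF Ar_qcat[OF C] idn_ar_pb[OF C M] slice_arr_cell[OF qcat_sset[OF C] s]])

lemma fibre_smaps:
  assumes C: "qcat C" and M: "wide C M" and s: "s \<in> smaps (Tw n) (slice C x)"
  shows "fibre_incl C n s \<in> smaps (Tw n) (arc C M)"
  unfolding fibre_incl_def
proof (rule span_map_smaps[OF s arc_cell[OF C M]])
  fix m k \<theta> y assume t: "\<theta> \<in> ops k m" and y: "y \<in> cells (slice C x) m"
  show "bw (Ar C) k (slice_arr C k (act (slice C x) m \<theta> y)) = act (arc C M) m \<theta> (bw (Ar C) m (slice_arr C m y))"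
    unfolding arc_def slice_arr_act[OF qcat_sset[OF C] y t] by (rule bw_act[OF _ slice_arr_cell[OF qcat_sset[OF C] y] t, symmetric])
      (rule qcat_sset[OF Ar_qcat[OF C]])
qed

lemma fibre_ev1:
  assumes C: "is_sset C" and x: "x \<in> cells C 0" and s: "s \<in> smaps (Tw n) (slice C x)"
  shows "bispan_map (ev 1) n (fibre_incl C n s) = bw (op_sset (Span C M)) n (cspan C x n)"
  unfolding bispan_map_def span_map_def[of "span_map (ev 1)"] bw_def[of "op_sset (Span C M)"]
proof (rule srestrict_cong)
  fix m v assume v: "v \<in> cells (Tw n) m"
  show "span_map (ev 1) m (fibre_incl C n s m v) = act (op_sset (Span C M)) n (map (\<lambda>p. n - snd p) v) (cspan C x n)"
    unfolding fibre_incl_in[OF v] cspan_act[OF C x mono_tw_ops[OF mono_tw_bw v]] unfolding cspan_def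
      ev_bw[OF order_refl slice_arr_cell[OF C smaps_in[OF s v]]] ev_slice_arr(2)[OF C smaps_in[OF s v]] ..
qed

text \<open>The source of \<open>slice_arr\<close> is the forgetful functor. This identity links the
  value at x of a precomposed functor with a restriction to spans in C.\<close>

lemma fibre_ev0:
  assumes C: "is_sset C" and s: "s \<in> smaps (Tw n) (slice C x)"
  shows "bispan_map (ev 0) n (fibre_incl C n s) = bispan_incl C n (span_map (forget C) n s)"
  unfolding bispan_map_def bispan_incl_def
proof (rule span_map_eqI)
  fix m v assume v: "v \<in> cells (Tw n) m"
  show "span_map (ev 0) m (fibre_incl C n s m v) = bw C m (span_map (forget C) n s m v)"
    unfolding fibre_incl_in[OF v] span_map_in[OF v]
    using ev_bw[OF le0 slice_arr_cell[OF C smaps_in[OF s v]]] ev_slice_arr(1)[OF C smaps_in[OF s v]] by simp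
qed

lemma base_list: "map (\<lambda>i. (0, n - i)) [0..<Suc n] \<in> cells (Tw n) n"
  unfolding Tw_cells by (auto simp del: upt_Suc)

lemma fibre_base:
  assumes C: "is_sset C" and x: "x \<in> cells C 0" and s: "s \<in> smaps (Tw n) (slice C x)"
  shows "ar_base n (fibre_incl C n s) = cspan C x n"
proof -
  have "ar_base n (fibre_incl C n s) = act (op_sset (Span C {})) n (map (\<lambda>p. n - snd p) (map (\<lambda>i. (0 :: nat, n - i)) [0..<Suc n])) (cspan C x n)"
    unfolding ar_base_def fibre_ev1[OF assms, of "{}"] bw_def[of "op_sset _"] srestrict_in[OF base_list] by (rule refl)
  then show ?thesis unfolding cspan_act[OF C x mono_tw_ops[OF mono_tw_bw base_list]] .
qed

text \<open>All M-components are identities and all targets are constant at x, so the conditions on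
  the base and on the M-legs hold; degenerate forward legs are in A. What remains are the proper
  forward legs and the squares in \<open>arc C M\<close>.\<close>

lemma fibre_incl_iff:
  assumes C: "qcat C" and M: "wide C M" and A: "wide C A" and x: "x \<in> cells C 0" and s: "s \<in> smaps (Tw n) (slice C x)"
  shows "fibre_incl C n s \<in> cells (ar_bispan C M A) n \<longleftrightarrow>
    (\<forall>i i' j. i < i' \<and> i' \<le> j \<and> j \<le> n \<longrightarrow> forget C 1 (s 1 [(i, j), (i', j)]) \<in> A) \<and>
    (\<forall>i i' j' j. i < i' \<and> i' \<le> j' \<and> j' < j \<and> j \<le> n \<longrightarrow> is_pullback (arc C M) (tw_square (fibre_incl C n s) i i' j' j))"
proof -
  note ss = qcat_sset[OF C]
  note sa = qcat_sset[OF Ar_qcat[OF C]]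
  let ?F = "fibre_incl C n s"
  let ?W = "{e \<in> cells (Span (Ar C) (ar_pb C M)) 1. is_equiv (Ar C) (fw_leg e) \<and> bw_leg e \<in> ar_fw C A}"
  have b: "ar_base n ?F \<in> cells (Span C M) n" "bispan_map (ev 1) n ?F = bw (op_sset (Span C M)) n (ar_base n ?F)"
    using fibre_base[OF ss x s] cspan_in[OF C M x] fibre_ev1[OF ss x s] by simp_all
  have e: "?F 1 [(i, j), (i', j)] \<in> ?W \<longleftrightarrow> forget C 1 (s 1 [(i, j), (i', j)]) \<in> A" if ij: "i \<le> i'" "i' \<le> j" "j \<le> n" for i i' j
  proof -
    have v: "[(i, j), (i', j)] \<in> cells (Tw n) 1" using ij by (auto simp: Tw_cells nth_Cons split: nat.splits)
    let ?s = "s 1 [(i, j), (i', j)]"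
    have s1: "?s \<in> cells (slice C x) 1" by (rule smaps_in[OF s v])
    let ?t = "slice_arr C 1 ?s"
    have t: "?t \<in> cells (Ar C) 1" by (rule slice_arr_cell[OF ss s1])
    have fw: "fw_leg (bw (Ar C) 1 ?t) = idn (Ar C) (act (Ar C) 1 [0] ?t)"
      unfolding fw_leg_def bw_tw using tw_edge[of 0 1 1 1 1 "Ar C" "\<lambda>p. 1 - snd p" 1 ?t] act_degenerate[OF sa t, of 0] by simp
    have "act (Ar C) 1 [0, 1] ?t = ?t" using sset_id[OF sa t] by (simp add: upt_rec)
    then have bl: "bw_leg (bw (Ar C) 1 ?t) = ?t"
      unfolding bw_leg_def bw_tw using tw_edge[of 0 0 0 1 1 "Ar C" "\<lambda>p. 1 - snd p" 1 ?t] by simp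
    have "is_equiv C (cst C x 1)" using idn_equiv[OF ss x] by (simp add: cst_def idn_def)
    then have "?t \<in> ar_fw C A \<longleftrightarrow> forget C 1 ?s \<in> A"
      unfolding ar_fw_def using t ev_slice_arr[OF ss s1] by simp
    then show ?thesis
      unfolding fibre_incl_in[OF v] using fw bl arc_cell[OF C M s1, unfolded arc_def] idn_equiv[OF sa act_degenerate(2)[OF sa t, of 0]] by simp
  qed
  have d: "forget C 1 (s 1 [(i, j), (i, j)]) \<in> A" if ij: "i \<le> j" "j \<le> n" for i j
  proof -
    have v: "[(i, j)] \<in> cells (Tw n) 0" using ij by (auto simp: Tw_cells)
    have o: "[0, 0] \<in> ops 1 0" by (simp add: ops_def)
    have s0: "s 0 [(i, j)] \<in> cells (slice C x) 0" by (rule smaps_in[OF s v])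
    have "s 1 [(i, j), (i, j)] = act (slice C x) 0 [0, 0] (s 0 [(i, j)])" using smaps_act[OF s o v] by (simp add: Tw_act)
    then have "forget C 1 (s 1 [(i, j), (i, j)]) = idn C (forget C 0 (s 0 [(i, j)]))"
      using forget_act[OF ss s0 o] by (simp add: idn_def)
    then show ?thesis using idn_wide[OF ss A forget_in[OF ss s0]] by simp
  qed
  have "(\<forall>i i' j. i \<le> i' \<and> i' \<le> j \<and> j \<le> n \<longrightarrow> ?F 1 [(i, j), (i', j)] \<in> ?W) \<longleftrightarrow>
    (\<forall>i i' j. i < i' \<and> i' \<le> j \<and> j \<le> n \<longrightarrow> forget C 1 (s 1 [(i, j), (i', j)]) \<in> A)"
    using e d by (metis (no_types, lifting) le_neq_implies_less less_imp_le_nat)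
  then show ?thesis
    using b fibre_smaps[OF C M s] unfolding ar_bispan_def sub_sset_def Bispan_def Span_def[of "op_sset _"] arc_def by simp
qed

text \<open>A single bispan contains no square, so only its forward leg is tested.\<close>

lemma fibre_incl_one:
  assumes C: "qcat C" and M: "wide C M" and A: "wide C A" and x: "x \<in> cells C 0" and s: "s \<in> smaps (Tw 1) (slice C x)"
    and a: "forget C 1 (s 1 [(0, 1), (1, 1)]) \<in> A"
  shows "fibre_incl C 1 s \<in> cells (ar_bispan C M A) 1"
  unfolding fibre_incl_iff[OF C M A x s]
proof (intro conjI allI impI)
  fix i i' j :: nat assume "i < i' \<and> i' \<le> j \<and> j \<le> 1"
  then have "i = 0" "i' = 1" "j = 1" by auto
  then show "forget C 1 (s 1 [(i, j), (i', j)]) \<in> A" using a by simp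
qed auto

lemma ar_bispan_act: "act (ar_bispan C M A) = act (Span (arc C M) W)"
  by (simp add: ar_bispan_def Bispan_def sub_sset_def Span_def arc_def)

section \<open>Grouplike functors on slices\<close>

lemma is_coproductD:
  assumes C: "is_sset C" and co: "is_coproduct C k e z"
  shows "z \<in> cells C 0" "i < k \<Longrightarrow> e i \<in> cells C 1 \<and> act C 1 [1] (e i) = z"
proof -
  have "(z, \<lambda>i. if i < k then e i else undefined) \<in> cells (under C k (\<lambda>i. src C (e i))) 0" "\<forall>i<k. e i \<in> cells C 1"
    using co unfolding is_coproduct_under[OF C] initial_def by auto
  then show "z \<in> cells C 0" "i < k \<Longrightarrow> e i \<in> cells C 1 \<and> act C 1 [1] (e i) = z" unfolding under_cells by (simp, metis One_nat_def face_small(1))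
qed

lemma forget_smaps: "is_sset C \<Longrightarrow> is_sset K \<Longrightarrow> t \<in> smaps K (slice C x) \<Longrightarrow> srestrict K (\<lambda>n F. forget C n (t n F)) \<in> smaps K C"
proof (rule srestrict_smaps)
  assume a: "is_sset C" "is_sset K" "t \<in> smaps K (slice C x)"
  fix n F assume F: "F \<in> cells K n"
  show "forget C n (t n F) \<in> cells C n" by (rule forget_in[OF a(1) smaps_in[OF a(3) F]])
  fix m \<theta> assume t: "\<theta> \<in> ops m n"
  show "act K n \<theta> F \<in> cells K m" by (rule sset_in[OF a(2) t F])
  show "forget C m (t m (act K n \<theta> F)) = act C n \<theta> (forget C n (t n F))"
    unfolding smaps_act[OF a(3) t F] by (rule forget_act[OF a(1) smaps_in[OF a(3) F] t])
qed

lemma preserves_forget: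
  assumes C: "qcat C" and fc: "has_finite_coproducts C" and p: "preserves_finite_coproducts Fin (slice C x) t"
  shows "preserves_finite_coproducts Fin C (srestrict Fin (\<lambda>n F. forget C n (t n F)))"
  unfolding preserves_finite_coproducts_def
proof (intro allI impI)
  fix k e z assume co: "is_coproduct Fin k e z"
  have "is_coproduct C k (\<lambda>i. forget C 1 (t 1 (e i))) (forget C 0 (t 0 z))"
    by (rule coproduct_forget[OF C fc]) (use p co in \<open>auto simp: preserves_finite_coproducts_def\<close>)
  then show "is_coproduct C k (\<lambda>i. srestrict Fin (\<lambda>n F. forget C n (t n F)) 1 (e i)) (srestrict Fin (\<lambda>n F. forget C n (t n F)) 0 z)"
    using is_coproductD[OF Fin_sset co] unfolding is_coproduct_under[OF qcat_sset[OF C]]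
    by (subst under_cong[of k _ "\<lambda>i. src C (forget C 1 (t 1 (e i)))"]) (auto cong: if_cong)
qed

text \<open>By \<open>Fin_two\<close>, t sends the two inclusions of a point to a coproduct cocone,
  and the fold map to a map that restricts to the identity on both summands; an extensive pair has
  such maps in A.\<close>

lemma fold_in:
  assumes A: "extensive_pair C A" and t: "t \<in> smaps Fin C" and p: "preserves_finite_coproducts Fin C t"
  shows "t 1 (fin_map 2 1 [0, 0]) \<in> A"
proof -
  have C: "is_sset C" using A unfolding extensive_pair_def extensive_def by (auto intro: qcat_sset)
  let ?c = "\<lambda>i. t 1 (fin_map 1 2 [i])"
  let ?x = "t 0 (fin_ob 1)"
  have x: "?x \<in> cells C 0" by (rule smaps_in[OF t fin_ob_cell])
  have co: "is_coproduct C 2 ?c (t 0 (fin_ob 2))" using p Fin_two unfolding preserves_finite_coproducts_def by blast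
  have id: "t 1 (fin_map 1 1 [0]) = idn C ?x"
    using smaps_act[OF t _ fin_ob_cell, of "[0, 0]" 1 1] fin_acts(6)[of 1] by (simp add: idn_def ops_def)
  have "triangle C (?c i) (t 1 (fin_map 2 1 [0, 0])) (idn C ?x)" if i: "i < 2" for i
    unfolding triangle_def
  proof (intro bexI conjI)
    have f: "fin_chain 1 2 1 [i] [0, 0] \<in> cells Fin 2" by (rule fin_chain_cell) (use i in auto)
    show "t 2 (fin_chain 1 2 1 [i] [0, 0]) \<in> cells C 2" by (rule smaps_in[OF t f])
    have "[0, 0] ! i = (0::nat)" using i by (auto simp: less_2_cases_iff)
    then show "act C 2 [0, 1] (t 2 (fin_chain 1 2 1 [i] [0, 0])) = ?c i"
      "act C 2 [1, 2] (t 2 (fin_chain 1 2 1 [i] [0, 0])) = t 1 (fin_map 2 1 [0, 0])"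
      "act C 2 [0, 2] (t 2 (fin_chain 1 2 1 [i] [0, 0])) = idn C ?x"
      using smaps_act[OF t _ f, of "[0, 1]" 1] smaps_act[OF t _ f, of "[1, 2]" 1] smaps_act[OF t _ f, of "[0, 2]" 1] id
      unfolding fin_acts by (simp_all add: ops_def)
  qed
  then have "triangle C (?c 0) (t 1 (fin_map 2 1 [0, 0])) (idn C ?x)" "triangle C (?c 1) (t 1 (fin_map 2 1 [0, 0])) (idn C ?x)" by simp_all
  then show ?thesis using A co x unfolding extensive_pair_def by metis
qed

text \<open>The one-point set is terminal, so every simplex of \<open>Fin\<close> extends canonically by it.\<close>

definition to_point :: "nat \<Rightarrow> (nat \<Rightarrow> nat \<Rightarrow> nat list) \<Rightarrow> nat \<Rightarrow> nat \<Rightarrow> nat list" where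
  "to_point n F i j = (if j = Suc n then (if i \<le> n then replicate (length (F i i)) 0 else if i = Suc n then [0] else []) else F i j)"

lemma to_point_cell:
  assumes F: "F \<in> cells Fin n" shows "to_point n F \<in> cells Fin (Suc n)"
proof (rule FinI)
  fix i assume "i \<le> Suc n"
  then show "to_point n F i i = [0..<length (to_point n F i i)]" using FinD(1)[OF F, of i] by (auto simp: to_point_def)
next
  fix i j assume a: "i \<le> j" "j \<le> Suc n"
  then show "length (to_point n F i j) = length (to_point n F i i)" "set (to_point n F i j) \<subseteq> set (to_point n F j j)"
    using FinD(2,3)[OF F, of i j] by (auto simp: to_point_def)
next
  fix i j k assume a: "i \<le> j" "j \<le> k" "k \<le> Suc n"
  show "to_point n F i k = map (nth (to_point n F j k)) (to_point n F i j)"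
  proof (cases "k = Suc n")
    case False then show ?thesis using a FinD(4)[OF F, of i j k] by (simp add: to_point_def)
  next
    case True
    show ?thesis
    proof (cases "j = Suc n")
      case jt: True
      then show ?thesis using True a by (auto simp: to_point_def map_replicate_const)
    next
      case False
      then have ij: "i \<le> j" "j \<le> n" using a True by auto
      have "map (nth (replicate (length (F j j)) (0::nat))) (F i j) = replicate (length (F i j)) 0"
        using FinD(3)[OF F ij] FinD(1)[OF F ij(2)] by (intro nth_equalityI) (auto, metis atLeastLessThan_iff nth_mem nth_replicate set_upt subsetD)
      then show ?thesis using True False ij FinD(2)[OF F ij] by (simp add: to_point_def)
    qed
  qed
next
  fix i j assume "\<not> (i \<le> j \<and> j \<le> Suc n)"
  then show "to_point n F i j = []" using FinD(5)[OF F, of i j] by (auto simp: to_point_def)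
qed

lemma to_point_act:
  assumes F: "F \<in> cells Fin n" and t: "\<theta> \<in> ops m n"
  shows "act Fin (Suc n) (\<theta> @ [Suc n]) (to_point n F) = to_point m (act Fin n \<theta> F)"
proof (intro ext)
  fix i j
  have l: "length \<theta> = Suc m" by (rule opsD(1)[OF t])
  show "act Fin (Suc n) (\<theta> @ [Suc n]) (to_point n F) i j = to_point m (act Fin n \<theta> F) i j"
    using ops_nth[OF t, of i] ops_nth[OF t, of j]
    by (auto simp: Fin_act to_point_def nth_append l le_Suc_eq less_Suc_eq_le)
qed

lemma to_point_faces:
  assumes F: "F \<in> cells Fin n"
  shows "act Fin (Suc n) [0..<Suc n] (to_point n F) = F" "act Fin (Suc n) [Suc n] (to_point n F) = fin_ob 1"
  using FinD(5)[OF F] by (auto simp: Fin_act to_point_def fin_ob_def fun_eq_iff less_Suc_eq_le upt_rec[of 0 "Suc 0"] simp del: upt_Suc)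

text \<open>Applying t to \<open>to_point\<close> gives simplices over t(1). The lift preserves
  coproducts because the slice reflects them, by \<open>coproduct_reflect\<close>.\<close>

lemma lift_slice:
  assumes C: "is_sset C" and t: "t \<in> smaps Fin C" and p: "preserves_finite_coproducts Fin C t"
  obtains t' where "t' \<in> smaps Fin (slice C (t 0 (fin_ob 1)))" "preserves_finite_coproducts Fin (slice C (t 0 (fin_ob 1))) t'"
    "srestrict Fin (\<lambda>n F. forget C n (t' n F)) = t"
proof
  let ?x = "t 0 (fin_ob 1)"
  let ?t = "srestrict Fin (\<lambda>n F. t (Suc n) (to_point n F))"
  show tc: "?t \<in> smaps Fin (slice C ?x)"
  proof (rule srestrict_smaps)
    fix n F assume F: "F \<in> cells Fin n"
    have "[Suc n] \<in> ops 0 (Suc n)" by (simp add: ops_def)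
    then show "t (Suc n) (to_point n F) \<in> cells (slice C ?x) n"
      using smaps_in[OF t to_point_cell[OF F]] smaps_act[OF t _ to_point_cell[OF F], of "[Suc n]" 0] to_point_faces(2)[OF F] by simp
    fix m \<theta> assume th: "\<theta> \<in> ops m n"
    show "act Fin n \<theta> F \<in> cells Fin m" by (rule sset_in[OF Fin_sset th F])
    have "\<theta> @ [Suc n] \<in> ops (Suc m) (Suc n)" using th by (auto simp: ops_def sorted_append subset_iff)
    then show "t (Suc m) (to_point m (act Fin n \<theta> F)) = act (slice C ?x) n \<theta> (t (Suc n) (to_point n F))"
      using smaps_act[OF t _ to_point_cell[OF F], of "\<theta> @ [Suc n]" "Suc m"] to_point_act[OF F th] by simp
  qed
  have fo: "forget C n (?t n F) = t n F" if F: "F \<in> cells Fin n" for n F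
  proof -
    have o: "[0..<Suc n] \<in> ops n (Suc n)" by (auto simp: ops_def simp del: upt_Suc)
    show ?thesis unfolding forget_def srestrict_in[OF F] smaps_act[OF t o to_point_cell[OF F], symmetric] to_point_faces(1)[OF F] ..
  qed
  show "srestrict Fin (\<lambda>n F. forget C n (?t n F)) = t"
    unfolding srestrict_def[of Fin "\<lambda>n F. forget C n (?t n F)"] using fo smaps_undef[OF t] by (intro ext) auto
  show "preserves_finite_coproducts Fin (slice C ?x) ?t"
    unfolding preserves_finite_coproducts_def
  proof (intro allI impI)
    fix k e z assume co: "is_coproduct Fin k e z"
    note d = is_coproductD[OF Fin_sset co]
    have "is_coproduct C k (\<lambda>i. t 1 (e i)) (t 0 z)" using p co unfolding preserves_finite_coproducts_def by blast
    then have co': "is_coproduct C k (\<lambda>i. forget C 1 (?t 1 (e i))) (forget C 0 (?t 0 z))"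
      using d fo unfolding is_coproduct_under[OF C] by (subst under_cong[of k _ "\<lambda>i. src C (t 1 (e i))"]) (auto cong: if_cong)
    show "is_coproduct (slice C ?x) k (\<lambda>i. ?t 1 (e i)) (?t 0 z)"
    proof (rule coproduct_reflect[OF C _ _ _ co'])
      fix i assume i: "i < k"
      show "?t 1 (e i) \<in> cells (slice C ?x) 1" by (rule smaps_in[OF tc]) (use d(2) i in blast)
      show "act (slice C ?x) 1 [1] (?t 1 (e i)) = ?t 0 z"
        using smaps_act[OF tc, of "[1]" 0 1 "e i"] d(2)[OF i] by (simp add: ops_def)
    next
      show "?t 0 z \<in> cells (slice C ?x) 0" by (rule smaps_in[OF tc d(1)])
    qed
  qed
qed

lemma cmon_grouplike_cong:
  assumes "\<And>i. i < 2 \<Longrightarrow> N 1 (bw Fin 1 (fin_map 1 2 [i])) = N' 1 (bw Fin 1 (fin_map 1 2 [i]))"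
    "N 1 (fw Fin 1 (fin_map 2 1 [0, 0])) = N' 1 (fw Fin 1 (fin_map 2 1 [0, 0]))"
  shows "cmon_grouplike X N \<longleftrightarrow> cmon_grouplike X N'"
  using assms(1)[of 0] assms(1)[of 1] assms(2) unfolding cmon_grouplike_def cmon_proj_def cmon_add_def by simp

lemma cst_zero: "is_sset C \<Longrightarrow> x \<in> cells C 0 \<Longrightarrow> cst C x 0 = x"
  unfolding cst_def using sset_id[of C x 0] by simp

text \<open>The hypothesis \<open>b\<close> places the bispan in the domain of the restricted
  functor, off which the value would be \<open>undefined\<close>; there \<open>fibre_ev0\<close>
  computes the source evaluation.\<close>

lemma nrig_value_precomp:
  assumes F: "qcat C" "wide C M" "wide C A" and x: "x \<in> cells C 0" and H: "H \<in> cells (fun_prod (Bispan C M A) X) 0"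
    and s: "s \<in> smaps (Tw n) (slice C x)" and b: "fibre_incl C n s \<in> cells (ar_bispan C M A) n"
  shows "nrig_value C (ev0_precomp C M A X 0 H) x n s = fun_at H n (bispan_incl C n (span_map (forget C) n s))"
proof -
  note ss = qcat_sset[OF F(1)]
  have c: "bw C 0 x = cspan C x 0" unfolding cspan_def cst_zero[OF ss x] ..
  have "cspan C x 0 \<in> cells (Span C M) 0" by (rule cspan_in[OF F(1,2) x])
  moreover have "(replicate (Suc n) 0, fibre_incl C n s) \<in> cells (pull (ar_bispan C M A) ar_base (Span C M) 0 (cspan C x 0)) n"
    using b fibre_base[OF ss x s] cspan_act'[OF ss x ops_replicate[of 0 0 n], of M] ops_replicate[of 0 0 n]
    by (simp add: pull_def sub_sset_def del: replicate_Suc)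
  moreover have "map (nth [0]) (replicate (Suc n) 0) = replicate (Suc n) 0" by (simp add: map_replicate_const)
  ultimately show ?thesis
    unfolding nrig_value_def c fun_at_def ev0_precomp_def using H ops_replicate[of 0 0 0] fibre_ev0[OF ss s]
    by (simp del: replicate_Suc)
qed

lemma fin_fold_leg: "bw Fin 1 f 1 [(0, 1), (1, 1)] = act Fin 1 [0, 0] f" "fw Fin 1 f 1 [(0, 1), (1, 1)] = act Fin 1 [0, 1] f"
  unfolding bw_tw fw_tw using tw_edge[of 0 1 1 1 1 Fin] by simp_all

text \<open>The shear condition reads three bispans only: two backward ones, whose forward leg is an
  identity, and the fold map, which is in A by \<open>fold_in\<close>. So all three lie in the
  fibre, where \<open>nrig_value_precomp\<close> compares the functors.\<close>

lemma grouplike_precomp: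
  assumes rc: "ring_context C M A" and x: "x \<in> cells C 0" and H: "H \<in> cells (fun_prod (Bispan C M A) X) 0"
    and t: "t \<in> smaps Fin (slice C x)" and t'_def: "t' = srestrict Fin (\<lambda>n F. forget C n (t n F))"
    and p: "preserves_finite_coproducts Fin C t'"
  shows "cmon_grouplike X (\<lambda>n s. nrig_value C (ev0_precomp C M A X 0 H) x n (span_map t n s)) \<longleftrightarrow>
    cmon_grouplike X (\<lambda>n s. fun_at H n (bispan_incl C n (span_map t' n s)))"
proof -
  note r = ring_contextD[OF rc]
  have t': "t' \<in> smaps Fin C" unfolding t'_def by (rule forget_smaps[OF r(2) Fin_sset t])
  have key: "nrig_value C (ev0_precomp C M A X 0 H) x 1 (span_map t 1 s) = fun_at H 1 (bispan_incl C 1 (span_map t' 1 s))"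
    if s: "s \<in> smaps (Tw 1) Fin" and a: "t' 1 (s 1 [(0, 1), (1, 1)]) \<in> A" for s
  proof -
    have v: "[(0, 1), (1, 1)] \<in> cells (Tw 1) 1" by (auto simp: Tw_cells nth_Cons split: nat.splits)
    have ts: "span_map t 1 s \<in> smaps (Tw 1) (slice C x)" by (rule span_map_smaps[OF s]) (rule smaps_in[OF t] smaps_act[OF t]; assumption)+
    have "forget C 1 (span_map t 1 s 1 [(0, 1), (1, 1)]) = t' 1 (s 1 [(0, 1), (1, 1)])"
      unfolding span_map_in[OF v] t'_def srestrict_in[OF smaps_in[OF s v]] ..
    then have "fibre_incl C 1 (span_map t 1 s) \<in> cells (ar_bispan C M A) 1"
      using fibre_incl_one[OF r(1,3,4) x ts] a by simp
    moreover have "span_map (forget C) 1 (span_map t 1 s) = span_map t' 1 s"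
      by (rule span_map_eqI) (simp add: span_map_in t'_def smaps_in[OF s])
    ultimately show ?thesis using nrig_value_precomp[OF r(1,3,4) x H ts] by simp
  qed
  have f1: "fin_map 1 2 [i] \<in> cells Fin 1" if "i < 2" for i by (rule fin_map_cell) (use that in auto)
  have f2: "fin_map 2 1 [0, 0] \<in> cells Fin 1" by (rule fin_map_cell) auto
  show ?thesis
  proof (rule cmon_grouplike_cong)
    fix i :: nat assume i: "i < 2"
    note d = act_degenerate[OF Fin_sset f1[OF i], of 0, OF le0]
    have "t' 1 (bw Fin 1 (fin_map 1 2 [i]) 1 [(0, 1), (1, 1)]) = idn C (t' 0 (act Fin 1 [0] (fin_map 1 2 [i])))"
      unfolding fin_fold_leg d(1) using smaps_act[OF t' _ d(2), of "[0, 0]" 1] by (simp add: idn_def ops_def)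
    then show "nrig_value C (ev0_precomp C M A X 0 H) x 1 (span_map t 1 (bw Fin 1 (fin_map 1 2 [i]))) =
       fun_at H 1 (bispan_incl C 1 (span_map t' 1 (bw Fin 1 (fin_map 1 2 [i]))))"
      using key[OF tw_smaps[OF Fin_sset f1[OF i] mono_tw_bw, folded bw_tw]] idn_wide[OF r(2,4) smaps_in[OF t' d(2)]] by simp
  next
    have "act Fin 1 [0, 1] (fin_map 2 1 [0, 0]) = fin_map 2 1 [0, 0]" using sset_id[OF Fin_sset f2] by (simp add: upt_rec)
    then show "nrig_value C (ev0_precomp C M A X 0 H) x 1 (span_map t 1 (fw Fin 1 (fin_map 2 1 [0, 0]))) =
       fun_at H 1 (bispan_incl C 1 (span_map t' 1 (fw Fin 1 (fin_map 2 1 [0, 0]))))"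
      using key[OF tw_smaps[OF Fin_sset f2 mono_tw_fw, folded fw_tw]] fold_in[OF r(6) t' p] fin_fold_leg(2) by simp
  qed
qed

text \<open>Copower functors of the slices become copower functors of C by forgetting, and each
  copower functor t of C arises in this way from the slice over t(1).\<close>

lemma grouplike_iff:
  assumes rc: "ring_context C M A" and H: "H \<in> cells (fun_prod (Bispan C M A) X) 0"
  shows "(\<forall>x\<in>cells C 0. grouplike (slice C x) X (nrig_value C (ev0_precomp C M A X 0 H) x)) \<longleftrightarrow>
    grouplike C X (\<lambda>n s. fun_at H n (bispan_incl C n s))"
proof
  note r = ring_contextD[OF rc]
  assume g: "grouplike C X (\<lambda>n s. fun_at H n (bispan_incl C n s))"
  show "\<forall>x\<in>cells C 0. grouplike (slice C x) X (nrig_value C (ev0_precomp C M A X 0 H) x)"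
    unfolding grouplike_def
  proof (intro ballI impI)
    fix x t assume x: "x \<in> cells C 0" and t: "t \<in> smaps Fin (slice C x)" and p: "preserves_finite_coproducts Fin (slice C x) t"
    note p' = preserves_forget[OF r(1,5) p]
    show "cmon_grouplike X (\<lambda>n s. nrig_value C (ev0_precomp C M A X 0 H) x n (span_map t n s))"
      unfolding grouplike_precomp[OF rc x H t refl p'] using g forget_smaps[OF r(2) Fin_sset t] p' unfolding grouplike_def by blast
  qed
next
  note r = ring_contextD[OF rc]
  assume g: "\<forall>x\<in>cells C 0. grouplike (slice C x) X (nrig_value C (ev0_precomp C M A X 0 H) x)"
  show "grouplike C X (\<lambda>n s. fun_at H n (bispan_incl C n s))"
    unfolding grouplike_def
  proof (intro ballI impI)
    fix t assume t: "t \<in> smaps Fin C" and p: "preserves_finite_coproducts Fin C t"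
    have x: "t 0 (fin_ob 1) \<in> cells C 0" by (rule smaps_in[OF t fin_ob_cell])
    obtain t' where t': "t' \<in> smaps Fin (slice C (t 0 (fin_ob 1)))" "preserves_finite_coproducts Fin (slice C (t 0 (fin_ob 1))) t'"
      "srestrict Fin (\<lambda>n F. forget C n (t' n F)) = t"
      by (rule lift_slice[OF r(2) t p])
    show "cmon_grouplike X (\<lambda>n s. fun_at H n (bispan_incl C n (span_map t n s)))"
      using grouplike_precomp[OF rc x H t'(1) t'(3)[symmetric] p] g x t' unfolding grouplike_def by blast
  qed
qed

section \<open>Invariance under equivalences\<close>

lemma triangleD:
  assumes "is_sset X" "triangle X f g h"
  shows "f \<in> cells X 1" "g \<in> cells X 1" "h \<in> cells X 1" "act X 1 [1] f = act X 1 [0] g" "act X 1 [0] h = act X 1 [0] f"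
    "act X 1 [1] h = act X 1 [1] g"
proof -
  obtain s where s: "s \<in> cells X 2" "act X 2 [0, 1] s = f" "act X 2 [1, 2] s = g" "act X 2 [0, 2] s = h"
    using assms(2) unfolding triangle_def by blast
  have o: "[0, 1] \<in> ops 1 2" "[1, 2] \<in> ops 1 2" "[0, 2] \<in> ops 1 2" "[0] \<in> ops 0 1" "[1] \<in> ops 0 1" by (auto simp: ops_def)
  show "f \<in> cells X 1" "g \<in> cells X 1" "h \<in> cells X 1" using sset_in[OF assms(1) _ s(1)] o s by metis+
  show "act X 1 [1] f = act X 1 [0] g" "act X 1 [0] h = act X 1 [0] f" "act X 1 [1] h = act X 1 [1] g"
    using sset_comp[OF assms(1) o(4) o(1) s(1)] sset_comp[OF assms(1) o(5) o(1) s(1)] sset_comp[OF assms(1) o(4) o(2) s(1)]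
      sset_comp[OF assms(1) o(5) o(2) s(1)] sset_comp[OF assms(1) o(4) o(3) s(1)] sset_comp[OF assms(1) o(5) o(3) s(1)] s by simp_all
qed

lemma compose_exists:
  assumes X: "qcat X" and f: "f \<in> cells X 1" and g: "g \<in> cells X 1" and fg: "act X 1 [1] f = act X 1 [0] g"
  obtains h where "triangle X f g h"
proof -
  let ?s = "\<lambda>i. if i = 0 then g else f"
  have "compatible X 2 ({..2} - {1}) ?s"
    unfolding compatible_def using f g fg by (auto simp: le_Suc_eq numeral_2_eq_2)
  then obtain \<sigma> where s: "\<sigma> \<in> cells X 2" "\<forall>i\<in>{..2} - {1}. bd X 2 i \<sigma> = ?s i"
    using X[unfolded qcat_def, THEN conjunct2, rule_format, of 1 2 ?s] by auto
  have "face 2 0 = [1, 2]" "face 2 2 = [0, 1]" "{..2} - {1::nat} = {0, 2}" by (auto simp: face_def upt_rec)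
  then have "act X 2 [0, 1] \<sigma> = f" "act X 2 [1, 2] \<sigma> = g" using s(2) by simp_all
  then have "triangle X f g (act X 2 [0, 2] \<sigma>)" unfolding triangle_def using s(1) by blast
  then show ?thesis by (rule that)
qed

text \<open>The two implications fill the inner horns of a 3-simplex at 1 and at 2; the missing face
  is the triangle sought.\<close>

lemma triangle_assoc:
  assumes X: "qcat X" and t: "triangle X f g a" "triangle X g h b"
  shows "triangle X f b c \<longleftrightarrow> triangle X a h c"
proof -
  have ss: "is_sset X" by (rule qcat_sset[OF X])
  obtain u where u: "u \<in> cells X 2" "act X 2 [0, 1] u = f" "act X 2 [1, 2] u = g" "act X 2 [0, 2] u = a"
    using t(1) unfolding triangle_def by blast
  obtain v where v: "v \<in> cells X 2" "act X 2 [0, 1] v = g" "act X 2 [1, 2] v = h" "act X 2 [0, 2] v = b"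
    using t(2) unfolding triangle_def by blast
  have fc: "face 3 0 = [1, 2, 3]" "face 3 1 = [0, 2, 3]" "face 3 2 = [0, 1, 3]" "face 3 3 = [0, 1, 2]"
    "face 2 0 = [1, 2]" "face 2 1 = [0, 2]" "face 2 2 = [0, 1]" by (auto simp: face_def upt_rec)
  have c3: "act X 2 [p, q] (act X 3 [i, j, k] \<sigma>) = act X 3 [[i, j, k] ! p, [i, j, k] ! q] \<sigma>"
    if "\<sigma> \<in> cells X 3" "i \<le> j" "j \<le> k" "k \<le> 3" "p \<le> q" "q \<le> 2" for i j k p q \<sigma>
    using sset_comp[OF ss _ _ that(1), of "[p, q]" 1 2 "[i, j, k]"] that by (auto simp: ops_def)
  have m3: "act X 3 [i, j, k] \<sigma> \<in> cells X 2" if "\<sigma> \<in> cells X 3" "i \<le> j" "j \<le> k" "k \<le> 3" for i j k \<sigma>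
    by (rule sset_in[OF ss _ that(1)]) (use that in \<open>auto simp: ops_def\<close>)
  have s3: "{..3} - {1::nat} = {0, 2, 3}" "{..3} - {2::nat} = {0, 1, 3}" by auto
  show ?thesis
  proof
    assume "triangle X f b c"
    then obtain w where w: "w \<in> cells X 2" "act X 2 [0, 1] w = f" "act X 2 [1, 2] w = b" "act X 2 [0, 2] w = c"
      unfolding triangle_def by blast
    let ?s = "\<lambda>i::nat. if i = 0 then v else if i = 2 then w else u"
    have "compatible X 3 ({..3} - {1}) ?s"
      unfolding compatible_def s3 using u v w by (auto simp: fc fc[unfolded One_nat_def])
    then obtain \<sigma> where s: "\<sigma> \<in> cells X 3" "\<forall>i\<in>{..3} - {1}. bd X 3 i \<sigma> = ?s i"
      using X[unfolded qcat_def, THEN conjunct2, rule_format, of 1 3 ?s] by auto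
    then have "act X 3 [1, 2, 3] \<sigma> = v" "act X 3 [0, 1, 3] \<sigma> = w" "act X 3 [0, 1, 2] \<sigma> = u" unfolding s3 by (simp_all add: fc fc[unfolded One_nat_def])
    then show "triangle X a h c" unfolding triangle_def using m3[OF s(1), of 0 2 3] c3[OF s(1)] u v w by (intro bexI[of _ "act X 3 [0, 2, 3] \<sigma>"]) (auto)
  next
    assume "triangle X a h c"
    then obtain w where w: "w \<in> cells X 2" "act X 2 [0, 1] w = a" "act X 2 [1, 2] w = h" "act X 2 [0, 2] w = c"
      unfolding triangle_def by blast
    let ?s = "\<lambda>i::nat. if i = 0 then v else if i = 1 then w else u"
    have "compatible X 3 ({..3} - {2}) ?s"
      unfolding compatible_def s3 using u v w by (auto simp: fc fc[unfolded One_nat_def])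
    then obtain \<sigma> where s: "\<sigma> \<in> cells X 3" "\<forall>i\<in>{..3} - {2}. bd X 3 i \<sigma> = ?s i"
      using X[unfolded qcat_def, THEN conjunct2, rule_format, of 2 3 ?s] by auto
    then have "act X 3 [1, 2, 3] \<sigma> = v" "act X 3 [0, 2, 3] \<sigma> = w" "act X 3 [0, 1, 2] \<sigma> = u" unfolding s3 by (simp_all add: fc fc[unfolded One_nat_def])
    then show "triangle X f b c" unfolding triangle_def using m3[OF s(1), of 0 1 3] c3[OF s(1)] u v w by (intro bexI[of _ "act X 3 [0, 1, 3] \<sigma>"]) (auto)
  qed
qed

lemma triangle_id: "is_sset X \<Longrightarrow> f \<in> cells X 1 \<Longrightarrow> act X 1 [1] f = y \<Longrightarrow> triangle X f (idn X y) f"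
    "is_sset X \<Longrightarrow> f \<in> cells X 1 \<Longrightarrow> act X 1 [0] f = y \<Longrightarrow> triangle X (idn X y) f f"
  using triangle_id_right triangle_id_left by (auto simp: src_def tgt_def)

lemma equivD:
  assumes "is_equiv X f"
  obtains g where "f \<in> cells X 1" "g \<in> cells X 1" "triangle X f g (idn X (act X 1 [0] f))" "triangle X g f (idn X (act X 1 [1] f))"
  using assms unfolding is_equiv_def src_def tgt_def by blast

lemma equivI:
  assumes "is_sset X" "triangle X f g (idn X (act X 1 [0] f))" "triangle X g f (idn X (act X 1 [1] f))"
  shows "is_equiv X f"
  unfolding is_equiv_def src_def tgt_def using triangleD(1,2)[OF assms(1,2)] assms(2,3) by blast

lemma equiv_comp:
  assumes X: "qcat X" and f: "is_equiv X f" and g: "is_equiv X g" and t: "triangle X f g h"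
  shows "is_equiv X h"
proof -
  note ss = qcat_sset[OF X]
  obtain f' where f': "f \<in> cells X 1" "f' \<in> cells X 1" "triangle X f f' (idn X (act X 1 [0] f))" "triangle X f' f (idn X (act X 1 [1] f))"
    by (rule equivD[OF f])
  obtain g' where g': "g \<in> cells X 1" "g' \<in> cells X 1" "triangle X g g' (idn X (act X 1 [0] g))" "triangle X g' g (idn X (act X 1 [1] g))"
    by (rule equivD[OF g])
  note tD = triangleD[OF ss t]
  have "act X 1 [1] g' = act X 1 [0] f'" using triangleD(4)[OF ss f'(3)] triangleD(4)[OF ss g'(4)] tD(4) by simp
  then obtain h' where h': "triangle X g' f' h'" using compose_exists[OF X g'(2) f'(2)] by blast
  have "triangle X h g' f" using triangle_assoc[OF X t g'(3)] triangle_id(1)[OF ss f'(1)] tD(4) by metis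
  then have 1: "triangle X h h' (idn X (act X 1 [0] f))" using triangle_assoc[OF X _ h'] f'(3) by metis
  have "act X 1 [1] g' = act X 1 [1] f" using triangleD(4)[OF ss g'(4)] tD(4) by simp
  then have "triangle X h' f g'" using triangle_assoc[OF X h' f'(4)] triangle_id(1)[OF ss g'(2)] by metis
  then have 2: "triangle X h' h (idn X (act X 1 [1] g))" using triangle_assoc[OF X _ t] g'(4) by metis
  show ?thesis by (rule equivI[OF ss]) (use 1 2 tD in auto)
qed

text \<open>The shear map is transported by conjugation: s is \<open>\<alpha>\<^sub>2\<close>, then
  s', then the inverse of \<open>\<alpha>\<^sub>2\<close>. The edges d, d', d'' are the diagonals of
  the naturality squares; the required equations hold after \<open>\<alpha>\<^sub>1\<close>, which
  can be cancelled.\<close>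

lemma grouplike_transport:
  assumes X: "qcat X" and a1: "is_equiv X \<alpha>\<^sub>1" and a2: "is_equiv X \<alpha>\<^sub>2"
    and n: "triangle X \<alpha>\<^sub>2 p' d" "triangle X p \<alpha>\<^sub>1 d" "triangle X \<alpha>\<^sub>2 q' d'" "triangle X q \<alpha>\<^sub>1 d'" "triangle X \<alpha>\<^sub>2 r' d''" "triangle X r \<alpha>\<^sub>1 d''"
    and s': "triangle X s' p' p'" "triangle X s' q' r'" "is_equiv X s'"
  obtains s where "triangle X s p p" "triangle X s q r" "is_equiv X s"
proof -
  note ss = qcat_sset[OF X]
  obtain \<beta>\<^sub>1 where b1: "\<alpha>\<^sub>1 \<in> cells X 1" "\<beta>\<^sub>1 \<in> cells X 1" "triangle X \<alpha>\<^sub>1 \<beta>\<^sub>1 (idn X (act X 1 [0] \<alpha>\<^sub>1))" by (rule equivD[OF a1])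
  obtain \<beta>\<^sub>2 where b2: "\<alpha>\<^sub>2 \<in> cells X 1" "\<beta>\<^sub>2 \<in> cells X 1" "triangle X \<alpha>\<^sub>2 \<beta>\<^sub>2 (idn X (act X 1 [0] \<alpha>\<^sub>2))" "triangle X \<beta>\<^sub>2 \<alpha>\<^sub>2 (idn X (act X 1 [1] \<alpha>\<^sub>2))"
    by (rule equivD[OF a2])
  have ends: "act X 1 [1] \<alpha>\<^sub>2 = act X 1 [0] s'" "act X 1 [1] s' = act X 1 [1] \<alpha>\<^sub>2" "act X 1 [0] \<beta>\<^sub>2 = act X 1 [1] \<alpha>\<^sub>2" "s' \<in> cells X 1"
    using triangleD(4,5)[OF ss n(1)] triangleD[OF ss s'(1)] triangleD(4)[OF ss b2(3)] by auto
  obtain u where u: "triangle X \<alpha>\<^sub>2 s' u" by (rule compose_exists[OF X b2(1) ends(4,1)])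
  note uD = triangleD[OF ss u]
  have ub: "act X 1 [1] u = act X 1 [0] \<beta>\<^sub>2" using uD(6) ends by simp
  obtain s where s: "triangle X u \<beta>\<^sub>2 s" by (rule compose_exists[OF X uD(3) b2(2) ub])
  have be: "is_equiv X \<beta>\<^sub>2" by (rule equivI[OF ss, of _ \<alpha>\<^sub>2]) (use b2 triangleD[OF ss b2(3)] triangleD[OF ss b2(4)] in auto)
  have se: "is_equiv X s" by (rule equiv_comp[OF X equiv_comp[OF X a2 s'(3) u] be s])
  have su: "triangle X s \<alpha>\<^sub>2 u" using triangle_assoc[OF X s b2(4)] triangle_id(1)[OF ss uD(3)] ub ends(3) by metis
  have key: "triangle X s e f"
    if e: "triangle X \<alpha>\<^sub>2 e' d" "triangle X e \<alpha>\<^sub>1 d" and f: "triangle X \<alpha>\<^sub>2 f' d'" "triangle X f \<alpha>\<^sub>1 d'" and s'ef: "triangle X s' e' f'" for e e' f f' d d'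
  proof -
    have "triangle X u e' d'" using triangle_assoc[OF X u s'ef] f(1) by metis
    then have sd: "triangle X s d d'" using triangle_assoc[OF X su e(1)] by metis
    have "triangle X g \<alpha>\<^sub>1 c \<Longrightarrow> triangle X c \<beta>\<^sub>1 g" for g c
      using triangle_assoc[OF X _ b1(3)] triangle_id(1)[OF ss] triangleD[OF ss] by metis
    then show ?thesis using triangle_assoc[OF X sd] e(2) f(2) by metis
  qed
  show ?thesis by (rule that[OF key[OF n(1,2) n(1,2) s'(1)] key[OF n(3,4) n(5,6) s'(2)] se])
qed

section \<open>Simplicial sets that may lack degeneracies\<close>

definition good :: "'b sset \<Rightarrow> nat \<Rightarrow> 'b \<Rightarrow> bool" where
  "good K n b \<longleftrightarrow> (\<forall>m. \<forall>\<theta>\<in>ops m n. act K n \<theta> b \<in> cells K m)"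

text \<open>
  The fibres of the bispan category of arrows are only known to be closed under faces, not under
  degeneracies. A simplicial map out of such a set is undefined at the missing degeneracies of a
  simplex, which forces its value at that simplex to be totally degenerate.
\<close>

definition face_closed :: "'b sset \<Rightarrow> bool" where
  "face_closed K \<longleftrightarrow>
     (\<forall>n. \<forall>b\<in>cells K n. act K n [0..<Suc n] b = b) \<and>
     (\<forall>k m n. \<forall>\<psi>\<in>ops k m. \<forall>\<theta>\<in>ops m n. \<forall>b\<in>cells K n. act K m \<psi> (act K n \<theta> b) = act K n (map (nth \<theta>) \<psi>) b) \<and>
     (\<forall>m n. \<forall>\<theta>\<in>ops m n. \<forall>b. distinct \<theta> \<longrightarrow> b \<in> cells K n \<longrightarrow> act K n \<theta> b \<in> cells K m)"

lemma face_closedD: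
  assumes "face_closed K" "b \<in> cells K n"
  shows "act K n [0..<Suc n] b = b" "\<psi> \<in> ops k m \<Longrightarrow> \<theta> \<in> ops m n \<Longrightarrow> act K m \<psi> (act K n \<theta> b) = act K n (map (nth \<theta>) \<psi>) b"
    "\<theta> \<in> ops m n \<Longrightarrow> distinct \<theta> \<Longrightarrow> act K n \<theta> b \<in> cells K m"
  using assms unfolding face_closed_def by blast+

lemma good_act: "face_closed K \<Longrightarrow> b \<in> cells K n \<Longrightarrow> good K n b \<Longrightarrow> \<theta> \<in> ops m n \<Longrightarrow> good K m (act K n \<theta> b)"
  unfolding good_def by (metis face_closedD(2) ops_comp)

lemma map_nth_upt_map: "\<psi> \<in> ops k m \<Longrightarrow> map (nth (map f [0..<Suc m])) \<psi> = map f \<psi>"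
  by (subst map_nth_map[OF _ ops_id]) (simp_all only: ops_map_nth_id)

text \<open>The operator repeats each vertex at least m + 1 times, after S further copies of the
  first, so \<theta> factors through it by an injective operator. As membership passes to faces, a
  missing image of b under \<theta> makes all these large degeneracies missing.\<close>

lemma not_good_blowup:
  assumes K: "face_closed K" and b: "b \<in> cells K n" and t: "\<theta> \<in> ops m n" "act K n \<theta> b \<notin> cells K m" and q: "S + (n * Suc m + m) \<le> q"
  shows "map (\<lambda>p. min n ((p - S) div Suc m)) [0..<Suc q] \<in> ops q n"
    "act K n (map (\<lambda>p. min n ((p - S) div Suc m)) [0..<Suc q]) b \<notin> cells K q"
proof -
  let ?T = "map (\<lambda>p. min n ((p - S) div Suc m)) [0..<Suc q]"
  \<comment> \<open>The i-th entry is the i-th position in the block of the vertex \<theta> ! i;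
    this choice is strictly increasing even where \<theta> is constant.\<close>
  let ?i = "map (\<lambda>i. S + (\<theta> ! i * Suc m + i)) [0..<Suc m]"
  have "min n ((x - S) div Suc m) \<le> min n ((y - S) div Suc m)" if "x \<le> y" for x y
    using div_le_mono[of "x - S" "y - S" "Suc m"] that by linarith
  then have "sorted ?T" by (intro sorted_mapI) (auto simp del: upt_Suc)
  then show T: "?T \<in> ops q n" unfolding ops_def by (auto simp del: upt_Suc)
  have mono: "\<theta> ! i * Suc m + i < \<theta> ! j * Suc m + j" if "i < j" "j \<le> m" for i j
  proof -
    have "\<theta> ! i \<le> \<theta> ! j" using sorted_nth_mono[OF opsD(2)[OF t(1)]] opsD(1)[OF t(1)] that by simp
    then have "\<theta> ! i * Suc m \<le> \<theta> ! j * Suc m" by (rule mult_le_mono1)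
    then show ?thesis using that by linarith
  qed
  have bd: "S + (\<theta> ! i * Suc m + i) \<le> q" if "i \<le> m" for i
    using mult_le_mono1[OF ops_nth[OF t(1) that], of "Suc m"] that q by linarith
  have s: "sorted_wrt (<) ?i" unfolding sorted_wrt_iff_nth_less using mono by (auto simp del: upt_Suc mult_Suc_right)
  have i: "?i \<in> ops m q" unfolding ops_def
    using bd strict_sorted_imp_sorted[OF s] by (auto simp del: upt_Suc mult_Suc_right simp: less_Suc_eq_le)
  have d: "distinct ?i" using s by (simp only: strict_sorted_iff)
  have "min n ((S + (\<theta> ! i * Suc m + i) - S) div Suc m) = \<theta> ! i" if "i \<le> m" for i
  proof -
    have "(\<theta> ! i * Suc m + i) div Suc m = \<theta> ! i" using that by (intro div_nat_eqI) auto
    then show ?thesis using ops_nth[OF t(1) that] by simp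
  qed
  then have "map (\<lambda>p. min n ((p - S) div Suc m)) ?i = map (nth \<theta>) [0..<Suc m]"
    unfolding map_map o_def by (intro map_cong[OF refl]) (auto simp del: upt_Suc mult_Suc_right simp: less_Suc_eq_le)
  then have "map (nth ?T) ?i = \<theta>" unfolding map_nth_upt_map[OF i] map_nth_upt[OF opsD(1)[OF t(1)]] .
  then have e: "act K q ?i (act K n ?T b) = act K n \<theta> b" unfolding face_closedD(2)[OF K b i T] by (rule arg_cong)
  show "act K n ?T b \<notin> cells K q"
  proof
    assume "act K n ?T b \<in> cells K q"
    from face_closedD(3)[OF K this i d] show False unfolding e using t(2) by blast
  qed
qed

text \<open>The first vertex of \<open>undefined\<close>, regarded as a simplex of every large
  dimension. It depends on X alone, so that the values forced at different simplices
  coincide.\<close>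

definition undef_vertex :: "'x sset \<Rightarrow> 'x" where
  "undef_vertex X = (SOME y. \<exists>l. \<forall>q\<ge>l. act X q [0] undefined = y)"

text \<open>By \<open>not_good_blowup\<close>, the degeneracies of u =
  \<open>h n (\<psi>, b)\<close> along the operators for S = 0 and for S = n (m + 1) are both
  \<open>undefined\<close>, hence equal. One and the same operator ?i restricts the first to u and
  the second to a constant simplex.\<close>

lemma not_good_value:
  assumes X: "is_sset X" and K: "face_closed K" and b: "b \<in> cells K n" and ng: "\<not> good K n b"
    and h: "h \<in> smaps (simplex N \<otimes>\<^sub>s K) X" and p: "\<psi> \<in> ops n N"
  shows "h n (\<psi>, b) = cst X (undef_vertex X) n" "undef_vertex X \<in> cells X 0"
proof -
  obtain m \<theta> where t: "\<theta> \<in> ops m n" "act K n \<theta> b \<notin> cells K m" using ng unfolding good_def by blast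
  let ?u = "h n (\<psi>, b)"
  \<comment> \<open>A dimension large enough for both shifts.\<close>
  let ?l = "n * Suc m + (n * Suc m + m)"
  let ?T = "\<lambda>S q. map (\<lambda>p. min n ((p - S) div Suc m)) [0..<Suc q]"
  have u: "?u \<in> cells X n" by (rule smaps_in[OF h]) (use b p in simp)
  have un: "act X n (?T S q) ?u = undefined" if q: "S + (n * Suc m + m) \<le> q" for S q
  proof -
    note T = not_good_blowup[OF K b t q]
    have "act X n (?T S q) ?u = h q (act (simplex N \<otimes>\<^sub>s K) n (?T S q) (\<psi>, b))"
      using smaps_act[OF h T(1), of "(\<psi>, b)"] b p by simp
    then show ?thesis using smaps_undef[OF h, of "act (simplex N \<otimes>\<^sub>s K) n (?T S q) (\<psi>, b)" q] T(2) by simp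
  qed
  define y where "y = act X n [0] ?u"
  have yq: "act X q [0] undefined = y" if q: "?l \<le> q" for q
  proof -
    have q0: "0 + (n * Suc m + m) \<le> q" using q by simp
    have "act X q [0] (act X n (?T 0 q) ?u) = act X n [0] ?u"
      using sset_comp[OF X _ not_good_blowup(1)[OF K b t q0] u, of "[0]" 0] by (simp add: ops_def del: upt_Suc)
    then show ?thesis unfolding un[OF q0] y_def .
  qed
  have y: "undef_vertex X = y"
    unfolding undef_vertex_def
  proof (rule some_equality)
    show "\<exists>l. \<forall>q\<ge>l. act X q [0] undefined = y" using yq by blast
    fix z assume "\<exists>l. \<forall>q\<ge>l. act X q [0] undefined = z"
    then obtain l where "\<forall>q\<ge>l. act X q [0] undefined = z" by blast
    then show "z = y" using yq[of "max l ?l"] by simp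
  qed
  \<comment> \<open>The first position of each block for the shift 0; none of these positions
    exceeds the shift n (m + 1), so for that shift they all map to 0.\<close>
  let ?i = "map (\<lambda>i. i * Suc m) [0..<Suc n]"
  have i: "?i \<in> ops n ?l" unfolding ops_def
    by (auto simp del: upt_Suc mult_Suc_right simp: less_Suc_eq_le intro!: sorted_mapI mult_le_mono1 trans_le_add1)
  have le: "0 + (n * Suc m + m) \<le> ?l" "n * Suc m + (n * Suc m + m) \<le> ?l" by simp_all
  have a: "act X ?l ?i (act X n (?T S ?l) ?u) = act X n (map (\<lambda>p. min n ((p - S) div Suc m)) ?i) ?u" if "S + (n * Suc m + m) \<le> ?l" for S
    unfolding sset_comp[OF X i not_good_blowup(1)[OF K b t that] u] map_nth_upt_map[OF i] ..
  have "map (\<lambda>p. min n ((p - 0) div Suc m)) ?i = [0..<Suc n]"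
    unfolding map_map o_def by (intro map_idI) (auto simp del: upt_Suc mult_Suc_right simp: less_Suc_eq_le)
  then have 1: "act X ?l ?i undefined = ?u" using a[OF le(1)] sset_id[OF X u] unfolding un[OF le(1)] by metis
  have "map (\<lambda>p. min n ((p - n * Suc m) div Suc m)) ?i = replicate (Suc n) 0"
  proof -
    have "min n ((i * Suc m - n * Suc m) div Suc m) = 0" if "i \<le> n" for i using mult_le_mono1[OF that, of "Suc m"] by (simp del: mult_Suc_right)
    then show ?thesis unfolding map_map o_def
      by (intro nth_equalityI) (auto simp del: upt_Suc mult_Suc_right replicate_Suc simp: less_Suc_eq_le)
  qed
  then have "act X ?l ?i undefined = act X n (replicate (Suc n) 0) ?u" using a[OF le(2)] unfolding un[OF le(2)] by metis
  then show "?u = cst X (undef_vertex X) n" using 1 cst_vertex[OF X u le0] unfolding y y_def by simp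
  show "undef_vertex X \<in> cells X 0" unfolding y y_def by (rule sset_in[OF X _ u]) (simp add: ops_def)
qed

section \<open>Components of transformations\<close>

definition component :: "'b sset \<Rightarrow> (nat list \<times> 'b, 'x) smap \<Rightarrow> 'b \<Rightarrow> 'x" where
  "component K h t = h 1 ([0, 1], act K 0 [0, 0] t)"

text \<open>The 2-simplex of transformations is evaluated at the twofold degeneracy of t, which
  exists because t is good.\<close>

lemma component_triangle:
  assumes X: "is_sset X" and K: "face_closed K" and t: "t \<in> cells K 0" and g: "good K 0 t" and tr: "triangle (fun_sset K X) f e h"
  shows "triangle X (component K f t) (component K e t) (component K h t)"
proof -
  obtain s where s: "s \<in> cells (fun_sset K X) 2" "act (fun_sset K X) 2 [0, 1] s = f" "act (fun_sset K X) 2 [1, 2] s = e" "act (fun_sset K X) 2 [0, 2] s = h"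
    using tr unfolding triangle_def by blast
  have sm: "s \<in> smaps (simplex 2 \<otimes>\<^sub>s K) X" using s(1) by (simp add: fun_cells)
  have o2: "[0, 0, 0] \<in> ops 2 0" and o1: "[0, 0] \<in> ops 1 0" and i2: "[0, 1, 2] \<in> ops 2 2" and i1: "[0, 1] \<in> ops 1 1" by (auto simp: ops_def)
  have t2: "act K 0 [0, 0, 0] t \<in> cells K 2" and t1: "act K 0 [0, 0] t \<in> cells K 1" using g o2 o1 unfolding good_def by auto
  let ?y = "([0, 1, 2], act K 0 [0, 0, 0] t)"
  have y: "?y \<in> cells (simplex 2 \<otimes>\<^sub>s K) 2" using t2 i2 by simp
  have e: "act X 2 [i, j] (s 2 ?y) = component K (act (fun_sset K X) 2 [i, j] s) t" if ij: "i \<le> j" "j \<le> 2" for i j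
  proof -
    have o: "[i, j] \<in> ops 1 2" using ij by (auto simp: ops_def)
    have "i < 3" "j < 3" using ij by auto
    then have n: "map (nth [0, 1, 2]) [i, j] = [i, j]" "map (nth [0::nat, 0, 0]) [i, j] = [0, 0]" by (auto simp: less_Suc_eq numeral_3_eq_3)
    have "act X 2 [i, j] (s 2 ?y) = s 1 ([i, j], act K 0 [0, 0] t)"
      using smaps_act[OF sm o y] face_closedD(2)[OF K t o o2] n by simp
    then show ?thesis unfolding component_def fun_act_app[OF o i1 t1] by simp
  qed
  show ?thesis
    unfolding triangle_def using smaps_in[OF sm y] e[of 0 1] e[of 1 2] e[of 0 2] s by (intro bexI[of _ "s 2 ?y"]) auto
qed

lemma component_ends:
  assumes K: "face_closed K" and t: "t \<in> cells K 0" and d: "act K 0 [0, 0] t \<in> cells K 1" and h: "h \<in> cells (fun_sset K X) 1" and i: "i \<le> 1"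
  shows "act X 1 [i] (component K h t) = act (fun_sset K X) 1 [i] h 0 ([0], t)"
    "component K (idn (fun_sset K X) (act (fun_sset K X) 1 [i] h)) t = idn X (act X 1 [i] (component K h t))"
proof -
  have hm: "h \<in> smaps (simplex 1 \<otimes>\<^sub>s K) X" using h by (simp add: fun_cells)
  have o: "[0, 0] \<in> ops 1 0" "[i] \<in> ops 0 1" "[0, 1] \<in> ops 1 1" "[0] \<in> ops 0 0" using i by (auto simp: ops_def)
  have b: "[0, 1] ! i = i" using i by (cases i) auto
  have t0: "act K 1 [i] (act K 0 [0, 0] t) = t" using face_closedD(2)[OF K t o(2,1)] face_closedD(1)[OF K t] i by (cases i) auto
  have 1: "act X 1 [i] (component K h t) = h 0 ([i], t)"
    unfolding component_def using smaps_act[OF hm o(2), of "([0, 1], act K 0 [0, 0] t)"] d o b t0 by simp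
  then show "act X 1 [i] (component K h t) = act (fun_sset K X) 1 [i] h 0 ([0], t)" unfolding fun_act_app[OF o(2,4) t] by simp
  have "component K (idn (fun_sset K X) (act (fun_sset K X) 1 [i] h)) t = h 1 ([i, i], act K 0 [0, 0] t)"
    unfolding component_def idn_def fun_act_app[OF o(1,3) d] using fun_act_app[OF o(2), of "[0, 0]" 1] o d by simp
  also have "\<dots> = idn X (h 0 ([i], t))"
    unfolding idn_def using smaps_act[OF hm o(1), of "([i], t)"] o t by simp
  finally show "component K (idn (fun_sset K X) (act (fun_sset K X) 1 [i] h)) t = idn X (act X 1 [i] (component K h t))" unfolding 1 .
qed

lemma component_equiv:
  assumes X: "is_sset X" and K: "face_closed K" and t: "t \<in> cells K 0" and g: "good K 0 t" and h: "is_equiv (fun_sset K X) h"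
  shows "is_equiv X (component K h t)"
proof -
  obtain e where e: "h \<in> cells (fun_sset K X) 1" "triangle (fun_sset K X) h e (idn (fun_sset K X) (act (fun_sset K X) 1 [0] h))"
    "triangle (fun_sset K X) e h (idn (fun_sset K X) (act (fun_sset K X) 1 [1] h))" by (rule equivD[OF h])
  have d: "act K 0 [0, 0] t \<in> cells K 1" using g unfolding good_def by (auto simp: ops_def)
  show ?thesis
    by (rule equivI[OF X, of _ "component K e t"])
      (use component_triangle[OF X K t g e(2)] component_triangle[OF X K t g e(3)] component_ends(2)[OF K t d e(1)] in simp_all)
qed

text \<open>The product of the interval with e consists of two triangles, built on the two
  degeneracies of e; they exist because e is good.\<close>

lemma naturality:
  assumes X: "is_sset X" and K: "face_closed K" and e: "e \<in> cells K 1" and g: "good K 1 e" and h: "h \<in> smaps (simplex 1 \<otimes>\<^sub>s K) X"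
  shows "triangle X (component K h (act K 1 [0] e)) (h 1 ([1, 1], e)) (h 1 ([0, 1], e))"
    "triangle X (h 1 ([0, 0], e)) (component K h (act K 1 [1] e)) (h 1 ([0, 1], e))"
proof -
  have o: "[0, 0, 1] \<in> ops 2 1" "[0, 1, 1] \<in> ops 2 1" "[0, 1] \<in> ops 1 2" "[1, 2] \<in> ops 1 2" "[0, 2] \<in> ops 1 2" "[0, 0] \<in> ops 1 0" "[0] \<in> ops 0 1" "[1] \<in> ops 0 1" by (auto simp: ops_def)
  have e2: "act K 1 [0, 0, 1] e \<in> cells K 2" "act K 1 [0, 1, 1] e \<in> cells K 2" using g o unfolding good_def by auto
  have id: "act K 1 [0, 1] e = e" using face_closedD(1)[OF K e] by (simp add: upt_rec)
  note c = face_closedD(2)[OF K e]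
  have y: "([0, 1, 1], act K 1 [0, 0, 1] e) \<in> cells (simplex 1 \<otimes>\<^sub>s K) 2" "([0, 0, 1], act K 1 [0, 1, 1] e) \<in> cells (simplex 1 \<otimes>\<^sub>s K) 2"
    using e2 o by simp_all
  note a = smaps_act[OF h _ y(1)] and a' = smaps_act[OF h _ y(2)]
  show "triangle X (component K h (act K 1 [0] e)) (h 1 ([1, 1], e)) (h 1 ([0, 1], e))"
    unfolding triangle_def component_def
    using smaps_in[OF h y(1)] a[OF o(3)] a[OF o(4)] a[OF o(5)] c[OF o(3,1)] c[OF o(4,1)] c[OF o(5,1)] c[OF o(6,7)] id
    by (intro bexI[of _ "h 2 ([0, 1, 1], act K 1 [0, 0, 1] e)"]) auto
  show "triangle X (h 1 ([0, 0], e)) (component K h (act K 1 [1] e)) (h 1 ([0, 1], e))"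
    unfolding triangle_def component_def
    using smaps_in[OF h y(2)] a'[OF o(3)] a'[OF o(4)] a'[OF o(5)] c[OF o(3,2)] c[OF o(4,2)] c[OF o(5,2)] c[OF o(6,8)] id
    by (intro bexI[of _ "h 2 ([0, 0, 1], act K 1 [0, 1, 1] e)"]) auto
qed

lemma cst_one: "cst X y 1 = idn X y"
  by (simp add: cst_def idn_def)

lemma not_good_face: "face_closed K \<Longrightarrow> b \<in> cells K n \<Longrightarrow> \<theta> \<in> ops m n \<Longrightarrow> \<not> good K m (act K n \<theta> b) \<Longrightarrow> \<not> good K n b"
  using good_act[of K b n \<theta> m] by blast

text \<open>The operator ?p jumps from 0 to 1 between i and i + 1, where b has the degenerate edge
  at t. So the component is an edge of the value at b, which is totally degenerate by
  \<open>not_good_value\<close>.\<close>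

lemma component_trivial:
  assumes X: "is_sset X" and K: "face_closed K" and b: "b \<in> cells K n" and ng: "\<not> good K n b"
    and i: "i < n" "act K n [i, Suc i] b = act K 0 [0, 0] t" and h: "h \<in> smaps (simplex 1 \<otimes>\<^sub>s K) X"
  shows "component K h t = idn X (undef_vertex X)"
proof -
  let ?p = "map (\<lambda>j. if j \<le> i then 0 :: nat else 1) [0..<Suc n]"
  have p: "?p \<in> ops n 1" unfolding ops_def by (auto simp del: upt_Suc intro!: sorted_mapI)
  note v = not_good_value[OF X K b ng h p]
  have o: "[i, Suc i] \<in> ops 1 n" using i by (auto simp: ops_def)
  have "(?p, b) \<in> cells (simplex 1 \<otimes>\<^sub>s K) n" using p b by simp
  from smaps_act[OF h o this] have "h 1 (map (nth ?p) [i, Suc i], act K 0 [0, 0] t) = act X n [i, Suc i] (cst X (undef_vertex X) n)"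
    unfolding v(1) i(2)[symmetric] by simp
  moreover have "map (nth ?p) [i, Suc i] = [0, 1]" unfolding map_nth_upt_map[OF o] by simp
  ultimately show ?thesis unfolding component_def cst_act[OF X v(2) o] cst_one by (simp only:)
qed

text \<open>
  In the application p and q are the projections, r is the addition and \<open>\<delta>\<close> the backward fold
  map, with t the value at 1 and t' the value at 2. If one of p, q, r is not good, its value is
  an identity; the simplices provided by the last six assumptions are then not good either and
  contain degenerate edges at t and t', so that the components there are identities as well.
\<close>

lemma grouplike_invariance:
  assumes X: "qcat X" and K: "face_closed K" and h: "is_equiv (fun_sset K X) h"
    and t: "t \<in> cells K 0" "t' \<in> cells K 0"
    and p: "\<And>e. e \<in> {p, q, r} \<Longrightarrow> e \<in> cells K 1 \<and> act K 1 [0] e = t' \<and> act K 1 [1] e = t" and dl: "\<delta> \<in> cells K 1"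
    and w1: "good K 0 t' \<Longrightarrow> act K 1 [0, 0, 1] r \<in> cells K 2"
    and w2: "\<And>e. e \<in> {p, q} \<Longrightarrow> good K 0 t \<Longrightarrow> act K 1 [0, 1, 1] e \<in> cells K 2"
    and w3: "good K 0 t' \<Longrightarrow> act K 1 [0, 1, 1] \<delta> \<in> cells K 2 \<and> act K 1 [1] \<delta> = t'"
    and w4: "good K 0 t' \<Longrightarrow> good K 1 \<delta> \<Longrightarrow> \<exists>c\<in>cells K 3. act K 3 [0, 1] c = act K 0 [0, 0] t \<and> act K 3 [2, 3] c = r"
    and w5: "good K 0 t \<Longrightarrow> good K 1 p \<Longrightarrow> \<exists>c\<in>cells K 3. act K 3 [0, 1] c = \<delta> \<and> act K 3 [2, 3] c = act K 0 [0, 0] t"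
    and w6: "\<And>e. e \<in> {p, q} \<Longrightarrow> good K 0 t' \<Longrightarrow> good K 1 \<delta> \<Longrightarrow> \<exists>c\<in>cells K 3. act K 3 [0, 1] c = e \<and> act K 3 [2, 3] c = act K 0 [0, 0] t'"
    and s': "triangle X s' (h 1 ([1, 1], p)) (h 1 ([1, 1], p))" "triangle X s' (h 1 ([1, 1], q)) (h 1 ([1, 1], r))" "is_equiv X s'"
  obtains s where "triangle X s (h 1 ([0, 0], p)) (h 1 ([0, 0], p))" "triangle X s (h 1 ([0, 0], q)) (h 1 ([0, 0], r))" "is_equiv X s"
proof -
  note ss = qcat_sset[OF X]
  have hm: "h \<in> smaps (simplex 1 \<otimes>\<^sub>s K) X" using equivD[OF h] unfolding fun_cells by blast
  let ?y = "undef_vertex X"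
  let ?i = "idn X ?y"
  have o: "[0, 0, 1] \<in> ops 2 1" "[0, 1, 1] \<in> ops 2 1" "[0, 1] \<in> ops 1 2" "[1, 2] \<in> ops 1 2" "[0, 1] \<in> ops 1 3" "[2, 3] \<in> ops 1 3"
    "[0] \<in> ops 0 1" "[1] \<in> ops 0 1" "[0, 0] \<in> ops 1 1" "[0, 1] \<in> ops 1 1" "[1, 1] \<in> ops 1 1" "[0, 0] \<in> ops 1 0" by (auto simp: ops_def)
  have bad: "h 1 ([a, b], e) = ?i" "?y \<in> cells X 0" if "e \<in> {p, q, r}" "\<not> good K 1 e" "[a, b] \<in> ops 1 1" for a b e
    using not_good_value[OF ss K _ that(2) hm that(3)] p[OF that(1)] cst_one[of X ?y] by auto
  show ?thesis
  proof (cases "good K 0 t \<and> good K 0 t'")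
    \<comment> \<open>Each of p, q, r has both t and t' as ends, so none of them is good; their
      values are all the same identity, which is then a shear map.\<close>
    case False
    have "\<not> good K 1 e" if "e \<in> {p, q, r}" for e
      using not_good_face[OF K, of e 1 "[0]" 0] not_good_face[OF K, of e 1 "[1]" 0] False p[OF that] o by auto
    then have "h 1 ([0, 0], p) = ?i" "h 1 ([0, 0], q) = ?i" "h 1 ([0, 0], r) = ?i" "?y \<in> cells X 0"
      using bad(1)[OF _ _ o(9)] bad(2)[of p, OF _ _ o(9)] by blast+
    moreover have "triangle X ?i ?i ?i" using triangle_id(1)[OF ss idn_in[OF ss]] act_idn[OF ss, of ?y 1] calculation by simp
    ultimately show ?thesis using that[of ?i] idn_equiv[OF ss] by simp
  next
    case True
    have eqv: "is_equiv X (component K h t)" "is_equiv X (component K h t')"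
      using component_equiv[OF ss K _ _ h] t True by auto
    \<comment> \<open>One bad edge among p, q, r trivializes both components: the simplices of
      \<open>w1\<close> to \<open>w6\<close> carry the defect to a simplex that has a degenerate
      edge at t or t'.\<close>
    have tr: "component K h t = ?i" "component K h t' = ?i" if e: "e \<in> {p, q, r}" and ng: "\<not> good K 1 e" for e
    proof -
      have eK: "e \<in> cells K 1" and e0: "act K 1 [0] e = t'" "act K 1 [1] e = t" using p[OF e] by auto
      note c = face_closedD(2)[OF K]
      have id: "act K 1 [0, 1] b = b" if "b \<in> cells K 1" for b using face_closedD(1)[OF K that] by (simp add: upt_rec)
      have c3: "component K h u = ?i" if "c \<in> cells K 3" "act K 3 [i, Suc i] c = act K 0 [0, 0] u" "i < 3" "[j, k] \<in> ops 1 3" "\<not> good K 1 (act K 3 [j, k] c)" for c i u j k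
        using component_trivial[OF ss K that(1) not_good_face[OF K that(1,4,5)] that(3,2) hm] .
      have c2: "component K h u = ?i" if "b \<in> cells K 1" "\<not> good K 1 b" "act K 1 [0, 1, 1] b \<in> cells K 2" "act K 1 [1] b = u" for b u
      proof (rule component_trivial[OF ss K that(3) not_good_face[OF K that(3) o(3)], of 1])
        show "\<not> good K 1 (act K 2 [0, 1] (act K 1 [0, 1, 1] b))" using c[OF that(1) o(3,2)] id[OF that(1)] that(2) by simp
        show "act K 2 [1, Suc 1] (act K 1 [0, 1, 1] b) = act K 0 [0, 0] u"
          using c[OF that(1) o(4,2)] c[OF that(1) o(12,8)] that(4) by (simp add: numeral_2_eq_2)
      qed (use hm in auto)
      have c2': "component K h u = ?i" if "b \<in> cells K 1" "\<not> good K 1 b" "act K 1 [0, 0, 1] b \<in> cells K 2" "act K 1 [0] b = u" for b u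
      proof (rule component_trivial[OF ss K that(3) not_good_face[OF K that(3) o(4)], of 0])
        show "\<not> good K 1 (act K 2 [1, 2] (act K 1 [0, 0, 1] b))" using c[OF that(1) o(4,1)] id[OF that(1)] that(2) by simp
        show "act K 2 [0, Suc 0] (act K 1 [0, 0, 1] b) = act K 0 [0, 0] u"
          using c[OF that(1) o(3,1)] c[OF that(1) o(12,7)] that(4) by simp
      qed (use hm in auto)
      show "component K h t = ?i"
      proof (cases "e \<in> {p, q}")
        case pq: True show ?thesis by (rule c2[OF eK ng w2[OF pq] e0(2)]) (use True in simp)
      next
        case False
        then have er: "e = r" using e by blast
        show ?thesis
        \<comment> \<open>If \<delta> is good, r and the degenerate edge at t lie in one simplex;
          otherwise \<delta> is bad and, for good p, lies in a simplex together with this edge; and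
          a bad p has t as its target.\<close>
        proof (cases "good K 1 \<delta>")
          case dg: True
          obtain b where "b \<in> cells K 3" "act K 3 [0, 1] b = act K 0 [0, 0] t" "act K 3 [2, 3] b = r" using w4 dg True by blast
          then show ?thesis using c3[of b 0 t 2 3] ng er o by simp
        next
          case dg: False
          show ?thesis
          proof (cases "good K 1 p")
            case pg: True
            obtain b where "b \<in> cells K 3" "act K 3 [0, 1] b = \<delta>" "act K 3 [2, 3] b = act K 0 [0, 0] t" using w5 pg True by blast
            then show ?thesis using c3[of b 2 t 0 1] dg o by simp
          next
            case pg: False
            have pp: "p \<in> {p, q}" "p \<in> {p, q, r}" by auto
            show ?thesis by (rule c2[OF _ pg w2[OF pp(1)]]) (use p[OF pp(2)] True in auto)
          qed
        qed
      qed
      show "component K h t' = ?i"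
      proof (cases "e \<in> {p, q}")
        case False
        then have er: "e = r" using e by blast
        show ?thesis by (rule c2'[OF eK ng _ e0(1)]) (use True w1 er in simp)
      next
        case pq: True
        show ?thesis
        proof (cases "good K 1 \<delta>")
          case dg: False show ?thesis by (rule c2[OF dl dg]) (use w3 True in auto)
        next
          case dg: True
          obtain b where "b \<in> cells K 3" "act K 3 [0, 1] b = e" "act K 3 [2, 3] b = act K 0 [0, 0] t'" using w6[OF pq _ dg] True by blast
          then show ?thesis using c3[of b 2 t' 0 1] ng o by simp
        qed
      qed
    qed
    \<comment> \<open>Good edges give genuine naturality squares; for a bad edge all four sides are
      the same identity.\<close>
    have "\<exists>d. triangle X (component K h t') (h 1 ([1, 1], e)) d \<and> triangle X (h 1 ([0, 0], e)) (component K h t) d" if e: "e \<in> {p, q, r}" for e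
    proof (cases "good K 1 e")
      case g: True
      show ?thesis using naturality[OF ss K _ g hm] p[OF e] by metis
    next
      case g: False
      have "triangle X ?i ?i ?i" using triangle_id(1)[OF ss idn_in[OF ss]] act_idn[OF ss, of ?y 1] bad(2)[OF e g o(9)] by simp
      then show ?thesis using tr[OF e g] bad(1)[OF e g] o by auto
    qed
    then obtain d d' d'' where "triangle X (component K h t') (h 1 ([1, 1], p)) d" "triangle X (h 1 ([0, 0], p)) (component K h t) d"
      "triangle X (component K h t') (h 1 ([1, 1], q)) d'" "triangle X (h 1 ([0, 0], q)) (component K h t) d'"
      "triangle X (component K h t') (h 1 ([1, 1], r)) d''" "triangle X (h 1 ([0, 0], r)) (component K h t) d''"
      by (metis insertCI)
    from grouplike_transport[OF X eqv this s', where thesis = thesis] that show ?thesis by blast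
  qed
qed

section \<open>The fibres of the bispan category of arrows\<close>

definition fib :: "'c sset \<Rightarrow> 'c set \<Rightarrow> 'c set \<Rightarrow> 'c \<Rightarrow> 'c arr spn spn sset" where
  "fib C M A x = sub_sset (ar_bispan C M A) (\<lambda>n b. ar_base n b = cspan C x n)"

lemma base_cspan:
  assumes C: "is_sset C" and x: "x \<in> cells C 0" and b: "bispan_map (ev 1) n b = bw (op_sset (Span C M)) n (cspan C x n)"
  shows "ar_base n b = cspan C x n"
proof -
  have "ar_base n b = act (op_sset (Span C M)) n (map (\<lambda>p. n - snd p) (map (\<lambda>i. (0 :: nat, n - i)) [0..<Suc n])) (cspan C x n)"
    unfolding ar_base_def b bw_def[of "op_sset _"] srestrict_in[OF base_list] by (rule refl)
  then show ?thesis unfolding cspan_act[OF C x mono_tw_ops[OF mono_tw_bw base_list]] .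
qed

lemma fib_cells:
  assumes C: "qcat C" and M: "wide C M" and x: "x \<in> cells C 0"
  shows "b \<in> cells (fib C M A x) n \<longleftrightarrow> b \<in> cells (Bispan (Ar C) (ar_pb C M) (ar_fw C A)) n \<and>
    bispan_map (ev 1) n b = bw (op_sset (Span C M)) n (cspan C x n)"
  unfolding fib_def sub_sset_def ar_bispan_def using base_cspan[OF qcat_sset[OF C] x, of n b M] cspan_in[OF C M x, of n] by auto

lemma fib_act: "act (fib C M A x) = act (Span (arc C M) W)"
  unfolding fib_def sub_sset_def using ar_bispan_act[of C M A W] by simp

lemma bw_cspan_act:
  assumes C: "is_sset C" and x: "x \<in> cells C 0" and t: "\<theta> \<in> ops m n"
  shows "act (Span Z W) n \<theta> (bw (op_sset (Span C M)) n (cspan C x n)) = bw (op_sset (Span C M)) m (cspan C x m)"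
  unfolding Span_act[OF t] bw_def[of "op_sset _"]
proof (rule srestrict_cong)
  fix l v assume v: "v \<in> cells (Tw m) l"
  note v' = Tw_map[OF t v]
  show "srestrict (Tw n) (\<lambda>l v. act (op_sset (Span C M)) n (map (\<lambda>p. n - snd p) v) (cspan C x n)) l (map (map_prod ((!) \<theta>) ((!) \<theta>)) v) =
    act (op_sset (Span C M)) m (map (\<lambda>p. m - snd p) v) (cspan C x m)"
    unfolding srestrict_in[OF v'] cspan_act[OF C x mono_tw_ops[OF mono_tw_bw v]] by (rule cspan_act[OF C x mono_tw_ops[OF mono_tw_bw v']])
qed

lemma map_prod_ops: "v \<in> cells (Tw m) l \<Longrightarrow> \<psi> \<in> ops m j \<Longrightarrow>
    map (map_prod (nth \<theta>) (nth \<theta>)) (map (map_prod (nth \<psi>) (nth \<psi>)) v) = map (map_prod (nth (map (nth \<theta>) \<psi>)) (nth (map (nth \<theta>) \<psi>))) v"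
proof -
  assume v: "v \<in> cells (Tw m) l" and p: "\<psi> \<in> ops m j"
  have "fst p \<le> m \<and> snd p \<le> m" if "p \<in> set v" for p
    using v that by (auto simp: Tw_cells in_set_conv_nth less_Suc_eq_le)
  then show ?thesis using opsD(1)[OF p] by (auto simp: less_Suc_eq_le)
qed

text \<open>An injective operator keeps the strict inequalities between the ends of intervals, so
  every square of the face is a square of h. A degeneracy would add squares with a degenerate side,
  about which nothing is known in Z.\<close>

lemma Span_face_closed:
  assumes h: "h \<in> cells (Span Z W) n"
  shows "act (Span Z W) n [0..<Suc n] h = h"
    "\<psi> \<in> ops k m \<Longrightarrow> \<theta> \<in> ops m n \<Longrightarrow> act (Span Z W) m \<psi> (act (Span Z W) n \<theta> h) = act (Span Z W) n (map (nth \<theta>) \<psi>) h"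
    "\<theta> \<in> ops m n \<Longrightarrow> distinct \<theta> \<Longrightarrow> act (Span Z W) n \<theta> h \<in> cells (Span Z W) m"
proof -
  have hm: "h \<in> smaps (Tw n) Z" using h unfolding Span_def by simp
  have id: "map (map_prod (nth [0..<Suc n]) (nth [0..<Suc n])) v = v" if v: "v \<in> cells (Tw n) l" for v l
  proof (rule map_idI)
    fix p assume "p \<in> set v"
    then have "fst p \<le> snd p" "snd p \<le> n" using v by (auto simp: Tw_cells in_set_conv_nth less_Suc_eq_le)
    then show "map_prod (nth [0..<Suc n]) (nth [0..<Suc n]) p = p" by (cases p) (simp del: upt_Suc)
  qed
  show "act (Span Z W) n [0..<Suc n] h = h"
    unfolding Span_act[OF ops_id] srestrict_def using id smaps_undef[OF hm] by (intro ext) (auto simp del: upt_Suc)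
  {
    assume p: "\<psi> \<in> ops k m" and t: "\<theta> \<in> ops m n"
    show "act (Span Z W) m \<psi> (act (Span Z W) n \<theta> h) = act (Span Z W) n (map (nth \<theta>) \<psi>) h"
      unfolding Span_act[OF p] Span_act[OF t] Span_act[OF ops_comp[OF p t]]
      by (rule srestrict_cong) (simp only: srestrict_in[OF Tw_map[OF p]] map_prod_ops[OF _ p])
  }
  assume t: "\<theta> \<in> ops m n" and d: "distinct \<theta>"
  have lt: "\<theta> ! i < \<theta> ! j" if "i < j" "j \<le> m" for i j
    using that sorted_nth_mono[OF opsD(2)[OF t], of i j] opsD(1)[OF t] d by (simp add: nth_eq_iff_index_eq le_neq_implies_less)
  have le: "\<theta> ! i \<le> \<theta> ! j" if "i \<le> j" "j \<le> m" for i j using lt[of i j] that by (cases "i = j") auto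
  note b = ops_nth[OF t]
  let ?h = "act (Span Z W) n \<theta> h"
  have "?h \<in> smaps (Tw m) Z"
    unfolding Span_act[OF t]
  proof (rule srestrict_smaps)
    fix l v assume v: "v \<in> cells (Tw m) l"
    show "h l (map (map_prod (nth \<theta>) (nth \<theta>)) v) \<in> cells Z l" by (rule smaps_in[OF hm Tw_map[OF t v]])
    fix k \<chi> assume c: "\<chi> \<in> ops k l"
    show "act (Tw m) l \<chi> v \<in> cells (Tw m) k" unfolding Tw_act by (rule Tw_in[OF v c])
    have "map (map_prod (nth \<theta>) (nth \<theta>)) (map (nth v) \<chi>) = map (nth (map (map_prod (nth \<theta>) (nth \<theta>)) v)) \<chi>"
      using ops_nth[OF c] opsD(1)[OF c] v by (intro nth_equalityI) (auto simp: Tw_cells less_Suc_eq_le)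
    then show "h k (map (map_prod (nth \<theta>) (nth \<theta>)) (act (Tw m) l \<chi> v)) = act Z l \<chi> (h l (map (map_prod (nth \<theta>) (nth \<theta>)) v))"
      using smaps_act[OF hm c Tw_map[OF t v]] unfolding Tw_act by metis
  qed
  moreover have "?h 1 [(i, j), (i', j)] \<in> W" if a: "i \<le> i' \<and> i' \<le> j \<and> j \<le> m" for i i' j
  proof -
    have "[(i, j), (i', j)] \<in> cells (Tw m) 1" using a by (auto simp: Tw_cells nth_Cons split: nat.splits)
    then have "?h 1 [(i, j), (i', j)] = h 1 [(\<theta> ! i, \<theta> ! j), (\<theta> ! i', \<theta> ! j)]" unfolding Span_act[OF t] by simp
    then show ?thesis using h a le[of i i'] le[of i' j] b[of j] unfolding Span_def by simp
  qed
  moreover have "is_pullback Z (tw_square ?h i i' j' j)" if a: "i < i' \<and> i' \<le> j' \<and> j' < j \<and> j \<le> m" for i i' j' j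
  proof -
    have "tw_square ?h i i' j' j = tw_square h (\<theta> ! i) (\<theta> ! i') (\<theta> ! j') (\<theta> ! j)"
      unfolding tw_square_def
    proof (rule srestrict_cong)
      fix l v assume v: "v \<in> cells square l"
      let ?f = "\<lambda>(a, b). (if a = 0 then i else i', if b = 0 then j else j')"
      have "map ?f v \<in> cells (Tw m) l" by (rule tw_square_in[OF v]) (use a in auto)
      then have "?h l (map ?f v) = h l (map (map_prod (nth \<theta>) (nth \<theta>)) (map ?f v))" unfolding Span_act[OF t] by (rule srestrict_in)
      moreover have "map (map_prod (nth \<theta>) (nth \<theta>)) (map ?f v) =
        map (\<lambda>(a, b). (if a = 0 then \<theta> ! i else \<theta> ! i', if b = 0 then \<theta> ! j else \<theta> ! j')) v" by (auto split: prod.splits)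
      ultimately show "?h l (map ?f v) = h l (map (\<lambda>(a, b). (if a = 0 then \<theta> ! i else \<theta> ! i', if b = 0 then \<theta> ! j else \<theta> ! j')) v)" by metis
    qed
    then show ?thesis using h a lt[of i i'] le[of i' j'] lt[of j' j] b[of j] unfolding Span_def by simp
  qed
  ultimately show "?h \<in> cells (Span Z W) m" unfolding Span_def by simp
qed

lemma fib_face_closed:
  assumes C: "qcat C" and M: "wide C M" and x: "x \<in> cells C 0"
  shows "face_closed (fib C M A x)"
proof -
  let ?W = "{e \<in> cells (Span (Ar C) (ar_pb C M)) 1. is_equiv (Ar C) (fw_leg e) \<and> bw_leg e \<in> ar_fw C A}"
  have B: "Bispan (Ar C) (ar_pb C M) (ar_fw C A) = Span (arc C M) ?W" by (simp add: Bispan_def arc_def)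
  note c = fib_cells[OF C M x, where A = A, unfolded B] and a = fib_act[where W = ?W]
  show ?thesis
    unfolding face_closed_def
  proof (intro conjI allI ballI impI)
    fix n b assume "b \<in> cells (fib C M A x) n"
    then show "act (fib C M A x) n [0..<Suc n] b = b" unfolding c a using Span_face_closed(1) by blast
  next
    fix k m n \<psi> \<theta> b assume "\<psi> \<in> ops k m" "\<theta> \<in> ops m n" "b \<in> cells (fib C M A x) n"
    then show "act (fib C M A x) m \<psi> (act (fib C M A x) n \<theta> b) = act (fib C M A x) n (map (nth \<theta>) \<psi>) b"
      unfolding c a using Span_face_closed(2) by blast
  next
    fix m n \<theta> b assume t: "\<theta> \<in> ops m n" "distinct \<theta>" and b: "b \<in> cells (fib C M A x) n"
    have f: "bispan_map (ev 1) m (act (Span (arc C M) ?W) n \<theta> b) = act (Span (op_sset (Span C M)) {}) n \<theta> (bispan_map (ev 1) n b)"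
      unfolding bispan_map_def by (rule Span_act_span_map[OF t(1), symmetric])
    have b': "b \<in> cells (Span (arc C M) ?W) n" "bispan_map (ev 1) n b = bw (op_sset (Span C M)) n (cspan C x n)" using b unfolding c by blast+
    then have "bispan_map (ev 1) m (act (Span (arc C M) ?W) n \<theta> b) = bw (op_sset (Span C M)) m (cspan C x m)"
      by (simp only: f b'(2) bw_cspan_act[OF qcat_sset[OF C] x t(1)])
    with Span_face_closed(3)[OF b'(1) t] show "act (fib C M A x) n \<theta> b \<in> cells (fib C M A x) m" unfolding c a by (rule conjI)
  qed
qed

text \<open>All faces and degeneracies of the constant span are constant, so the condition that cuts
  out the pullback does not involve the simplex coordinate.\<close>

lemma pull_fib:
  assumes C: "is_sset C" and x: "x \<in> cells C 0"
  shows "pull (ar_bispan C M A) ar_base (Span C M) n (cspan C x n) = simplex n \<otimes>\<^sub>s fib C M A x"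
proof (rule sset.equality)
  show "cells (pull (ar_bispan C M A) ar_base (Span C M) n (cspan C x n)) = cells (simplex n \<otimes>\<^sub>s fib C M A x)"
    using cspan_act'[OF C x, where M = M] by (auto simp: fun_eq_iff pull_def sub_sset_def fib_def)
  show "act (pull (ar_bispan C M A) ar_base (Span C M) n (cspan C x n)) = act (simplex n \<otimes>\<^sub>s fib C M A x)"
    by (simp add: pull_def sub_sset_def fib_def prod_sset_def)
qed simp

section \<open>Bispans built from diagrams of finite sets\<close>

definition corner :: "nat \<Rightarrow> nat \<Rightarrow> nat \<Rightarrow> nat \<Rightarrow> nat \<times> nat \<Rightarrow> nat" where
  "corner a b c d = (\<lambda>(p, q). if p = 0 then (if q = 0 then a else b) else (if q = 0 then c else d))"

text \<open>The bispan over x obtained from a diagram F of finite sets, composed with g, under t.\<close>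

definition cel :: "'c sset \<Rightarrow> (nat \<Rightarrow> nat \<Rightarrow> nat list, 'c) smap \<Rightarrow> nat \<Rightarrow> (nat \<times> nat \<Rightarrow> nat) \<Rightarrow> nat \<Rightarrow> (nat \<Rightarrow> nat \<Rightarrow> nat list) \<Rightarrow> 'c arr spn spn" where
  "cel C t n g k F = fibre_incl C n (span_map t n (tw Fin n g k F))"

definition sq :: "'c sset \<Rightarrow> (nat \<Rightarrow> nat \<Rightarrow> nat list, 'c) smap \<Rightarrow> nat \<Rightarrow> (nat \<Rightarrow> nat \<Rightarrow> nat list) \<Rightarrow> nat \<Rightarrow> nat \<Rightarrow> nat \<Rightarrow> nat \<Rightarrow> ((nat \<times> nat) list, 'c arr spn) smap" where
  "sq C t k F a b c d = srestrict square (\<lambda>l v. bw (Ar C) l (slice_arr C l (t l (act Fin k (map (corner a b c d) v) F))))"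

lemma tw_in: "v \<in> cells (Tw n) l \<Longrightarrow> tw C n g k F l v = act C k (map g v) F"
  by (simp add: tw_def)

lemma cel_in: "v \<in> cells (Tw n) l \<Longrightarrow> cel C t n g k F l v = bw (Ar C) l (slice_arr C l (t l (act Fin k (map g v) F)))"
  unfolding cel_def by (simp add: fibre_incl_in span_map_in tw_in)

lemma cel_cong: "(\<And>i j. i \<le> j \<Longrightarrow> j \<le> n \<Longrightarrow> g (i, j) = g' (i, j)) \<Longrightarrow> cel C t n g k F = cel C t n g' k F"
proof -
  assume a: "\<And>i j. i \<le> j \<Longrightarrow> j \<le> n \<Longrightarrow> g (i, j) = g' (i, j)"
  have "tw Fin n g k F = tw Fin n g' k F"
    unfolding tw_def
  proof (rule srestrict_cong)
    fix l v assume v: "v \<in> cells (Tw n) l"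
    have "map g v = map g' v" using a v by (intro map_cong[OF refl]) (auto simp: Tw_def)
    then show "act Fin k (map g v) F = act Fin k (map g' v) F" by (simp only:)
  qed
  then show ?thesis by (simp add: cel_def)
qed

lemma cel_sub:
  assumes F: "F \<in> cells Fin k" and t: "\<theta> \<in> ops j k" and g: "mono_tw n j g"
  shows "cel C t n g j (act Fin k \<theta> F) = cel C t n (\<lambda>p. \<theta> ! g p) k F"
proof -
  have "tw Fin n g j (act Fin k \<theta> F) = tw Fin n (\<lambda>p. \<theta> ! g p) k F"
    unfolding tw_def by (rule srestrict_cong) (simp add: sset_comp[OF Fin_sset mono_tw_ops[OF g] t F] o_def)
  then show ?thesis by (simp add: cel_def)
qed

lemma cel_const:
  assumes F: "F \<in> cells Fin k" and c: "c \<le> k" "act Fin k [c] F = fin_ob u"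
  shows "cel C t n (\<lambda>p. c) k F = cel C t n (\<lambda>p. 0) 0 (fin_ob u)"
  using cel_sub[OF F, of "[c]" 0 n "\<lambda>p. 0" C t] c by (simp add: ops_def mono_tw_def)

lemma sq_sub:
  assumes F: "F \<in> cells Fin k" and t: "\<theta> \<in> ops j k" and o: "a \<le> b" "a \<le> c" "b \<le> d" "c \<le> d" "d \<le> j"
  shows "sq C t j (act Fin k \<theta> F) a b c d = sq C t k F (\<theta> ! a) (\<theta> ! b) (\<theta> ! c) (\<theta> ! d)"
  unfolding sq_def
proof (rule srestrict_cong)
  fix l v assume v: "v \<in> cells square l"
  have "map (corner a b c d) v \<in> ops l j"
    using v o unfolding square_def le2_def corner_def
    by (auto simp: ops_def sorted_wrt_map split: prod.splits if_splits intro: sorted_wrt_mono_rel[rotated])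
  moreover have "map (nth \<theta>) (map (corner a b c d) v) = map (corner (\<theta> ! a) (\<theta> ! b) (\<theta> ! c) (\<theta> ! d)) v"
    by (auto simp: corner_def)
  ultimately have "act Fin j (map (corner a b c d) v) (act Fin k \<theta> F) = act Fin k (map (corner (\<theta> ! a) (\<theta> ! b) (\<theta> ! c) (\<theta> ! d)) v) F"
    using sset_comp[OF Fin_sset _ t F, of "map (corner a b c d) v" l] by (simp only:)
  then show "bw (Ar C) l (slice_arr C l (t l (act Fin j (map (corner a b c d) v) (act Fin k \<theta> F)))) =
    bw (Ar C) l (slice_arr C l (t l (act Fin k (map (corner (\<theta> ! a) (\<theta> ! b) (\<theta> ! c) (\<theta> ! d)) v) F)))"
    by (simp only:)
qed

lemma sq_const:
  assumes F: "F \<in> cells Fin k" and c: "c \<le> k" "act Fin k [c] F = fin_ob u"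
  shows "sq C t k F c c c c = sq C t 0 (fin_ob u) 0 0 0 0"
  using sq_sub[OF F, of "[c]" 0 0 0 0 0 C t] c by (simp add: ops_def)

text \<open>\<open>sq\<close> records a square by the vertices of F at its four corners, so that
  squares of different cells can be recognised as the same.\<close>

lemma tw_square_cel:
  assumes "i \<le> i'" "i' \<le> j'" "j' \<le> j" "j \<le> n"
  shows "tw_square (cel C t n g k F) i i' j' j = sq C t k F (g (i, j)) (g (i, j')) (g (i', j)) (g (i', j'))"
  unfolding tw_square_def sq_def
proof (rule srestrict_cong)
  fix l v assume v: "v \<in> cells square l"
  let ?f = "\<lambda>(a, b). (if a = 0 then i else i', if b = 0 then j else j')"
  have "map g (map ?f v) = map (corner (g (i, j)) (g (i, j')) (g (i', j)) (g (i', j'))) v"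
    by (auto simp: corner_def)
  then show "cel C t n g k F l (map ?f v) = bw (Ar C) l (slice_arr C l (t l (act Fin k (map (corner (g (i, j)) (g (i, j')) (g (i', j)) (g (i', j'))) v) F)))"
    unfolding cel_in[OF tw_square_in[OF v assms]] by metis
qed

lemma cel_act:
  assumes th: "\<theta> \<in> ops m n"
  shows "act (fib C M A x) n \<theta> (cel C t n g k F) = cel C t m (\<lambda>(i, j). g (\<theta> ! i, \<theta> ! j)) k F"
proof -
  have "act (Span Fin {}) n \<theta> (tw Fin n g k F) = tw Fin m (\<lambda>(i, j). g (\<theta> ! i, \<theta> ! j)) k F"
    unfolding Span_act[OF th] tw_def[of _ m]
  proof (rule srestrict_cong)
    fix l v assume v: "v \<in> cells (Tw m) l"
    have "map g (map (map_prod (nth \<theta>) (nth \<theta>)) v) = map (\<lambda>(i, j). g (\<theta> ! i, \<theta> ! j)) v" by auto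
    then show "tw Fin n g k F l (map (map_prod (nth \<theta>) (nth \<theta>)) v) = act Fin k (map (\<lambda>(i, j). g (\<theta> ! i, \<theta> ! j)) v) F"
      unfolding tw_in[OF Tw_map[OF th v]] by (rule arg_cong)
  qed
  then show ?thesis
    unfolding fib_act[where W = "{}"] cel_def fibre_incl_def
      Span_act_span_map[OF th, where W' = "{}" and K = "slice C x"] Span_act_span_map[OF th, where W' = "{}" and K = Fin] by (simp only:)
qed

text \<open>The setting for one copower functor on the slice over x. The forward legs that occur
  below are identities and the fold map, and \<open>fold\<close> places the latter in A.\<close>

locale copower =
  fixes C :: "'c sset" and M A :: "'c set" and x :: 'c and t :: "(nat \<Rightarrow> nat \<Rightarrow> nat list, 'c) smap"
  assumes C: "qcat C" and M: "wide C M" and A: "wide C A" and x: "x \<in> cells C 0" and t: "t \<in> smaps Fin (slice C x)"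
    and fold: "forget C 1 (t 1 (fin_map 2 1 [0, 0])) \<in> A"
begin

abbreviation "K \<equiv> fib C M A x"
abbreviation "pb k F a b c d \<equiv> is_pullback (arc C M) (sq C t k F a b c d)"

lemma leg_id:
  assumes F: "F \<in> cells Fin k" and a: "a \<le> k"
  shows "forget C 1 (t 1 (act Fin k [a, a] F)) \<in> A"
proof -
  note ss = qcat_sset[OF C]
  have o: "[0, 0] \<in> ops 1 0" by (simp add: ops_def)
  note d = act_degenerate[OF Fin_sset F a]
  have s: "t 0 (act Fin k [a] F) \<in> cells (slice C x) 0" by (rule smaps_in[OF t d(2)])
  have "forget C 1 (t 1 (act Fin k [a, a] F)) = idn C (forget C 0 (t 0 (act Fin k [a] F)))"
    unfolding d(1) idn_def smaps_act[OF t o d(2)] by (rule forget_act[OF ss s o])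
  then show ?thesis using idn_wide[OF ss A forget_in[OF ss s]] by simp
qed

lemma cel_iff:
  assumes F: "F \<in> cells Fin k" and g: "mono_tw n k g"
  shows "cel C t n g k F \<in> cells K n \<longleftrightarrow>
    (\<forall>i i' j. i < i' \<and> i' \<le> j \<and> j \<le> n \<longrightarrow> forget C 1 (t 1 (act Fin k [g (i, j), g (i', j)] F)) \<in> A) \<and>
    (\<forall>i i' j' j. i < i' \<and> i' \<le> j' \<and> j' < j \<and> j \<le> n \<longrightarrow> pb k F (g (i, j)) (g (i, j')) (g (i', j)) (g (i', j')))"
proof -
  have s: "span_map t n (tw Fin n g k F) \<in> smaps (Tw n) (slice C x)"
    by (rule span_map_smaps[OF tw_smaps[OF Fin_sset F g]]) (rule smaps_in[OF t] smaps_act[OF t]; assumption)+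
  have e: "span_map t n (tw Fin n g k F) 1 [(i, j), (i', j)] = t 1 (act Fin k [g (i, j), g (i', j)] F)" if "i < i' \<and> i' \<le> j \<and> j \<le> n" for i i' j
  proof -
    have v: "[(i, j), (i', j)] \<in> cells (Tw n) 1" using that by (auto simp: Tw_cells nth_Cons split: nat.splits)
    show ?thesis unfolding span_map_in[OF v] tw_in[OF v] by simp
  qed
  have q: "tw_square (cel C t n g k F) i i' j' j = sq C t k F (g (i, j)) (g (i, j')) (g (i', j)) (g (i', j'))"
    if "i < i' \<and> i' \<le> j' \<and> j' < j \<and> j \<le> n" for i i' j' j by (rule tw_square_cel) (use that in auto)
  have "cel C t n g k F \<in> cells K n \<longleftrightarrow> cel C t n g k F \<in> cells (ar_bispan C M A) n"
    unfolding fib_def sub_sset_def cel_def using fibre_base[OF qcat_sset[OF C] x s] by simp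
  then show ?thesis
    using fibre_incl_iff[OF C M A x s] e q unfolding cel_def by simp
qed

lemma sq_two: "i < i' \<and> i' \<le> j' \<and> j' < j \<and> j \<le> 2 \<Longrightarrow> i = 0 \<and> i' = 1 \<and> j' = 1 \<and> j = (2 :: nat)"
  by auto

text \<open>The cell depends on the right end of an interval only: its forward legs are identities,
  and its squares are indexed by two right ends j' < j, with 1 \<le> j' because a square moves the
  left end strictly within the interval up to j'.\<close>

lemma bw_cel_iff:
  assumes F: "F \<in> cells Fin k" and g: "\<And>j j'. j' \<le> j \<Longrightarrow> j \<le> n \<Longrightarrow> g j \<le> g j' \<and> g j' \<le> k"
  shows "cel C t n (\<lambda>p. g (snd p)) k F \<in> cells K n \<longleftrightarrow> (\<forall>j' j. 1 \<le> j' \<and> j' < j \<and> j \<le> n \<longrightarrow> pb k F (g j) (g j') (g j) (g j'))"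
proof -
  have m: "mono_tw n k (\<lambda>p. g (snd p))" unfolding mono_tw_def using g by auto
  have "(\<forall>i i' j' j. i < i' \<and> i' \<le> j' \<and> j' < j \<and> j \<le> n \<longrightarrow> pb k F (g j) (g j') (g j) (g j')) \<longleftrightarrow>
    (\<forall>j' j. 1 \<le> j' \<and> j' < j \<and> j \<le> n \<longrightarrow> pb k F (g j) (g j') (g j) (g j'))"
    (is "?l = ?r")
  proof
    assume l: ?l show ?r using l[rule_format, of 0 1] by auto
  next
    assume r: ?r show ?l using r by auto
  qed
  then show ?thesis unfolding cel_iff[OF F m] using leg_id[OF F g[OF order_refl, THEN conjunct2]] by auto
qed

definition "ob u = cel C t 0 (\<lambda>p. 0) 0 (fin_ob u)"
definition "edge f = cel C t 1 (\<lambda>p. 1 - snd p) 1 f"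

lemma ob_in: "ob u \<in> cells K 0"
  unfolding ob_def by (subst cel_iff[OF fin_ob_cell]) (auto simp: mono_tw_def)

lemma edge_in: "f \<in> cells Fin 1 \<Longrightarrow> edge f \<in> cells K 1"
  unfolding edge_def using bw_cel_iff[of f 1 1 "\<lambda>j. 1 - j"] by auto

text \<open>The twofold degeneracy of the object is a 2-simplex with exactly one square; goodness
  places it in the fibre, so this square is cartesian.\<close>

lemma good_ob:
  assumes g: "good K 0 (ob u)" and F: "F \<in> cells Fin k" and c: "c \<le> k" "act Fin k [c] F = fin_ob u"
  shows "pb k F c c c c"
proof -
  have "act K 0 [0, 0, 0] (ob u) \<in> cells K 2" using g unfolding good_def by (auto simp: ops_def)
  then have "cel C t 2 (\<lambda>p. 0) 0 (fin_ob u) \<in> cells K 2"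
    unfolding ob_def using cel_act[of "[0, 0, 0]" 2 0 C M A x t "\<lambda>p. 0" 0 "fin_ob u"] by (simp add: ops_def split_def)
  then have "pb 0 (fin_ob u) 0 0 0 0" using bw_cel_iff[OF fin_ob_cell, of 2 "\<lambda>j. 0", THEN iffD1, rule_format, of u 1 2] by auto
  then show ?thesis unfolding sq_const[OF F c] .
qed

text \<open>The degeneracy [0, 0, 1] of the edge has a single square, constant in one direction and
  f in the other; goodness makes it cartesian.\<close>

lemma good_edge:
  assumes g: "good K 1 (edge f)" and F: "F \<in> cells Fin k" and f: "f = act Fin k [a, b] F" "a \<le> b" "b \<le> k"
  shows "pb k F a b a b"
proof -
  have o: "[a, b] \<in> ops 1 k" using f by (simp add: ops_def)
  have fc: "f \<in> cells Fin 1" unfolding f by (rule sset_in[OF Fin_sset o F])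
  have "act K 1 [0, 0, 1] (edge f) \<in> cells K 2" using g unfolding good_def by (auto simp: ops_def)
  then have c: "cel C t 2 (\<lambda>p. 1 - [0, 0, 1] ! snd p) 1 f \<in> cells K 2"
    unfolding edge_def using cel_act[of "[0, 0, 1]" 2 1 C M A x t "\<lambda>p. 1 - snd p" 1 f] by (simp add: ops_def split_def)
  have "[0 :: nat, 0, 1] ! j' \<le> [0, 0, 1] ! j \<and> [0, 0, 1] ! j \<le> (1::nat)" if "j' \<le> j" "j \<le> 2" for j j' :: nat
    using that by (auto simp: nth_Cons le_Suc_eq numeral_2_eq_2 split: nat.splits)
  then have "pb 1 f 0 1 0 1" using c bw_cel_iff[OF fc, of 2 "\<lambda>j. 1 - [0, 0, 1] ! j", THEN iffD1, rule_format, of 1 2] by (simp add: diff_le_mono2)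
  then show ?thesis using sq_sub[OF F o, of 0 1 0 1 C t] unfolding f by simp
qed

end

context copower begin

lemma cel_face:
  assumes th: "\<theta> \<in> ops m n" and g: "\<And>i j. i \<le> j \<Longrightarrow> j \<le> m \<Longrightarrow> g (\<theta> ! i, \<theta> ! j) = g' (i, j)"
  shows "act K n \<theta> (cel C t n g k F) = cel C t m g' k F"
  unfolding cel_act[OF th] by (rule cel_cong) (simp add: g)

text \<open>\<open>add\<close> is the forward fold map, \<open>proj i\<close> the backward inclusion
  of a point, and \<open>dup\<close> the backward fold map from 1 to 2, that is the
  diagonal.\<close>

definition "add = cel C t 1 fst 1 (fin_map 2 1 [0, 0])"
definition "proj i = edge (fin_map 1 2 [i])"
definition "dup = edge (fin_map 2 1 [0, 0])"

lemma fin_edges: "fin_map 2 1 [0, 0] \<in> cells Fin 1" "i < 2 \<Longrightarrow> fin_map 1 2 [i] \<in> cells Fin 1"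
  by (rule fin_map_cell; simp)+

lemma fin_twos: "i < 2 \<Longrightarrow> fin_chain 1 2 1 [i] [0, 0] \<in> cells Fin 2" "i < 2 \<Longrightarrow> fin_chain 2 1 2 [0, 0] [i] \<in> cells Fin 2"
  by (rule fin_chain_cell; simp)+

lemma act_edge: "f \<in> cells Fin 1 \<Longrightarrow> i \<le> 1 \<Longrightarrow> act Fin 1 [1 - i] f = fin_ob u \<Longrightarrow> act K 1 [i] (edge f) = ob u"
proof -
  assume f: "f \<in> cells Fin 1" and i: "i \<le> 1" and u: "act Fin 1 [1 - i] f = fin_ob u"
  have "act K 1 [i] (edge f) = cel C t 0 (\<lambda>p. 1 - i) 1 f"
    unfolding edge_def by (rule cel_face) (use i in \<open>auto simp: ops_def\<close>)
  also have "\<dots> = ob u" unfolding ob_def by (rule cel_const[OF f _ u]) simp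
  finally show ?thesis .
qed

lemma leg: "a \<le> b \<Longrightarrow> b \<le> 1 \<Longrightarrow> forget C 1 (t 1 (act Fin 1 [a, b] (fin_map 2 1 [0, 0]))) \<in> A"
proof (cases "a = b")
  case False
  assume "a \<le> b" "b \<le> 1"
  then have "a = 0" "b = 1" using False by auto
  moreover have "act Fin 1 [0, 1] (fin_map 2 1 [0, 0]) = fin_map 2 1 [0, 0]" using sset_id[OF Fin_sset fin_edges(1)] by (simp add: upt_rec)
  ultimately show ?thesis using fold by simp
qed (use leg_id[OF fin_edges(1)] in auto)

lemma add_in: "add \<in> cells K 1"
  unfolding add_def by (subst cel_iff[OF fin_edges(1) mono_tw_fw]) (use leg in auto)

lemma act_add: "act K 1 [0] add = ob 2" "act K 1 [1] add = ob 1"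
proof -
  have a: "act K 1 [i] add = cel C t 0 (\<lambda>p. i) 1 (fin_map 2 1 [0, 0])" if "i \<le> 1" for i
    unfolding add_def by (rule cel_face) (use that in \<open>auto simp: ops_def\<close>)
  show "act K 1 [0] add = ob 2" unfolding a[OF le0] ob_def by (rule cel_const[OF fin_edges(1) _ fin_acts(1)]) simp
  show "act K 1 [1] add = ob 1" unfolding a[OF order_refl] ob_def by (rule cel_const[OF fin_edges(1) _ fin_acts(2)]) simp
qed

lemma proj_in: "i < 2 \<Longrightarrow> proj i \<in> cells K 1" "i < 2 \<Longrightarrow> act K 1 [0] (proj i) = ob 2" "i < 2 \<Longrightarrow> act K 1 [1] (proj i) = ob 1"
  unfolding proj_def using edge_in act_edge[of _ 0 2] act_edge[of _ 1 1] fin_edges(2) fin_acts by auto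

lemma dup_in: "dup \<in> cells K 1" "act K 1 [1] dup = ob 2"
  unfolding dup_def using edge_in act_edge[of _ 1 2] fin_edges(1) fin_acts by auto

lemma deg_ob: "act K 0 [0, 0] (ob u) = cel C t 1 (\<lambda>p. 0) 0 (fin_ob u)"
  unfolding ob_def using cel_act[of "[0, 0]" 1 0 C M A x t "\<lambda>p. 0" 0 "fin_ob u"] by (simp add: ops_def split_def)

text \<open>The degeneracy that repeats the target has one square, constant at u, and this is
  cartesian by \<open>good_ob\<close>.\<close>

lemma deg_edge:
  assumes f: "f \<in> cells Fin 1" "act Fin 1 [0] f = fin_ob u" and g: "good K 0 (ob u)"
  shows "act K 1 [0, 1, 1] (edge f) \<in> cells K 2"
proof -
  have e: "act K 1 [0, 1, 1] (edge f) = cel C t 2 (\<lambda>p. 1 - [0, 1, 1] ! snd p) 1 f"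
    unfolding edge_def by (rule cel_face) (auto simp: ops_def)
  have le: "[0 :: nat, 1, 1] ! j' \<le> [0, 1, 1] ! j" if "j' \<le> j" "j \<le> 2" for j j' :: nat
    using that by (auto simp: nth_Cons le_Suc_eq numeral_2_eq_2 split: nat.splits)
  show ?thesis
    unfolding e
  proof (subst bw_cel_iff[OF f(1), of 2 "\<lambda>j. 1 - [0, 1, 1] ! j"])
    show "\<forall>j' j. 1 \<le> j' \<and> j' < j \<and> j \<le> 2 \<longrightarrow> pb 1 f (1 - [0, 1, 1] ! j) (1 - [0, 1, 1] ! j') (1 - [0, 1, 1] ! j) (1 - [0, 1, 1] ! j')"
    proof (intro allI impI)
      fix j' j :: nat assume "1 \<le> j' \<and> j' < j \<and> j \<le> 2"
      then have "j' = 1" "j = 2" by auto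
      then show "pb 1 f (1 - [0, 1, 1] ! j) (1 - [0, 1, 1] ! j') (1 - [0, 1, 1] ! j) (1 - [0, 1, 1] ! j')"
        using good_ob[OF g f(1) _ f(2)] by simp
    qed
  qed (use le in \<open>auto simp: diff_le_mono2\<close>)
qed

text \<open>Here the source is repeated, and the only square is constant at the two-element
  set.\<close>

lemma deg_add:
  assumes g: "good K 0 (ob 2)" shows "act K 1 [0, 0, 1] add \<in> cells K 2"
proof -
  let ?f = "fin_map 2 1 [0, 0]"
  have e: "act K 1 [0, 0, 1] add = cel C t 2 (\<lambda>p. [0, 0, 1] ! fst p) 1 ?f"
    unfolding add_def by (rule cel_face) (auto simp: ops_def)
  have le: "[0 :: nat, 0, 1] ! j' \<le> [0, 0, 1] ! j \<and> [0 :: nat, 0, 1] ! j \<le> 1" if "j' \<le> j" "j \<le> 2" for j j' :: nat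
    using that by (auto simp: nth_Cons le_Suc_eq numeral_2_eq_2 split: nat.splits)
  have m: "mono_tw 2 1 (\<lambda>p. [0, 0, 1] ! fst p)" unfolding mono_tw_def using le by auto
  show ?thesis
    unfolding e cel_iff[OF fin_edges(1) m]
  proof (intro conjI allI impI)
    fix i i' j :: nat assume a: "i < i' \<and> i' \<le> j \<and> j \<le> 2"
    show "forget C 1 (t 1 (act Fin 1 [[0, 0, 1] ! fst (i, j), [0, 0, 1] ! fst (i', j)] ?f)) \<in> A"
      unfolding fst_conv by (rule leg) (use le[of i i'] a in auto)
  next
    fix i i' j' j :: nat assume "i < i' \<and> i' \<le> j' \<and> j' < j \<and> j \<le> 2"
    then have "i = 0 \<and> i' = 1" using sq_two by blast
    then show "pb 1 ?f ([0, 0, 1] ! fst (i, j)) ([0, 0, 1] ! fst (i, j')) ([0, 0, 1] ! fst (i', j)) ([0, 0, 1] ! fst (i', j'))"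
      using good_ob[OF g fin_edges(1) _ fin_acts(1)] by simp
  qed
qed

text \<open>The 3-simplex is the backward chain of f', then f, then the identity of u. Its squares
  involve only right ends from 1 on, hence f and u; so f' itself may be bad.\<close>

lemma bw_three:
  assumes F: "F \<in> cells Fin 2" and f: "act Fin 2 [0, 1] F = f" "act Fin 2 [1, 2] F = f'" "act Fin 2 [0] F = fin_ob u"
    and g: "good K 0 (ob u)" "good K 1 (edge f)"
  shows "\<exists>c\<in>cells K 3. act K 3 [0, 1] c = edge f' \<and> act K 3 [2, 3] c = act K 0 [0, 0] (ob u)"
proof
  let ?g = "\<lambda>j. 2 - [0, 1, 2, 2] ! j"
  let ?c = "cel C t 3 (\<lambda>p. ?g (snd p)) 2 F"
  have le: "[0 :: nat, 1, 2, 2] ! j' \<le> [0, 1, 2, 2] ! j" if "j' \<le> j" "j \<le> 3" for j j' :: nat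
    using that by (auto simp: nth_Cons le_Suc_eq numeral_3_eq_3 split: nat.splits)
  show "?c \<in> cells K 3"
  proof (subst bw_cel_iff[OF F, of 3 ?g])
    show "\<forall>j' j. 1 \<le> j' \<and> j' < j \<and> j \<le> 3 \<longrightarrow> pb 2 F (?g j) (?g j') (?g j) (?g j')"
    proof (intro allI impI)
      fix j' j :: nat assume "1 \<le> j' \<and> j' < j \<and> j \<le> 3"
      then have "(j' = 1 \<and> j = 2) \<or> (j' = 1 \<and> j = 3) \<or> (j' = 2 \<and> j = 3)" by auto
      then show "pb 2 F (?g j) (?g j') (?g j) (?g j')"
        using good_edge[OF g(2) F f(1)[symmetric]] good_ob[OF g(1) F _ f(3)] by (elim disjE) simp_all
    qed
  qed (use le in \<open>auto simp: diff_le_mono2\<close>)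
  have "act K 3 [0, 1] ?c = cel C t 1 (\<lambda>p. [1, 2] ! (1 - snd p)) 2 F"
    by (rule cel_face) (auto simp: ops_def nth_Cons split: nat.splits)
  also have "\<dots> = edge f'"
    unfolding edge_def f(2)[symmetric] by (rule cel_sub[OF F _ mono_tw_bw, symmetric]) (auto simp: ops_def)
  finally have 1: "act K 3 [0, 1] ?c = edge f'" .
  have "act K 3 [2, 3] ?c = cel C t 1 (\<lambda>p. 0) 2 F"
    by (rule cel_face) (auto simp: ops_def le_Suc_eq)
  also have "\<dots> = act K 0 [0, 0] (ob u)" unfolding deg_ob by (rule cel_const[OF F _ f(3)]) simp
  finally show "act K 3 [0, 1] ?c = edge f' \<and> act K 3 [2, 3] ?c = act K 0 [0, 0] (ob u)" using 1 by blast
qed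

text \<open>The 3-simplex is the identity of 1, then the diagonal, then the addition, with objects
  1, 1, 2, 1. Its squares are that of the diagonal and constant ones at 2; none requires the
  addition to be good.\<close>

lemma dup_add_three:
  assumes g: "good K 0 (ob 2)" "good K 1 dup"
  shows "\<exists>c\<in>cells K 3. act K 3 [0, 1] c = act K 0 [0, 0] (ob 1) \<and> act K 3 [2, 3] c = add"
proof
  let ?f = "fin_map 2 1 [0, 0]"
  have id: "act Fin 1 [0, 1] ?f = ?f" using sset_id[OF Fin_sset fin_edges(1)] by (simp add: upt_rec)
  let ?g = "\<lambda>p :: nat \<times> nat. if snd p \<le> 1 \<or> fst p = 3 then 1 else 0 :: nat"
  let ?c = "cel C t 3 ?g 1 ?f"
  have m: "mono_tw 3 1 ?g" unfolding mono_tw_def by auto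
  show "?c \<in> cells K 3"
    unfolding cel_iff[OF fin_edges(1) m]
  proof (intro conjI allI impI)
    fix i i' j :: nat assume a: "i < i' \<and> i' \<le> j \<and> j \<le> 3"
    show "forget C 1 (t 1 (act Fin 1 [?g (i, j), ?g (i', j)] ?f)) \<in> A"
      by (rule leg) (use a in auto)
  next
    fix i i' j' j :: nat assume "i < i' \<and> i' \<le> j' \<and> j' < j \<and> j \<le> 3"
    then have "(j' = 1 \<and> i = 0 \<and> i' = 1 \<and> 2 \<le> j) \<or> (2 \<le> j' \<and> 2 \<le> j \<and> i < 3 \<and> i' < 3)" by auto
    then show "pb 1 ?f (?g (i, j)) (?g (i, j')) (?g (i', j)) (?g (i', j'))"
      using good_edge[OF g(2)[unfolded dup_def] fin_edges(1), of 0 1] id good_ob[OF g(1) fin_edges(1) _ fin_acts(1)] by (elim disjE) simp_all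
  qed
  have "act K 3 [0, 1] ?c = cel C t 1 (\<lambda>p. 1) 1 ?f"
    by (rule cel_face) (auto simp: ops_def le_Suc_eq)
  also have "\<dots> = act K 0 [0, 0] (ob 1)" unfolding deg_ob by (rule cel_const[OF fin_edges(1) _ fin_acts(2)]) simp
  finally have 1: "act K 3 [0, 1] ?c = act K 0 [0, 0] (ob 1)" .
  have "act K 3 [2, 3] ?c = add"
    unfolding add_def by (rule cel_face) (auto simp: ops_def le_Suc_eq)
  then show "act K 3 [0, 1] ?c = act K 0 [0, 0] (ob 1) \<and> act K 3 [2, 3] ?c = add" using 1 by blast
qed

text \<open>\<open>grouplike_invariance\<close> applies with the diagonal as \<delta>; the
  3-simplices it asks for contain the composites of the diagonal with the addition, and with the
  projections in both orders.\<close>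

lemma grouplike_fibre:
  assumes X: "qcat X" and h: "is_equiv (fun_sset K X) h"
    and g: "cmon_grouplike X (\<lambda>n s. fun_at (act (fun_sset K X) 1 [1] h) n (fibre_incl C n (span_map t n s)))"
  shows "cmon_grouplike X (\<lambda>n s. fun_at (act (fun_sset K X) 1 [0] h) n (fibre_incl C n (span_map t n s)))"
proof -
  have v: "fun_at (act (fun_sset K X) 1 [i] h) 1 b = h 1 ([i, i], b)" if "i \<le> 1" "b \<in> cells K 1" for i b
    unfolding fun_at_def using fun_act_app[of "[i]" 0 1 "[0, 0]" 1 b K X h] that by (simp add: ops_def)
  have e: "fibre_incl C 1 (span_map t 1 (bw Fin 1 (fin_map 1 2 [i]))) = proj i" "fibre_incl C 1 (span_map t 1 (fw Fin 1 (fin_map 2 1 [0, 0]))) = add" for i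
    unfolding proj_def edge_def add_def cel_def bw_tw fw_tw by simp_all
  have iff: "cmon_grouplike X (\<lambda>n s. fun_at (act (fun_sset K X) 1 [i] h) n (fibre_incl C n (span_map t n s))) \<longleftrightarrow>
    (\<exists>s. triangle X s (h 1 ([i, i], proj 0)) (h 1 ([i, i], proj 0)) \<and> triangle X s (h 1 ([i, i], proj 1)) (h 1 ([i, i], add)) \<and> is_equiv X s)"
    if "i \<le> 1" for i
    unfolding cmon_grouplike_def cmon_proj_def cmon_add_def e using v[OF that] proj_in(1) add_in by simp
  obtain s' where s': "triangle X s' (h 1 ([1, 1], proj 0)) (h 1 ([1, 1], proj 0))" "triangle X s' (h 1 ([1, 1], proj 1)) (h 1 ([1, 1], add))" "is_equiv X s'"
    using g unfolding iff[OF order_refl] by blast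
  have pr: "e \<in> cells K 1 \<and> act K 1 [0] e = ob 2 \<and> act K 1 [1] e = ob 1" if "e \<in> {proj 0, proj 1, add}" for e
    using that proj_in add_in act_add by auto
  have pe: "\<exists>i<2. e = proj i" if "e \<in> {proj 0, proj 1}" for e using that by (auto intro: exI[of _ 0] exI[of _ 1])
  have c: "act Fin 2 [0] (fin_chain a b c f g) = fin_ob a" for a b c f g
    by (auto simp: fun_eq_iff Fin_act fin_chain_def fin_ob_def)
  obtain s where "triangle X s (h 1 ([0, 0], proj 0)) (h 1 ([0, 0], proj 0))" "triangle X s (h 1 ([0, 0], proj 1)) (h 1 ([0, 0], add))" "is_equiv X s"
  proof (rule grouplike_invariance[OF X fib_face_closed[OF C M x] h ob_in ob_in pr dup_in(1) deg_add _ _ dup_add_three _ _ s'])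
    fix e assume "e \<in> {proj 0, proj 1}" "good K 0 (ob 1)"
    then show "act K 1 [0, 1, 1] e \<in> cells K 2" using pe[of e] deg_edge[OF fin_edges(2) fin_acts(1)] unfolding proj_def by metis
  next
    assume "good K 0 (ob 2)"
    then show "act K 1 [0, 1, 1] dup \<in> cells K 2 \<and> act K 1 [1] dup = ob 2" using dup_in(2) deg_edge[OF fin_edges(1) fin_acts(1)] unfolding dup_def by metis
  next
    assume "good K 0 (ob 1)" "good K 1 (proj 0)"
    then show "\<exists>c\<in>cells K 3. act K 3 [0, 1] c = dup \<and> act K 3 [2, 3] c = act K 0 [0, 0] (ob 1)"
      unfolding proj_def dup_def by (intro bw_three[OF fin_twos(1)[of 0] fin_acts(3,4) c]) simp_all
  next
    fix e assume e: "e \<in> {proj 0, proj 1}" and gd: "good K 0 (ob 2)" "good K 1 dup"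
    obtain i where i: "i < 2" "e = proj i" using pe[OF e] by blast
    show "\<exists>c\<in>cells K 3. act K 3 [0, 1] c = e \<and> act K 3 [2, 3] c = act K 0 [0, 0] (ob 2)"
      unfolding i(2) proj_def by (rule bw_three[OF fin_twos(2)[OF i(1)] fin_acts(3,4) c gd[unfolded dup_def]])
  qed
  then show ?thesis unfolding iff[OF le0] by blast
qed

end

lemma equiv_image:
  assumes K: "is_sset K" and f: "\<And>n \<sigma>. \<sigma> \<in> cells K n \<Longrightarrow> f n \<sigma> \<in> cells L n"
    "\<And>m n \<theta> \<sigma>. \<theta> \<in> ops m n \<Longrightarrow> \<sigma> \<in> cells K n \<Longrightarrow> f m (act K n \<theta> \<sigma>) = act L n \<theta> (f n \<sigma>)"
    and e: "is_equiv K e"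
  shows "is_equiv L (f 1 e)"
proof -
  have o: "[0, 1] \<in> ops 1 2" "[1, 2] \<in> ops 1 2" "[0, 2] \<in> ops 1 2" "[0] \<in> ops 0 1" "[1] \<in> ops 0 1" "[0, 0] \<in> ops 1 0" by (auto simp: ops_def)
  have t: "triangle L (f 1 a) (f 1 b) (f 1 c)" if "triangle K a b c" for a b c
  proof -
    obtain s where s: "s \<in> cells K 2" "act K 2 [0, 1] s = a" "act K 2 [1, 2] s = b" "act K 2 [0, 2] s = c"
      using \<open>triangle K a b c\<close> unfolding triangle_def by blast
    show ?thesis unfolding triangle_def using f(1)[OF s(1)] f(2)[OF o(1) s(1)] f(2)[OF o(2) s(1)] f(2)[OF o(3) s(1)] s by (intro bexI[of _ "f 2 s"]) auto
  qed
  obtain g where g: "e \<in> cells K 1" "g \<in> cells K 1" "triangle K e g (idn K (act K 1 [0] e))" "triangle K g e (idn K (act K 1 [1] e))"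
    by (rule equivD[OF e])
  have "f 1 (idn K (act K 1 [i] e)) = idn L (act L 1 [i] (f 1 e))" if i: "[i] \<in> ops 0 1" for i
    unfolding idn_def f(2)[OF o(6) sset_in[OF K i g(1)]] f(2)[OF i g(1)] ..
  then show ?thesis
    unfolding is_equiv_def src_def tgt_def using f(1)[OF g(1)] f(1)[OF g(2)] t[OF g(3)] t[OF g(4)] o by (intro conjI bexI[of _ "f 1 g"]) auto
qed

lemma sub_sset_simps [simp]: "\<sigma> \<in> cells (sub_sset K P) n \<longleftrightarrow> \<sigma> \<in> cells K n \<and> P n \<sigma>" "act (sub_sset K P) = act K"
  by (simp_all add: sub_sset_def)

section \<open>Full subcategories\<close>

lemma full_sub_simps [simp]: "\<sigma> \<in> cells (full_sub K V) n \<longleftrightarrow> \<sigma> \<in> cells K n \<and> (\<forall>i\<le>n. act K n [i] \<sigma> \<in> V)" "act (full_sub K V) = act K"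
  by (simp_all add: full_sub_def)

lemma sub_sset_sset:
  assumes "is_sset K" "\<And>m n \<theta> \<sigma>. \<theta> \<in> ops m n \<Longrightarrow> \<sigma> \<in> cells K n \<Longrightarrow> P n \<sigma> \<Longrightarrow> P m (act K n \<theta> \<sigma>)"
  shows "is_sset (sub_sset K P)"
  by (rule is_ssetI) (use assms sset_in[OF assms(1)] sset_id[OF assms(1)] sset_comp[OF assms(1)] in auto)

lemma vertex_act: "is_sset K \<Longrightarrow> \<theta> \<in> ops m n \<Longrightarrow> \<sigma> \<in> cells K n \<Longrightarrow> i \<le> m \<Longrightarrow> act K m [i] (act K n \<theta> \<sigma>) = act K n [\<theta> ! i] \<sigma>"
  using sset_comp[of K "[i]" 0 m \<theta> n \<sigma>] by (simp add: ops_def)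

lemma full_sub_sset: "is_sset K \<Longrightarrow> is_sset (full_sub K V)"
  unfolding full_sub_def by (rule sub_sset_sset) (simp_all add: vertex_act ops_nth)

text \<open>The inverse of e has the same two ends in the opposite order, so all vertices of the
  witnessing triangles lie in V.\<close>

lemma full_sub_equiv:
  assumes K: "is_sset K" and e: "is_equiv K e" and V: "act K 1 [0] e \<in> V" "act K 1 [1] e \<in> V"
  shows "is_equiv (full_sub K V) e"
proof -
  obtain g where g: "e \<in> cells K 1" "g \<in> cells K 1" "triangle K e g (idn K (act K 1 [0] e))" "triangle K g e (idn K (act K 1 [1] e))"
    by (rule equivD[OF e])
  have o: "[0, 1] \<in> ops 1 2" "[1, 2] \<in> ops 1 2" by (auto simp: ops_def)
  have ends: "act K 1 [0] g \<in> V" "act K 1 [1] g \<in> V" using triangleD(4)[OF K g(3)] triangleD(4)[OF K g(4)] V by simp_all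
  have t: "triangle (full_sub K V) a b c"
    if "triangle K a b c" "act K 1 [0] a \<in> V" "act K 1 [1] a \<in> V" "act K 1 [1] b \<in> V" for a b c
  proof -
    obtain s where s: "s \<in> cells K 2" "act K 2 [0, 1] s = a" "act K 2 [1, 2] s = b" "act K 2 [0, 2] s = c"
      using \<open>triangle K a b c\<close> unfolding triangle_def by blast
    have "act K 2 [i] s \<in> V" if "i \<le> 2" for i
    proof -
      have "i = 0 \<or> i = 1 \<or> i = 2" using that by auto
      then show ?thesis using vertex_act[OF K o(1) s(1), of 0] vertex_act[OF K o(1) s(1), of 1] vertex_act[OF K o(2) s(1), of 1]
          s \<open>act K 1 [0] a \<in> V\<close> \<open>act K 1 [1] a \<in> V\<close> \<open>act K 1 [1] b \<in> V\<close> by auto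
    qed
    then show ?thesis unfolding triangle_def using s by (intro bexI[of _ s]) auto
  qed
  have v: "a \<in> cells (full_sub K V) 1" if "a \<in> cells K 1" "act K 1 [0] a \<in> V" "act K 1 [1] a \<in> V" for a
    using that by (auto simp: le_Suc_eq)
  show ?thesis
    unfolding is_equiv_def src_def tgt_def idn_def full_sub_simps(2)
    using v[OF g(1) V] v[OF g(2) ends] t[OF g(3) V ends(2)] t[OF g(4) ends V(2)] unfolding idn_def by blast
qed

text \<open>Both ends of \<eta> preserve V, so it is an equivalence already in the full subcategory
  P of functors that preserve V; on P, restriction to the full subcategory is a simplicial
  map.\<close>

lemma restrict_nat_equiv:
  fixes K :: "'a sset"
  assumes K: "is_sset K" and F: "\<And>n \<sigma>. \<sigma> \<in> cells (full_sub K V) n \<Longrightarrow> F' n \<sigma> = F n \<sigma>"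
    and V: "\<And>R. R \<in> cells K 0 \<Longrightarrow> R \<in> V \<Longrightarrow> F 0 R \<in> V" and e: "nat_equiv K K F (\<lambda>n x. x)"
  shows "nat_equiv (full_sub K V) (full_sub K V) F' (\<lambda>n x. x)"
proof -
  let ?K = "full_sub K V"
  define P where "P = {h :: (nat list \<times> 'a, 'a) smap. \<forall>R\<in>cells ?K 0. h 0 ([0], R) \<in> V}"
  define r where "r n h = srestrict (simplex n \<otimes>\<^sub>s ?K) h" for n and h :: "(nat list \<times> 'a, 'a) smap"
  obtain \<eta> where \<eta>: "is_equiv (fun_sset K K) \<eta>" "act (fun_sset K K) 1 [0] \<eta> = fun_vertex K F" "act (fun_sset K K) 1 [1] \<eta> = fun_vertex K (\<lambda>n x. x)"
    using e unfolding nat_equiv_def src_def tgt_def by blast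
  have o0: "[0] \<in> ops 0 0" by (simp add: ops_def)
  have id: "R \<in> V" if "R \<in> cells ?K 0" for R using that sset_id[OF K, of R 0] by simp
  have "fun_vertex K G \<in> P" if "\<And>R. R \<in> cells K 0 \<Longrightarrow> R \<in> V \<Longrightarrow> G 0 R \<in> V" for G
    unfolding P_def mem_Collect_eq
  proof
    fix R assume R: "R \<in> cells ?K 0"
    then show "fun_vertex K G 0 ([0], R) \<in> V" unfolding fun_vertex_def using that[of R] id[OF R] o0 by simp
  qed
  from this[of F, OF V] this[of "\<lambda>n x. x"] have "fun_vertex K F \<in> P" "fun_vertex K (\<lambda>n x. x) \<in> P" by simp_all
  then have 1: "is_equiv (full_sub (fun_sset K K) P) \<eta>" using full_sub_equiv[OF fun_is_sset \<eta>(1)] \<eta> by simp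
  have fn: "act (fun_sset ?K ?K) n \<theta> (r n h) = r m (act (fun_sset K K) n \<theta> h)" if t: "\<theta> \<in> ops m n" for m n \<theta> h
    unfolding fun_act[OF t] r_def by (rule srestrict_cong) (use ops_comp[OF _ t] in auto)
  have 2: "is_equiv (fun_sset ?K ?K) (r 1 \<eta>)"
  proof (rule equiv_image[OF full_sub_sset[OF fun_is_sset] _ _ 1])
    fix n h assume h: "h \<in> cells (full_sub (fun_sset K K) P) n"
    then have hm: "h \<in> smaps (simplex n \<otimes>\<^sub>s K) K" by (simp add: fun_cells)
    show "r n h \<in> cells (fun_sset ?K ?K) n"
      unfolding fun_cells r_def
    proof (rule srestrict_smaps)
      fix m y assume y: "y \<in> cells (simplex n \<otimes>\<^sub>s ?K) m"
      then obtain \<psi> k where yk: "y = (\<psi>, k)" "\<psi> \<in> ops m n" "k \<in> cells ?K m" by auto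
      then have y': "y \<in> cells (simplex n \<otimes>\<^sub>s K) m" by simp
      have "act K m [j] (h m y) \<in> V" if j: "j \<le> m" for j
      proof -
        have o: "[j] \<in> ops 0 m" "[\<psi> ! j] \<in> ops 0 n" using j ops_nth[OF yk(2) j] by (auto simp: ops_def)
        have R: "act K m [j] k \<in> cells ?K 0" using sset_in[OF full_sub_sset[OF K] o(1) yk(3)] by simp
        have "act K m [j] (h m y) = h 0 ([\<psi> ! j], act K m [j] k)" using smaps_act[OF hm o(1) y'] yk(1) by simp
        also have "\<dots> = act (fun_sset K K) n [\<psi> ! j] h 0 ([0], act K m [j] k)"
          using R by (subst fun_act_app[OF o(2) o0]) simp_all
        also have "\<dots> \<in> V" using h ops_nth[OF yk(2) j] R unfolding P_def by auto
        finally show ?thesis .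
      qed
      then show "h m y \<in> cells ?K m" using smaps_in[OF hm y'] by simp
      fix j \<theta> assume t: "\<theta> \<in> ops j m"
      show "act (simplex n \<otimes>\<^sub>s ?K) m \<theta> y \<in> cells (simplex n \<otimes>\<^sub>s ?K) j"
        using yk ops_comp[OF t yk(2)] sset_in[OF full_sub_sset[OF K] t yk(3)] by simp
      show "h j (act (simplex n \<otimes>\<^sub>s ?K) m \<theta> y) = act ?K m \<theta> (h m y)" using smaps_act[OF hm t y'] yk(1) by simp
    qed
  next
    fix m n \<theta> h assume "\<theta> \<in> ops m n"
    then show "r m (act (full_sub (fun_sset K K) P) n \<theta> h) = act (fun_sset ?K ?K) n \<theta> (r n h)" using fn by simp
  qed
  have "act (fun_sset ?K ?K) 1 [0] (r 1 \<eta>) = fun_vertex ?K F'" "act (fun_sset ?K ?K) 1 [1] (r 1 \<eta>) = fun_vertex ?K (\<lambda>n x. x)"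
    using fn[of "[0]" 0 1 \<eta>] fn[of "[1]" 0 1 \<eta>] unfolding \<eta>(2,3) r_def fun_vertex_def using F
    by (auto simp: ops_def srestrict_def fun_eq_iff)
  then show ?thesis unfolding nat_equiv_def src_def tgt_def using 2 by blast
qed

lemma restrict_smap:
  assumes "is_sset K" "f \<in> smaps K L" "\<And>R. R \<in> cells K 0 \<Longrightarrow> R \<in> V \<Longrightarrow> f 0 R \<in> W"
  shows "srestrict (full_sub K V) f \<in> smaps (full_sub K V) (full_sub L W)"
proof (rule srestrict_smaps)
  fix n \<sigma> assume s: "\<sigma> \<in> cells (full_sub K V) n"
  have "act L n [i] (f n \<sigma>) \<in> W" if "i \<le> n" for i
  proof -
    have o: "[i] \<in> ops 0 n" using that by (simp add: ops_def)
    have "act L n [i] (f n \<sigma>) = f 0 (act K n [i] \<sigma>)" using smaps_act[OF assms(2) o, of \<sigma>] s by simp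
    then show ?thesis using assms(3)[OF sset_in[OF assms(1) o]] s that by simp
  qed
  then show "f n \<sigma> \<in> cells (full_sub L W) n" using smaps_in[OF assms(2), of \<sigma>] s by simp
  fix m \<theta> assume t: "\<theta> \<in> ops m n"
  show "act (full_sub K V) n \<theta> \<sigma> \<in> cells (full_sub K V) m" by (rule sset_in[OF full_sub_sset[OF assms(1)] t s])
  show "f m (act (full_sub K V) n \<theta> \<sigma>) = act (full_sub L W) n \<theta> (f n \<sigma>)" using smaps_act[OF assms(2) t, of \<sigma>] s by simp
qed

lemma restrict_inverse_equivalences:
  assumes K: "is_sset K" and L: "is_sset L" and fg: "inverse_equivalences K L f g"
    and V: "\<And>R. R \<in> cells K 0 \<Longrightarrow> R \<in> V \<Longrightarrow> f 0 R \<in> W" and W: "\<And>H. H \<in> cells L 0 \<Longrightarrow> H \<in> W \<Longrightarrow> g 0 H \<in> V"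
  shows "inverse_equivalences (full_sub K V) (full_sub L W) (srestrict (full_sub K V) f) (srestrict (full_sub L W) g)"
proof -
  have f: "f \<in> smaps K L" and g: "g \<in> smaps L K" using fg unfolding inverse_equivalences_def by auto
  note f' = restrict_smap[OF K f V] and g' = restrict_smap[OF L g W]
  show ?thesis
    unfolding inverse_equivalences_def
  proof (intro conjI f' g')
    show "nat_equiv (full_sub K V) (full_sub K V) (\<lambda>n x. srestrict (full_sub L W) g n (srestrict (full_sub K V) f n x)) (\<lambda>n x. x)"
    proof (rule restrict_nat_equiv[OF K, where F = "\<lambda>n x. g n (f n x)"])
      fix n \<sigma> assume "\<sigma> \<in> cells (full_sub K V) n"
      then show "srestrict (full_sub L W) g n (srestrict (full_sub K V) f n \<sigma>) = g n (f n \<sigma>)" using smaps_in[OF f'] by (metis srestrict_in)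
    qed (use fg V W smaps_in[OF f] in \<open>auto simp: inverse_equivalences_def\<close>)
    show "nat_equiv (full_sub L W) (full_sub L W) (\<lambda>n x. srestrict (full_sub K V) f n (srestrict (full_sub L W) g n x)) (\<lambda>n x. x)"
    proof (rule restrict_nat_equiv[OF L, where F = "\<lambda>n x. f n (g n x)"])
      fix n \<sigma> assume "\<sigma> \<in> cells (full_sub L W) n"
      then show "srestrict (full_sub K V) f n (srestrict (full_sub L W) g n \<sigma>) = f n (g n \<sigma>)" using smaps_in[OF g'] by (metis srestrict_in)
    qed (use fg V W smaps_in[OF g] in \<open>auto simp: inverse_equivalences_def\<close>)
  qed
qed

section \<open>Values of normed semirings, and the equivalence\<close>

lemma NRig_sset:
  fixes C :: "'c sset" and X :: "'x sset"
  shows "is_sset (NRig C M A X)"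
  unfolding NRig_def sections_def
\<comment> \<open>Functor categories are simplicial sets whatever their domain, and the condition on
  sections is stable under the action.\<close>
proof (rule full_sub_sset, rule sub_sset_sset[OF fun_is_sset])
  fix m n \<theta> and s :: "(nat list \<times> 'c spn, ('c, 'x) nmon_cell) smap"
  assume t: "\<theta> \<in> ops m n" and s: "\<forall>m. \<forall>(\<psi>, \<sigma>)\<in>cells (simplex n \<otimes>\<^sub>s Span C M) m. fst (s m (\<psi>, \<sigma>)) = \<sigma>"
  show "\<forall>k. \<forall>(\<psi>, \<sigma>)\<in>cells (simplex m \<otimes>\<^sub>s Span C M) k. fst (act (fun_sset (Span C M) (NMon C M A X)) n \<theta> s k (\<psi>, \<sigma>)) = \<sigma>"
  proof (intro allI ballI, clarify)
    fix k \<psi> \<sigma> assume "(\<psi>, \<sigma>) \<in> cells (simplex m \<otimes>\<^sub>s Span C M) k"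
    then have p: "\<psi> \<in> ops k m" "\<sigma> \<in> cells (Span C M) k" by auto
    show "fst (act (fun_sset (Span C M) (NMon C M A X)) n \<theta> s k (\<psi>, \<sigma>)) = \<sigma>"
      unfolding fun_act_app[OF t p] using s[rule_format, of "(map (nth \<theta>) \<psi>, \<sigma>)" k] ops_comp[OF p(1) t] p(2) by simp
  qed
qed

text \<open>Evaluation at x in all dimensions: the constant span at x turns a simplex of sections
  into a simplex of functors on the fibre, by \<open>pull_fib\<close>.\<close>

definition value_at :: "'c sset \<Rightarrow> 'c \<Rightarrow> ((nat list \<times> 'c spn, ('c, 'x) nmon_cell) smap, (nat list \<times> 'c arr spn spn, 'x) smap) smap" where
  "value_at C x n R = snd (R n ([0..<Suc n], cspan C x n))"

lemma value_at_smap: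
  assumes C: "qcat C" and M: "wide C M" and x: "x \<in> cells C 0" and R: "R \<in> cells (NRig C M A X) n"
  shows "value_at C x n R \<in> cells (fun_sset (fib C M A x) X) n"
    "\<theta> \<in> ops m n \<Longrightarrow> value_at C x m (act (NRig C M A X) n \<theta> R) = act (fun_sset (fib C M A x) X) n \<theta> (value_at C x n R)"
proof -
  note ss = qcat_sset[OF C]
  have Rm: "R \<in> smaps (simplex n \<otimes>\<^sub>s Span C M) (NMon C M A X)"
    using R unfolding NRig_def sections_def by (simp add: fun_cells)
  have Rs: "fst (R k (\<psi>, \<sigma>)) = \<sigma>" if "\<psi> \<in> ops k n" "\<sigma> \<in> cells (Span C M) k" for k \<psi> \<sigma>
    using R that unfolding NRig_def sections_def by auto
  have y: "([0..<Suc n], cspan C x n) \<in> cells (simplex n \<otimes>\<^sub>s Span C M) n" using ops_id cspan_in[OF C M x] by simp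
  have f: "fst (R n ([0..<Suc n], cspan C x n)) = cspan C x n" by (rule Rs[OF ops_id cspan_in[OF C M x]])
  have "R n ([0..<Suc n], cspan C x n) \<in> cells (NMon C M A X) n" by (rule smaps_in[OF Rm y])
  then show "value_at C x n R \<in> cells (fun_sset (fib C M A x) X) n"
    using f pull_fib[OF ss x, of M A n] unfolding value_at_def fun_cells NMon_def fibrewise_functors_def by (auto split: prod.splits)
  assume t: "\<theta> \<in> ops m n"
  have a: "act (Span C M) n \<theta> (cspan C x n) = cspan C x m" by (rule cspan_act'[OF ss x t])
  have "act (NRig C M A X) n \<theta> R m ([0..<Suc m], cspan C x m) = R m (\<theta>, cspan C x m)"
    unfolding NRig_def sections_def full_sub_simps sub_sset_simps fun_act_app[OF t ops_id cspan_in[OF C M x]] map_nth_upt[OF opsD(1)[OF t]] ..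
  also have "\<dots> = act (NMon C M A X) n \<theta> (R n ([0..<Suc n], cspan C x n))"
    using smaps_act[OF Rm t y] a ops_map_nth_id map_nth_upt ops_id[of n] t by (simp add: ops_map_nth_id del: upt_Suc)
  finally show "value_at C x m (act (NRig C M A X) n \<theta> R) = act (fun_sset (fib C M A x) X) n \<theta> (value_at C x n R)"
    unfolding value_at_def fun_act[OF t] using f a pull_fib[OF ss x, of M A m]
    by (cases "R n ([0..<Suc n], cspan C x n)") (simp add: NMon_def fibrewise_functors_def opsD[OF t] del: upt_Suc)
qed

lemma nrig_value_eq: "is_sset C \<Longrightarrow> x \<in> cells C 0 \<Longrightarrow> nrig_value C R x = (\<lambda>n s. fun_at (value_at C x 0 R) n (fibre_incl C n s))"
  unfolding nrig_value_def value_at_def fun_at_def cspan_def by (simp add: cst_zero)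

text \<open>Evaluation at x sends e to an equivalence of functors on the fibre; for each copower
  functor on the slice the fold map lies in A, so that \<open>grouplike_fibre\<close> transfers the
  shear map.\<close>

lemma grouplike_equiv:
  assumes rc: "ring_context C M A" and X: "qcat X" and e: "is_equiv (NRig C M A X) e"
    and g: "\<forall>x\<in>cells C 0. grouplike (slice C x) X (nrig_value C (act (NRig C M A X) 1 [1] e) x)"
  shows "\<forall>x\<in>cells C 0. grouplike (slice C x) X (nrig_value C (act (NRig C M A X) 1 [0] e) x)"
  unfolding grouplike_def
proof (intro ballI impI)
  note r = ring_contextD[OF rc]
  fix x t assume x: "x \<in> cells C 0" and t: "t \<in> smaps Fin (slice C x)" and p: "preserves_finite_coproducts Fin (slice C x) t"
  have "srestrict Fin (\<lambda>n F. forget C n (t n F)) 1 (fin_map 2 1 [0, 0]) \<in> A"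
    by (rule fold_in[OF r(6) forget_smaps[OF r(2) Fin_sset t] preserves_forget[OF r(1,5) p]])
  moreover have "fin_map 2 1 [0, 0] \<in> cells Fin 1" by (rule fin_map_cell) auto
  ultimately have "forget C 1 (t 1 (fin_map 2 1 [0, 0])) \<in> A" by simp
  then interpret copower C M A x t by unfold_locales (use r x t in auto)
  have e1: "e \<in> cells (NRig C M A X) 1" using e unfolding is_equiv_def by blast
  let ?h = "value_at C x 1 e"
  have h: "is_equiv (fun_sset K X) ?h" by (rule equiv_image[OF NRig_sset _ _ e]) (rule value_at_smap[OF r(1,3) x]; assumption)+
  have v: "nrig_value C (act (NRig C M A X) 1 [i] e) x = (\<lambda>n s. fun_at (act (fun_sset K X) 1 [i] ?h) n (fibre_incl C n s))" if "i \<le> 1" for i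
    unfolding nrig_value_eq[OF r(2) x] using value_at_smap(2)[OF r(1,3) x e1, of "[i]" 0] that by (simp add: ops_def)
  show "cmon_grouplike X (\<lambda>n s. nrig_value C (act (NRig C M A X) 1 [0] e) x n (span_map t n s))"
    unfolding v[OF le0]
  proof (rule grouplike_fibre[OF X h])
    have "cmon_grouplike X (\<lambda>n s. nrig_value C (act (NRig C M A X) 1 [1] e) x n (span_map t n s))"
      using g x t p unfolding grouplike_def by blast
    then show "cmon_grouplike X (\<lambda>n s. fun_at (act (fun_sset K X) 1 [1] ?h) n (fibre_incl C n (span_map t n s)))" unfolding v[OF order_refl] .
  qed
qed

lemma sset_good: "is_sset K \<Longrightarrow> face_closed K" "is_sset K \<Longrightarrow> b \<in> cells K n \<Longrightarrow> good K n b"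
  unfolding face_closed_def good_def by (simp_all add: sset_in sset_id sset_comp del: upt_Suc)

theorem theorem4p3p6:
  fixes F :: "'u sset" and F\<^sub>M F\<^sub>A :: "'u set" and X :: "'x sset"
    and \<Phi> :: "((nat list \<times> 'u spn, ('u, 'x) nmon_cell) smap, (nat list \<times> 'u spn spn, 'x) smap) smap"
  assumes "ring_context F F\<^sub>M F\<^sub>A"
    and "qcat X" and "cocomplete TYPE('u) X" and "has_finite_products X"
    and "product_preserves_colimits TYPE('u) X"
    and "inverse_equivalences (NRig F F\<^sub>M F\<^sub>A X) (fun_prod (Bispan F F\<^sub>M F\<^sub>A) X)
           \<Phi> (ev0_precomp F F\<^sub>M F\<^sub>A X)"
  shows "equivalence (NRing F F\<^sub>M F\<^sub>A X) (Tamb F F\<^sub>M F\<^sub>A X) (srestrict (NRing F F\<^sub>M F\<^sub>A X) \<Phi>)"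
proof -
  let ?K = "NRig F F\<^sub>M F\<^sub>A X" and ?L = "fun_prod (Bispan F F\<^sub>M F\<^sub>A) X" and ?E = "ev0_precomp F F\<^sub>M F\<^sub>A X"
  let ?V = "{R :: (nat list \<times> 'u spn, ('u, 'x) nmon_cell) smap. \<forall>x\<in>cells F 0. grouplike (slice F x) X (nrig_value F R x)}"
  let ?W = "{h :: (nat list \<times> 'u spn spn, 'x) smap. grouplike F X (\<lambda>n s. fun_at h n (bispan_incl F n s))}"
  have K: "is_sset ?K" by (rule NRig_sset)
  have L: "is_sset ?L" unfolding fun_prod_def by (rule full_sub_sset[OF fun_is_sset])
  have \<Phi>: "\<Phi> \<in> smaps ?K ?L" and ne: "nat_equiv ?K ?K (\<lambda>n R. ?E n (\<Phi> n R)) (\<lambda>n R. R)"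
    using assms(6) unfolding inverse_equivalences_def by auto
  have W: "?E 0 H \<in> ?V \<longleftrightarrow> H \<in> ?W" if "H \<in> cells ?L 0" for H
    using grouplike_iff[OF assms(1) that] by simp
  have V: "\<Phi> 0 R \<in> ?W" if R: "R \<in> cells ?K 0" "R \<in> ?V" for R
  proof -
    obtain \<eta> where \<eta>: "is_equiv (fun_sset ?K ?K) \<eta>" "act (fun_sset ?K ?K) 1 [0] \<eta> = fun_vertex ?K (\<lambda>n R. ?E n (\<Phi> n R))"
      "act (fun_sset ?K ?K) 1 [1] \<eta> = fun_vertex ?K (\<lambda>n R. R)"
      using ne unfolding nat_equiv_def src_def tgt_def by blast
    \<comment> \<open>The component of \<eta> at R is an equivalence from
      \<open>?E 0 (\<Phi> 0 R)\<close> to R; \<open>grouplike_equiv\<close> carries grouplikeness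
      from its target back to its source.\<close>
    have e: "is_equiv ?K (component ?K \<eta> R)"
      by (rule component_equiv[OF K sset_good(1)[OF K] R(1) sset_good(2)[OF K R(1)] \<eta>(1)])
    have \<eta>c: "\<eta> \<in> cells (fun_sset ?K ?K) 1" using \<eta>(1) unfolding is_equiv_def by blast
    have v: "act ?K 1 [i] (component ?K \<eta> R) = act (fun_sset ?K ?K) 1 [i] \<eta> 0 ([0], R)" if "i \<le> 1" for i
      by (rule component_ends(1)[OF sset_good(1)[OF K] R(1) _ \<eta>c that]) (rule sset_in[OF K _ R(1)], simp add: ops_def)
    have "act ?K 1 [0] (component ?K \<eta> R) = ?E 0 (\<Phi> 0 R)" "act ?K 1 [1] (component ?K \<eta> R) = R"
      unfolding v[OF le0] v[OF order_refl] \<eta>(2,3) fun_vertex_def using R(1) by (simp_all add: ops_def)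
    then have "?E 0 (\<Phi> 0 R) \<in> ?V" using grouplike_equiv[OF assms(1,2) e] R(2) by simp
    then show ?thesis using W[OF smaps_in[OF \<Phi> R(1)]] by simp
  qed
  have "inverse_equivalences (full_sub ?K ?V) (full_sub ?L ?W) (srestrict (full_sub ?K ?V) \<Phi>) (srestrict (full_sub ?L ?W) ?E)"
    by (rule restrict_inverse_equivalences[OF K L assms(6) V]) (use W in blast)+
  then show ?thesis unfolding equivalence_def NRing_def Tamb_def by blast
qed

end
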